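(* Let $\{\varphi^\varepsilon\}$ (indexed by $\varepsilon\to0$) be a sequence of functions in $H^1_{\rho^0}(\mathbb{R}^d)$ such that $\varphi^\varepsilon\rightharpoonup\varphi^0$ weakly in $H^1_{\rho^0}(\mathbb{R}^d)$. Then $\varphi^\varepsilon$ two-scale converges to $\varphi^0$ (regarded as a function on $\mathbb{R}^d\times Y$ independent of $y$), and there exist a subsequence $\{\varphi^{\varepsilon'}\}$ and $\varphi_1\in L^2_{\rho^0}(\mathbb{R}^d;\mathcal W_{\mathrm{per}}(Y))$ such that $\nabla\varphi^{\varepsilon'}$ two-scale converges (componentwise) to $\nabla\varphi^0+\nabla_y\varphi_1$.
   Context: Let $d\ge1$, $\sigma>0$, $L>0$, $Y=[0,L]^d$. Let $V\in C^\infty(\mathbb{R}^d)$ be polynomially bounded from above and bounded from below, with constants $a,b>0$ such that $-\nabla V(x)\cdot x\le a-b|x|^2$ for all $x\in\mathbb{R}^d$, and let $\rho^0(x)=\frac1{C_{\rho^0}}e^{-\frac1\sigma V(x)}$ with $C_{\rho^0}=\int_{\mathbb{R}^d}e^{-\frac1\sigma V(x)}dx$. $L^2_{\rho^0}(\mathbb{R}^d)$ is the space of measurable $u$ with $\int_{\mathbb{R}^d}u^2\rho^0dx<\infty$; $H^1_{\rho^0}(\mathbb{R}^d)$ is the space of measurable weakly differentiable $u$ with $\|u\|_{H^1_{\rho^0}}^2=\int u^2\rho^0dx+\int|\nabla u|^2\rho^0dx<\infty$. $L^2_{\rho^0}(\mathbb{R}^d\times Y)$ is the space of measurable $u\colon\mathbb{R}^d\times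 Y\to\mathbb{R}$ with $\int_{\mathbb{R}^d}\int_Yu(x,y)^2\rho^0(x)\,dy\,dx<\infty$. $C^k_{\mathrm{per}}(Y)$ is the space of $Y$-periodic functions in $C^k(\mathbb{R}^d)$; $H^1_{\mathrm{per}}(Y)$ is the closure of $C^\infty_{\mathrm{per}}(Y)$ in the $H^1(Y)$ norm; $\mathcal W_{\mathrm{per}}(Y)=H^1_{\mathrm{per}}(Y)/\mathbb{R}$ with norm $\|u\|_{\mathcal W_{\mathrm{per}}(Y)}=\|\nabla u\|_{L^2(Y)}$. $L^2_{\rho^0}(\mathbb{R}^d;C^0_{\mathrm{per}}(Y))$ is the space of measurable $u\colon x\mapsto u(x,\cdot)\in C^0_{\mathrm{per}}(Y)$ with $\int_{\mathbb{R}^d}\sup_{y\in Y}|u(x,y)|^2\rho^0(x)\,dx<\infty$. $L^2_{\rho^0}(\mathbb{R}^d;\mathcal W_{\mathrm{per}}(Y))$ is the space of measurable $u\colon x\mapsto u(x,\cdot)\in\mathcal W_{\mathrm{per}}(Y)$ with $\int_{\mathbb{R}^d}\int_Y|\nabla_yu(x,y)|^2\rho^0(x)\,dy\,dx<\infty$. Two-scale convergence: a sequence $\{\varphi^\varepsilon\}$ in $L^2_{\rho^0}(\mathbb{R}^d)$ two-scale converges to $\varphi^0\in L^2_{\rho^0}(\mathbb{R}^d\times Y)$ if for every $\psi\in L^2_{\rho^0}(\mathbb{R}^d;C^0_{\mathrm{per}}(Y))$ $$\lim_{\varepsilon\to0}\int_{\mathbb{R}^d}\varphi^\varepsilon(x)\,\psi\!\left(x,\frac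 x\varepsilon\right)\rho^0(x)\,dx=\frac1{|Y|}\int_{\mathbb{R}^d}\int_Y\varphi^0(x,y)\psi(x,y)\rho^0(x)\,dy\,dx.$$ *)

theory Defs
  imports "HOL-Analysis.Analysis"
begin

text \<open>Elements of the function spaces below are represented by actual functions; equality almost
  everywhere is only divided out in the quotient space \<open>W_per\<close>.\<close>

subsection \<open>Smooth functions and weak gradients\<close>

definition grad :: "(real^'n \<Rightarrow> real) \<Rightarrow> real^'n \<Rightarrow> real^'n"
  where "grad f x = (\<chi> i. frechet_derivative f (at x) (axis i 1))"

primrec C_k :: "nat \<Rightarrow> (real^'n \<Rightarrow> real) \<Rightarrow> bool"
  where
    "C_k 0 f \<longleftrightarrow> continuous_on UNIV f"
  | "C_k (Suc k) f \<longleftrightarrow> f differentiable_on UNIV \<and> (\<forall>i. C_k k (\<lambda>x. grad f x $ i))"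

definition smooth :: "(real^'n \<Rightarrow> real) \<Rightarrow> bool"
  where "smooth f \<longleftrightarrow> (\<forall>k. C_k k f)"

definition test_function :: "(real^'n) set \<Rightarrow> (real^'n \<Rightarrow> real) \<Rightarrow> bool"
  where "test_function \<Omega> \<zeta> \<longleftrightarrow> smooth \<zeta> \<and>
    compact (closure {x. \<zeta> x \<noteq> 0}) \<and> closure {x. \<zeta> x \<noteq> 0} \<subseteq> \<Omega>"

definition locally_integrable ::
    "(real^'n) set \<Rightarrow> (real^'n \<Rightarrow> 'b::{banach, second_countable_topology}) \<Rightarrow> bool"
  where "locally_integrable \<Omega> f \<longleftrightarrow> (\<forall>K. compact K \<and> K \<subseteq> \<Omega> \<longrightarrow> set_integrable lebesgue K f)"

definition has_weak_gradient ::
    "(real^'n) set \<Rightarrow> (real^'n \<Rightarrow> real) \<Rightarrow> (real^'n \<Rightarrow> real^'n) \<Rightarrow> bool"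
  where "has_weak_gradient \<Omega> u g \<longleftrightarrow> locally_integrable \<Omega> u \<and> locally_integrable \<Omega> g \<and>
    (\<forall>\<zeta>. test_function \<Omega> \<zeta> \<longrightarrow>
      (LINT x:\<Omega>|lebesgue. u x *\<^sub>R grad \<zeta> x) = - (LINT x:\<Omega>|lebesgue. \<zeta> x *\<^sub>R g x))"

text \<open>A representative of the weak gradient, which is unique up to a null set.\<close>

definition weak_grad :: "(real^'n) set \<Rightarrow> (real^'n \<Rightarrow> real) \<Rightarrow> real^'n \<Rightarrow> real^'n"
  where "weak_grad \<Omega> u = (SOME g. has_weak_gradient \<Omega> u g)"


subsection \<open>Weighted Sobolev spaces and weak convergence\<close>

text \<open>Here \<open>w\<close> is the weight: \<open>H1 UNIV \<rho>\<close> is the weighted space on the whole space and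
  \<open>H1 (interior Y) (\<lambda>_. 1)\<close> is the usual Sobolev space on the cell \<open>Y\<close>.\<close>

definition H1 :: "(real^'n) set \<Rightarrow> (real^'n \<Rightarrow> real) \<Rightarrow> (real^'n \<Rightarrow> real) set"
  where "H1 \<Omega> w = {u. set_borel_measurable lebesgue \<Omega> u \<and> (\<exists>g. has_weak_gradient \<Omega> u g) \<and>
    set_integrable lebesgue \<Omega> (\<lambda>x. (u x)\<^sup>2 * w x) \<and>
    set_integrable lebesgue \<Omega> (\<lambda>x. (norm (weak_grad \<Omega> u x))\<^sup>2 * w x)}"

definition H1_norm :: "(real^'n) set \<Rightarrow> (real^'n \<Rightarrow> real) \<Rightarrow> (real^'n \<Rightarrow> real) \<Rightarrow> real"
  where "H1_norm \<Omega> w u = sqrt ((LINT x:\<Omega>|lebesgue. (u x)\<^sup>2 * w x) +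
    (LINT x:\<Omega>|lebesgue. (norm (weak_grad \<Omega> u x))\<^sup>2 * w x))"

text \<open>Boundedness by the \<open>H1\<close> norm forces such a functional to respect equality a.e.\<close>

definition H1_functional :: "(real^'n) set \<Rightarrow> (real^'n \<Rightarrow> real) \<Rightarrow> ((real^'n \<Rightarrow> real) \<Rightarrow> real) \<Rightarrow> bool"
  where "H1_functional \<Omega> w F \<longleftrightarrow>
    (\<forall>u\<in>H1 \<Omega> w. \<forall>v\<in>H1 \<Omega> w. F (\<lambda>x. u x + v x) = F u + F v) \<and>
    (\<forall>u\<in>H1 \<Omega> w. \<forall>c. F (\<lambda>x. c * u x) = c * F u) \<and>
    (\<exists>C. \<forall>u\<in>H1 \<Omega> w. \<bar>F u\<bar> \<le> C * H1_norm \<Omega> w u)"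

definition H1_weakly_convergent ::
    "(real^'n) set \<Rightarrow> (real^'n \<Rightarrow> real) \<Rightarrow> (nat \<Rightarrow> real^'n \<Rightarrow> real) \<Rightarrow> (real^'n \<Rightarrow> real) \<Rightarrow> bool"
  where "H1_weakly_convergent \<Omega> w u u0 \<longleftrightarrow> (\<forall>n. u n \<in> H1 \<Omega> w) \<and> u0 \<in> H1 \<Omega> w \<and>
    (\<forall>F. H1_functional \<Omega> w F \<longrightarrow> (\<lambda>n. F (u n)) \<longlonglongrightarrow> F u0)"

definition L2 :: "(real^'n \<Rightarrow> real) \<Rightarrow> (real^'n \<Rightarrow> real) set"
  where "L2 \<rho> = {u. u \<in> borel_measurable lebesgue \<and> integrable lebesgue (\<lambda>x. (u x)\<^sup>2 * \<rho> x)}"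


subsection \<open>Periodic functions on the cell\<close>

definition cell :: "real \<Rightarrow> (real^'n) set"
  where "cell L = {y. \<forall>i. 0 \<le> y $ i \<and> y $ i \<le> L}"

definition periodic :: "real \<Rightarrow> (real^'n \<Rightarrow> real) \<Rightarrow> bool"
  where "periodic L f \<longleftrightarrow> (\<forall>x i. f (x + L *\<^sub>R axis i 1) = f x)"

definition H1_per :: "real \<Rightarrow> (real^'n \<Rightarrow> real) set"
  where "H1_per L = {u \<in> H1 (interior (cell L)) (\<lambda>_. 1).
    \<exists>v. (\<forall>n::nat. smooth (v n) \<and> periodic L (v n)) \<and>
      (\<lambda>n. H1_norm (interior (cell L)) (\<lambda>_. 1) (\<lambda>y. u y - v n y)) \<longlonglongrightarrow> 0}"

definition W_per :: "real \<Rightarrow> (real^'n \<Rightarrow> real) set set"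
  where "W_per L = H1_per L // {(u, v). u \<in> H1_per L \<and> v \<in> H1_per L \<and>
    (\<exists>c. AE y in lebesgue. y \<in> cell L \<longrightarrow> u y = v y + c)}"

definition W_grad :: "real \<Rightarrow> (real^'n \<Rightarrow> real) set \<Rightarrow> real^'n \<Rightarrow> real^'n"
  where "W_grad L U = weak_grad (interior (cell L)) (SOME u. u \<in> U)"

definition W_norm :: "real \<Rightarrow> (real^'n \<Rightarrow> real) set \<Rightarrow> real"
  where "W_norm L U = sqrt (LINT y:cell L|lebesgue. (norm (W_grad L U y))\<^sup>2)"

text \<open>The distance \<open>\<parallel>U - V\<parallel>\<close>, by linearity of the gradient.\<close>

definition W_dist :: "real \<Rightarrow> (real^'n \<Rightarrow> real) set \<Rightarrow> (real^'n \<Rightarrow> real) set \<Rightarrow> real"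
  where "W_dist L U V = sqrt (LINT y:cell L|lebesgue. (norm (W_grad L U y - W_grad L V y))\<^sup>2)"

definition W_borel :: "real \<Rightarrow> (real^'n \<Rightarrow> real) set measure"
  where "W_borel L =
    sigma (W_per L) {S. openin (Metric_space.mtopology (W_per L) (W_dist L)) S}"


subsection \<open>Spaces of functions of two variables\<close>

text \<open>Measurability is with respect to the product of the two Lebesgue measures, which is not
  completed; up to equality a.e. this gives the same space as the completion. Values \<open>u x y\<close> with
  \<open>y\<close> outside the cell are irrelevant.\<close>

definition L2_cell :: "real \<Rightarrow> (real^'n \<Rightarrow> real) \<Rightarrow> (real^'n \<Rightarrow> real^'n \<Rightarrow> real) set"
  where "L2_cell L \<rho> = {u.
    set_borel_measurable (lebesgue \<Otimes>\<^sub>M lebesgue) (UNIV \<times> cell L) (\<lambda>(x, y). u x y) \<and>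
    set_integrable (lebesgue \<Otimes>\<^sub>M lebesgue) (UNIV \<times> cell L) (\<lambda>(x, y). (u x y)\<^sup>2 * \<rho> x)}"

text \<open>Continuous periodic functions are bounded, so they are the periodic elements of the Banach
  space of bounded continuous functions; measurability is with respect to its Borel sets.\<close>

definition L2_C_per :: "real \<Rightarrow> (real^'n \<Rightarrow> real) \<Rightarrow> (real^'n \<Rightarrow> ((real^'n) \<Rightarrow>\<^sub>C real)) set"
  where "L2_C_per L \<rho> = {\<psi> :: real^'n \<Rightarrow> ((real^'n) \<Rightarrow>\<^sub>C real).
    \<psi> \<in> borel_measurable lebesgue \<and> (\<forall>x. periodic L (\<psi> x)) \<and>
    integrable lebesgue (\<lambda>x. (SUP y\<in>cell L. \<bar>\<psi> x y\<bar>)\<^sup>2 * \<rho> x)}"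

definition L2_W_per :: "real \<Rightarrow> (real^'n \<Rightarrow> real) \<Rightarrow> (real^'n \<Rightarrow> (real^'n \<Rightarrow> real) set) set"
  where "L2_W_per L \<rho> = {u. u \<in> measurable lebesgue (W_borel L) \<and>
    integrable lebesgue (\<lambda>x. (W_norm L (u x))\<^sup>2 * \<rho> x)}"

text \<open>\<open>g\<close> is a jointly measurable choice of \<open>\<nabla>\<^sub>y u\<close>. The pointwise choice
  \<open>\<lambda>x. W_grad L (u x)\<close> need not be jointly measurable.\<close>

definition has_y_gradient ::
    "real \<Rightarrow> (real^'n \<Rightarrow> (real^'n \<Rightarrow> real) set) \<Rightarrow> (real^'n \<Rightarrow> real^'n \<Rightarrow> real^'n) \<Rightarrow> bool"
  where "has_y_gradient L u g \<longleftrightarrow>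
    set_borel_measurable (lebesgue \<Otimes>\<^sub>M lebesgue) (UNIV \<times> cell L) (\<lambda>(x, y). g x y) \<and>
    (AE x in lebesgue. \<forall>w\<in>u x. has_weak_gradient (interior (cell L)) w (g x))"


subsection \<open>Two-scale convergence\<close>

definition gibbs :: "real \<Rightarrow> (real^'n \<Rightarrow> real) \<Rightarrow> real^'n \<Rightarrow> real"
  where "gibbs \<sigma> V x = exp (- V x / \<sigma>) / (LINT z|lebesgue. exp (- V z / \<sigma>))"

definition two_scale_convergent ::
    "real \<Rightarrow> (real^'n \<Rightarrow> real) \<Rightarrow> (nat \<Rightarrow> real) \<Rightarrow> (nat \<Rightarrow> real^'n \<Rightarrow> real)
      \<Rightarrow> (real^'n \<Rightarrow> real^'n \<Rightarrow> real) \<Rightarrow> bool"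
  where "two_scale_convergent L \<rho> \<epsilon> \<phi> \<phi>0 \<longleftrightarrow>
    (\<forall>n. \<phi> n \<in> L2 \<rho>) \<and> \<phi>0 \<in> L2_cell L \<rho> \<and>
    (\<forall>\<psi>\<in>L2_C_per L \<rho>.
      (\<lambda>n. LINT x|lebesgue. \<phi> n x * \<psi> x (x /\<^sub>R \<epsilon> n) * \<rho> x)
      \<longlonglongrightarrow> 1 / measure lebesgue (cell L :: (real^'n) set) *
        (LINT x|lebesgue. (LINT y:cell L|lebesgue. \<phi>0 x y * \<psi> x y * \<rho> x)))"

end

theory Submission
  imports Defs "HOL-Library.Diagonal_Subsequence"
begin

text \<open>Write \<open>\<mu>\<close> for the measure with density \<open>\<rho>\<close>, \<open>\<nu>\<close> for the normalised Lebesgue measure on the cell and \<open>N\<close>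
  for their product. Every test function \<open>\<psi>(x, y)\<close> can be approximated, in a norm that controls both sides of the
  definition of two-scale convergence, by combinations of products of a bump \<open>\<zeta>(x)\<close> with a wave
  \<open>cos (\<kappa> \<bullet> y + phase)\<close> whose frequency \<open>\<kappa>\<close> is compatible with the period (\<open>trig_poly_dense\<close>, an instance of the
  Stone-Weierstrass theorem, and \<open>bump_density\<close>). For sequences bounded in the mean it therefore suffices to test
  with such products (\<open>two_scale_convergentI\<close>).

  A sequence \<open>u\<^sub>n\<close> that converges weakly in the Sobolev space is bounded there, by uniform boundedness. Integration by
  parts along \<open>\<kappa>\<close> against the wave \<open>cos (\<kappa> \<bullet> x / \<epsilon> + phase)\<close> gains a factor \<open>\<epsilon>\<close>, so that all tests of \<open>u\<^sub>n\<close> at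
  nonzero frequencies tend to zero (\<open>oscillation_vanishes\<close>). Only the frequency zero survives, and this is weak
  convergence: the two-scale limit of \<open>u\<^sub>n\<close> is its weak limit (\<open>no_oscillation\<close>).

  For the gradients, consider the gradient fields \<open>\<zeta>(x) cos (\<kappa> \<bullet> y + phase) \<kappa>\<close>, which are gradients in \<open>y\<close> of smooth
  periodic potentials. Countably many of them are enough, so along a subsequence the tests of \<open>\<nabla> u\<^sub>n\<close> against all of
  them converge. By the Cauchy-Schwarz inequality and the averaging of oscillating functions, the limits form a
  functional on the span of the fields that is bounded in the norm of \<open>L\<^sup>2(N)\<close>. Its Riesz representative \<open>g\<close> lies in
  the closure of the span (\<open>two_scale_field_limit\<close>). The two-scale limit of \<open>\<nabla> u\<^sub>n\<close> is the sum of its weak limit and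
  \<open>g\<close> (\<open>gradient_limit_tested\<close>): a coordinate vector splits into a multiple of \<open>\<kappa>\<close>, which is tested by the fields, and
  a vector orthogonal to \<open>\<kappa>\<close>, for which integration by parts does not differentiate the wave and reduces the test to
  one of \<open>u\<^sub>n\<close>, while \<open>g\<close> is orthogonal to such fields.

  Finally \<open>\<lambda>y. g (x, y)\<close> is for almost every \<open>x\<close> a limit in the mean of gradients of smooth periodic functions. By the
  Poincare inequality (\<open>poincare_periodic\<close>) these functions converge once their means are removed, so that
  \<open>\<lambda>y. g (x, y)\<close> is the gradient of an element of the quotient space, which depends measurably on \<open>x\<close>
  (\<open>corrector_exists\<close>).\<close>

section \<open>Calculus of smooth functions\<close>

lemma grad_eqI:
  assumes "(f has_derivative (\<lambda>h. G \<bullet> h)) (at x)"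
  shows "grad f x = G"
  by (simp add: grad_def vec_eq_iff inner_axis flip: frechet_derivative_at[OF assms])

lemma has_derivative_grad:
  fixes f :: "real^'n \<Rightarrow> real"
  assumes "f differentiable (at x)"
  shows "(f has_derivative (\<lambda>h. grad f x \<bullet> h)) (at x)"
proof -
  have d: "(f has_derivative frechet_derivative f (at x)) (at x)"
    using assms frechet_derivative_works by blast
  then interpret bounded_linear "frechet_derivative f (at x)" by (rule has_derivative_bounded_linear)
  have "frechet_derivative f (at x) h = grad f x \<bullet> h" for h
  proof -
    have "h = (\<Sum>i\<in>UNIV. h $ i *\<^sub>R axis i 1)"
      by (simp add: vec_eq_iff sum_component axis_def if_distrib cong: if_cong)
    then have "frechet_derivative f (at x) h = frechet_derivative f (at x) (\<Sum>i\<in>UNIV. h $ i *\<^sub>R axis i 1)"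
      by simp
    also have "\<dots> = (\<Sum>i\<in>UNIV. h $ i * frechet_derivative f (at x) (axis i 1))"
      by (simp add: sum scaleR)
    finally show ?thesis by (simp add: grad_def inner_vec_def mult.commute)
  qed
  then show ?thesis using d by presburger
qed

lemma grad_const: "grad (\<lambda>x. c) x = 0"
  by (rule grad_eqI) (auto intro!: derivative_eq_intros)

lemma grad_add:
  assumes "f differentiable (at x)" "g differentiable (at x)"
  shows "grad (\<lambda>x. f x + g x) x = grad f x + grad g x"
  by (rule grad_eqI) (auto intro!: derivative_eq_intros has_derivative_grad assms simp: inner_add_left)

lemma grad_mult:
  assumes "f differentiable (at x)" "g differentiable (at x)"
  shows "grad (\<lambda>x. f x * g x) x = f x *\<^sub>R grad g x + g x *\<^sub>R grad f x"
  by (rule grad_eqI) (auto intro!: derivative_eq_intros has_derivative_grad assms simp: inner_add_left)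

lemma C_k_imp_differentiable: "C_k (Suc k) f \<Longrightarrow> f differentiable (at x)"
  by (simp add: differentiable_on_def)

lemma C_k_antimono_Suc: "C_k (Suc k) f \<Longrightarrow> C_k k f"
proof (induction k arbitrary: f)
  case 0
  then show ?case by (simp add: differentiable_imp_continuous_on)
next
  case (Suc k)
  then show ?case by (metis C_k.simps(2))
qed

lemma C_k_const: "C_k k (\<lambda>x. c)"
  by (induction k arbitrary: c) (auto simp: grad_const)

lemma C_k_add: "C_k k f \<Longrightarrow> C_k k g \<Longrightarrow> C_k k (\<lambda>x. f x + g x)"
proof (induction k arbitrary: f g)
  case 0
  then show ?case by (auto intro: continuous_intros)
next
  case (Suc k)
  then show ?case
    by (auto simp: differentiable_on_def grad_add intro!: Suc.IH)
qed

lemma C_k_mult: "C_k k f \<Longrightarrow> C_k k g \<Longrightarrow> C_k k (\<lambda>x. f x * g x)"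
proof (induction k arbitrary: f g)
  case 0
  then show ?case by (auto intro: continuous_intros)
next
  case (Suc k)
  have f: "C_k k f" and g: "C_k k g" using Suc.prems C_k_antimono_Suc by blast+
  have "(\<lambda>x. grad (\<lambda>x. f x * g x) x $ i) = (\<lambda>x. f x * grad g x $ i + g x * grad f x $ i)" for i
    using Suc.prems by (auto simp: grad_mult C_k_imp_differentiable[of k])
  then show ?case using Suc.prems f g
    by (auto simp: differentiable_on_def intro!: C_k_add Suc.IH)
qed

lemma C_k_prod: "finite I \<Longrightarrow> (\<And>i. i \<in> I \<Longrightarrow> C_k k (f i)) \<Longrightarrow> C_k k (\<lambda>x. \<Prod>i\<in>I. f i x)"
  by (induction I rule: finite_induct) (auto intro: C_k_const C_k_mult)

lemma grad_exp:
  assumes "f differentiable (at x)"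
  shows "grad (\<lambda>x. exp (f x)) x = exp (f x) *\<^sub>R grad f x"
  by (rule grad_eqI) (auto intro!: derivative_eq_intros has_derivative_grad assms)

lemma C_k_exp: "C_k k f \<Longrightarrow> C_k k (\<lambda>x. exp (f x))"
proof (induction k arbitrary: f)
  case 0
  then show ?case by (auto intro: continuous_intros)
next
  case (Suc k)
  have "C_k k (\<lambda>x. exp (f x))" using Suc C_k_antimono_Suc by blast
  moreover have "(\<lambda>x. grad (\<lambda>x. exp (f x)) x $ i) = (\<lambda>x. exp (f x) * grad f x $ i)" for i
    using Suc.prems by (auto simp: grad_exp C_k_imp_differentiable[of k])
  moreover have "(\<lambda>x. exp (f x)) differentiable (at x)" for x
    using has_derivative_exp[OF has_derivative_grad[of f x]] Suc.prems C_k_imp_differentiable differentiableI by blast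
  ultimately show ?case using Suc.prems
    by (auto simp: differentiable_on_def intro!: C_k_mult)
qed

lemma smooth_const: "smooth (\<lambda>x. c)"
  by (simp add: smooth_def C_k_const)
lemma smooth_add: "smooth f \<Longrightarrow> smooth g \<Longrightarrow> smooth (\<lambda>x. f x + g x)"
  by (simp add: smooth_def C_k_add)
lemma smooth_mult: "smooth f \<Longrightarrow> smooth g \<Longrightarrow> smooth (\<lambda>x. f x * g x)"
  by (simp add: smooth_def C_k_mult)
lemma smooth_diff: "smooth f \<Longrightarrow> smooth g \<Longrightarrow> smooth (\<lambda>x. f x - g x)"
  using smooth_add[OF _ smooth_mult[OF smooth_const[of "-1"]], of f g] by simp
lemma smooth_exp: "smooth f \<Longrightarrow> smooth (\<lambda>x. exp (f x))"
  by (simp add: smooth_def C_k_exp)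
lemma smooth_prod: "finite I \<Longrightarrow> (\<And>i. i \<in> I \<Longrightarrow> smooth (f i)) \<Longrightarrow> smooth (\<lambda>x. \<Prod>i\<in>I. f i x)"
  by (simp add: smooth_def C_k_prod)
lemma smooth_sum: "(\<And>i. i \<in> I \<Longrightarrow> smooth (f i)) \<Longrightarrow> smooth (\<lambda>x. \<Sum>i\<in>I. f i x)"
  by (induction I rule: infinite_finite_induct) (auto intro: smooth_const smooth_add)

lemma smooth_differentiable: "smooth f \<Longrightarrow> f differentiable (at x)"
  by (metis C_k_imp_differentiable smooth_def)
lemma smooth_has_derivative: "smooth f \<Longrightarrow> (f has_derivative (\<lambda>h. grad f x \<bullet> h)) (at x)"
  by (simp add: has_derivative_grad smooth_differentiable)
lemma smooth_continuous: "smooth f \<Longrightarrow> continuous_on S f"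
  by (metis C_k.simps(1) continuous_on_subset smooth_def top_greatest)
lemma smooth_grad: "smooth f \<Longrightarrow> smooth (\<lambda>x. grad f x $ i)"
  by (metis C_k.simps(2) smooth_def)
lemma smooth_grad_continuous: "smooth f \<Longrightarrow> continuous_on S (grad f)"
  using smooth_continuous[OF smooth_grad] by (intro continuous_on_vec_lambda[of S "\<lambda>i x. grad f x $ i", simplified vec_lambda_eta])

lemma grad_sum:
  assumes "\<And>i. i \<in> I \<Longrightarrow> f i differentiable (at x)"
  shows "grad (\<lambda>x. \<Sum>i\<in>I. f i x) x = (\<Sum>i\<in>I. grad (f i) x)"
  by (rule grad_eqI)
     (auto intro!: derivative_eq_intros has_derivative_grad assms simp: inner_sum_left)

subsection \<open>Waves\<close>

text \<open>The quarter-period phases make the family closed, up to factors, under gradients and products, so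
  that sine and cosine need no separate treatment.\<close>

definition wave :: "real^'n \<Rightarrow> int \<Rightarrow> real^'n \<Rightarrow> real"
  where "wave \<kappa> j y = cos (\<kappa> \<bullet> y + of_int j * (pi / 2))"

lemma has_derivative_wave: "(wave \<kappa> j has_derivative (\<lambda>h. (wave \<kappa> (j + 1) y *\<^sub>R \<kappa>) \<bullet> h)) (at y)"
proof -
  have "- sin (\<kappa> \<bullet> y + of_int j * (pi / 2)) = wave \<kappa> (j + 1) y"
    unfolding wave_def by (simp add: minus_sin_cos_eq algebra_simps add_divide_distrib)
  then show ?thesis
    unfolding wave_def[abs_def] by (auto intro!: derivative_eq_intros simp: wave_def)
qed

lemma grad_wave: "grad (wave \<kappa> j) y = wave \<kappa> (j + 1) y *\<^sub>R \<kappa>"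
  by (rule grad_eqI[OF has_derivative_wave])

lemma smooth_wave: "smooth (wave \<kappa> j)"
proof -
  have "C_k k (wave \<kappa> j)" for k
  proof (induction k arbitrary: j)
    case 0
    show ?case unfolding wave_def[abs_def] C_k.simps by (intro continuous_intros)
  next
    case (Suc k)
    have "wave \<kappa> j differentiable (at y)" for y
      using has_derivative_wave differentiableI by blast
    then show ?case
      by (auto simp: grad_wave differentiable_on_def intro!: C_k_mult C_k_const Suc)
  qed
  then show ?thesis by (simp add: smooth_def)
qed

lemma wave_mult:
  "wave \<kappa> j y * wave \<kappa>' j' y = (wave (\<kappa> - \<kappa>') (j - j') y + wave (\<kappa> + \<kappa>') (j + j') y) / 2"
proof -
  have "\<kappa> \<bullet> y + of_int j * (pi / 2) - (\<kappa>' \<bullet> y + of_int j' * (pi / 2)) = (\<kappa> - \<kappa>') \<bullet> y + of_int (j - j') * (pi / 2)"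
    "\<kappa> \<bullet> y + of_int j * (pi / 2) + (\<kappa>' \<bullet> y + of_int j' * (pi / 2)) = (\<kappa> + \<kappa>') \<bullet> y + of_int (j + j') * (pi / 2)"
    by (simp_all add: algebra_simps add_divide_distrib diff_divide_distrib)
  then show ?thesis unfolding wave_def cos_times_cos by presburger
qed

lemma wave_scale: "wave \<kappa> j (y /\<^sub>R e) = wave (\<kappa> /\<^sub>R e) j y"
  by (simp add: wave_def)

lemma abs_wave_le: "\<bar>wave \<kappa> j y\<bar> \<le> 1"
  by (simp add: wave_def)

subsection \<open>Bump functions supported in boxes\<close>

text \<open>The powers in the denominator make the family closed under derivatives up to linear combinations,
  so that smoothness follows by one induction over all \<open>n\<close>.\<close>

definition flat :: "real \<Rightarrow> nat \<Rightarrow> real \<Rightarrow> real"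
  where "flat c n t = (if t > 0 then exp (- c / t) / t ^ n else 0)"

lemma flat_tendsto_0:
  assumes "c > 0"
  shows "(flat c n \<longlongrightarrow> 0) (at 0)"
proof -
  have "((\<lambda>t. (inverse t * c) ^ n / exp (inverse t * c) / c ^ n) \<longlongrightarrow> 0 / c ^ n) (at_right 0)"
  proof (intro tendsto_divide)
    have "filterlim (\<lambda>t. inverse t * c) at_top (at_right (0::real))"
      using assms by (intro filterlim_at_top_mult_tendsto_pos[OF tendsto_const] filterlim_inverse_at_top_right) auto
    then show "((\<lambda>t. (inverse t * c) ^ n / exp (inverse t * c)) \<longlongrightarrow> 0) (at_right 0)"
      by (rule filterlim_compose[OF tendsto_power_div_exp_0])
  qed (use assms in auto)
  moreover have "eventually (\<lambda>t. (inverse t * c) ^ n / exp (inverse t * c) / c ^ n = flat c n t) (at_right 0)"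
    unfolding eventually_at_filter
    using assms by (intro always_eventually) (auto simp: flat_def exp_minus field_simps)
  ultimately have "(flat c n \<longlongrightarrow> 0) (at_right 0)" using tendsto_cong by fastforce
  moreover have "(flat c n \<longlongrightarrow> 0) (at_left 0)"
    by (rule tendsto_eventually) (auto simp: flat_def eventually_at_filter)
  ultimately show ?thesis by (simp add: filterlim_split_at)
qed

lemma has_derivative_flat:
  assumes "c > 0"
  shows "(flat c n has_real_derivative (c * flat c (n + 2) t - n * flat c (n + 1) t)) (at t)"
proof -
  consider "t > 0" | "t < 0" | "t = 0" by linarith
  then show ?thesis
  proof cases
    case 1
    have "((\<lambda>t. exp (- c / t) / t ^ n) has_real_derivative (c * flat c (n + 2) t - n * flat c (n + 1) t)) (at t)"
    proof (cases n)
      case 0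
      show ?thesis
        using 1 unfolding 0 by (auto intro!: derivative_eq_intros simp: flat_def field_simps power2_eq_square)
    next
      case (Suc k)
      show ?thesis
        using 1 unfolding Suc
        by (auto intro!: derivative_eq_intros simp: flat_def field_simps power2_eq_square simp del: power_Suc)
           (simp add: algebra_simps)?
    qed
    moreover have "eventually (\<lambda>t. exp (- c / t) / t ^ n = flat c n t) (nhds t)"
      using eventually_nhds_in_open[of "{0<..}" t] 1 by (auto elim!: eventually_mono simp: flat_def)
    ultimately show ?thesis by (simp add: DERIV_cong_ev)
  next
    case 2
    have "eventually (\<lambda>t. 0 = flat c n t) (nhds t)"
      using eventually_nhds_in_open[of "{..<0}" t] 2 by (auto elim!: eventually_mono simp: flat_def)
    then have "(flat c n has_real_derivative 0) (at t)"
      using DERIV_cong_ev[of t t "\<lambda>_. 0" "flat c n" 0 0] by simp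
    then show ?thesis using 2 by (simp add: flat_def)
  next
    case 3
    have "(flat c n (0 + h) - flat c n 0) / h = flat c (n + 1) h" for h by (simp add: flat_def)
    then have "(flat c n has_real_derivative 0) (at 0)"
      using flat_tendsto_0[OF assms, of "n + 1"] unfolding DERIV_def by (simp only:)
    then show ?thesis using 3 by (simp add: flat_def)
  qed
qed

lemma smooth_flat:
  fixes i :: "'n::finite"
  assumes "c > 0"
  shows "smooth (\<lambda>x. flat c n (p + s * x $ i))"
proof -
  have "C_k k (\<lambda>x. flat c n (p + s * x $ i))" for k
  proof (induction k arbitrary: n)
    case 0
    have "continuous_on UNIV (flat c n)"
      by (rule DERIV_continuous_on[OF DERIV_subset[OF has_derivative_flat[OF assms]]]) auto
    then show ?case by (auto intro!: continuous_on_compose2[of UNIV "flat c n"] continuous_intros)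
  next
    case (Suc k)
    let ?D = "\<lambda>x. c * flat c (n + 2) (p + s * x $ i) + (- real n) * flat c (n + 1) (p + s * x $ i)"
    have d: "((\<lambda>x::real^'n. flat c n (p + s * x $ i)) has_derivative (\<lambda>h. ((?D x * s) *\<^sub>R axis i 1) \<bullet> h)) (at x)" for x
    proof -
      have "((\<lambda>x::real^'n. p + s * x $ i) has_derivative (\<lambda>h. s * h $ i)) (at x)"
        by (auto intro!: derivative_eq_intros bounded_linear.has_derivative[OF bounded_linear_vec_nth])
      then have "((\<lambda>x::real^'n. flat c n (p + s * x $ i)) has_derivative
          (\<lambda>h. (s * h $ i) * (c * flat c (n + 2) (p + s * x $ i) - real n * flat c (n + 1) (p + s * x $ i)))) (at x)"
        by (rule has_derivative_compose[OF _ has_derivative_flat[OF assms, unfolded has_field_derivative_def, of n], THEN has_derivative_eq_rhs]) auto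
      moreover have "(\<lambda>h::real^'n. (s * h $ i) * (c * flat c (n + 2) (p + s * x $ i) - real n * flat c (n + 1) (p + s * x $ i)))
         = (\<lambda>h. ((?D x * s) *\<^sub>R axis i 1) \<bullet> h)"
        by (auto simp: inner_axis inner_commute algebra_simps)
      ultimately show ?thesis by (rule has_derivative_eq_rhs)
    qed
    have "C_k k (\<lambda>x::real^'n. (?D x * s) * axis i 1 $ j)" for j
      by (intro C_k_mult C_k_add C_k_const Suc)
    then show ?case
      using d differentiableI[OF d] by (auto simp: differentiable_on_def grad_eqI[OF d])
  qed
  then show ?thesis by (simp add: smooth_def)
qed

text \<open>Decreasing the constants \<open>1 / Suc m\<close> makes the bumps steeper: they increase with
  \<open>m\<close> to the indicator of the box.\<close>

definition box_bump :: "real^'n \<Rightarrow> real^'n \<Rightarrow> nat \<Rightarrow> real^'n \<Rightarrow> real"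
  where "box_bump p q m x = (\<Prod>i\<in>UNIV. flat (1 / Suc m) 0 (x $ i - p $ i) * flat (1 / Suc m) 0 (q $ i - x $ i))"

lemma smooth_box_bump: "smooth (box_bump p q m)"
  unfolding box_bump_def[abs_def]
proof (intro smooth_prod smooth_mult)
  show "smooth (\<lambda>x. flat (1 / real (Suc m)) 0 (x $ i - p $ i))" for i
    using smooth_flat[of "1 / Suc m" 0 "- p $ i" 1 i] by simp
  show "smooth (\<lambda>x. flat (1 / real (Suc m)) 0 (q $ i - x $ i))" for i
    using smooth_flat[of "1 / Suc m" 0 "q $ i" "-1" i] by simp
qed simp

lemma box_bump_bounds: "0 \<le> box_bump p q m x" "box_bump p q m x \<le> 1"
  unfolding box_bump_def
  by (auto simp: flat_def intro!: prod_nonneg prod_le_1 mult_le_one)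

lemma box_bump_nonzero_iff: "box_bump p q m x \<noteq> 0 \<longleftrightarrow> x \<in> box p q"
  by (auto simp: box_bump_def flat_def mem_box_cart)

lemma test_function_box_bump:
  assumes "cbox p q \<subseteq> \<Omega>"
  shows "test_function \<Omega> (box_bump p q m)"
proof -
  have "closure {x. box_bump p q m x \<noteq> 0} \<subseteq> cbox p q"
    unfolding box_bump_nonzero_iff by (rule closure_minimal) (auto simp: mem_box less_imp_le)
  then show ?thesis
    unfolding test_function_def using assms smooth_box_bump
    by (meson closed_closure compact_Int_closed compact_cbox dual_order.trans inf.absorb_iff2 compact_eq_bounded_closed bounded_subset)
qed

lemma box_bump_tendsto_indicator: "(\<lambda>m. box_bump p q m x) \<longlonglongrightarrow> indicator (box p q) x"
proof (cases "x \<in> box p q")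
  case True
  have 0: "(\<lambda>m. - (1 / real (Suc m))) \<longlonglongrightarrow> - 0"
    by (intro tendsto_minus LIMSEQ_Suc lim_1_over_n)
  have "(\<lambda>m. flat (1 / Suc m) 0 t) \<longlonglongrightarrow> 1" if "t > 0" for t
  proof -
    have "(\<lambda>m. exp (- (1 / real (Suc m)) / t)) \<longlonglongrightarrow> exp (- 0 / t)"
      by (intro tendsto_intros 0) (use that in auto)
    then show ?thesis using that by (simp add: flat_def)
  qed
  then have "(\<lambda>m. box_bump p q m x) \<longlonglongrightarrow> (\<Prod>i\<in>(UNIV::'a set). 1 * 1)"
    unfolding box_bump_def using True by (intro tendsto_prod tendsto_mult) (auto simp: mem_box_cart)
  then show ?thesis using True by simp
next
  case False
  then have "box_bump p q m x = 0" for m using box_bump_nonzero_iff by blast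
  then show ?thesis using False by simp
qed

section \<open>Square integrable functions\<close>

definition sqint :: "'a measure \<Rightarrow> ('a \<Rightarrow> 'b::euclidean_space) \<Rightarrow> bool"
  where "sqint M f \<longleftrightarrow> f \<in> borel_measurable M \<and> integrable M (\<lambda>x. (norm (f x))\<^sup>2)"

definition l2norm :: "'a measure \<Rightarrow> ('a \<Rightarrow> 'b::euclidean_space) \<Rightarrow> real"
  where "l2norm M f = sqrt (\<integral>x. (norm (f x))\<^sup>2 \<partial>M)"

lemma l2norm_nonneg [simp]: "0 \<le> l2norm M f"
  by (simp add: l2norm_def)

lemma l2norm_sq: "(l2norm M f)\<^sup>2 = (\<integral>x. (norm (f x))\<^sup>2 \<partial>M)"
  by (simp add: l2norm_def)

lemma sqint_measurable [dest]: "sqint M f \<Longrightarrow> f \<in> borel_measurable M"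
  by (simp add: sqint_def)

lemma sqint_integrable_sq: "sqint M f \<Longrightarrow> integrable M (\<lambda>x. (norm (f x))\<^sup>2)"
  by (simp add: sqint_def)

lemma sqint_bound:
  assumes "sqint M f" "g \<in> borel_measurable M" "AE x in M. norm (g x) \<le> c * norm (f x)"
  shows "sqint M g"
proof -
  have "integrable M (\<lambda>x. c\<^sup>2 * (norm (f x))\<^sup>2)" using assms by (simp add: sqint_def)
  moreover have "AE x in M. norm ((norm (g x))\<^sup>2) \<le> norm (c\<^sup>2 * (norm (f x))\<^sup>2)"
    using assms(3)
  proof eventually_elim
    case (elim x)
    then have "(norm (g x))\<^sup>2 \<le> (c * norm (f x))\<^sup>2" by (intro power_mono) auto
    then show ?case by (simp add: power_mult_distrib)
  qed
  ultimately have "integrable M (\<lambda>x. (norm (g x))\<^sup>2)"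
    using assms(2) by - (rule Bochner_Integration.integrable_bound[of M "\<lambda>x. c\<^sup>2 * (norm (f x))\<^sup>2"], auto)
  then show ?thesis using assms(2) by (simp add: sqint_def)
qed

lemma sqint_zero: "sqint M (\<lambda>x. 0)"
  by (simp add: sqint_def)

lemma sqint_add:
  assumes "sqint M f" "sqint M g" shows "sqint M (\<lambda>x. f x + g x)"
proof -
  have "integrable M (\<lambda>x. 2 * (norm (f x))\<^sup>2 + 2 * (norm (g x))\<^sup>2)" using assms by (simp add: sqint_def)
  moreover have "(norm (f x + g x))\<^sup>2 \<le> 2 * (norm (f x))\<^sup>2 + 2 * (norm (g x))\<^sup>2" for x
  proof -
    have "(norm (f x + g x))\<^sup>2 \<le> (norm (f x) + norm (g x))\<^sup>2" by (intro power_mono norm_triangle_ineq) auto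
    also have "\<dots> \<le> 2 * (norm (f x))\<^sup>2 + 2 * (norm (g x))\<^sup>2"
      using sum_squares_bound[of "norm (f x)" "norm (g x)"] by (simp add: power2_sum)
    finally show ?thesis .
  qed
  ultimately have "integrable M (\<lambda>x. (norm (f x + g x))\<^sup>2)"
    using sqint_measurable[OF assms(1)] sqint_measurable[OF assms(2)]
    by - (rule Bochner_Integration.integrable_bound[of M "\<lambda>x. 2 * (norm (f x))\<^sup>2 + 2 * (norm (g x))\<^sup>2"], auto)
  then show ?thesis using assms by (auto simp: sqint_def)
qed

lemma sqint_scaleR: "sqint M f \<Longrightarrow> sqint M (\<lambda>x. c *\<^sub>R f x)"
  by (auto simp: sqint_def power_mult_distrib)

lemma sqint_mult: "sqint M (f :: _ \<Rightarrow> real) \<Longrightarrow> sqint M (\<lambda>x. c * f x)"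
  using sqint_scaleR[of M f c] by simp

lemma sqint_diff: "sqint M f \<Longrightarrow> sqint M g \<Longrightarrow> sqint M (\<lambda>x. f x - g x)"
  using sqint_add[OF _ sqint_scaleR[of M g "-1"], of f] by simp

lemma sqint_sum: "(\<And>i. i \<in> I \<Longrightarrow> sqint M (f i)) \<Longrightarrow> sqint M (\<lambda>x. \<Sum>i\<in>I. f i x)"
  by (induction I rule: infinite_finite_induct) (auto intro: sqint_zero sqint_add)

lemma sqint_norm: "sqint M f \<Longrightarrow> sqint M (\<lambda>x. norm (f x))"
  by (auto simp: sqint_def)

lemma sqint_inner_right: "sqint M f \<Longrightarrow> sqint M (\<lambda>x. f x \<bullet> b)"
  using Cauchy_Schwarz_ineq2[of "f _" b] by - (rule sqint_bound[where c="norm b"], auto simp: mult.commute)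

lemma sqint_component: "sqint M (f :: _ \<Rightarrow> real^'n) \<Longrightarrow> sqint M (\<lambda>x. f x $ i)"
  using sqint_inner_right[of M f "axis i 1"] by (simp add: inner_axis)

lemma sqint_integrable_inner:
  assumes "sqint M f" "sqint M g" shows "integrable M (\<lambda>x. f x \<bullet> g x)"
proof -
  have "integrable M (\<lambda>x. (norm (f x))\<^sup>2 + (norm (g x))\<^sup>2)" using assms by (simp add: sqint_def)
  moreover have "\<bar>f x \<bullet> g x\<bar> \<le> (norm (f x))\<^sup>2 + (norm (g x))\<^sup>2" for x
    using Cauchy_Schwarz_ineq2[of "f x" "g x"] sum_squares_bound[of "norm (f x)" "norm (g x)"]
      mult_nonneg_nonneg[of "norm (f x)" "norm (g x)"] by (simp add: power2_eq_square)
  ultimately show ?thesis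
    using assms unfolding sqint_def by - (rule Bochner_Integration.integrable_bound[OF \<open>integrable M _\<close>], auto)
qed

lemma sqint_integrable_mult:
  "sqint M f \<Longrightarrow> sqint M g \<Longrightarrow> integrable M (\<lambda>x. f x * g x :: real)"
  using sqint_integrable_inner[of M f g] by simp

lemma l2norm_add_sq:
  assumes "sqint M f" "sqint M g"
  shows "(l2norm M (\<lambda>x. f x + t *\<^sub>R g x))\<^sup>2 = (l2norm M f)\<^sup>2 + 2 * t * (\<integral>x. f x \<bullet> g x \<partial>M) + t\<^sup>2 * (l2norm M g)\<^sup>2"
proof -
  note [simp] = sqint_integrable_inner[OF assms] sqint_integrable_sq[OF assms(1)] sqint_integrable_sq[OF assms(2)]
  have "(norm (f x + t *\<^sub>R g x))\<^sup>2 = (norm (f x))\<^sup>2 + (2 * t) * (f x \<bullet> g x) + t\<^sup>2 * (norm (g x))\<^sup>2" for x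
    unfolding power2_norm_eq_inner by (simp add: inner_add_left inner_add_right inner_commute algebra_simps power2_eq_square)
  then show ?thesis unfolding l2norm_sq by simp
qed

text \<open>The quadratic polynomial \<open>l2norm M (f + t g)\<^sup>2\<close> in \<open>t\<close> is
  nonnegative.\<close>

lemma l2_Cauchy_Schwarz:
  assumes "sqint M f" "sqint M g"
  shows "\<bar>\<integral>x. f x \<bullet> g x \<partial>M\<bar> \<le> l2norm M f * l2norm M g"
proof -
  define A B C where "A = (l2norm M f)\<^sup>2" and "B = (\<integral>x. f x \<bullet> g x \<partial>M)" and "C = (l2norm M g)\<^sup>2"
  have pos: "0 \<le> A + 2 * t * B + t\<^sup>2 * C" for t
    unfolding A_def B_def C_def l2norm_add_sq[OF assms, symmetric] by simp
  have "B\<^sup>2 \<le> A * C"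
  proof (cases "C = 0")
    case True
    have "B = 0"
    proof (rule ccontr)
      assume "B \<noteq> 0"
      \<comment> \<open>At this \<open>t\<close> the polynomial, linear for \<open>C = 0\<close>, has the value \<open>- 1\<close>.\<close>
      then show False using pos[of "- (A + 1) / (2 * B)"] True by (simp add: field_simps)
    qed
    then show ?thesis using True by simp
  next
    case False
    then have "C > 0" by (simp add: C_def)
    then show ?thesis using pos[of "- B / C"] by (simp add: power2_eq_square field_simps)
  qed
  then have "\<bar>B\<bar>\<^sup>2 \<le> (l2norm M f * l2norm M g)\<^sup>2" by (simp add: A_def C_def power_mult_distrib)
  then show ?thesis unfolding B_def by (rule power2_le_imp_le) simp
qed

lemma l2norm_scaleR: "l2norm M (\<lambda>x. c *\<^sub>R f x) = \<bar>c\<bar> * l2norm M f"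
  by (simp add: l2norm_def power_mult_distrib real_sqrt_mult)

lemma l2norm_minus_commute: "l2norm M (\<lambda>x. f x - g x) = l2norm M (\<lambda>x. g x - f x)"
  by (simp add: l2norm_def norm_minus_commute)

lemma l2norm_triangle:
  assumes "sqint M f" "sqint M g"
  shows "l2norm M (\<lambda>x. f x + g x) \<le> l2norm M f + l2norm M g"
proof (rule power2_le_imp_le)
  have "(l2norm M (\<lambda>x. f x + g x))\<^sup>2 = (l2norm M f)\<^sup>2 + 2 * (\<integral>x. f x \<bullet> g x \<partial>M) + (l2norm M g)\<^sup>2"
    using l2norm_add_sq[OF assms, of 1] by simp
  also have "\<dots> \<le> (l2norm M f + l2norm M g)\<^sup>2"
    using l2_Cauchy_Schwarz[OF assms] by (simp add: power2_sum)
  finally show "(l2norm M (\<lambda>x. f x + g x))\<^sup>2 \<le> (l2norm M f + l2norm M g)\<^sup>2" .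
qed simp

lemma l2norm_triangle_diff:
  assumes "sqint M f" "sqint M g" "sqint M h"
  shows "l2norm M (\<lambda>x. f x - h x) \<le> l2norm M (\<lambda>x. f x - g x) + l2norm M (\<lambda>x. g x - h x)"
  using l2norm_triangle[OF sqint_diff[OF assms(1,2)] sqint_diff[OF assms(2,3)]] by simp

lemma l2norm_diff_ge:
  assumes "sqint M f" "sqint M g"
  shows "\<bar>l2norm M f - l2norm M g\<bar> \<le> l2norm M (\<lambda>x. f x - g x)"
  using l2norm_triangle_diff[OF assms sqint_zero] l2norm_triangle_diff[OF assms(2,1) sqint_zero]
    l2norm_minus_commute[of M f g] by simp

lemma l2norm_mono:
  assumes "sqint M f" "sqint M g" "AE x in M. norm (f x) \<le> norm (g x)"
  shows "l2norm M f \<le> l2norm M g"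
  unfolding l2norm_def
  using assms(3) by (intro real_sqrt_le_mono integral_mono_AE sqint_integrable_sq assms)
    (auto elim!: eventually_mono intro!: power_mono)

lemma l2norm_eq_0:
  assumes "sqint M f" "l2norm M f = 0"
  shows "AE x in M. f x = 0"
  using integral_nonneg_eq_0_iff_AE[OF sqint_integrable_sq[OF assms(1)]] assms(2) by (simp add: l2norm_def)

lemma l2norm_sqint_AE_cong:
  assumes "AE x in M. f x = g x" "sqint M f" "g \<in> borel_measurable M"
  shows "l2norm M f = l2norm M g" "sqint M g"
proof -
  show "sqint M g" by (rule sqint_bound[OF assms(2,3), of 1]) (use assms(1) in auto)
  show "l2norm M f = l2norm M g" unfolding l2norm_def
    using assms by (intro arg_cong[where f=sqrt] integral_cong_AE) auto
qed

lemma l2_tendsto_inner: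
  assumes "\<And>n. sqint M (f n)" "sqint M f0" "sqint M g" "(\<lambda>n. l2norm M (\<lambda>x. f n x - f0 x)) \<longlonglongrightarrow> 0"
  shows "(\<lambda>n. \<integral>x. f n x \<bullet> g x \<partial>M) \<longlonglongrightarrow> (\<integral>x. f0 x \<bullet> g x \<partial>M)"
proof -
  have "norm ((\<integral>x. f n x \<bullet> g x \<partial>M) - (\<integral>x. f0 x \<bullet> g x \<partial>M)) \<le> l2norm M (\<lambda>x. f n x - f0 x) * l2norm M g" for n
    using l2_Cauchy_Schwarz[OF sqint_diff[OF assms(1)[of n] assms(2)] assms(3)]
    by (simp add: inner_diff_left sqint_integrable_inner assms)
  moreover have "(\<lambda>n. l2norm M (\<lambda>x. f n x - f0 x) * l2norm M g) \<longlonglongrightarrow> 0"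
    using tendsto_mult_right[OF assms(4)] by simp
  ultimately have "(\<lambda>n. (\<integral>x. f n x \<bullet> g x \<partial>M) - (\<integral>x. f0 x \<bullet> g x \<partial>M)) \<longlonglongrightarrow> 0"
    by - (rule Lim_null_comparison[OF always_eventually[OF allI]])
  then show ?thesis by (rule LIM_zero_cancel)
qed

lemma l2norm_tendsto:
  assumes "\<And>n. sqint M (f n)" "sqint M f0" "(\<lambda>n. l2norm M (\<lambda>x. f n x - f0 x)) \<longlonglongrightarrow> 0"
  shows "(\<lambda>n. l2norm M (f n)) \<longlonglongrightarrow> l2norm M f0"
proof -
  have "(\<lambda>n. l2norm M (f n) - l2norm M f0) \<longlonglongrightarrow> 0"
    using l2norm_diff_ge[OF assms(1) assms(2)]
    by (intro Lim_null_comparison[OF _ assms(3)] always_eventually) auto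
  then show ?thesis by (rule LIM_zero_cancel)
qed

subsection \<open>Completeness\<close>

text \<open>The squared increments stay summable in the mean when weighted with \<open>4 ^ n\<close>, because
  \<open>4 / 9 < 1\<close>. Hence almost everywhere the weighted increments tend to zero, and the increments
  are eventually below \<open>(1 / 2) ^ n\<close>. Unlike a comparison of the mean of the increments with that
  of their squares, this works for infinite measures.\<close>

lemma l2_AE_convergent:
  fixes f :: "nat \<Rightarrow> 'a \<Rightarrow> 'b::euclidean_space"
  assumes "\<And>n. sqint M (f n)" "\<And>n. l2norm M (\<lambda>x. f (Suc n) x - f n x) \<le> (1 / 3) ^ n"
  shows "AE x in M. convergent (\<lambda>n. f n x)"
proof -
  note [measurable] = sqint_measurable[OF assms(1)]
  define d where "d n x = f (Suc n) x - f n x" for n x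
  have [measurable]: "d n \<in> borel_measurable M" for n unfolding d_def[abs_def] by measurable
  have int: "integrable M (\<lambda>x. 4 ^ n * (norm (d n x))\<^sup>2)" for n
    unfolding d_def by (intro integrable_mult_right sqint_integrable_sq sqint_diff assms)
  have "(\<integral>\<^sup>+x. ennreal (4 ^ n * (norm (d n x))\<^sup>2) \<partial>M) \<le> ennreal ((4 / 9) ^ n)" for n
  proof -
    have "(\<integral>\<^sup>+x. ennreal (4 ^ n * (norm (d n x))\<^sup>2) \<partial>M) = ennreal (4 ^ n * (l2norm M (d n))\<^sup>2)"
      using nn_integral_eq_integral[OF int] by (simp add: l2norm_sq)
    also have "\<dots> \<le> ennreal (4 ^ n * ((1 / 3) ^ n)\<^sup>2)"
      using assms(2)[of n] unfolding d_def by (intro ennreal_leI mult_left_mono power_mono) auto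
    also have "4 ^ n * ((1 / 3) ^ n)\<^sup>2 = (4 / 9 :: real) ^ n"
      by (simp add: power_mult_distrib[symmetric] power2_eq_square)
    finally show ?thesis .
  qed
  then have "(\<integral>\<^sup>+x. (\<Sum>n. ennreal (4 ^ n * (norm (d n x))\<^sup>2)) \<partial>M) \<le> (\<Sum>n. ennreal ((4 / 9) ^ n))"
    by (subst nn_integral_suminf) (auto intro!: suminf_le)
  also have "\<dots> < \<infinity>"
    using summable_geometric[of "4 / 9 :: real"] by (subst suminf_ennreal2) auto
  finally have "AE x in M. (\<Sum>n. ennreal (4 ^ n * (norm (d n x))\<^sup>2)) \<noteq> \<infinity>"
    by (intro nn_integral_noteq_infinite) auto
  then show ?thesis
  proof eventually_elim
    case (elim x)
    have sm: "summable (\<lambda>n. 4 ^ n * (norm (d n x))\<^sup>2)"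
      by (rule summable_suminf_not_top[OF _ ]) (use elim in auto)
    then have "(\<lambda>n. 4 ^ n * (norm (d n x))\<^sup>2) \<longlonglongrightarrow> 0" by (rule summable_LIMSEQ_zero)
    then have "eventually (\<lambda>n. 4 ^ n * (norm (d n x))\<^sup>2 < 1) sequentially"
      by (rule order_tendstoD) simp
    then have "eventually (\<lambda>n. norm (d n x) \<le> (1 / 2) ^ n) sequentially"
    proof eventually_elim
      case (elim n)
      have "(norm (d n x))\<^sup>2 \<le> ((1 / 2) ^ n)\<^sup>2"
        using elim by (simp add: power_mult_distrib[symmetric] power2_eq_square field_simps flip: power_mult)
          (simp add: power_mult_distrib power2_eq_square field_simps flip: power_mult_distrib)?
      then show ?case by (rule power2_le_imp_le) simp
    qed
    then have "summable (\<lambda>n. d n x)"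
      by (rule summable_comparison_test_ev[OF _ summable_geometric]) simp
    then have "convergent (\<lambda>n. \<Sum>i<n. d i x)" by (simp add: summable_iff_convergent)
    moreover have "(\<Sum>i<n. d i x) = f n x - f 0 x" for n
      unfolding d_def by (rule sum_lessThan_telescope)
    ultimately show ?case by (simp add: convergent_diff_const_right_iff)
  qed
qed

text \<open>A fast subsequence has a pointwise limit almost everywhere, and Fatou's lemma bounds the distance
  of the sequence to it.\<close>

lemma l2_complete:
  fixes f :: "nat \<Rightarrow> 'a \<Rightarrow> 'b::euclidean_space"
  assumes f: "\<And>n. sqint M (f n)"
    and cau: "\<And>e. e > 0 \<Longrightarrow> \<exists>N. \<forall>m\<ge>N. \<forall>n\<ge>N. l2norm M (\<lambda>x. f m x - f n x) \<le> e"
  obtains w where "sqint M w" "(\<lambda>n. l2norm M (\<lambda>x. f n x - w x)) \<longlonglongrightarrow> 0"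
proof -
  note [measurable] = sqint_measurable[OF f]
  have "\<exists>N. \<forall>k. \<forall>m\<ge>N k. \<forall>n\<ge>N k. l2norm M (\<lambda>x. f m x - f n x) \<le> (1 / 3) ^ k"
    by (rule choice) (use cau in auto)
  then obtain N where N: "\<And>k m n. m \<ge> N k \<Longrightarrow> n \<ge> N k \<Longrightarrow> l2norm M (\<lambda>x. f m x - f n x) \<le> (1 / 3) ^ k"
    by blast
  \<comment> \<open>A convenient nondecreasing and unbounded choice with \<open>N k \<le> r k\<close>.\<close>
  define r where "r k = k + (\<Sum>i\<le>k. N i)" for k
  have rN: "N k \<le> r k" and rS: "r k \<le> r (Suc k)" and rk: "k \<le> r k" for k
    using member_le_sum[of k "{..k}" N] by (auto simp: r_def)
  have "AE x in M. convergent (\<lambda>k. f (r k) x)"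
    using N[of _ "r (Suc _)" "r _"] rN rS order_trans[OF rN rS] by (intro l2_AE_convergent f) auto
  define w where "w x = lim (\<lambda>k. f (r k) x)" for x
  have [measurable]: "w \<in> borel_measurable M" unfolding w_def[abs_def] by measurable
  have lim: "AE x in M. (\<lambda>k. f (r k) x) \<longlonglongrightarrow> w x"
    using \<open>AE x in M. convergent (\<lambda>k. f (r k) x)\<close> by eventually_elim (simp add: w_def convergent_LIMSEQ_iff)
  have bnd: "(\<integral>\<^sup>+x. ennreal ((norm (f n x - w x))\<^sup>2) \<partial>M) \<le> ennreal (e\<^sup>2)"
    if e: "\<And>m. m \<ge> K \<Longrightarrow> l2norm M (\<lambda>x. f n x - f m x) \<le> e" for n K e
  proof -
    have "(\<integral>\<^sup>+x. ennreal ((norm (f n x - w x))\<^sup>2) \<partial>M) =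
        (\<integral>\<^sup>+x. liminf (\<lambda>k. ennreal ((norm (f n x - f (r k) x))\<^sup>2)) \<partial>M)"
    proof (rule nn_integral_cong_AE, use lim in eventually_elim)
      case (elim x)
      have "(\<lambda>k. ennreal ((norm (f n x - f (r k) x))\<^sup>2)) \<longlonglongrightarrow> ennreal ((norm (f n x - w x))\<^sup>2)"
        by (intro tendsto_intros elim)
      from lim_imp_Liminf[OF _ this] show ?case by simp
    qed
    also have "\<dots> \<le> liminf (\<lambda>k. \<integral>\<^sup>+x. ennreal ((norm (f n x - f (r k) x))\<^sup>2) \<partial>M)"
      by (rule nn_integral_liminf) auto
    also have "\<dots> \<le> limsup (\<lambda>k. \<integral>\<^sup>+x. ennreal ((norm (f n x - f (r k) x))\<^sup>2) \<partial>M)"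
      by (intro Liminf_le_Limsup) simp
    also have "\<dots> \<le> ennreal (e\<^sup>2)"
    proof (rule Limsup_bounded, rule eventually_sequentiallyI[of K])
      fix k assume "k \<ge> K"
      then have "l2norm M (\<lambda>x. f n x - f (r k) x) \<le> e" using e rk[of k] by simp
      then have "(l2norm M (\<lambda>x. f n x - f (r k) x))\<^sup>2 \<le> e\<^sup>2" by (intro power_mono) auto
      then show "(\<integral>\<^sup>+x. ennreal ((norm (f n x - f (r k) x))\<^sup>2) \<partial>M) \<le> ennreal (e\<^sup>2)"
        using nn_integral_eq_integral[OF sqint_integrable_sq[OF sqint_diff[OF f f]], of n "r k"]
        by (simp add: l2norm_sq ennreal_leI)
    qed
    finally show ?thesis .
  qed
  have sq: "sqint M (\<lambda>x. f (N 0) x - w x)"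
  proof -
    have "(\<integral>\<^sup>+x. ennreal ((norm (f (N 0) x - w x))\<^sup>2) \<partial>M) \<le> ennreal (1\<^sup>2)"
      by (rule bnd[of "N 0"]) (use N[of 0] in auto)
    then show ?thesis unfolding sqint_def
      by (auto simp: integrable_iff_bounded intro: le_less_trans)
  qed
  then have w: "sqint M w" using sqint_diff[OF f[of "N 0"] sq] by simp
  have "(\<lambda>n. l2norm M (\<lambda>x. f n x - w x)) \<longlonglongrightarrow> 0"
  proof (rule LIMSEQ_I)
    fix e :: real assume "e > 0"
    then obtain K where K: "\<And>m n. m \<ge> K \<Longrightarrow> n \<ge> K \<Longrightarrow> l2norm M (\<lambda>x. f m x - f n x) \<le> e / 2"
      using cau[of "e / 2"] by auto
    have "l2norm M (\<lambda>x. f n x - w x) < e" if "n \<ge> K" for n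
    proof -
      have "ennreal ((l2norm M (\<lambda>x. f n x - w x))\<^sup>2) \<le> ennreal ((e / 2)\<^sup>2)"
        using bnd[of K n "e / 2"] K that nn_integral_eq_integral[OF sqint_integrable_sq[OF sqint_diff[OF f w]], of n]
        by (simp add: l2norm_sq)
      then have "(l2norm M (\<lambda>x. f n x - w x))\<^sup>2 \<le> (e / 2)\<^sup>2" by (simp add: ennreal_le_iff)
      then have "l2norm M (\<lambda>x. f n x - w x) \<le> e / 2"
        by (rule power2_le_imp_le) (use \<open>e > 0\<close> in simp)
      then show ?thesis using \<open>e > 0\<close> by simp
    qed
    then show "\<exists>K. \<forall>n\<ge>K. norm (l2norm M (\<lambda>x. f n x - w x) - 0) < e" by auto
  qed
  then show thesis using w that by blast
qed

subsection \<open>Weakly bounded sequences are bounded\<close>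

text \<open>A gliding hump. If the norms are unbounded, pick terms \<open>v n\<close> with norm above \<open>4
  ^ n\<close> and sum their multiples of norm \<open>(1 / 3) ^ n\<close>, with signs such that the pairing of
  the partial sum with \<open>v n\<close> is not reduced by the \<open>n\<close>-th step. All later steps
  together undo at most half of that step, so the sum pairs with \<open>v n\<close> to at least \<open>(4 / 3)
  ^ n / 2\<close>.\<close>

lemma l2_uniform_boundedness:
  fixes u :: "nat \<Rightarrow> 'a \<Rightarrow> 'b::euclidean_space"
  assumes u: "\<And>n. sqint M (u n)"
    and bdd: "\<And>w. sqint M w \<Longrightarrow> \<exists>C. \<forall>n. \<bar>\<integral>x. u n x \<bullet> w x \<partial>M\<bar> \<le> C"
  shows "\<exists>C. \<forall>n. l2norm M (u n) \<le> C"
proof (rule ccontr)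
  assume "\<not> ?thesis"
  then have "\<exists>k. l2norm M (u k) > 4 ^ n" for n :: nat by (meson not_le)
  then obtain k where k: "\<And>n. l2norm M (u (k n)) > 4 ^ n" by metis
  define v where "v n = u (k n)" for n
  define a where "a n = l2norm M (v n)" for n
  have a: "a n > 4 ^ n" for n using k by (simp add: a_def v_def)
  then have apos: "a n > 0" for n by (meson less_trans zero_less_power zero_less_numeral)
  have v: "sqint M (v n)" for n by (simp add: v_def u)
  define step where "step n S = (\<lambda>x. S x + ((if (\<integral>x. S x \<bullet> v n x \<partial>M) \<ge> 0 then 1 else - 1) * (1 / 3) ^ n / a n) *\<^sub>R v n x)"
    for n and S :: "'a \<Rightarrow> 'b"
  define S where "S = rec_nat (\<lambda>x. 0) step"
  have S_Suc: "S (Suc n) = step n (S n)" for n by (simp add: S_def)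
  have S: "sqint M (S n)" for n
  proof (induction n)
    case 0 then show ?case by (simp add: S_def sqint_zero)
  next
    case (Suc n) then show ?case unfolding S_Suc step_def by (intro sqint_add sqint_scaleR v)
  qed
  define s where "s n = (if (\<integral>x. S n x \<bullet> v n x \<partial>M) \<ge> 0 then 1 else - 1 :: real)" for n
  have S_Suc': "S (Suc n) = (\<lambda>x. S n x + (s n * (1 / 3) ^ n / a n) *\<^sub>R v n x)" for n
    by (simp add: S_Suc step_def s_def)
  have step_norm: "l2norm M (\<lambda>x. S (Suc n) x - S n x) = (1 / 3) ^ n" for n
    unfolding S_Suc' using apos[of n] by (simp add: l2norm_scaleR a_def[symmetric] s_def abs_mult)
  have tail: "l2norm M (\<lambda>x. S (n + m) x - S n x) \<le> 3 / 2 * (1 / 3) ^ n * (1 - (1 / 3) ^ m)" for n m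
  proof (induction m)
    case 0 show ?case by (simp add: l2norm_def)
  next
    case (Suc m)
    have "l2norm M (\<lambda>x. S (n + Suc m) x - S n x)
        \<le> l2norm M (\<lambda>x. S (Suc (n + m)) x - S (n + m) x) + l2norm M (\<lambda>x. S (n + m) x - S n x)"
      using l2norm_triangle_diff[OF S S S] by simp
    also have "\<dots> \<le> (1 / 3) ^ (n + m) + 3 / 2 * (1 / 3) ^ n * (1 - (1 / 3) ^ m)"
      using Suc step_norm by (intro add_mono) auto
    also have "\<dots> = 3 / 2 * (1 / 3) ^ n * (1 - (1 / 3) ^ Suc m)"
      by (simp add: power_add field_simps)
    finally show ?case .
  qed
  have tail': "l2norm M (\<lambda>x. S m x - S n x) \<le> 3 / 2 * (1 / 3) ^ n" if "m \<ge> n" for m n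
  proof -
    note nm = that
    obtain j where j: "m = n + j" using nm by (auto simp: le_iff_add)
    have "3 / 2 * (1 / 3) ^ n * (1 - (1 / 3) ^ j) \<le> (3 / 2 * (1 / 3) ^ n :: real)"
      by (rule mult_left_le) auto
    then show ?thesis unfolding j using tail[of n j] by (rule order_trans[rotated])
  qed
  obtain w where w: "sqint M w" "(\<lambda>n. l2norm M (\<lambda>x. S n x - w x)) \<longlonglongrightarrow> 0"
  proof (rule l2_complete[OF S])
    fix e :: real assume "e > 0"
    have "(\<lambda>n. 3 / 2 * (1 / 3) ^ n) \<longlonglongrightarrow> 3 / 2 * (0::real)"
      by (intro tendsto_intros LIMSEQ_power_zero) auto
    then have "eventually (\<lambda>n. 3 / 2 * (1 / 3) ^ n < e) sequentially" by (rule order_tendstoD) (use \<open>e > 0\<close> in simp)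
    then obtain N where N: "\<And>n. n \<ge> N \<Longrightarrow> 3 / 2 * (1 / 3) ^ n < e" by (auto simp: eventually_sequentially)
    have "l2norm M (\<lambda>x. S m x - S n x) \<le> e" if "m \<ge> N" "n \<ge> N" for m n
      using tail'[of m n] tail'[of n m] N[OF that(1)] N[OF that(2)] l2norm_minus_commute[of M "S m" "S n"]
      by (cases "m \<le> n") auto
    then show "\<exists>N. \<forall>m\<ge>N. \<forall>n\<ge>N. l2norm M (\<lambda>x. S m x - S n x) \<le> e" by blast
  qed
  have wS: "l2norm M (\<lambda>x. w x - S n x) \<le> 3 / 2 * (1 / 3) ^ n" for n
  proof (rule tendsto_le[OF _ tendsto_const l2norm_tendsto[of M "\<lambda>m x. S m x - S n x"]])
    show "eventually (\<lambda>m. l2norm M (\<lambda>x. S m x - S n x) \<le> 3 / 2 * (1 / 3) ^ n) sequentially"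
      using tail' by (intro eventually_sequentiallyI[of n])
    have e: "(\<lambda>x. (S m x - S n x) - (w x - S n x)) = (\<lambda>x. S m x - w x)" for m by auto
    show "(\<lambda>m. l2norm M (\<lambda>x. (S m x - S n x) - (w x - S n x))) \<longlonglongrightarrow> 0" unfolding e by (rule w)
  qed (auto intro: sqint_diff w S)
  have big: "\<bar>\<integral>x. v n x \<bullet> w x \<partial>M\<bar> \<ge> 1 / 2 * (4 / 3) ^ n" for n
  proof -
    define c where "c = s n * (1 / 3) ^ n / a n"
    have ints: "integrable M (\<lambda>x. S n x \<bullet> v n x)" "integrable M (\<lambda>x. v n x \<bullet> v n x)" "integrable M (\<lambda>x. w x \<bullet> v n x)"
      "integrable M (\<lambda>x. S (Suc n) x \<bullet> v n x)"
      by (intro sqint_integrable_inner S v w)+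
    have "(\<integral>x. S (Suc n) x \<bullet> v n x \<partial>M) = (\<integral>x. S n x \<bullet> v n x \<partial>M) + c * (\<integral>x. v n x \<bullet> v n x \<partial>M)"
      unfolding S_Suc' c_def[symmetric] using ints by (simp add: inner_add_left)
    also have "(\<integral>x. v n x \<bullet> v n x \<partial>M) = (a n)\<^sup>2" by (simp add: a_def l2norm_sq power2_norm_eq_inner)
    also have "c * (a n)\<^sup>2 = s n * (a n * (1 / 3) ^ n)" using apos[of n] by (simp add: c_def power2_eq_square)
    finally have "\<bar>\<integral>x. S (Suc n) x \<bullet> v n x \<partial>M\<bar> \<ge> a n * (1 / 3) ^ n"
      using mult_pos_pos[OF apos[of n], of "(1 / 3) ^ n"] by (auto simp: s_def split: if_splits)
    moreover have "\<bar>(\<integral>x. w x \<bullet> v n x \<partial>M) - (\<integral>x. S (Suc n) x \<bullet> v n x \<partial>M)\<bar> \<le> 3 / 2 * (1 / 3) ^ Suc n * a n"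
    proof -
      have "\<bar>(\<integral>x. w x \<bullet> v n x \<partial>M) - (\<integral>x. S (Suc n) x \<bullet> v n x \<partial>M)\<bar> \<le> l2norm M (\<lambda>x. w x - S (Suc n) x) * a n"
        using l2_Cauchy_Schwarz[OF sqint_diff[OF w(1) S] v, of "Suc n" n] ints by (simp add: inner_diff_left a_def)
      also have "\<dots> \<le> 3 / 2 * (1 / 3) ^ Suc n * a n" by (intro mult_right_mono wS less_imp_le[OF apos])
      finally show ?thesis .
    qed
    moreover have "3 / 2 * (1 / 3) ^ Suc n * a n = a n * (1 / 3) ^ n / 2" by simp
    ultimately have "\<bar>\<integral>x. w x \<bullet> v n x \<partial>M\<bar> \<ge> a n * (1 / 3) ^ n / 2" by linarith
    moreover have "a n * (1 / 3) ^ n / 2 \<ge> 4 ^ n * (1 / 3) ^ n / 2"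
      using a[of n] by (intro divide_right_mono mult_right_mono) auto
    moreover have "4 ^ n * (1 / 3) ^ n / 2 = 1 / 2 * (4 / 3 :: real) ^ n"
      by (simp flip: power_mult_distrib)
    ultimately show ?thesis by (simp add: inner_commute)
  qed
  obtain C where C: "\<And>n. \<bar>\<integral>x. u n x \<bullet> w x \<partial>M\<bar> \<le> C" using bdd[OF w(1)] by blast
  obtain n where "(4 / 3 :: real) ^ n > 2 * C" using real_arch_pow[of "4 / 3 :: real" "2 * C"] by auto
  then show False using big[of n] C[of "k n"] by (simp add: v_def)
qed

subsection \<open>Representation of a functional on the span of a sequence\<close>

lemma l2_parallelogram:
  assumes "sqint M f" "sqint M g"
  shows "(l2norm M (\<lambda>x. f x - g x))\<^sup>2 = 2 * (l2norm M f)\<^sup>2 + 2 * (l2norm M g)\<^sup>2 - 4 * (l2norm M (\<lambda>x. (1 / 2) *\<^sub>R (f x + g x)))\<^sup>2"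
  using l2norm_add_sq[OF assms, of 1] l2norm_add_sq[OF assms, of "-1"]
    arg_cong[where f="\<lambda>t. t\<^sup>2", OF l2norm_scaleR[of M "1/2" "\<lambda>x. f x + g x"]]
  by (simp add: power_mult_distrib power_divide del: l2norm_scaleR)

text \<open>Minimise the square of the norm minus twice the functional over the span. The bound keeps the
  infimum finite, the parallelogram law makes minimising sequences convergent, and the first variation at the
  limit gives the representation. The approximation of \<open>w\<close> by combinations of the \<open>G
  j\<close> is part of the conclusion because it places \<open>w\<close> in the closure of the span.\<close>

lemma l2_riesz_span:
  fixes G :: "nat \<Rightarrow> 'a \<Rightarrow> 'b::euclidean_space" and l :: "nat \<Rightarrow> real"
  assumes G: "\<And>j. sqint M (G j)"
    and bound: "\<And>m c. \<bar>\<Sum>j<m. c j * l j\<bar> \<le> C * l2norm M (\<lambda>x. \<Sum>j<m. c j *\<^sub>R G j x)"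
  obtains w m c where "sqint M w" "\<And>j. (\<integral>x. w x \<bullet> G j x \<partial>M) = l j"
    "(\<lambda>n::nat. l2norm M (\<lambda>x. (\<Sum>j<m n. c n j *\<^sub>R G j x) - w x)) \<longlonglongrightarrow> 0"
proof -
  \<comment> \<open>The graph of the functional: carrying the value along avoids choosing coefficients, which are not unique when the \<open>G j\<close> are dependent.\<close>
  define D where "D = {(f, t). \<exists>m c. f = (\<lambda>x. \<Sum>j<m. c j *\<^sub>R G j x) \<and> t = (\<Sum>j<m. c j * l j)}"
  have D_sq: "sqint M f" if "(f, t) \<in> D" for f t
    using that by (auto simp: D_def intro!: sqint_sum sqint_scaleR G)
  have D_G: "(G j, l j) \<in> D" for j
    unfolding D_def by (auto intro!: exI[of _ "Suc j"] exI[of _ "\<lambda>i. if i = j then 1 else 0"]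
      simp: if_distrib[of "\<lambda>t. t * _"] if_distrib[of "\<lambda>t. t *\<^sub>R _"] cong: if_cong)
  have D_lin: "(\<lambda>x. a *\<^sub>R f x + b *\<^sub>R g x, a * s + b * t) \<in> D" if "(f, s) \<in> D" "(g, t) \<in> D" for a b f g s t
  proof -
    obtain m c m' c' where f: "f = (\<lambda>x. \<Sum>j<m. c j *\<^sub>R G j x)" "s = (\<Sum>j<m. c j * l j)"
      and g: "g = (\<lambda>x. \<Sum>j<m'. c' j *\<^sub>R G j x)" "t = (\<Sum>j<m'. c' j * l j)"
      using \<open>(f, s) \<in> D\<close> \<open>(g, t) \<in> D\<close> unfolding D_def by blast
    define M' where "M' = max m m'"
    define e where "e j = a * (if j < m then c j else 0) + b * (if j < m' then c' j else 0)" for j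
    have 1: "(\<Sum>j<m. c j *\<^sub>R h j) = (\<Sum>j<M'. (if j < m then c j else 0) *\<^sub>R h j)"
      "(\<Sum>j<m'. c' j *\<^sub>R h j) = (\<Sum>j<M'. (if j < m' then c' j else 0) *\<^sub>R h j)" for h :: "nat \<Rightarrow> 'c::real_vector"
      by (rule sum.mono_neutral_cong_left; auto simp: M'_def)+
    have "(\<lambda>x. a *\<^sub>R f x + b *\<^sub>R g x) = (\<lambda>x. \<Sum>j<M'. e j *\<^sub>R G j x)"
      unfolding f g e_def 1 by (simp add: scaleR_sum_right scaleR_add_left sum.distrib)
    moreover have "a * s + b * t = (\<Sum>j<M'. e j * l j)"
      using 1[of l] unfolding f g e_def by (simp add: sum_distrib_left distrib_right sum.distrib mult.assoc)
    ultimately show ?thesis unfolding D_def by blast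
  qed
  define B where "B = \<bar>C\<bar>"
  have D_bd: "\<bar>t\<bar> \<le> B * l2norm M f" if "(f, t) \<in> D" for f t
  proof -
    have "\<bar>t\<bar> \<le> C * l2norm M f" using that bound by (auto simp: D_def)
    also have "\<dots> \<le> B * l2norm M f" by (intro mult_right_mono) (auto simp: B_def)
    finally show ?thesis .
  qed
  define J where "J p = (l2norm M (fst p))\<^sup>2 - 2 * snd p" for p :: "('a \<Rightarrow> 'b) \<times> real"
  have J_lb: "J p \<ge> - B\<^sup>2" if "p \<in> D" for p
  proof -
    obtain f t where p: "p = (f, t)" by force
    have "2 * t \<le> 2 * B * l2norm M f" using D_bd[of f t] that p by simp
    moreover have "0 \<le> (l2norm M f - B)\<^sup>2" by simp
    ultimately show ?thesis unfolding J_def p by (simp add: power2_diff algebra_simps)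
  qed
  define I where "I = Inf (J ` D)"
  have bdd: "bdd_below (J ` D)" using J_lb by (intro bdd_belowI[of _ "- B\<^sup>2"]) blast
  have I_le: "I \<le> J p" if "p \<in> D" for p unfolding I_def using bdd that by (simp add: cInf_lower)
  have "\<exists>p\<in>D. J p < I + 1 / Suc n" for n
    using cInf_lessD[of "J ` D" "I + 1 / Suc n"] D_G by (force simp: I_def)
  then obtain p where p: "\<And>n. p n \<in> D" "\<And>n. J (p n) < I + 1 / Suc n" by metis
  define f t where "f n = fst (p n)" and "t n = snd (p n)" for n
  have ft: "(f n, t n) \<in> D" for n using p by (simp add: f_def t_def)
  have J_ft: "(l2norm M (f n))\<^sup>2 - 2 * t n < I + 1 / Suc n" for n using p(2)[of n] by (simp add: J_def f_def t_def)
  have fsq: "sqint M (f n)" for n using D_sq ft by blast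
  have cau: "(l2norm M (\<lambda>x. f m x - f n x))\<^sup>2 \<le> 2 * (1 / Suc m + 1 / Suc n)" for m n
  proof -
    have "(\<lambda>x. (1/2) *\<^sub>R f m x + (1/2) *\<^sub>R f n x, 1/2 * t m + 1/2 * t n) \<in> D" by (intro D_lin ft)
    from I_le[OF this] have "I \<le> (l2norm M (\<lambda>x. (1/2) *\<^sub>R (f m x + f n x)))\<^sup>2 - (t m + t n)"
      by (simp add: J_def scaleR_add_right)
    then show ?thesis
      using l2_parallelogram[OF fsq fsq, of m n] J_ft[of m] J_ft[of n] unfolding distrib_left by argo
  qed
  obtain w where w: "sqint M w" "(\<lambda>n. l2norm M (\<lambda>x. f n x - w x)) \<longlonglongrightarrow> 0"
  proof (rule l2_complete[OF fsq])
    fix e :: real assume e: "e > 0"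
    then obtain N where N: "1 / Suc N < e\<^sup>2 / 4" using nat_approx_posE[of "e\<^sup>2 / 4"] by auto
    have "l2norm M (\<lambda>x. f m x - f n x) \<le> e" if "m \<ge> N" "n \<ge> N" for m n
    proof (rule power2_le_imp_le)
      have "1 / real (Suc m) \<le> 1 / Suc N" "1 / real (Suc n) \<le> 1 / Suc N"
        using that by (auto intro!: divide_left_mono)
      then show "(l2norm M (\<lambda>x. f m x - f n x))\<^sup>2 \<le> e\<^sup>2" using cau[of m n] N by argo
    qed (use e in simp)
    then show "\<exists>N. \<forall>m\<ge>N. \<forall>n\<ge>N. l2norm M (\<lambda>x. f m x - f n x) \<le> e" by blast
  qed
  have rep: "(\<integral>x. w x \<bullet> G j x \<partial>M) = l j" for j
  proof -
    define b where "b = (l2norm M (G j))\<^sup>2"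
    have lim: "(\<lambda>n. \<integral>x. f n x \<bullet> G j x \<partial>M) \<longlonglongrightarrow> (\<integral>x. w x \<bullet> G j x \<partial>M)"
      by (rule l2_tendsto_inner[OF fsq w(1) G w(2)])
    have pos: "0 \<le> 2 * s * ((\<integral>x. w x \<bullet> G j x \<partial>M) - l j) + s\<^sup>2 * b" for s
    proof (rule tendsto_le[OF _ _ tendsto_const])
      have "- (1 / Suc n) \<le> 2 * s * ((\<integral>x. f n x \<bullet> G j x \<partial>M) - l j) + s\<^sup>2 * b" for n
      proof -
        have "(\<lambda>x. 1 *\<^sub>R f n x + s *\<^sub>R G j x, 1 * t n + s * l j) \<in> D" by (intro D_lin ft D_G)
        from I_le[OF this] show ?thesis
          using l2norm_add_sq[OF fsq G, of n s j] J_ft[of n] by (simp add: J_def b_def algebra_simps)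
      qed
      then show "\<forall>\<^sub>F n in sequentially. 0 \<le> 2 * s * ((\<integral>x. f n x \<bullet> G j x \<partial>M) - l j) + s\<^sup>2 * b + 1 / Suc n"
        by (intro always_eventually) (smt (verit))
      have "(\<lambda>n. 2 * s * ((\<integral>x. f n x \<bullet> G j x \<partial>M) - l j) + s\<^sup>2 * b + 1 / Suc n) \<longlonglongrightarrow>
        2 * s * ((\<integral>x. w x \<bullet> G j x \<partial>M) - l j) + s\<^sup>2 * b + 0"
        by (intro tendsto_intros lim LIMSEQ_Suc lim_1_over_n)
      then show "(\<lambda>n. 2 * s * ((\<integral>x. f n x \<bullet> G j x \<partial>M) - l j) + s\<^sup>2 * b + 1 / Suc n) \<longlonglongrightarrow>
        2 * s * ((\<integral>x. w x \<bullet> G j x \<partial>M) - l j) + s\<^sup>2 * b" by simp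
    qed simp
    define E where "E = (\<integral>x. w x \<bullet> G j x \<partial>M) - l j"
    \<comment> \<open>The optimal step is \<open>- E / b\<close>; the shifted denominator also covers \<open>b = 0\<close>.\<close>
    have "0 \<le> 2 * (- E / (b + 1)) * E + (- E / (b + 1))\<^sup>2 * b" using pos unfolding E_def by blast
    moreover have "2 * (- E / (b + 1)) * E + (- E / (b + 1))\<^sup>2 * b = - (E / (b + 1))\<^sup>2 * (b + 2)"
    proof -
      have "b + 1 \<noteq> 0" by (simp add: b_def add_nonneg_eq_0_iff)
      define k where "k = E / (b + 1)"
      have E: "E = k * (b + 1)" using \<open>b + 1 \<noteq> 0\<close> by (simp add: k_def)
      have "2 * (- k) * E + (- k)\<^sup>2 * b = - (k\<^sup>2 * (b + 2))"
        unfolding E by (simp add: power2_eq_square algebra_simps)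
      then show ?thesis by (simp add: k_def)
    qed
    ultimately have "(E / (b + 1))\<^sup>2 * (b + 2) \<le> 0" by linarith
    moreover have "b \<ge> 0" by (simp add: b_def)
    ultimately have "E = 0" by (simp add: mult_le_0_iff)
    then show ?thesis by (simp add: E_def)
  qed
  have "\<exists>m c. f n = (\<lambda>x. \<Sum>j<m. c j *\<^sub>R G j x)" for n using ft[of n] by (auto simp: D_def)
  then obtain m c where "\<And>n. f n = (\<lambda>x. \<Sum>j<m n. c n j *\<^sub>R G j x)" by metis
  then have "(\<lambda>n. l2norm M (\<lambda>x. (\<Sum>j<m n. c n j *\<^sub>R G j x) - w x)) \<longlonglongrightarrow> 0" using w(2) by simp
  then show thesis by (rule that[OF w(1) rep])
qed

section \<open>Integration by parts\<close>

lemma measurable_lebesgue_continuous: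
  fixes f :: "real^'n \<Rightarrow> 'b::topological_space"
  shows "continuous_on UNIV f \<Longrightarrow> f \<in> borel_measurable lebesgue"
  by (simp add: borel_measurable_continuous_onI measurable_completion)

lemma integral_lebesgue_continuous:
  fixes f :: "real^'n \<Rightarrow> 'b::euclidean_space"
  shows "continuous_on UNIV f \<Longrightarrow> integral\<^sup>L lebesgue f = integral\<^sup>L lborel f"
  by (simp add: borel_measurable_continuous_onI integral_completion)

lemma integral_lborel_translate:
  fixes f :: "real^'n \<Rightarrow> 'b::{banach, second_countable_topology}"
  assumes "f \<in> borel_measurable borel"
  shows "(\<integral>x. f (x + c) \<partial>lborel) = integral\<^sup>L lborel f"
proof -
  have "integral\<^sup>L lborel f = integral\<^sup>L (distr lborel borel ((+) c)) f" by (simp add: lborel_distr_plus)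
  also have "\<dots> = (\<integral>x. f (x + c) \<partial>lborel)"
    using assms by (subst integral_distr) (auto simp: add.commute)
  finally show ?thesis by simp
qed

lemma integrable_indicator_continuous:
  fixes f :: "real^'n \<Rightarrow> real"
  assumes "continuous_on UNIV f" "S \<in> sets borel" "bounded S"
  shows "integrable lborel (\<lambda>x. indicator S x * f x)"
proof -
  have "integrable lborel (\<lambda>x. indicator (closure S) x *\<^sub>R f x)"
    using assms by (intro borel_integrable_compact) (auto intro: continuous_on_subset)
  then have "set_integrable lborel (closure S) f" by (simp add: set_integrable_def)
  then have "set_integrable lborel S f"
    by (rule set_integrable_subset) (use assms closure_subset in auto)
  then show ?thesis by (simp add: set_integrable_def)
qed

text \<open>The difference quotients in direction \<open>e\<close> integrate to zero and converge boundedly to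
  the derivative. The invariance under small shifts is the vanishing of boundary terms.\<close>

lemma integral_derivative_zero:
  fixes f :: "real^'n \<Rightarrow> real"
  assumes f: "\<And>x. f differentiable (at x)" "continuous_on UNIV (grad f)"
    and S: "S \<in> sets borel" "bounded S"
    and inv: "\<And>h. 0 < h \<Longrightarrow> h \<le> \<delta> \<Longrightarrow>
      (\<integral>x. indicator S x * f (x + h *\<^sub>R e) \<partial>lborel) = (\<integral>x. indicator S x * f x \<partial>lborel)"
    and "\<delta> > 0"
  shows "(\<integral>x. indicator S x * (grad f x \<bullet> e) \<partial>lborel) = 0"
proof -
  have cf: "continuous_on UNIV f"
    using f(1) by (simp add: continuous_at_imp_continuous_on differentiable_imp_continuous_within)
  define h where "h n = \<delta> / Suc n" for n
  have h: "0 < h n" "h n \<le> \<delta>" for n using \<open>\<delta> > 0\<close> by (auto simp: h_def field_simps)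
  have h0: "h \<longlonglongrightarrow> 0"
    using tendsto_mult_right[OF LIMSEQ_Suc[OF lim_1_over_n], of \<delta>] by (simp add: h_def[abs_def] field_simps)
  define q where "q n x = indicator S x * ((f (x + h n *\<^sub>R e) - f x) / h n)" for n x
  obtain R where R: "\<And>x. x \<in> S \<Longrightarrow> norm x \<le> R" using S(2) unfolding bounded_iff by blast
  let ?K = "cball 0 (R + \<delta> * norm e) :: (real^'n) set"
  have "compact (grad f ` ?K)" using f(2) by (intro compact_continuous_image) (auto intro: continuous_on_subset)
  then have "bounded (grad f ` ?K)" by (rule compact_imp_bounded)
  then obtain B where B: "\<And>x. x \<in> ?K \<Longrightarrow> norm (grad f x) \<le> B"
    unfolding bounded_iff by blast
  have q_bound: "norm (q n x) \<le> indicator S x * (B * norm e)" for n x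
  proof (cases "x \<in> S")
    case True
    have "norm (f (x + h n *\<^sub>R e) - f x) \<le> B * norm (h n *\<^sub>R e)"
    proof -
      have sub: "closed_segment x (x + h n *\<^sub>R e) \<subseteq> ?K"
      proof
        fix y assume "y \<in> closed_segment x (x + h n *\<^sub>R e)"
        then obtain t where t: "0 \<le> t" "t \<le> 1" "y = x + (t * h n) *\<^sub>R e"
          by (auto simp: closed_segment_def algebra_simps)
        have "norm y \<le> norm x + (t * h n) * norm e" unfolding t using h(1)[of n] t by (metis abs_of_nonneg less_imp_le mult_nonneg_nonneg norm_scaleR norm_triangle_ineq)
        also have "\<dots> \<le> R + \<delta> * norm e" using R[OF True] t h(1,2)[of n]
          by (intro add_mono mult_right_mono) (auto intro: order_trans[OF mult_left_le_one_le])
        finally show "y \<in> ?K" by simp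
      qed
      have "norm (f (x + h n *\<^sub>R e) - f x) \<le> norm (h n *\<^sub>R e) * B"
      proof (rule differentiable_bound_segment[where f'="\<lambda>y k. grad f y \<bullet> k" and G="?K"])
        show seg: "x + t *\<^sub>R (h n *\<^sub>R e) \<in> ?K" if "t \<in> {0..1}" for t :: real
        proof -
          have "x + t *\<^sub>R (h n *\<^sub>R e) \<in> closed_segment x (x + h n *\<^sub>R e)"
            using that by (auto simp: in_segment algebra_simps intro!: exI[of _ t])
          then show ?thesis using sub by blast
        qed
        show "(f has_derivative (\<lambda>k. grad f y \<bullet> k)) (at y within ?K)" for y
          using has_derivative_at_withinI[OF has_derivative_grad[OF f(1)]] .
        show "onorm (\<lambda>k. grad f (x + t *\<^sub>R (h n *\<^sub>R e)) \<bullet> k) \<le> B" if "t \<in> {0..1}" for t :: real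
          using B[OF seg[OF that]]
          by (intro onorm_le) (auto intro!: order_trans[OF Cauchy_Schwarz_ineq2] mult_right_mono)
      qed
      then show ?thesis by (simp add: mult.commute)
    qed
    then show ?thesis using True h(1)[of n] by (simp add: q_def field_simps)
  qed (simp add: q_def)
  have q_lim: "(\<lambda>n. q n x) \<longlonglongrightarrow> indicator S x * (grad f x \<bullet> e)" for x
  proof -
    have d: "((\<lambda>t. f (x + t *\<^sub>R e)) has_real_derivative (grad f x \<bullet> e)) (at 0)"
    proof -
      have "((\<lambda>t. x + t *\<^sub>R e) has_derivative (\<lambda>t. t *\<^sub>R e)) (at 0)"
        by (auto intro!: derivative_eq_intros)
      from has_derivative_compose[OF this, of f "\<lambda>k. grad f x \<bullet> k"] has_derivative_grad[OF f(1)]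
      show ?thesis by (simp add: has_field_derivative_def mult_commute_abs)
    qed
    then have "((\<lambda>t. (f (x + t *\<^sub>R e) - f x) / t) \<longlongrightarrow> grad f x \<bullet> e) (at 0)"
      by (simp add: DERIV_def)
    moreover have "filterlim h (at 0) sequentially"
      using h0 h(1) by (auto simp: filterlim_at order_less_imp_not_eq2 intro!: always_eventually)
    ultimately have "(\<lambda>n. (f (x + h n *\<^sub>R e) - f x) / h n) \<longlonglongrightarrow> grad f x \<bullet> e"
      by (rule filterlim_compose)
    then show ?thesis unfolding q_def by (intro tendsto_intros)
  qed
  have cfh: "continuous_on UNIV (\<lambda>x. f (x + h n *\<^sub>R e))" for n
    by (intro continuous_on_compose2[OF cf] continuous_intros) auto
  have "(\<integral>x. q n x \<partial>lborel) = 0" for n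
  proof -
    have "q n x = (1 / h n) * (indicator S x * f (x + h n *\<^sub>R e) - indicator S x * f x)" for x
      by (simp add: q_def field_simps)
    then show ?thesis
      using inv[OF h] integrable_indicator_continuous[OF cf S] integrable_indicator_continuous[OF cfh[of n] S]
      by (simp add: inv[OF h])
  qed
  moreover have "(\<lambda>n. \<integral>x. q n x \<partial>lborel) \<longlonglongrightarrow> (\<integral>x. indicator S x * (grad f x \<bullet> e) \<partial>lborel)"
  proof (rule integral_dominated_convergence[where w="\<lambda>x. indicator S x * (B * norm e)"])
    show "integrable lborel (\<lambda>x. indicator S x * (B * norm e))"
      by (intro integrable_indicator_continuous S) auto
    have [measurable]: "f \<in> borel_measurable borel" "grad f \<in> borel_measurable borel" "S \<in> sets borel"
      using cf f(2) S by (auto intro: borel_measurable_continuous_onI)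
    show "(\<lambda>x. indicator S x * (grad f x \<bullet> e)) \<in> borel_measurable lborel" by measurable
    show "q n \<in> borel_measurable lborel" for n unfolding q_def[abs_def] by measurable
  qed (use q_lim q_bound in auto)
  ultimately show ?thesis by (simp add: LIMSEQ_const_iff)
qed

lemma test_functionE:
  assumes "test_function \<Omega> \<zeta>"
  shows "smooth \<zeta>" "\<And>x. x \<notin> \<Omega> \<Longrightarrow> \<zeta> x = 0" "\<And>x. x \<notin> \<Omega> \<Longrightarrow> grad \<zeta> x = 0"
    "\<exists>K. compact K \<and> K \<subseteq> \<Omega> \<and> (\<forall>x. x \<notin> K \<longrightarrow> \<zeta> x = 0 \<and> grad \<zeta> x = 0)"
proof -
  let ?K = "closure {x. \<zeta> x \<noteq> 0}"
  show s: "smooth \<zeta>" using assms by (simp add: test_function_def)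
  have z: "\<zeta> x = 0" "grad \<zeta> x = 0" if "x \<notin> ?K" for x
  proof -
    show "\<zeta> x = 0" using that closure_subset[of "{x. \<zeta> x \<noteq> 0}"] by blast
    have "((\<lambda>x. 0) has_derivative (\<lambda>h. 0 \<bullet> h)) (at x)" by simp
    then have "(\<zeta> has_derivative (\<lambda>h. 0 \<bullet> h)) (at x)"
    proof (rule has_derivative_transform_within_open[of _ _ _ _ "- ?K"])
      show "0 = \<zeta> y" if "y \<in> - ?K" for y using that closure_subset[of "{x. \<zeta> x \<noteq> 0}"] by auto
    qed (use that in auto)
    then show "grad \<zeta> x = 0" by (rule grad_eqI)
  qed
  have K: "compact ?K" "?K \<subseteq> \<Omega>" using assms by (auto simp: test_function_def)
  show "\<exists>K. compact K \<and> K \<subseteq> \<Omega> \<and> (\<forall>x. x \<notin> K \<longrightarrow> \<zeta> x = 0 \<and> grad \<zeta> x = 0)"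
    using K z by blast
  show "\<zeta> x = 0" "grad \<zeta> x = 0" if "x \<notin> \<Omega>" for x using z[of x] that K by auto
qed

lemma test_functionI:
  assumes "smooth \<zeta>" "compact K" "K \<subseteq> \<Omega>" "\<And>x. x \<notin> K \<Longrightarrow> \<zeta> x = 0"
  shows "test_function \<Omega> \<zeta>"
proof -
  have "closure {x. \<zeta> x \<noteq> 0} \<subseteq> K"
    using assms by (intro closure_minimal compact_imp_closed) auto
  then show ?thesis unfolding test_function_def using assms
    by (meson closed_closure compact_Int_closed dual_order.trans inf.absorb_iff2 compact_eq_bounded_closed bounded_subset)
qed

lemma test_function_mult:
  assumes "test_function \<Omega> \<zeta>" "smooth f"
  shows "test_function \<Omega> (\<lambda>x. \<zeta> x * f x)"
proof -
  obtain K where "compact K" "K \<subseteq> \<Omega>" "\<And>x. x \<notin> K \<Longrightarrow> \<zeta> x = 0" using test_functionE(4)[OF assms(1)] by blast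
  then show ?thesis using test_functionE(1)[OF assms(1)] assms(2)
    by (intro test_functionI[of _ K]) (auto intro: smooth_mult)
qed

lemma continuous_compact_support_bounded:
  fixes f :: "real^'n \<Rightarrow> 'b::euclidean_space"
  assumes "continuous_on UNIV f" "compact K" "\<And>x. x \<notin> K \<Longrightarrow> f x = 0"
  obtains B where "0 \<le> B" "\<And>x. norm (f x) \<le> B"
proof -
  have "compact (f ` K)" using assms by (intro compact_continuous_image) (auto intro: continuous_on_subset)
  then have "bounded (f ` K)" by (rule compact_imp_bounded)
  then obtain B where B: "\<And>x. x \<in> K \<Longrightarrow> norm (f x) \<le> B"
    unfolding bounded_iff by blast
  show thesis
  proof (rule that[of "\<bar>B\<bar>"])
    show "norm (f x) \<le> \<bar>B\<bar>" for x using B[of x] assms(3)[of x] by (cases "x \<in> K") auto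
  qed simp
qed

lemma integrable_continuous_compact_support:
  fixes f :: "real^'n \<Rightarrow> 'b::euclidean_space"
  assumes "continuous_on UNIV f" "compact K" "\<And>x. x \<notin> K \<Longrightarrow> f x = 0"
  shows "integrable lborel f" "integrable lebesgue f"
proof -
  have "integrable lborel (\<lambda>x. indicator K x *\<^sub>R f x)"
    using assms by (intro borel_integrable_compact) (auto intro: continuous_on_subset)
  moreover have "(\<lambda>x. indicator K x *\<^sub>R f x) = f" using assms(3) by (auto simp: indicator_def fun_eq_iff)
  ultimately show "integrable lborel f" by simp
  then show "integrable lebesgue f"
    using assms(1) by (simp add: integrable_completion borel_measurable_continuous_onI)
qed

lemma integral_vec_component:
  fixes f :: "'a \<Rightarrow> real^'n"
  shows "integrable M f \<Longrightarrow> (\<integral>x. f x \<partial>M) $ i = (\<integral>x. f x $ i \<partial>M)"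
  by (rule integral_bounded_linear[OF bounded_linear_vec_nth, symmetric])

text \<open>On a ball slightly larger than the support, small shifts do not push the support across the
  boundary.\<close>

lemma integral_grad_test_function:
  fixes \<zeta> :: "real^'n \<Rightarrow> real"
  assumes "test_function \<Omega> \<zeta>"
  shows "(\<integral>x. grad \<zeta> x \<partial>lebesgue) = 0"
proof -
  obtain K where K: "compact K" "\<And>x. x \<notin> K \<Longrightarrow> \<zeta> x = 0" "\<And>x. x \<notin> K \<Longrightarrow> grad \<zeta> x = 0"
    using test_functionE(4)[OF assms] by blast
  have s: "smooth \<zeta>" using assms by (rule test_functionE)
  obtain R where R: "\<And>x. x \<in> K \<Longrightarrow> norm x \<le> R" using compact_imp_bounded[OF K(1)] unfolding bounded_iff by blast
  note int = integrable_continuous_compact_support[OF smooth_grad_continuous[OF s] K(1,3)]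
  have "(\<integral>x. grad \<zeta> x \<partial>lborel) $ i = 0" for i
  proof -
    let ?S = "cball 0 (R + 1) :: (real^'n) set"
    have "(\<integral>x. indicator ?S x * (grad \<zeta> x \<bullet> axis i 1) \<partial>lborel) = 0"
    proof (rule integral_derivative_zero[where \<delta>=1])
      fix h :: real assume h: "0 < h" "h \<le> 1"
      have "\<zeta> (x + h *\<^sub>R axis i 1) = 0" if "x \<notin> ?S" for x
      proof (rule K(2), rule notI)
        assume "x + h *\<^sub>R axis i 1 \<in> K"
        then have "norm (x + h *\<^sub>R axis i 1) \<le> R" by (rule R)
        moreover have "norm x \<le> norm (x + h *\<^sub>R axis i 1) + norm (h *\<^sub>R axis i (1::real) :: real^'n)" by (rule norm_triangle_sub[of x "x + h *\<^sub>R axis i 1", simplified minus_add_distrib, THEN order_trans]) (simp add: norm_minus_commute)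
        ultimately show False using that h by (simp add: norm_axis_1)
      qed
      then have "(\<lambda>x. indicator ?S x * \<zeta> (x + h *\<^sub>R axis i 1)) = (\<lambda>x. \<zeta> (x + h *\<^sub>R axis i 1))"
        by (auto simp: indicator_def fun_eq_iff)
      moreover have "(\<lambda>x. indicator ?S x * \<zeta> x) = \<zeta>"
      proof
        fix x show "indicator ?S x * \<zeta> x = \<zeta> x"
          using R[of x] K(2)[of x] by (cases "x \<in> K") (auto simp: indicator_def)
      qed
      ultimately show "(\<integral>x. indicator ?S x * \<zeta> (x + h *\<^sub>R axis i 1) \<partial>lborel) = (\<integral>x. indicator ?S x * \<zeta> x \<partial>lborel)"
        using integral_lborel_translate[of \<zeta> "h *\<^sub>R axis i 1"] smooth_continuous[OF s, of UNIV] by (simp add: borel_measurable_continuous_onI)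
    qed (auto simp: smooth_differentiable s smooth_grad_continuous)
    moreover have "(\<lambda>x. indicator ?S x * (grad \<zeta> x \<bullet> axis i 1)) = (\<lambda>x. grad \<zeta> x $ i)"
    proof
      fix x show "indicator ?S x * (grad \<zeta> x \<bullet> axis i 1) = grad \<zeta> x $ i"
        using R[of x] K(3)[of x] by (cases "x \<in> K") (auto simp: indicator_def inner_axis)
    qed
    ultimately show ?thesis using integral_vec_component[OF int(1)] by simp
  qed
  then show ?thesis
    using integral_lebesgue_continuous[OF smooth_grad_continuous[OF s]] by (simp add: vec_eq_iff)
qed

section \<open>Periodic functions on the cell\<close>

lemma cell_eq_cbox: "cell L = cbox 0 (\<chi> i. L)"
  by (auto simp: cell_def mem_box_cart)

lemma interior_cell: "interior (cell L) = box 0 (\<chi> i. L)"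
  by (simp add: cell_eq_cbox interior_cbox)

lemma cell_sets [measurable, simp]: "cell L \<in> sets borel" "cell L \<in> sets lebesgue"
  by (auto simp: cell_eq_cbox)

lemma bounded_cell: "bounded (cell L)"
  by (simp add: cell_eq_cbox)

lemma AE_cell_interior: "AE y in lebesgue. y \<in> cell L \<longleftrightarrow> y \<in> interior (cell L)"
proof -
  have "cbox 0 (\<chi> i. L) - box 0 (\<chi> i. L) \<in> null_sets lebesgue"
    using negligible_frontier_interval negligible_iff_null_sets by blast
  then have "AE y in lebesgue. y \<notin> cbox 0 (\<chi> i. L) - box 0 (\<chi> i. L)" by (rule AE_not_in)
  then show ?thesis
    unfolding interior_cell cell_eq_cbox using box_subset_cbox[of 0 "\<chi> i. L"] by (auto elim!: eventually_mono)
qed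

lemma measure_cell: "L > 0 \<Longrightarrow> measure lebesgue (cell L :: (real^'n) set) = L ^ CARD('n)"
  using content_cbox_cart[of "0 :: real^'n" "\<chi> i. L"] interval_ne_empty_cart(1)[of "0 :: real^'n" "\<chi> i. L"]
  by (simp add: cell_eq_cbox)

text \<open>With total mass one, integrals with respect to it are the averages over the cell that occur in
  two-scale limits.\<close>

definition cellm :: "real \<Rightarrow> (real^'n) measure"
  where "cellm L = uniform_measure lebesgue (cell L)"

lemma sets_cellm [measurable_cong, simp]: "sets (cellm L) = sets lebesgue"
  by (simp add: cellm_def)
lemma space_cellm [simp]: "space (cellm L) = UNIV"
  by (simp add: cellm_def)

lemma cellm_density:
  assumes "L > 0"
  shows "cellm L = density lebesgue (\<lambda>y::real^'n. ennreal (indicator (cell L) y / L ^ CARD('n)))"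
proof -
  have "emeasure lebesgue (cell L :: (real^'n) set) = ennreal (L ^ CARD('n))"
    using measure_cell[OF assms, where 'n='n] by (metis bounded_cell bounded_set_imp_lmeasurable cell_sets(2) emeasure_eq_measure2)
  then show ?thesis unfolding cellm_def uniform_measure_def using assms
    by (intro density_cong) (auto simp: indicator_def divide_ennreal[of 1, simplified] intro!: AE_I2)
qed

lemma integrable_scaleR_iff:
  fixes f :: "'a \<Rightarrow> 'b::{banach, second_countable_topology}"
  assumes "c \<noteq> 0" shows "integrable M (\<lambda>x. c *\<^sub>R f x) \<longleftrightarrow> integrable M f"
proof
  assume "integrable M (\<lambda>x. c *\<^sub>R f x)"
  then have "integrable M (\<lambda>x. inverse c *\<^sub>R c *\<^sub>R f x)" by (rule integrable_scaleR_right)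
  then show "integrable M f" using assms by simp
qed simp

lemma integral_cellm:
  fixes f :: "real^'n \<Rightarrow> 'b::euclidean_space"
  assumes "L > 0" "f \<in> borel_measurable lebesgue"
  shows "(\<integral>y. f y \<partial>cellm L) = (LINT y:cell L|lebesgue. f y) /\<^sub>R L ^ CARD('n)"
    and "integrable (cellm L) f \<longleftrightarrow> set_integrable lebesgue (cell L) f"
proof -
  have e: "(indicator (cell L) y / L ^ CARD('n)) *\<^sub>R f y = inverse (L ^ CARD('n)) *\<^sub>R (indicator (cell L) y *\<^sub>R f y)" for y
    by (simp add: divide_inverse mult.commute)
  show "(\<integral>y. f y \<partial>cellm L) = (LINT y:cell L|lebesgue. f y) /\<^sub>R L ^ CARD('n)"
    unfolding cellm_density[OF assms(1)] using assms
    by (subst integral_density) (simp_all add: e set_lebesgue_integral_def del: scaleR_scaleR)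
  show "integrable (cellm L) f \<longleftrightarrow> set_integrable lebesgue (cell L) f"
    unfolding cellm_density[OF assms(1)] using assms
    by (subst integrable_density) (simp_all add: e set_integrable_def integrable_scaleR_iff del: scaleR_scaleR)
qed

lemma finite_measure_cellm:
  assumes "L > 0"
  shows "finite_measure (cellm L :: (real^'n) measure)" and "measure (cellm L) (UNIV :: (real^'n) set) = 1"
proof -
  have m: "emeasure lebesgue (cell L :: (real^'n) set) = ennreal (L ^ CARD('n))"
    using measure_cell[OF assms, where 'n='n] by (metis bounded_cell bounded_set_imp_lmeasurable cell_sets(2) emeasure_eq_measure2)
  have "emeasure (cellm L) (UNIV :: (real^'n) set) = 1"
    unfolding cellm_def using assms by (simp add: emeasure_uniform_measure m divide_ennreal)
  then show "finite_measure (cellm L :: (real^'n) measure)" "measure (cellm L) (UNIV :: (real^'n) set) = 1"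
    by (auto intro!: finite_measureI simp: measure_def)
qed

lemma AE_cellm:
  assumes "L > 0"
  shows "(AE y in cellm L. P y) \<longleftrightarrow> (AE y in lebesgue. y \<in> cell L \<longrightarrow> P y)"
  unfolding cellm_density[OF assms]
  using assms by (subst AE_density) (auto simp: indicator_def ennreal_zero_less_divide intro!: AE_cong split: if_splits)

lemma integrable_cellm_bounded:
  fixes f :: "real^'n \<Rightarrow> 'b::euclidean_space"
  assumes "L > 0" "continuous_on UNIV f"
  shows "integrable (cellm L) f"
proof -
  have "set_integrable lborel (cell L) f"
    unfolding set_integrable_def cell_eq_cbox
    using assms(2) by (intro borel_integrable_compact) (auto intro: continuous_on_subset)
  then have "set_integrable lebesgue (cell L) f" unfolding set_integrable_def using assms
    by (subst integrable_completion) (auto simp: borel_measurable_continuous_onI)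
  then show ?thesis using assms by (simp add: integral_cellm measurable_lebesgue_continuous)
qed

lemma sqint_cellm_continuous:
  fixes f :: "real^'n \<Rightarrow> 'b::euclidean_space"
  assumes "L > 0" "continuous_on UNIV f"
  shows "sqint (cellm L) f"
proof -
  have "f \<in> borel_measurable (cellm L)"
    using measurable_lebesgue_continuous[OF assms(2)] by (simp cong: measurable_cong_sets)
  then show ?thesis unfolding sqint_def
    using assms by (auto intro!: integrable_cellm_bounded continuous_intros)
qed

lemma integral_cellm_lborel:
  fixes f :: "real^'n \<Rightarrow> real"
  assumes "L > 0" "continuous_on UNIV f"
  shows "(\<integral>y. f y \<partial>cellm L) = (\<integral>y. indicator (cell L) y * f y \<partial>lborel) / L ^ CARD('n)"
  unfolding integral_cellm(1)[OF assms(1) measurable_lebesgue_continuous[OF assms(2)]] set_lebesgue_integral_def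
proof -
  have [measurable]: "f \<in> borel_measurable borel" by (rule borel_measurable_continuous_onI[OF assms(2)])
  show "(\<integral>y. indicator (cell L) y *\<^sub>R f y \<partial>lebesgue) /\<^sub>R L ^ CARD('n) = (\<integral>y. indicator (cell L) y * f y \<partial>lborel) / L ^ CARD('n)"
    by (subst integral_completion) (simp_all add: divide_inverse)
qed

lemma periodicD: "periodic L f \<Longrightarrow> f (x + L *\<^sub>R axis i 1) = f x"
  by (simp add: periodic_def)

lemma periodic_of_nat: "periodic L f \<Longrightarrow> f (x + (of_nat k * L) *\<^sub>R axis i 1) = f x"
proof (induction k)
  case (Suc k)
  then show ?case using periodicD[OF Suc.prems, of "x + (of_nat k * L) *\<^sub>R axis i 1"]
    by (simp add: algebra_simps)
qed simp

lemma periodic_of_int: "periodic L f \<Longrightarrow> f (x + (of_int k * L) *\<^sub>R axis i 1) = f x"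
proof (cases k)
  case (nonneg n)
  then show "periodic L f \<Longrightarrow> ?thesis" using periodic_of_nat[of L f x n] by simp
next
  case (neg n)
  then show "periodic L f \<Longrightarrow> ?thesis"
    using periodic_of_nat[of L f "x + (of_int k * L) *\<^sub>R axis i 1" "Suc n" i]
    by (simp add: add.assoc flip: scaleR_add_left distrib_right del: of_nat_Suc)
qed

lemma periodic_lattice:
  assumes "periodic L f"
  shows "f (x + (\<Sum>i\<in>I. (of_int (k i) * L) *\<^sub>R axis i 1)) = f x"
  by (induction I arbitrary: x rule: infinite_finite_induct)
     (auto simp: periodic_of_int[OF assms] add.assoc[symmetric])

text \<open>One point of the cell serves all periodic functions at once, so that different functions can be
  compared at it.\<close>

lemma cell_representative:
  assumes "L > 0"
  obtains y where "y \<in> cell L" "\<And>f. periodic L f \<Longrightarrow> f x = f y"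
proof -
  define k where "k i = - \<lfloor>x $ i / L\<rfloor>" for i
  define y where "y = x + (\<Sum>i\<in>UNIV. (of_int (k i) * L) *\<^sub>R axis i 1)"
  have "y $ i = x $ i + of_int (k i) * L" for i
    by (simp add: y_def axis_def if_distrib cong: if_cong)
  moreover have "of_int \<lfloor>x $ i / L\<rfloor> * L \<le> x $ i" "x $ i \<le> (of_int \<lfloor>x $ i / L\<rfloor> + 1) * L" for i
    using floor_correct[of "x $ i / L"] assms pos_le_divide_eq[OF assms, of "of_int \<lfloor>x $ i / L\<rfloor>" "x $ i"]
      pos_divide_less_eq[OF assms, of "x $ i" "of_int \<lfloor>x $ i / L\<rfloor> + 1"] by auto
  ultimately have "y \<in> cell L" by (auto simp: cell_def k_def algebra_simps) (smt (verit))+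
  moreover have "f x = f y" if "periodic L f" for f
    using periodic_lattice[OF that, of x k UNIV] by (simp add: y_def)
  ultimately show thesis using that by blast
qed

lemma periodic_translate: "periodic L f \<Longrightarrow> periodic L (\<lambda>x. f (x + c))"
  unfolding periodic_def by (metis add.assoc add.commute)

text \<open>Translating the cell by \<open>h\<close> in direction \<open>i\<close> exchanges a slab for its
  translate by one period.\<close>

lemma integral_cell_translate_axis:
  fixes f :: "real^'n \<Rightarrow> real"
  assumes f: "continuous_on UNIV f" "periodic L f" and h: "0 \<le> h" "h \<le> L"
  shows "(\<integral>x. indicator (cell L) x * f (x + h *\<^sub>R axis i 1) \<partial>lborel) = (\<integral>x. indicator (cell L) x * f x \<partial>lborel)"
proof -
  \<comment> \<open>Half-open in direction \<open>i\<close>, so that adjacent slabs partition their union.\<close>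
  define slab where "slab s t = {x :: real^'n. (\<forall>j. j \<noteq> i \<longrightarrow> 0 \<le> x $ j \<and> x $ j \<le> L) \<and> s \<le> x $ i \<and> x $ i < t}" for s t
  have slab [measurable]: "slab s t \<in> sets borel" for s t
    unfolding slab_def by measurable
  have bdd: "bounded (slab s t)" for s t
  proof -
    have "slab s t \<subseteq> cbox (\<chi> j. min 0 s) (\<chi> j. max L t)"
      by (auto simp: slab_def mem_box_cart min_le_iff_disj le_max_iff_disj) (metis less_imp_le)+
    then show ?thesis using bounded_cbox bounded_subset by blast
  qed
  have shift: "indicat_real (slab s t) (x - c *\<^sub>R axis i 1) = indicator (slab (s + c) (t + c)) x" for s t c x
  proof -
    have "x - c *\<^sub>R axis i 1 \<in> slab s t \<longleftrightarrow> x \<in> slab (s + c) (t + c)"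
      by (auto simp: slab_def axis_def algebra_simps)
    then show ?thesis by (simp add: indicator_def)
  qed
  have cell: "(\<integral>x. indicator (cell L) x * g x \<partial>lborel) = (\<integral>x. indicator (slab 0 L) x * g x \<partial>lborel)"
    if g: "continuous_on UNIV g" for g :: "real^'n \<Rightarrow> real"
  proof (rule integral_cong_AE)
    have "{x :: real^'n. axis i 1 \<bullet> x = L} \<in> null_sets lborel"
    proof -
      have "negligible {x :: real^'n. axis i 1 \<bullet> x = L}" by (rule negligible_hyperplane) (simp add: axis_eq_0_iff)
      then show ?thesis by (simp add: negligible_iff_null_sets null_sets_completion_iff closed_hyperplane borel_closed)
    qed
    from AE_not_in[OF this] show "AE x in lborel. indicator (cell L) x * g x = indicator (slab 0 L) x * g x"
    proof eventually_elim
      case (elim x)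
      then have "x $ i \<noteq> L" by (simp add: inner_axis')
      then have "x \<in> cell L \<longleftrightarrow> x \<in> slab 0 L"
        unfolding cell_def slab_def by (auto simp: less_le)
      then show ?case by (simp add: indicator_def)
    qed
    show "(\<lambda>x. indicator (cell L) x * g x) \<in> borel_measurable lborel" "(\<lambda>x. indicator (slab 0 L) x * g x) \<in> borel_measurable lborel"
      using borel_measurable_continuous_onI[OF g] by measurable
  qed
  have tr: "(\<integral>x. indicator (slab s t) x * f (x + c *\<^sub>R axis i 1) \<partial>lborel) = (\<integral>x. indicator (slab (s + c) (t + c)) x * f x \<partial>lborel)" for s t c
  proof -
    have [measurable]: "f \<in> borel_measurable borel" by (rule borel_measurable_continuous_onI[OF f(1)])
    have "(\<integral>x. indicator (slab (s + c) (t + c)) x * f x \<partial>lborel) = (\<integral>x. indicator (slab (s + c) (t + c)) (x + c *\<^sub>R axis i 1) * f (x + c *\<^sub>R axis i 1) \<partial>lborel)"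
      by (rule integral_lborel_translate[symmetric]) measurable
    also have "\<dots> = (\<integral>x. indicator (slab s t) x * f (x + c *\<^sub>R axis i 1) \<partial>lborel)"
      using shift[of "s + c" "t + c" _ "-c"] by simp
    finally show ?thesis by simp
  qed
  have int: "integrable lborel (\<lambda>x. indicator (slab s t) x * f x)" for s t
    by (rule integrable_indicator_continuous[OF f(1) slab bdd])
  have split: "(\<integral>x. indicator (slab s t) x * f x \<partial>lborel) + (\<integral>x. indicator (slab t u) x * f x \<partial>lborel) = (\<integral>x. indicator (slab s u) x * f x \<partial>lborel)"
    if "s \<le> t" "t \<le> u" for s t u
  proof -
    have "indicator (slab s t) x * f x + indicator (slab t u) x * f x = indicator (slab s u) x * f x" for x
      using that by (auto simp: slab_def indicator_def)
    then show ?thesis by (simp flip: Bochner_Integration.integral_add[OF int int])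
  qed
  have "(\<integral>x. indicator (cell L) x * f (x + h *\<^sub>R axis i 1) \<partial>lborel) = (\<integral>x. indicator (slab 0 L) x * f (x + h *\<^sub>R axis i 1) \<partial>lborel)"
    by (intro cell continuous_on_compose2[OF f(1)] continuous_intros) auto
  also have "\<dots> = (\<integral>x. indicator (slab h (L + h)) x * f x \<partial>lborel)" using tr[of 0 L h] by simp
  also have "\<dots> = (\<integral>x. indicator (slab h L) x * f x \<partial>lborel) + (\<integral>x. indicator (slab L (L + h)) x * f x \<partial>lborel)"
    using split[of h L "L + h"] h by simp
  also have "(\<integral>x. indicator (slab L (L + h)) x * f x \<partial>lborel) = (\<integral>x. indicator (slab 0 h) x * f x \<partial>lborel)"
    using tr[of 0 h L] periodicD[OF f(2)] by (simp add: add.commute)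
  also have "(\<integral>x. indicator (slab h L) x * f x \<partial>lborel) + (\<integral>x. indicator (slab 0 h) x * f x \<partial>lborel) = (\<integral>x. indicator (slab 0 L) x * f x \<partial>lborel)"
    using split[of 0 h L] h by simp
  also have "\<dots> = (\<integral>x. indicator (cell L) x * f x \<partial>lborel)" by (rule cell[OF f(1), symmetric])
  finally show ?thesis .
qed

lemma integral_cellm_translate:
  fixes f :: "real^'n \<Rightarrow> real"
  assumes L: "L > 0" and f: "continuous_on UNIV f" "periodic L f" and c: "c \<in> cell L"
  shows "(\<integral>x. f (x + c) \<partial>cellm L) = (\<integral>x. f x \<partial>cellm L)"
proof -
  have cont: "continuous_on UNIV (\<lambda>x. g (x + d))" if "continuous_on UNIV g" for g :: "real^'n \<Rightarrow> real" and d
    by (intro continuous_on_compose2[OF that] continuous_intros) auto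
  have "(\<integral>x. f (x + (\<Sum>i\<in>I. c $ i *\<^sub>R axis i 1)) \<partial>cellm L) = (\<integral>x. f x \<partial>cellm L)" if "finite I" for I
    using that
  proof (induction I)
    case (insert j I)
    let ?g = "\<lambda>x. f (x + (\<Sum>i\<in>I. c $ i *\<^sub>R axis i 1))"
    have "(\<integral>x. ?g (x + c $ j *\<^sub>R axis j 1) \<partial>cellm L) = (\<integral>x. ?g x \<partial>cellm L)"
      using integral_cell_translate_axis[OF cont[OF f(1)] periodic_translate[OF f(2)], of "c $ j" j] c
      by (simp add: integral_cellm_lborel[OF L cont[OF f(1)]] integral_cellm_lborel[OF L cont[OF cont[OF f(1)]]] cell_def[of L, symmetric])
        (simp add: cell_def)?
    then show ?case using insert by (simp add: add.assoc add.left_commute add.commute)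
  qed simp
  moreover have "(\<Sum>i\<in>UNIV. c $ i *\<^sub>R axis i 1) = c"
    by (simp add: vec_eq_iff axis_def if_distrib cong: if_cong)
  ultimately show ?thesis by (metis finite)
qed

subsection \<open>Waves with the periods of the cell\<close>

text \<open>The frequencies of the waves that have the periods of the cell.\<close>

definition dual_lattice :: "real \<Rightarrow> (real^'n) set"
  where "dual_lattice L = {\<kappa>. \<forall>i. \<exists>k::int. \<kappa> $ i = 2 * pi * of_int k / L}"

lemma dual_lattice_add: "\<kappa> \<in> dual_lattice L \<Longrightarrow> \<kappa>' \<in> dual_lattice L \<Longrightarrow> \<kappa> + \<kappa>' \<in> dual_lattice L"
  unfolding dual_lattice_def
proof (safe)
  fix i assume "\<forall>i. \<exists>k. \<kappa> $ i = 2 * pi * real_of_int k / L" "\<forall>i. \<exists>k. \<kappa>' $ i = 2 * pi * real_of_int k / L"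
  then obtain k k' :: int where "\<kappa> $ i = 2 * pi * of_int k / L" "\<kappa>' $ i = 2 * pi * of_int k' / L" by meson
  then show "\<exists>k. (\<kappa> + \<kappa>') $ i = 2 * pi * real_of_int k / L"
    by (intro exI[of _ "k + k'"]) (simp add: algebra_simps add_divide_distrib)
qed

lemma dual_lattice_minus: "\<kappa> \<in> dual_lattice L \<Longrightarrow> - \<kappa> \<in> dual_lattice L"
  unfolding dual_lattice_def
proof (safe)
  fix i assume "\<forall>i. \<exists>k. \<kappa> $ i = 2 * pi * real_of_int k / L"
  then obtain k :: int where "\<kappa> $ i = 2 * pi * of_int k / L" by meson
  then show "\<exists>k. (- \<kappa>) $ i = 2 * pi * real_of_int k / L"
    by (intro exI[of _ "- k"]) simp
qed

lemma dual_lattice_diff: "\<kappa> \<in> dual_lattice L \<Longrightarrow> \<kappa>' \<in> dual_lattice L \<Longrightarrow> \<kappa> - \<kappa>' \<in> dual_lattice L"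
  using dual_lattice_add[OF _ dual_lattice_minus] by fastforce

lemma dual_lattice_zero: "0 \<in> dual_lattice L"
  by (auto simp: dual_lattice_def intro!: exI[of _ 0])

lemma countable_dual_lattice: "countable (dual_lattice L :: (real^'n) set)"
proof -
  have "dual_lattice L \<subseteq> range (\<lambda>k :: int^'n. \<chi> i. 2 * pi * of_int (k $ i) / L)"
  proof
    fix \<kappa> :: "real^'n" assume "\<kappa> \<in> dual_lattice L"
    then obtain k where "\<And>i. \<kappa> $ i = 2 * pi * of_int (k i) / L" unfolding dual_lattice_def by (auto simp: choice_iff)
    then show "\<kappa> \<in> range (\<lambda>k :: int^'n. \<chi> i. 2 * pi * of_int (k $ i) / L)"
      by (intro range_eqI[of _ _ "\<chi> i. k i"]) (simp add: vec_eq_iff)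
  qed
  then show ?thesis by (rule countable_subset) auto
qed

lemma periodic_wave:
  assumes "L > 0" "\<kappa> \<in> dual_lattice L" shows "periodic L (wave \<kappa> j)"
  unfolding periodic_def
proof (intro allI)
  fix x and i
  obtain k :: int where k: "\<kappa> $ i = 2 * pi * of_int k / L" using assms(2) unfolding dual_lattice_def by blast
  have "\<kappa> \<bullet> (x + L *\<^sub>R axis i 1) + of_int j * (pi / 2) = (\<kappa> \<bullet> x + of_int j * (pi / 2)) + 2 * pi * of_int k"
    using assms(1) by (simp add: inner_add_right inner_axis k)
  then show "wave \<kappa> j (x + L *\<^sub>R axis i 1) = wave \<kappa> j x"
    unfolding wave_def by (simp only: cos_add sin_int_2pin cos_int_2pin) simp
qed

text \<open>A half-period shift changes the sign of a wave but not its integral.\<close>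

lemma integral_wave_zero:
  assumes L: "L > 0" and \<kappa>: "\<kappa> \<in> dual_lattice L" "\<kappa> \<noteq> 0"
  shows "(\<integral>y. wave \<kappa> j y \<partial>cellm L) = 0"
proof -
  obtain i where i: "\<kappa> $ i \<noteq> 0" using \<kappa>(2) by (auto simp: vec_eq_iff)
  obtain k :: int where k: "\<kappa> $ i = 2 * pi * of_int k / L" using \<kappa>(1) unfolding dual_lattice_def by blast
  have k1: "1 \<le> \<bar>k\<bar>" using i k by auto
  define h where "h = L / (2 * \<bar>of_int k\<bar>)"
  have "1 \<le> \<bar>real_of_int k\<bar>" using k1 by linarith
  then have h: "0 \<le> h" "h \<le> L" using L by (auto simp: h_def field_simps)
  have "\<kappa> $ i * h = sgn (of_int k) * pi" using k1 L by (auto simp: h_def k sgn_if)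
  then have "cos (\<kappa> $ i * h) = -1" "sin (\<kappa> $ i * h) = 0" using k1 by (auto simp: sgn_if)
  moreover have "wave \<kappa> j (y + h *\<^sub>R axis i 1) = cos ((\<kappa> \<bullet> y + of_int j * (pi / 2)) + \<kappa> $ i * h)" for y
    unfolding wave_def by (simp add: inner_add_right inner_axis algebra_simps)
  ultimately have shift: "wave \<kappa> j (y + h *\<^sub>R axis i 1) = - wave \<kappa> j y" for y
    by (simp add: wave_def cos_add)
  have "(\<integral>y. wave \<kappa> j (y + h *\<^sub>R axis i 1) \<partial>cellm L) = (\<integral>y. wave \<kappa> j y \<partial>cellm L)"
    using h L by (intro integral_cellm_translate L smooth_continuous smooth_wave periodic_wave \<kappa>) (auto simp: cell_def axis_def)
  then show ?thesis by (simp add: shift)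
qed

subsection \<open>The Poincare inequality for periodic functions\<close>

lemma grad_translate:
  assumes "smooth v" shows "grad (\<lambda>x. v (x + c)) x = grad v (x + c)"
proof (rule grad_eqI)
  have "((\<lambda>x. x + c) has_derivative (\<lambda>h. h)) (at x)" by (auto intro!: derivative_eq_intros)
  from has_derivative_compose[OF this smooth_has_derivative[OF assms]]
  show "((\<lambda>x. v (x + c)) has_derivative (\<lambda>h. grad v (x + c) \<bullet> h)) (at x)" .
qed

lemma periodic_grad:
  assumes "smooth v" "periodic L v" shows "periodic L (\<lambda>x. grad v x $ i)"
proof -
  have "(\<lambda>x. v (x + L *\<^sub>R axis j 1)) = v" for j using periodicD[OF assms(2)] by blast
  then have "grad v (x + L *\<^sub>R axis j 1) = grad v x" for x j
    using grad_translate[OF assms(1), of "L *\<^sub>R axis j 1" x] by simp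
  then show ?thesis by (simp add: periodic_def)
qed

lemma periodic_continuous_bounded:
  fixes f :: "real^'n \<Rightarrow> real"
  assumes "L > 0" "continuous_on UNIV f" "periodic L f"
  obtains B where "\<And>x. \<bar>f x\<bar> \<le> B"
proof -
  have "compact (f ` cell L)" unfolding cell_eq_cbox
    using assms by (intro compact_continuous_image) (auto intro: continuous_on_subset)
  then have "bounded (f ` cell L)" by (rule compact_imp_bounded)
  then obtain B where "\<And>x. x \<in> cell L \<Longrightarrow> \<bar>f x\<bar> \<le> B" unfolding bounded_iff by auto
  then show thesis using cell_representative[OF assms(1)] assms(3) that by metis
qed

lemma smooth_periodic_grad_bounded:
  fixes v :: "real^'n \<Rightarrow> real"
  assumes "L > 0" "smooth v" "periodic L v"
  obtains B where "0 \<le> B" "\<And>x. norm (grad v x) \<le> B"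
proof -
  have "\<exists>B. \<forall>x. \<bar>grad v x $ i\<bar> \<le> B" for i
    using periodic_continuous_bounded[OF assms(1) smooth_continuous[OF smooth_grad[OF assms(2)]] periodic_grad[OF assms(2,3)], of i] by metis
  then obtain B where B: "\<And>i x. \<bar>grad v x $ i\<bar> \<le> B i" by metis
  have "norm (grad v x) \<le> (\<Sum>i\<in>UNIV. B i)" for x
    by (rule order_trans[OF norm_le_l1_cart sum_mono]) (rule B)
  then show thesis using that[of "\<Sum>i\<in>UNIV. B i"] by (metis norm_ge_zero order_trans)
qed

lemma smooth_lipschitz:
  assumes "smooth v" "\<And>x. norm (grad v x) \<le> B"
  shows "\<bar>v x - v y\<bar> \<le> B * norm (x - y)"
proof -
  have "norm (v x - v y) \<le> B * norm (x - y)"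
  proof (rule differentiable_bound[where S=UNIV and f'="\<lambda>x k. grad v x \<bullet> k"])
    show "(v has_derivative (\<lambda>k. grad v z \<bullet> k)) (at z within UNIV)" for z
      using smooth_has_derivative[OF assms(1)] by simp
    show "onorm (\<lambda>k. grad v z \<bullet> k) \<le> B" for z
      using assms(2)[of z] by (intro onorm_le) (auto intro!: order_trans[OF Cauchy_Schwarz_ineq2] mult_right_mono)
  qed auto
  then show ?thesis by simp
qed

lemma continuous_translate: "continuous_on UNIV f \<Longrightarrow> continuous_on UNIV (\<lambda>x::real^'n. f (x + c))"
  by (rule continuous_on_compose2[of UNIV f]) (auto intro: continuous_intros)

lemma l2norm_cellm_translate:
  fixes f :: "real^'n \<Rightarrow> real"
  assumes "L > 0" "continuous_on UNIV f" "periodic L f" "c \<in> cell L"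
  shows "l2norm (cellm L) (\<lambda>x. f (x + c)) = l2norm (cellm L) f"
  unfolding l2norm_def
  by (subst integral_cellm_translate[OF assms(1) _ _ assms(4), of "\<lambda>x. (norm (f x))\<^sup>2"])
     (use assms in \<open>auto intro!: continuous_intros simp: periodic_def\<close>)

text \<open>Cut the path from \<open>x\<close> to \<open>x + c\<close> into many short steps. By translation
  invariance each contributes the same amount, and in the limit the difference quotient becomes a
  derivative.\<close>

lemma l2norm_increment_le:
  fixes v :: "real^'n \<Rightarrow> real"
  assumes L: "L > 0" and v: "smooth v" "periodic L v" and c: "c \<in> cell L"
  shows "l2norm (cellm L) (\<lambda>x. v (x + c) - v x) \<le> norm c * l2norm (cellm L) (grad v)"
proof -
  define d where "d n x = v (x + c /\<^sub>R Suc n) - v x" for n x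
  have cv: "continuous_on UNIV (\<lambda>x. v (x + a))" for a by (rule continuous_translate[OF smooth_continuous[OF v(1)]])
  have cd: "continuous_on UNIV (d n)" for n unfolding d_def[abs_def]
    using cv smooth_continuous[OF v(1)] by (intro continuous_intros)
  have pd: "periodic L (d n)" for n
    using periodicD[OF periodic_translate[OF v(2)]] periodicD[OF v(2)] by (simp add: d_def periodic_def)
  have sq: "sqint (cellm L) f" if "continuous_on UNIV f" for f :: "real^'n \<Rightarrow> real"
    using sqint_cellm_continuous[OF L that] .
  have steps: "l2norm (cellm L) (\<lambda>x. v (x + (real k / Suc n) *\<^sub>R c) - v x) \<le> k * l2norm (cellm L) (d n)"
    if "k \<le> Suc n" for k n
    using that
  proof (induction k)
    case 0 show ?case by (simp add: l2norm_def)
  next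
    case (Suc k)
    let ?a = "(real k / Suc n) *\<^sub>R c"
    have a: "?a \<in> cell L"
    proof -
      have "0 \<le> real k / Suc n" "real k / Suc n \<le> 1" using Suc.prems by auto
      then have "real k / Suc n * c $ i \<le> c $ i" "0 \<le> real k / Suc n * c $ i" for i
        using c mult_left_le_one_le[of "c $ i" "real k / Suc n"] unfolding cell_def by auto
      then show ?thesis using c unfolding cell_def
        by (simp only: mem_Collect_eq vector_scaleR_component real_scaleR_def) (meson order_trans)
    qed
    have "v (x + (real (Suc k) / Suc n) *\<^sub>R c) - v x = d n (x + ?a) + (v (x + ?a) - v x)" for x
      by (simp add: d_def add.assoc flip: scaleR_add_left) (simp add: add_divide_distrib divide_inverse add.commute distrib_right)?
    then have "l2norm (cellm L) (\<lambda>x. v (x + (real (Suc k) / Suc n) *\<^sub>R c) - v x)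
        \<le> l2norm (cellm L) (\<lambda>x. d n (x + ?a)) + l2norm (cellm L) (\<lambda>x. v (x + ?a) - v x)"
      using cv smooth_continuous[OF v(1)]
      by (simp only:) (intro l2norm_triangle sq continuous_translate cd continuous_intros)
    also have "l2norm (cellm L) (\<lambda>x. d n (x + ?a)) = l2norm (cellm L) (d n)"
      by (rule l2norm_cellm_translate[OF L cd pd a])
    finally show ?case using Suc by (simp add: algebra_simps)
  qed
  obtain B where B: "0 \<le> B" "\<And>x. norm (grad v x) \<le> B" using smooth_periodic_grad_bounded[OF L v] by blast
  have "(\<lambda>n. l2norm (cellm L) (\<lambda>x. real (Suc n) *\<^sub>R d n x)) \<longlonglongrightarrow> l2norm (cellm L) (\<lambda>x. grad v x \<bullet> c)"
    unfolding l2norm_def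
  proof (intro tendsto_real_sqrt integral_dominated_convergence[where w="\<lambda>x. (B * norm c)\<^sup>2"])
    interpret finite_measure "cellm L :: (real^'n) measure" by (rule finite_measure_cellm[OF L])
    show "integrable (cellm L) (\<lambda>x::real^'n. (B * norm c)\<^sup>2)" by simp
    show "(\<lambda>x. (norm (grad v x \<bullet> c))\<^sup>2) \<in> borel_measurable (cellm L)"
      using smooth_grad_continuous[OF v(1), of UNIV]
      by (intro borel_measurable_power borel_measurable_norm sqint_measurable[OF sq] continuous_intros)
    show "(\<lambda>x. (norm (real (Suc n) *\<^sub>R d n x))\<^sup>2) \<in> borel_measurable (cellm L)" for n
      using sqint_measurable[OF sq[OF cd[of n]]] by measurable
    have lim: "(\<lambda>n. real (Suc n) *\<^sub>R d n x) \<longlonglongrightarrow> grad v x \<bullet> c" for x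
    proof -
      have "((\<lambda>t. x + t *\<^sub>R c) has_derivative (\<lambda>t. t *\<^sub>R c)) (at 0)" by (auto intro!: derivative_eq_intros)
      from has_derivative_compose[OF this, of v "\<lambda>k. grad v x \<bullet> k"] smooth_has_derivative[OF v(1)]
      have "((\<lambda>t. v (x + t *\<^sub>R c)) has_real_derivative (grad v x \<bullet> c)) (at 0)"
        by (simp add: has_field_derivative_def mult_commute_abs)
      then have "((\<lambda>t. (v (x + t *\<^sub>R c) - v x) / t) \<longlongrightarrow> grad v x \<bullet> c) (at 0)" by (simp add: DERIV_def)
      moreover have "filterlim (\<lambda>n. inverse (real (Suc n))) (at 0) sequentially"
        using LIMSEQ_inverse_real_of_nat by (auto simp: filterlim_at intro!: always_eventually)
      ultimately have "(\<lambda>n. (v (x + inverse (real (Suc n)) *\<^sub>R c) - v x) / inverse (real (Suc n))) \<longlonglongrightarrow> grad v x \<bullet> c"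
        by (rule filterlim_compose)
      then show ?thesis by (simp add: d_def field_simps)
    qed
    show "AE x in cellm L. (\<lambda>n. (norm (real (Suc n) *\<^sub>R d n x))\<^sup>2) \<longlonglongrightarrow> (norm (grad v x \<bullet> c))\<^sup>2"
      by (intro AE_I2 tendsto_intros lim)
    show "AE x in cellm L. norm ((norm (real (Suc n) *\<^sub>R d n x))\<^sup>2) \<le> (B * norm c)\<^sup>2" for n
    proof (intro AE_I2)
      fix x
      have "\<bar>d n x\<bar> \<le> B * norm (c /\<^sub>R Suc n)"
        using smooth_lipschitz[OF v(1) B(2), of "x + c /\<^sub>R Suc n" x] by (simp add: d_def)
      then have "real (Suc n) * \<bar>d n x\<bar> \<le> B * norm c" by (simp add: field_simps)
      then have "norm (real (Suc n) *\<^sub>R d n x) \<le> B * norm c" by (simp add: abs_mult del: of_nat_Suc)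
      then show "norm ((norm (real (Suc n) *\<^sub>R d n x))\<^sup>2) \<le> (B * norm c)\<^sup>2" by (simp del: of_nat_Suc) (metis abs_ge_zero abs_mult abs_of_nat power2_abs power_mono power_mult_distrib)
    qed
  qed
  moreover have "l2norm (cellm L) (\<lambda>x. v (x + c) - v x) \<le> l2norm (cellm L) (\<lambda>x. real (Suc n) *\<^sub>R d n x)" for n
    using steps[of "Suc n" n] by (simp only: l2norm_scaleR) simp
  ultimately have "l2norm (cellm L) (\<lambda>x. v (x + c) - v x) \<le> l2norm (cellm L) (\<lambda>x. grad v x \<bullet> c)"
    by (intro LIMSEQ_le_const) auto
  also have "\<dots> \<le> l2norm (cellm L) (\<lambda>x. norm c *\<^sub>R grad v x)"
  proof (intro l2norm_mono AE_I2)
    show "norm (grad v x \<bullet> c) \<le> norm (norm c *\<^sub>R grad v x)" for x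
      using Cauchy_Schwarz_ineq2[of "grad v x" c] by (simp add: mult.commute)
  qed (auto intro!: sqint_cellm_continuous L continuous_intros smooth_grad_continuous v)
  finally show ?thesis by (simp add: l2norm_scaleR)
qed

lemma measurable_continuous_pair:
  fixes f :: "(real^'n) \<times> (real^'n) \<Rightarrow> 'b::topological_space"
  assumes "continuous_on UNIV f" "sets M = sets lebesgue" "sets N = sets lebesgue"
  shows "f \<in> borel_measurable (M \<Otimes>\<^sub>M N)"
proof -
  have "(\<lambda>z. (fst z, snd z)) \<in> (lebesgue \<Otimes>\<^sub>M lebesgue) \<rightarrow>\<^sub>M (borel \<Otimes>\<^sub>M borel :: ((real^'n) \<times> (real^'n)) measure)"
    by (intro measurable_Pair measurable_compose[OF measurable_fst] measurable_compose[OF measurable_snd])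
       (auto intro: measurable_completion)
  moreover have "f \<in> borel_measurable (borel \<Otimes>\<^sub>M borel)"
    unfolding borel_prod using assms(1) by (rule borel_measurable_continuous_onI)
  ultimately have "f \<in> borel_measurable (lebesgue \<Otimes>\<^sub>M lebesgue)" using measurable_compose by force
  moreover have "sets (M \<Otimes>\<^sub>M N) = sets (lebesgue \<Otimes>\<^sub>M lebesgue)" by (intro sets_pair_measure_cong assms)
  ultimately show ?thesis by (simp cong: measurable_cong_sets)
qed

text \<open>Averaging the squared increments over all translations in the cell gives twice the squared norm,
  because the mixed term factorises through the vanishing mean. The increments are controlled by the
  gradient.\<close>

lemma poincare_periodic:
  fixes v :: "real^'n \<Rightarrow> real"
  assumes L: "L > 0" and v: "smooth v" "periodic L v" and mean: "(\<integral>y. v y \<partial>cellm L) = 0"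
  shows "l2norm (cellm L) v \<le> (L * CARD('n)) * l2norm (cellm L) (grad v)"
proof -
  interpret finite_measure "cellm L :: (real^'n) measure" by (rule finite_measure_cellm[OF L])
  interpret P: pair_sigma_finite "cellm L :: (real^'n) measure" "cellm L :: (real^'n) measure" ..
  have cont: "continuous_on UNIV v" by (rule smooth_continuous[OF v(1)])
  have cva: "continuous_on UNIV (\<lambda>x. v (x + a))" for a by (rule continuous_translate[OF cont])
  have sq: "sqint (cellm L) f" if "continuous_on UNIV f" for f :: "real^'n \<Rightarrow> real"
    using sqint_cellm_continuous[OF L that] .
  obtain B where B: "\<And>x. \<bar>v x\<bar> \<le> B" using periodic_continuous_bounded[OF L cont v(2)] by blast
  \<comment> \<open>A bound for the length of the translations in the cell.\<close>
  define K where "K = L * CARD('n)"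
  define D where "D = l2norm (cellm L) (grad v)"
  define S where "S = (l2norm (cellm L) v)\<^sup>2"
  \<comment> \<open>The mixed term in the square of the increment by \<open>c\<close>.\<close>
  define m where "m c = (\<integral>x. v (x + c) * v x \<partial>cellm L)" for c
  have cm: "continuous_on UNIV (\<lambda>(c, x). v (x + c) * v x)"
    unfolding case_prod_beta by (intro continuous_intros continuous_on_compose2[OF cont]) auto
  have int2: "integrable (cellm L \<Otimes>\<^sub>M cellm L) (\<lambda>(c, x). v (x + c) * v x)"
  proof (rule finite_measure.integrable_const_bound[of _ _ "B * B"])
    show "finite_measure (cellm L \<Otimes>\<^sub>M cellm L :: ((real^'n) \<times> (real^'n)) measure)"
      by (rule finite_measure_pair_measure) unfold_locales
    show "AE z in cellm L \<Otimes>\<^sub>M cellm L. norm (case z of (c, x) \<Rightarrow> v (x + c) * v x) \<le> B * B"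
      using B by (auto simp: abs_mult intro!: AE_I2 mult_mono order_trans[OF abs_ge_zero B])
    show "(\<lambda>(c, x). v (x + c) * v x) \<in> borel_measurable (cellm L \<Otimes>\<^sub>M cellm L)"
      by (rule measurable_continuous_pair[OF cm]) auto
  qed
  have m_int: "integrable (cellm L) m" using P.integrable_fst[OF int2] unfolding m_def[abs_def] by simp
  have m0: "(\<integral>c. m c \<partial>cellm L) = 0"
  proof -
    have "(\<integral>c. m c \<partial>cellm L) = (\<integral>x. (\<integral>c. v (x + c) * v x \<partial>cellm L) \<partial>cellm L)"
      unfolding m_def using P.Fubini_integral[of "\<lambda>c x. v (x + c) * v x"] int2 by simp
    also have "\<dots> = (\<integral>x. 0 \<partial>(cellm L :: (real^'n) measure))"
    proof (rule integral_cong_AE)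
      have "AE x in cellm L. x \<in> cell L" using AE_cellm[OF L, of "\<lambda>x. x \<in> cell L"] by simp
      then show "AE x in cellm L. (\<integral>c. v (x + c) * v x \<partial>cellm L) = 0"
      proof eventually_elim
        case (elim x)
        have "(\<integral>c. v (c + x) \<partial>cellm L) = 0" using integral_cellm_translate[OF L cont v(2) elim] mean by simp
        then show ?case by (simp add: add.commute)
      qed
      show "(\<lambda>x. \<integral>c. v (x + c) * v x \<partial>cellm L) \<in> borel_measurable (cellm L)"
        using P.integrable_snd[OF int2] by auto
    qed auto
    finally show ?thesis by simp
  qed
  have incr: "2 * S - 2 * m c \<le> (K * D)\<^sup>2" if c: "c \<in> cell L" for c
  proof -
    have nc: "norm c \<le> K"
    proof -
      have "norm c \<le> (\<Sum>i\<in>UNIV. \<bar>c $ i\<bar>)" by (rule norm_le_l1_cart)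
      also have "\<dots> \<le> (\<Sum>i\<in>(UNIV :: 'n set). L)" using c by (intro sum_mono) (auto simp: cell_def)
      finally show ?thesis by (simp add: K_def mult.commute)
    qed
    have "(l2norm (cellm L) (\<lambda>x. v (x + c) + (- 1) *\<^sub>R v x))\<^sup>2 = (l2norm (cellm L) (\<lambda>x. v (x + c)))\<^sup>2 - 2 * m c + S"
      unfolding l2norm_add_sq[OF sq[OF cva] sq[OF cont]] by (simp add: m_def S_def)
    also have "l2norm (cellm L) (\<lambda>x. v (x + c)) = l2norm (cellm L) v"
      by (rule l2norm_cellm_translate[OF L cont v(2) c])
    finally have "2 * S - 2 * m c = (l2norm (cellm L) (\<lambda>x. v (x + c) - v x))\<^sup>2" by (simp add: S_def)
    also have "l2norm (cellm L) (\<lambda>x. v (x + c) - v x) \<le> norm c * D"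
      unfolding D_def by (rule l2norm_increment_le[OF L v c])
    then have "l2norm (cellm L) (\<lambda>x. v (x + c) - v x) \<le> K * D"
      using mult_right_mono[OF nc, of D] by (simp add: D_def)
    then have "(l2norm (cellm L) (\<lambda>x. v (x + c) - v x))\<^sup>2 \<le> (K * D)\<^sup>2" by (rule power_mono) simp
    finally show ?thesis .
  qed
  have "(\<integral>c. 2 * S - 2 * m c \<partial>cellm L) \<le> (\<integral>c. (K * D)\<^sup>2 \<partial>(cellm L :: (real^'n) measure))"
    using m_int incr AE_cellm[OF L, of "\<lambda>c. 2 * S - 2 * m c \<le> (K * D)\<^sup>2"] by (intro integral_mono_AE) auto
  then have "2 * S \<le> (K * D)\<^sup>2"
    using m_int m0 finite_measure_cellm(2)[OF L, where 'n='n] by simp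
  then have "(l2norm (cellm L) v)\<^sup>2 \<le> (K * D)\<^sup>2"
    unfolding S_def using zero_le_power2[of "l2norm (cellm L) v"] by linarith
  then show ?thesis unfolding K_def D_def by (rule power2_le_imp_le) (use L in simp)
qed

section \<open>Weak gradients\<close>

lemma lebesgue_AE_eq_integral:
  fixes f g :: "real^'n \<Rightarrow> 'b::euclidean_space"
  assumes "f \<in> borel_measurable lebesgue" "AE x in lebesgue. f x = g x"
  shows "g \<in> borel_measurable lebesgue" "integral\<^sup>L lebesgue f = integral\<^sup>L lebesgue g"
    "integrable lebesgue f \<longleftrightarrow> integrable lebesgue g"
proof -
  show g: "g \<in> borel_measurable lebesgue" using borel_measurable_AE[OF assms] .
  show "integral\<^sup>L lebesgue f = integral\<^sup>L lebesgue g" "integrable lebesgue f \<longleftrightarrow> integrable lebesgue g"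
    using integral_cong_AE[OF assms(1) g assms(2)] integrable_cong_AE[OF assms(1) g assms(2)] by auto
qed

text \<open>Boxes are stable under intersection and generate the Borel sets, so the integrals of
  \<open>f\<close> over all Borel sets vanish. Complements need the total integral to vanish, which is why the
  support lies in a box.\<close>

lemma integral_boxes_zero_imp_AE_zero:
  fixes f :: "real^'n \<Rightarrow> real"
  assumes f: "integrable lebesgue f" and box: "\<And>p q. (\<integral>x. indicator (box p q) x * f x \<partial>lebesgue) = 0"
    and supp: "\<And>x. x \<notin> box a b \<Longrightarrow> f x = 0"
  shows "AE x in lebesgue. f x = 0"
proof -
  obtain g where g [measurable]: "g \<in> borel_measurable borel" and fg: "AE x in lborel. f x = g x"
    using completion_ex_borel_measurable_real[of f lborel] f by auto
  have fg': "AE x in lebesgue. f x = g x" using fg by (rule AE_completion)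
  have gi: "integrable lborel g"
    using f fg' lebesgue_AE_eq_integral(3)[of f g] by (simp add: integrable_completion)
  have borel_sets: "sets borel = sigma_sets UNIV (range (\<lambda>(a, b). box a b :: (real^'n) set))"
    unfolding borel_eq_box by (rule sets_measure_of) simp
  have P: "(\<integral>x. indicator A x * g x \<partial>lborel) = 0" if "A \<in> sigma_sets UNIV (range (\<lambda>(a, b). box a b :: (real^'n) set))" for A
  proof -
    have stable: "Int_stable (range (\<lambda>(a, b). box a b :: (real^'n) set))"
      by (auto simp: Int_stable_def box_Int_box)
    have subP: "range (\<lambda>(a, b). box a b :: (real^'n) set) \<subseteq> Pow UNIV" by simp
    have eq: "(\<integral>x. indicator (box p q) x * g x \<partial>lborel) = 0" for p q
    proof -
      have "(\<integral>x. indicator (box p q) x * g x \<partial>lborel) = (\<integral>x. indicator (box p q) x * g x \<partial>lebesgue)"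
        by (rule integral_completion[symmetric]) measurable
      also have "\<dots> = (\<integral>x. indicator (box p q) x * f x \<partial>lebesgue)"
        by (rule lebesgue_AE_eq_integral(2)[symmetric])
           (use f fg' in \<open>auto intro!: borel_measurable_times borel_measurable_indicator\<close>)
      finally show ?thesis using box by simp
    qed
    show ?thesis
    proof (induction rule: sigma_sets_induct_disjoint[OF stable subP that, case_names basic empty compl union])
      case (basic A)
      then show ?case using eq by auto
    next
      case empty show ?case by simp
    next
      case (compl A)
      have A: "A \<in> sets borel" using compl(1) borel_sets by simp
      have "(\<integral>x. g x \<partial>lborel) = (\<integral>x. indicator (box a b) x * g x \<partial>lborel)"
        using fg supp by (intro integral_cong_AE) (auto simp: indicator_def)
      then have "(\<integral>x. g x \<partial>lborel) = 0" using eq by simp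
      moreover have "indicator (UNIV - A) x * g x = g x - indicator A x * g x" for x by (simp add: indicator_def)
      moreover have "integrable lborel (\<lambda>x. indicator A x * g x)"
        using integrable_mult_indicator[of A lborel g] gi A by simp
      ultimately show ?case using gi compl(2) by simp
    next
      case (union A)
      have A: "A i \<in> sets lborel" for i using union(2) borel_sets by auto
      have "(LINT x:(\<Union>i. A i)|lborel. g x) = (\<Sum>i. (LINT x:(A i)|lborel. g x))"
        using union(1) A gi integrable_mult_indicator[of "\<Union>i. A i" lborel g]
        by (intro lebesgue_integral_countable_add) (auto simp: disjoint_family_on_def set_integrable_def)
      then show ?case using union(3) by (simp add: set_lebesgue_integral_def)
    qed
  qed
  have "AE x in lborel. g x = 0"
  proof (rule density_unique_real[OF gi])
    fix A :: "(real^'n) set" assume "A \<in> sets lborel"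
    then have "A \<in> sigma_sets UNIV (range (\<lambda>(a, b). box a b :: (real^'n) set))"
      unfolding sets_lborel borel_sets .
    then show "(LINT x:A|lborel. g x) = (LINT x:A|lborel. 0)" using P by (simp add: set_lebesgue_integral_def)
  qed simp
  then have "AE x in lebesgue. g x = 0" by (rule AE_completion)
  with fg' show ?thesis by eventually_elim simp
qed

text \<open>The fundamental lemma of the calculus of variations: the bumps increase to the indicator of their
  box, and countably many boxes exhaust an open set.\<close>

lemma orthogonal_to_bumps_imp_AE_zero:
  fixes f :: "real^'n \<Rightarrow> real"
  assumes \<Omega>: "open \<Omega>" and f: "locally_integrable \<Omega> f"
    and orth: "\<And>p q m. cbox p q \<subseteq> \<Omega> \<Longrightarrow> (\<integral>x. box_bump p q m x * f x \<partial>lebesgue) = 0"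
  shows "AE x in lebesgue. x \<in> \<Omega> \<longrightarrow> f x = 0"
proof -
  have box: "(\<integral>x. indicator (box p q) x * f x \<partial>lebesgue) = 0" if "cbox p q \<subseteq> \<Omega>" for p q
  proof -
    have int: "integrable lebesgue (\<lambda>x. indicator (cbox p q) x * f x)"
      using f that by (simp add: locally_integrable_def set_integrable_def)
    have int': "integrable lebesgue (\<lambda>x. indicator (box p q) x * f x)"
    proof -
      have "set_integrable lebesgue (box p q) f"
        by (rule set_integrable_subset[of _ "cbox p q"]) (use int box_subset_cbox in \<open>auto simp: set_integrable_def\<close>)
      then show ?thesis by (simp add: set_integrable_def)
    qed
    have bb: "box_bump p q m x * f x = box_bump p q m x * (indicator (cbox p q) x * f x)" for m x
      using box_bump_nonzero_iff[of p q m x] box_subset_cbox[of p q] by (auto simp: indicator_def)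
    have "(\<lambda>m. \<integral>x. box_bump p q m x * f x \<partial>lebesgue) \<longlonglongrightarrow> (\<integral>x. indicator (box p q) x * f x \<partial>lebesgue)"
    proof (rule integral_dominated_convergence[where w="\<lambda>x. \<bar>indicator (cbox p q) x * f x\<bar>"])
      show "(\<lambda>x. indicator (box p q) x * f x) \<in> borel_measurable lebesgue" using int' by auto
      show "(\<lambda>x. box_bump p q m x * f x) \<in> borel_measurable lebesgue" for m
        unfolding bb using measurable_lebesgue_continuous[OF smooth_continuous[OF smooth_box_bump]]
        by (intro borel_measurable_times[OF _ borel_measurable_integrable[OF int]])
      show "integrable lebesgue (\<lambda>x. \<bar>indicator (cbox p q) x * f x\<bar>)" using int by (rule integrable_abs)
      show "AE x in lebesgue. (\<lambda>m. box_bump p q m x * f x) \<longlonglongrightarrow> indicator (box p q) x * f x"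
        by (intro AE_I2 tendsto_mult box_bump_tendsto_indicator tendsto_const)
      show "AE x in lebesgue. norm (box_bump p q m x * f x) \<le> \<bar>indicator (cbox p q) x * f x\<bar>" for m
        unfolding bb using box_bump_bounds[of p q m] by (intro AE_I2) (auto simp: abs_mult intro: mult_left_le_one_le)
    qed
    then show ?thesis using orth[OF that] by (simp add: LIMSEQ_const_iff)
  qed
  have loc: "AE x in lebesgue. x \<in> cbox a b \<longrightarrow> f x = 0" if ab: "cbox a b \<subseteq> \<Omega>" for a b
  proof -
    let ?g = "\<lambda>x. indicator (box a b) x * f x"
    have "set_integrable lebesgue (cbox a b) f" using f ab by (simp add: locally_integrable_def)
    then have "set_integrable lebesgue (box a b) f"
      by (rule set_integrable_subset) (use box_subset_cbox in auto)
    then have gi: "integrable lebesgue ?g" by (simp add: set_integrable_def)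
    have "AE x in lebesgue. ?g x = 0"
    proof (rule integral_boxes_zero_imp_AE_zero[OF gi, where a=a and b=b])
      fix p q :: "real^'n"
      obtain c d where cd: "box p q \<inter> box a b = box c d" using box_Int_box[of p q a b] by blast
      have "(\<integral>x. indicator (box c d) x * f x \<partial>lebesgue) = 0"
      proof (cases "box c d = {}")
        case False
        then have "cbox c d = closure (box c d)" by (simp add: closure_box)
        also have "\<dots> \<subseteq> cbox a b" unfolding cd[symmetric]
          using box_subset_cbox[of a b] by (intro closure_minimal) auto
        finally show ?thesis using box ab by blast
      qed simp
      moreover have "indicator (box p q) x * ?g x = indicator (box c d) x * f x" for x
        unfolding cd[symmetric] by (simp add: indicator_inter_arith)
      ultimately show "(\<integral>x. indicator (box p q) x * ?g x \<partial>lebesgue) = 0" by presburger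
    qed (simp add: indicator_def)
    moreover have "AE x in lebesgue. x \<notin> cbox a b - box a b"
      using negligible_frontier_interval negligible_iff_null_sets by (blast intro: AE_not_in)
    ultimately show ?thesis by eventually_elim (auto simp: indicator_def split: if_splits)
  qed
  obtain \<D> where D: "countable \<D>" "\<D> \<subseteq> Pow \<Omega>" "\<And>X. X \<in> \<D> \<Longrightarrow> \<exists>a b. X = cbox a b" "\<Union>\<D> = \<Omega>"
    using open_countable_Union_open_cbox[OF \<Omega>] by metis
  have "AE x in lebesgue. \<forall>X\<in>\<D>. x \<in> X \<longrightarrow> f x = 0"
    unfolding AE_ball_countable[OF D(1)] using D(2,3) loc by (metis PowD subsetD)
  then show ?thesis by eventually_elim (use D(4) in blast)
qed

lemma integrable_mult_compact_support:
  fixes h :: "real^'n \<Rightarrow> real" and g :: "real^'n \<Rightarrow> 'b::euclidean_space"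
  assumes h: "continuous_on UNIV h" "compact K" "\<And>x. x \<notin> K \<Longrightarrow> h x = 0"
    and g: "set_integrable lebesgue K g"
  shows "integrable lebesgue (\<lambda>x. h x *\<^sub>R g x)"
proof -
  obtain B where B: "0 \<le> B" "\<And>x. norm (h x) \<le> B" using continuous_compact_support_bounded[OF h] by blast
  have gi: "integrable lebesgue (\<lambda>x. indicator K x *\<^sub>R g x)" using g by (simp add: set_integrable_def)
  have eq: "h x *\<^sub>R g x = h x *\<^sub>R (indicator K x *\<^sub>R g x)" for x using h(3)[of x] by (cases "x \<in> K") auto
  show ?thesis unfolding eq
  proof (rule Bochner_Integration.integrable_bound)
    show "integrable lebesgue (\<lambda>x. B *\<^sub>R (indicator K x *\<^sub>R g x))" using gi by (rule integrable_scaleR_right)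
    show "(\<lambda>x. h x *\<^sub>R (indicator K x *\<^sub>R g x)) \<in> borel_measurable lebesgue"
      by (intro borel_measurable_scaleR borel_measurable_integrable[OF gi] measurable_lebesgue_continuous[OF h(1)])
    show "AE x in lebesgue. norm (h x *\<^sub>R (indicator K x *\<^sub>R g x)) \<le> norm (B *\<^sub>R (indicator K x *\<^sub>R g x))"
      using B(2) by (intro AE_I2) (auto simp: indicator_def B(1) intro!: mult_right_mono)
  qed
qed

lemma integrable_test_function:
  fixes g :: "real^'n \<Rightarrow> 'b::euclidean_space"
  assumes "test_function \<Omega> \<zeta>" "locally_integrable \<Omega> g"
  shows "integrable lebesgue (\<lambda>x. \<zeta> x *\<^sub>R g x)" "integrable lebesgue (\<lambda>x. grad \<zeta> x $ i *\<^sub>R g x)"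
proof -
  obtain K where K: "compact K" "K \<subseteq> \<Omega>" "\<And>x. x \<notin> K \<Longrightarrow> \<zeta> x = 0" "\<And>x. x \<notin> K \<Longrightarrow> grad \<zeta> x = 0"
    using test_functionE(4)[OF assms(1)] by blast
  have g: "set_integrable lebesgue K g" using assms(2) K by (simp add: locally_integrable_def)
  show "integrable lebesgue (\<lambda>x. \<zeta> x *\<^sub>R g x)" "integrable lebesgue (\<lambda>x. grad \<zeta> x $ i *\<^sub>R g x)"
    using K smooth_continuous[OF test_functionE(1)[OF assms(1)]] smooth_continuous[OF smooth_grad[OF test_functionE(1)[OF assms(1)]]]
    by (auto intro!: integrable_mult_compact_support[OF _ K(1) _ g])
qed

text \<open>Test functions vanish outside \<open>\<Omega>\<close>, so integration by parts can be stated on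
  the whole space and for one component at a time.\<close>

lemma has_weak_gradient_iff:
  fixes u :: "real^'n \<Rightarrow> real"
  shows "has_weak_gradient \<Omega> u g \<longleftrightarrow> locally_integrable \<Omega> u \<and> locally_integrable \<Omega> g \<and>
    (\<forall>\<zeta> i. test_function \<Omega> \<zeta> \<longrightarrow> (\<integral>x. u x * grad \<zeta> x $ i \<partial>lebesgue) = - (\<integral>x. \<zeta> x * g x $ i \<partial>lebesgue))"
proof -
  have "(LINT x:\<Omega>|lebesgue. u x *\<^sub>R grad \<zeta> x) = - (LINT x:\<Omega>|lebesgue. \<zeta> x *\<^sub>R g x) \<longleftrightarrow>
    (\<forall>i. (\<integral>x. u x * grad \<zeta> x $ i \<partial>lebesgue) = - (\<integral>x. \<zeta> x * g x $ i \<partial>lebesgue))"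
    if u: "locally_integrable \<Omega> u" and g: "locally_integrable \<Omega> g" and \<zeta>: "test_function \<Omega> \<zeta>" for \<zeta>
  proof -
    have 1: "(LINT x:\<Omega>|lebesgue. u x *\<^sub>R grad \<zeta> x) = (\<integral>x. u x *\<^sub>R grad \<zeta> x \<partial>lebesgue)"
      unfolding set_lebesgue_integral_def
    proof (rule Bochner_Integration.integral_cong[OF refl])
      fix x show "indicator \<Omega> x *\<^sub>R u x *\<^sub>R grad \<zeta> x = u x *\<^sub>R grad \<zeta> x"
        using test_functionE(3)[OF \<zeta>, of x] by (cases "x \<in> \<Omega>") auto
    qed
    have 2: "(LINT x:\<Omega>|lebesgue. \<zeta> x *\<^sub>R g x) = (\<integral>x. \<zeta> x *\<^sub>R g x \<partial>lebesgue)"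
      unfolding set_lebesgue_integral_def
    proof (rule Bochner_Integration.integral_cong[OF refl])
      fix x show "indicator \<Omega> x *\<^sub>R \<zeta> x *\<^sub>R g x = \<zeta> x *\<^sub>R g x"
        using test_functionE(2)[OF \<zeta>, of x] by (cases "x \<in> \<Omega>") auto
    qed
    have "integrable lebesgue (\<lambda>x. \<Sum>i\<in>UNIV. (grad \<zeta> x $ i *\<^sub>R u x) *\<^sub>R axis i (1::real))"
      by (intro Bochner_Integration.integrable_sum integrable_scaleR_left integrable_test_function(2)[OF \<zeta> u])
    moreover have "(\<Sum>i\<in>UNIV. (grad \<zeta> x $ i *\<^sub>R u x) *\<^sub>R axis i (1::real)) = u x *\<^sub>R grad \<zeta> x" for x
      by (simp add: vec_eq_iff axis_def if_distrib mult.commute cong: if_cong)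
    ultimately have i1: "integrable lebesgue (\<lambda>x. u x *\<^sub>R grad \<zeta> x)" by simp
    note i2 = integrable_test_function(1)[OF \<zeta> g]
    show ?thesis unfolding 1 2 vec_eq_iff
      using integral_vec_component[OF i1] integral_vec_component[OF i2] by simp
  qed
  then show ?thesis unfolding has_weak_gradient_def by blast
qed

lemma locally_integrable_component:
  fixes g :: "real^'n \<Rightarrow> real^'m"
  assumes "locally_integrable \<Omega> g" shows "locally_integrable \<Omega> (\<lambda>x. g x $ i)"
  unfolding locally_integrable_def set_integrable_def
proof safe
  fix K assume "compact K" "K \<subseteq> \<Omega>"
  then have "integrable lebesgue (\<lambda>x. indicator K x *\<^sub>R g x)"
    using assms by (auto simp: locally_integrable_def set_integrable_def)
  from integrable_bounded_linear[OF bounded_linear_vec_nth[of i] this]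
  show "integrable lebesgue (\<lambda>x. indicator K x *\<^sub>R g x $ i)" by simp
qed

lemma locally_integrable_lin:
  "locally_integrable \<Omega> f \<Longrightarrow> locally_integrable \<Omega> g \<Longrightarrow> locally_integrable \<Omega> (\<lambda>x. a *\<^sub>R f x + b *\<^sub>R g x)"
  unfolding locally_integrable_def
proof (intro allI impI)
  fix K assume f: "\<forall>K. compact K \<and> K \<subseteq> \<Omega> \<longrightarrow> set_integrable lebesgue K f"
    and g: "\<forall>K. compact K \<and> K \<subseteq> \<Omega> \<longrightarrow> set_integrable lebesgue K g" and K: "compact K \<and> K \<subseteq> \<Omega>"
  have "set_integrable lebesgue K (\<lambda>x. a *\<^sub>R f x)" "set_integrable lebesgue K (\<lambda>x. b *\<^sub>R g x)"
    using f g K by (auto intro: set_integrable_scaleR_right)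
  then show "set_integrable lebesgue K (\<lambda>x. a *\<^sub>R f x + b *\<^sub>R g x)" by (rule set_integral_add)
qed

lemma locally_integrable_continuous:
  fixes f :: "real^'n \<Rightarrow> 'b::euclidean_space"
  assumes "continuous_on UNIV f" shows "locally_integrable \<Omega> f"
  unfolding locally_integrable_def set_integrable_def
proof safe
  fix K :: "(real^'n) set" assume K: "compact K"
  then have "integrable lborel (\<lambda>x. indicator K x *\<^sub>R f x)"
    using assms by (intro borel_integrable_compact) (auto intro: continuous_on_subset)
  then show "integrable lebesgue (\<lambda>x. indicator K x *\<^sub>R f x)"
    using K assms borel_measurable_continuous_onI[OF assms]
    by (subst integrable_completion) (auto intro!: borel_measurable_scaleR borel_measurable_indicator simp: compact_imp_closed)
qed

lemma weak_gradient_unique: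
  assumes \<Omega>: "open \<Omega>" and "has_weak_gradient \<Omega> u g" "has_weak_gradient \<Omega> u h"
  shows "AE x in lebesgue. x \<in> \<Omega> \<longrightarrow> g x = h x"
proof -
  have loc: "locally_integrable \<Omega> g" "locally_integrable \<Omega> h"
    using assms by (auto simp: has_weak_gradient_def)
  have "AE x in lebesgue. x \<in> \<Omega> \<longrightarrow> (g x - h x) $ i = 0" for i
  proof (rule orthogonal_to_bumps_imp_AE_zero[OF \<Omega>])
    show "locally_integrable \<Omega> (\<lambda>x. (g x - h x) $ i)"
      using locally_integrable_component[OF locally_integrable_lin[OF loc, of 1 "-1"]] by simp
    fix p q m assume "cbox p q \<subseteq> \<Omega>"
    then have t: "test_function \<Omega> (box_bump p q m)" by (rule test_function_box_bump)
    have "(\<integral>x. box_bump p q m x * g x $ i \<partial>lebesgue) = (\<integral>x. box_bump p q m x * h x $ i \<partial>lebesgue)"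
    proof -
      have "(\<integral>x. u x * grad (box_bump p q m) x $ i \<partial>lebesgue) = - (\<integral>x. box_bump p q m x * g x $ i \<partial>lebesgue)"
        using assms(2) t unfolding has_weak_gradient_iff by blast
      moreover have "(\<integral>x. u x * grad (box_bump p q m) x $ i \<partial>lebesgue) = - (\<integral>x. box_bump p q m x * h x $ i \<partial>lebesgue)"
        using assms(3) t unfolding has_weak_gradient_iff by blast
      ultimately show ?thesis by simp
    qed
    moreover have "integrable lebesgue (\<lambda>x. box_bump p q m x * g x $ i)" "integrable lebesgue (\<lambda>x. box_bump p q m x * h x $ i)"
      using integrable_test_function(1)[OF t locally_integrable_component] loc by auto
    ultimately show "(\<integral>x. box_bump p q m x * (g x - h x) $ i \<partial>lebesgue) = 0"
      by (simp add: right_diff_distrib)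
  qed
  then have "AE x in lebesgue. \<forall>i\<in>UNIV. x \<in> \<Omega> \<longrightarrow> (g x - h x) $ i = 0" by (intro AE_finite_allI) auto
  then show ?thesis by eventually_elim (simp add: vec_eq_iff)
qed

lemma has_weak_gradient_weak_grad:
  "has_weak_gradient \<Omega> u g \<Longrightarrow> has_weak_gradient \<Omega> u (weak_grad \<Omega> u)"
  unfolding weak_grad_def by (rule someI[where P="has_weak_gradient \<Omega> u"])

lemma weak_grad_AE:
  "open \<Omega> \<Longrightarrow> has_weak_gradient \<Omega> u g \<Longrightarrow> AE x in lebesgue. x \<in> \<Omega> \<longrightarrow> weak_grad \<Omega> u x = g x"
  using weak_gradient_unique has_weak_gradient_weak_grad by blast

lemma has_weak_gradient_lin:
  fixes u v :: "real^'n \<Rightarrow> real"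
  assumes "has_weak_gradient \<Omega> u g" "has_weak_gradient \<Omega> v h"
  shows "has_weak_gradient \<Omega> (\<lambda>x. a * u x + b * v x) (\<lambda>x. a *\<^sub>R g x + b *\<^sub>R h x)"
proof -
  have loc: "locally_integrable \<Omega> u" "locally_integrable \<Omega> v" "locally_integrable \<Omega> g" "locally_integrable \<Omega> h"
    using assms by (auto simp: has_weak_gradient_def)
  show ?thesis unfolding has_weak_gradient_iff
  proof (intro conjI allI impI)
    show "locally_integrable \<Omega> (\<lambda>x. a * u x + b * v x)" using locally_integrable_lin[OF loc(1,2), of a b] by simp
    show "locally_integrable \<Omega> (\<lambda>x. a *\<^sub>R g x + b *\<^sub>R h x)" by (rule locally_integrable_lin[OF loc(3,4)])
    fix \<zeta> i assume t: "test_function \<Omega> \<zeta>"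
    have i: "integrable lebesgue (\<lambda>x. u x * grad \<zeta> x $ i)" "integrable lebesgue (\<lambda>x. v x * grad \<zeta> x $ i)"
      "integrable lebesgue (\<lambda>x. \<zeta> x * g x $ i)" "integrable lebesgue (\<lambda>x. \<zeta> x * h x $ i)"
      using integrable_test_function(2)[OF t loc(1), of i] integrable_test_function(2)[OF t loc(2), of i]
        integrable_test_function(1)[OF t locally_integrable_component[OF loc(3), of i]]
        integrable_test_function(1)[OF t locally_integrable_component[OF loc(4), of i]] by (auto simp: mult.commute)
    have "(a * u x + b * v x) * grad \<zeta> x $ i = a * (u x * grad \<zeta> x $ i) + b * (v x * grad \<zeta> x $ i)"
      "\<zeta> x * (a *\<^sub>R g x + b *\<^sub>R h x) $ i = a * (\<zeta> x * g x $ i) + b * (\<zeta> x * h x $ i)" for x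
      by (simp_all add: algebra_simps)
    then show "(\<integral>x. (a * u x + b * v x) * grad \<zeta> x $ i \<partial>lebesgue) = - (\<integral>x. \<zeta> x * (a *\<^sub>R g x + b *\<^sub>R h x) $ i \<partial>lebesgue)"
      using i assms t unfolding has_weak_gradient_iff by simp
  qed
qed

lemma has_weak_gradient_smooth:
  fixes v :: "real^'n \<Rightarrow> real"
  assumes "smooth v" shows "has_weak_gradient \<Omega> v (grad v)"
  unfolding has_weak_gradient_iff
proof (intro conjI allI impI)
  show loc: "locally_integrable \<Omega> v" "locally_integrable \<Omega> (grad v)"
    using assms by (auto intro!: locally_integrable_continuous smooth_continuous smooth_grad_continuous)
  fix \<zeta> i assume t: "test_function \<Omega> \<zeta>"
  have s: "smooth \<zeta>" using t by (rule test_functionE)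
  have i: "integrable lebesgue (\<lambda>x. v x * grad \<zeta> x $ i)" "integrable lebesgue (\<lambda>x. \<zeta> x * grad v x $ i)"
    using integrable_test_function(2)[OF t loc(1), of i]
      integrable_test_function(1)[OF t locally_integrable_component[OF loc(2), of i]] by (auto simp: mult.commute)
  have tv: "test_function \<Omega> (\<lambda>x. \<zeta> x * v x)" by (rule test_function_mult[OF t assms])
  obtain K where K: "compact K" "\<And>x. x \<notin> K \<Longrightarrow> grad (\<lambda>x. \<zeta> x * v x) x = 0"
    using test_functionE(4)[OF tv] by blast
  have "(\<integral>x. grad (\<lambda>x. \<zeta> x * v x) x $ i \<partial>lebesgue) = 0"
    using integral_grad_test_function[OF tv]
      integral_vec_component[OF integrable_continuous_compact_support(2)[OF smooth_grad_continuous[OF test_functionE(1)[OF tv]] K], of i] by simp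
  moreover have "grad (\<lambda>x. \<zeta> x * v x) x $ i = v x * grad \<zeta> x $ i + \<zeta> x * grad v x $ i" for x
    using grad_mult[OF smooth_differentiable[OF s] smooth_differentiable[OF assms], of x] by simp
  ultimately show "(\<integral>x. v x * grad \<zeta> x $ i \<partial>lebesgue) = - (\<integral>x. \<zeta> x * grad v x $ i \<partial>lebesgue)"
    using i by simp
qed

lemma locally_integrable_AE_cong:
  fixes f g :: "real^'n \<Rightarrow> 'b::euclidean_space"
  assumes "locally_integrable \<Omega> f" "AE x in lebesgue. x \<in> \<Omega> \<longrightarrow> f x = g x"
  shows "locally_integrable \<Omega> g"
  unfolding locally_integrable_def set_integrable_def
proof safe
  fix K assume "compact K" "K \<subseteq> \<Omega>"
  then have i: "integrable lebesgue (\<lambda>x. indicator K x *\<^sub>R f x)"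
    using assms by (auto simp: locally_integrable_def set_integrable_def)
  have "AE x in lebesgue. indicator K x *\<^sub>R f x = indicator K x *\<^sub>R g x"
    using assms(2) by eventually_elim (use \<open>K \<subseteq> \<Omega>\<close> in \<open>auto simp: indicator_def\<close>)
  then show "integrable lebesgue (\<lambda>x. indicator K x *\<^sub>R g x)"
    using i lebesgue_AE_eq_integral(3)[OF borel_measurable_integrable[OF i], of "\<lambda>x. indicator K x *\<^sub>R g x"] by blast
qed

lemma has_weak_gradient_AE_cong:
  fixes u u' :: "real^'n \<Rightarrow> real"
  assumes "has_weak_gradient \<Omega> u g" "AE x in lebesgue. x \<in> \<Omega> \<longrightarrow> u x = u' x" "AE x in lebesgue. x \<in> \<Omega> \<longrightarrow> g x = g' x"
  shows "has_weak_gradient \<Omega> u' g'"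
  unfolding has_weak_gradient_iff
proof (intro conjI allI impI)
  have loc: "locally_integrable \<Omega> u" "locally_integrable \<Omega> g" using assms by (auto simp: has_weak_gradient_def)
  show "locally_integrable \<Omega> u'" "locally_integrable \<Omega> g'"
    using locally_integrable_AE_cong loc assms by blast+
  fix \<zeta> i assume t: "test_function \<Omega> \<zeta>"
  have i: "integrable lebesgue (\<lambda>x. u x * grad \<zeta> x $ i)" "integrable lebesgue (\<lambda>x. \<zeta> x * g x $ i)"
    using integrable_test_function(2)[OF t loc(1), of i]
      integrable_test_function(1)[OF t locally_integrable_component[OF loc(2), of i]] by (auto simp: mult.commute)
  have "AE x in lebesgue. u x * grad \<zeta> x $ i = u' x * grad \<zeta> x $ i"
    using assms(2) by eventually_elim (use test_functionE(3)[OF t] in force)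
  moreover have "AE x in lebesgue. \<zeta> x * g x $ i = \<zeta> x * g' x $ i"
    using assms(3) by eventually_elim (use test_functionE(2)[OF t] in force)
  ultimately show "(\<integral>x. u' x * grad \<zeta> x $ i \<partial>lebesgue) = - (\<integral>x. \<zeta> x * g' x $ i \<partial>lebesgue)"
  proof -
    assume a: "AE x in lebesgue. u x * grad \<zeta> x $ i = u' x * grad \<zeta> x $ i"
      and b: "AE x in lebesgue. \<zeta> x * g x $ i = \<zeta> x * g' x $ i"
    have "(\<integral>x. u x * grad \<zeta> x $ i \<partial>lebesgue) = - (\<integral>x. \<zeta> x * g x $ i \<partial>lebesgue)"
      using assms(1) t unfolding has_weak_gradient_iff by blast
    then show ?thesis
      using lebesgue_AE_eq_integral(2)[OF borel_measurable_integrable[OF i(1)] a]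
        lebesgue_AE_eq_integral(2)[OF borel_measurable_integrable[OF i(2)] b] by simp
  qed
qed

section \<open>The quotient space of periodic Sobolev functions\<close>

abbreviation cell_int :: "real \<Rightarrow> (real^'n) set"
  where "cell_int L \<equiv> interior (cell L)"

text \<open>Membership in the Sobolev space of the cell says something only about the values inside. Cutting
  off outside gives functions that are measurable on the whole space.\<close>

definition restr :: "real \<Rightarrow> (real^'n \<Rightarrow> 'b::real_vector) \<Rightarrow> real^'n \<Rightarrow> 'b"
  where "restr L f y = indicator (cell_int L) y *\<^sub>R f y"

lemma restr_in: "y \<in> cell_int L \<Longrightarrow> restr L f y = f y"
  by (simp add: restr_def)

lemma AE_cellm_int:
  assumes "L > 0"
  shows "(AE y in cellm L. P y) \<longleftrightarrow> (AE y in lebesgue. y \<in> cell_int L \<longrightarrow> P y)"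
  unfolding AE_cellm[OF assms]
proof
  assume "AE y in lebesgue. y \<in> cell L \<longrightarrow> P y"
  then show "AE y in lebesgue. y \<in> cell_int L \<longrightarrow> P y"
    by eventually_elim (use interior_subset in blast)
next
  assume "AE y in lebesgue. y \<in> cell_int L \<longrightarrow> P y"
  with AE_cell_interior show "AE y in lebesgue. y \<in> cell L \<longrightarrow> P y" by eventually_elim blast
qed

lemma measurable_cellm [simp]: "f \<in> borel_measurable (cellm L) \<longleftrightarrow> f \<in> borel_measurable lebesgue"
  by (simp cong: measurable_cong_sets)

lemma cell_int_sets [measurable, simp]: "(cell_int L :: (real^'n) set) \<in> sets lebesgue"
  by (simp add: interior_cell)

lemma integral_cell_int:
  fixes f :: "real^'n \<Rightarrow> 'b::euclidean_space"
  assumes L: "L > 0" and f: "f \<in> borel_measurable lebesgue"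
  shows "(LINT y:cell_int L|lebesgue. f y) = L ^ CARD('n) *\<^sub>R (\<integral>y. f y \<partial>cellm L)"
    and "set_integrable lebesgue (cell_int L) f \<longleftrightarrow> integrable (cellm L) f"
proof -
  have m: "(\<lambda>y. indicator (cell L) y *\<^sub>R f y) \<in> borel_measurable lebesgue" using f by measurable
  have ae: "AE y in lebesgue. indicator (cell L) y *\<^sub>R f y = indicator (cell_int L) y *\<^sub>R f y"
    using AE_cell_interior by eventually_elim (auto simp: indicator_def)
  show "(LINT y:cell_int L|lebesgue. f y) = L ^ CARD('n) *\<^sub>R (\<integral>y. f y \<partial>cellm L)"
    using L integral_cellm(1)[OF L f] lebesgue_AE_eq_integral(2)[OF m ae] by (simp add: set_lebesgue_integral_def)
  show "set_integrable lebesgue (cell_int L) f \<longleftrightarrow> integrable (cellm L) f"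
    using integral_cellm(2)[OF L f] lebesgue_AE_eq_integral(3)[OF m ae] by (simp add: set_integrable_def)
qed

lemma integral_supported_in_cell:
  fixes f :: "real^'n \<Rightarrow> 'b::euclidean_space"
  assumes "L > 0" "f \<in> borel_measurable lebesgue" "\<And>y. y \<notin> cell_int L \<Longrightarrow> f y = 0"
  shows "(\<integral>y. f y \<partial>lebesgue) = L ^ CARD('n) *\<^sub>R (\<integral>y. f y \<partial>cellm L)"
proof -
  have "(\<lambda>y. indicator (cell_int L) y *\<^sub>R f y) = f" using assms(3) by (auto simp: indicator_def fun_eq_iff)
  then show ?thesis using integral_cell_int(1)[OF assms(1,2)] by (simp add: set_lebesgue_integral_def)
qed

lemma finite_sqint_integrable:
  assumes "finite_measure M" "sqint M f" shows "integrable M f"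
proof -
  interpret finite_measure M by fact
  show ?thesis
  proof (rule Bochner_Integration.integrable_bound)
    show "integrable M (\<lambda>x. 1 + (norm (f x))\<^sup>2)" using sqint_integrable_sq[OF assms(2)] by simp
    have "t \<le> 1 + t\<^sup>2" for t :: real
      using zero_le_power2[of "t - 1/2"] by (simp add: power2_diff power_divide)
    then show "AE x in M. norm (f x) \<le> norm (1 + (norm (f x))\<^sup>2)" by (intro AE_I2) (simp add: abs_of_nonneg)
  qed (use assms(2) in auto)
qed

lemma sqint_cellm_locally_integrable:
  fixes f :: "real^'n \<Rightarrow> 'b::euclidean_space"
  assumes "L > 0" "sqint (cellm L) f"
  shows "locally_integrable (cell_int L) f"
proof -
  have "f \<in> borel_measurable lebesgue" using sqint_measurable[OF assms(2)] by simp
  then have "set_integrable lebesgue (cell_int L) f"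
    using integral_cell_int(2)[OF assms(1)] finite_sqint_integrable[OF finite_measure_cellm(1)[OF assms(1)] assms(2)] by blast
  then show ?thesis unfolding locally_integrable_def
    by (auto intro!: set_integrable_subset[of _ "cell_int L"] simp: compact_imp_closed)
qed

lemma l2norm_null_comparison:
  assumes "\<And>n. l2norm M (f n) \<le> g n" "g \<longlonglongrightarrow> 0"
  shows "(\<lambda>n. l2norm M (f n)) \<longlonglongrightarrow> 0"
  by (rule Lim_null_comparison[OF always_eventually assms(2)]) (use assms(1) in simp)

text \<open>For a fixed test function both sides of the integration by parts are continuous in the
  mean.\<close>

lemma cell_weak_gradient_limit:
  fixes u :: "real^'n \<Rightarrow> real"
  assumes L: "L > 0" and v: "\<And>n. smooth (v n)" and u: "sqint (cellm L) u" and g: "sqint (cellm L) g"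
    and lim: "(\<lambda>n. l2norm (cellm L) (\<lambda>y. v n y - u y)) \<longlonglongrightarrow> 0"
      "(\<lambda>n. l2norm (cellm L) (\<lambda>y. grad (v n) y - g y)) \<longlonglongrightarrow> 0"
  shows "has_weak_gradient (cell_int L) u g"
  unfolding has_weak_gradient_iff
proof (intro conjI allI impI)
  show "locally_integrable (cell_int L) u" "locally_integrable (cell_int L) g"
    using sqint_cellm_locally_integrable L u g by blast+
  fix \<zeta> :: "real^'n \<Rightarrow> real" and i assume t: "test_function (cell_int L) \<zeta>"
  have s: "smooth \<zeta>" using t by (rule test_functionE)
  have sv: "sqint (cellm L) (v n)" "sqint (cellm L) (grad (v n))" for n
    using v by (auto intro!: sqint_cellm_continuous L smooth_continuous smooth_grad_continuous)
  have s1: "sqint (cellm L) (\<lambda>y. grad \<zeta> y $ i)"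
    by (intro sqint_cellm_continuous L smooth_continuous smooth_grad s)
  have s2: "sqint (cellm L) (\<lambda>y. \<zeta> y *\<^sub>R axis i (1::real) :: real^'n)"
    by (intro sqint_cellm_continuous L continuous_intros smooth_continuous s)
  have m: "(\<lambda>y. f y * grad \<zeta> y $ i) \<in> borel_measurable lebesgue" if "sqint (cellm L) f" for f :: "real^'n \<Rightarrow> real"
    using that sqint_measurable[OF s1] sqint_measurable[OF that] by simp
  have m': "(\<lambda>y. \<zeta> y * h y $ i) \<in> borel_measurable lebesgue" if "sqint (cellm L) h" for h :: "real^'n \<Rightarrow> real^'n"
    using sqint_measurable[OF sqint_component[OF that, of i]] measurable_lebesgue_continuous[OF smooth_continuous[OF s]] by simp
  have to_cell: "(\<integral>y. f y * grad \<zeta> y $ i \<partial>lebesgue) = L ^ CARD('n) * (\<integral>y. f y \<bullet> grad \<zeta> y $ i \<partial>cellm L)"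
    if "sqint (cellm L) f" for f
    using integral_supported_in_cell[OF L m[OF that]] test_functionE(3)[OF t] by simp
  have to_cell': "(\<integral>y. \<zeta> y * h y $ i \<partial>lebesgue) = L ^ CARD('n) * (\<integral>y. h y \<bullet> (\<zeta> y *\<^sub>R axis i 1) \<partial>cellm L)"
    if "sqint (cellm L) h" for h
    using integral_supported_in_cell[OF L m'[OF that]] test_functionE(2)[OF t] by (simp add: inner_axis)
  have "(\<integral>y. v n y \<bullet> grad \<zeta> y $ i \<partial>cellm L) = - (\<integral>y. grad (v n) y \<bullet> (\<zeta> y *\<^sub>R axis i 1) \<partial>cellm L)" for n
  proof -
    have "(\<integral>y. v n y * grad \<zeta> y $ i \<partial>lebesgue) = - (\<integral>y. \<zeta> y * grad (v n) y $ i \<partial>lebesgue)"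
      using has_weak_gradient_smooth[OF v, of "cell_int L" n] t unfolding has_weak_gradient_iff by blast
    then have "L ^ CARD('n) * (\<integral>y. v n y \<bullet> grad \<zeta> y $ i \<partial>cellm L) = L ^ CARD('n) * - (\<integral>y. grad (v n) y \<bullet> (\<zeta> y *\<^sub>R axis i 1) \<partial>cellm L)"
      unfolding to_cell[OF sv(1)] to_cell'[OF sv(2)] by simp
    then show ?thesis using L by (subst (asm) mult_cancel_left) simp
  qed
  moreover have "(\<lambda>n. \<integral>y. v n y \<bullet> grad \<zeta> y $ i \<partial>cellm L) \<longlonglongrightarrow> (\<integral>y. u y \<bullet> grad \<zeta> y $ i \<partial>cellm L)"
    by (rule l2_tendsto_inner[OF sv(1) u s1 lim(1)])
  moreover have "(\<lambda>n. - (\<integral>y. grad (v n) y \<bullet> (\<zeta> y *\<^sub>R axis i 1) \<partial>cellm L)) \<longlonglongrightarrow> - (\<integral>y. g y \<bullet> (\<zeta> y *\<^sub>R axis i 1) \<partial>cellm L)"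
    by (intro tendsto_minus l2_tendsto_inner[OF sv(2) g s2 lim(2)])
  ultimately have "(\<integral>y. u y \<bullet> grad \<zeta> y $ i \<partial>cellm L) = - (\<integral>y. g y \<bullet> (\<zeta> y *\<^sub>R axis i 1) \<partial>cellm L)"
    using LIMSEQ_unique by auto
  then show "(\<integral>y. u y * grad \<zeta> y $ i \<partial>lebesgue) = - (\<integral>y. \<zeta> y * g y $ i \<partial>lebesgue)"
    unfolding to_cell[OF u] to_cell'[OF g] by simp
qed

lemma cell_weak_grad_AE:
  "has_weak_gradient (cell_int L) u g \<Longrightarrow> AE y in lebesgue. y \<in> cell_int L \<longrightarrow> weak_grad (cell_int L) u y = g y"
  by (rule weak_grad_AE) simp_all

lemma set_integral_cell_cong:
  fixes f f' :: "real^'n \<Rightarrow> real"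
  assumes L: "L > 0" and f': "f' \<in> borel_measurable lebesgue" and ae: "AE y in lebesgue. y \<in> cell_int L \<longrightarrow> f y = f' y"
  shows "(LINT y:cell_int L|lebesgue. f y) = L ^ CARD('n) * (\<integral>y. f' y \<partial>cellm L)"
    "set_integrable lebesgue (cell_int L) f \<longleftrightarrow> integrable (cellm L) f'"
    "(LINT y:cell L|lebesgue. f y) = L ^ CARD('n) * (\<integral>y. f' y \<partial>cellm L)"
proof -
  have m: "(\<lambda>y. indicator (cell_int L) y *\<^sub>R f' y) \<in> borel_measurable lebesgue" using f' by (intro borel_measurable_scaleR borel_measurable_indicator) auto
  have m2: "(\<lambda>y. indicator (cell L) y *\<^sub>R f' y) \<in> borel_measurable lebesgue" using f' by (intro borel_measurable_scaleR borel_measurable_indicator) auto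
  have a: "AE y in lebesgue. indicator (cell_int L) y *\<^sub>R f' y = indicator (cell_int L) y *\<^sub>R f y"
    using ae by eventually_elim (auto simp: indicator_def)
  have a2: "AE y in lebesgue. indicator (cell L) y *\<^sub>R f' y = indicator (cell L) y *\<^sub>R f y"
    using ae AE_cell_interior by eventually_elim (auto simp: indicator_def)
  show "(LINT y:cell_int L|lebesgue. f y) = L ^ CARD('n) * (\<integral>y. f' y \<partial>cellm L)"
    using integral_cell_int(1)[OF L f'] lebesgue_AE_eq_integral(2)[OF m a] by (simp add: set_lebesgue_integral_def)
  show "set_integrable lebesgue (cell_int L) f \<longleftrightarrow> integrable (cellm L) f'"
    using integral_cell_int(2)[OF L f'] lebesgue_AE_eq_integral(3)[OF m a] by (simp add: set_integrable_def)
  show "(LINT y:cell L|lebesgue. f y) = L ^ CARD('n) * (\<integral>y. f' y \<partial>cellm L)"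
    using L integral_cellm(1)[OF L f'] lebesgue_AE_eq_integral(2)[OF m2 a2] by (simp add: set_lebesgue_integral_def)
qed

lemma H1_norm_cell:
  fixes f :: "real^'n \<Rightarrow> real"
  assumes L: "L > 0" and w: "has_weak_gradient (cell_int L) f G"
    and f': "f' \<in> borel_measurable lebesgue" "\<And>y. y \<in> cell_int L \<Longrightarrow> f y = f' y" and G: "G \<in> borel_measurable lebesgue"
  shows "H1_norm (cell_int L) (\<lambda>_. 1) f = sqrt (L ^ CARD('n) * ((l2norm (cellm L) f')\<^sup>2 + (l2norm (cellm L) G)\<^sup>2))"
proof -
  have "(LINT y:cell_int L|lebesgue. (f y)\<^sup>2 * 1) = L ^ CARD('n) * (\<integral>y. (f' y)\<^sup>2 \<partial>cellm L)"
    by (rule set_integral_cell_cong(1)[OF L]) (use f' in auto)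
  moreover have "(LINT y:cell_int L|lebesgue. (norm (weak_grad (cell_int L) f y))\<^sup>2 * 1) = L ^ CARD('n) * (\<integral>y. (norm (G y))\<^sup>2 \<partial>cellm L)"
    by (rule set_integral_cell_cong(1)[OF L]) (use G cell_weak_grad_AE[OF w] in \<open>auto elim!: eventually_mono\<close>)
  ultimately show ?thesis unfolding H1_norm_def by (simp add: l2norm_sq distrib_left)
qed

lemma H1_cellI:
  fixes u :: "real^'n \<Rightarrow> real"
  assumes L: "L > 0" and u: "sqint (cellm L) u" and g: "sqint (cellm L) g" and w: "has_weak_gradient (cell_int L) u g"
  shows "u \<in> H1 (cell_int L) (\<lambda>_. 1)"
proof -
  have m: "u \<in> borel_measurable lebesgue" "g \<in> borel_measurable lebesgue"
    using sqint_measurable[OF u] sqint_measurable[OF g] by auto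
  have ae: "AE y in lebesgue. y \<in> cell_int L \<longrightarrow> (norm (weak_grad (cell_int L) u y))\<^sup>2 * 1 = (norm (g y))\<^sup>2"
    using cell_weak_grad_AE[OF w] by eventually_elim simp
  have "set_integrable lebesgue (cell_int L) (\<lambda>y. (u y)\<^sup>2 * 1)"
    using set_integral_cell_cong(2)[OF L, of "\<lambda>y. (u y)\<^sup>2 * 1" "\<lambda>y. (u y)\<^sup>2 * 1"] m sqint_integrable_sq[OF u] by simp
  moreover have "set_integrable lebesgue (cell_int L) (\<lambda>y. (norm (weak_grad (cell_int L) u y))\<^sup>2 * 1)"
    using set_integral_cell_cong(2)[OF L _ ae] m sqint_integrable_sq[OF g] by simp
  moreover have "set_borel_measurable lebesgue (cell_int L) u"
    unfolding set_borel_measurable_def using m by measurable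
  ultimately show ?thesis using w by (auto simp: H1_def)
qed

text \<open>Measurability of the gradient is the point: local integrability gives it on compact boxes only,
  and countably many boxes exhaust the interior of the cell.\<close>

lemma H1_cellE:
  fixes u :: "real^'n \<Rightarrow> real"
  assumes L: "L > 0" and u: "u \<in> H1 (cell_int L) (\<lambda>_. 1)"
  shows "sqint (cellm L) (restr L u)" "sqint (cellm L) (restr L (weak_grad (cell_int L) u))"
    "has_weak_gradient (cell_int L) u (restr L (weak_grad (cell_int L) u))"
proof -
  have w: "has_weak_gradient (cell_int L) u (weak_grad (cell_int L) u)"
    using u has_weak_gradient_weak_grad by (auto simp: H1_def)
  show wr: "has_weak_gradient (cell_int L) u (restr L (weak_grad (cell_int L) u))"
    by (rule has_weak_gradient_AE_cong[OF w]) (auto simp: restr_in)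
  have m1: "restr L u \<in> borel_measurable lebesgue"
    using u by (simp add: H1_def set_borel_measurable_def restr_def[abs_def])
  have m2: "restr L (weak_grad (cell_int L) u) \<in> borel_measurable lebesgue"
  proof -
    obtain \<D> where D: "countable \<D>" "\<D> \<subseteq> Pow (cell_int L)" "\<And>X. X \<in> \<D> \<Longrightarrow> \<exists>a b. X = cbox a b" "\<Union>\<D> = (cell_int L :: (real^'n) set)"
      using open_countable_Union_open_cbox[OF open_interior] by metis
    have "{y \<in> space lebesgue. restr L (weak_grad (cell_int L) u) y \<in> S} \<in> sets lebesgue" if S: "open S" for S
    proof -
      have K: "{y. y \<in> X \<and> restr L (weak_grad (cell_int L) u) y \<in> S} \<in> sets lebesgue" if "X \<in> \<D>" for X
      proof -
        have X: "compact X" "X \<subseteq> cell_int L" using D that by fastforce+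
        then have "(\<lambda>y. indicator X y *\<^sub>R weak_grad (cell_int L) u y) \<in> borel_measurable lebesgue"
          using w by (auto simp: has_weak_gradient_def locally_integrable_def set_integrable_def)
        from measurable_sets[OF this, of S] S
        have "X \<inter> ((\<lambda>y. indicator X y *\<^sub>R weak_grad (cell_int L) u y) -` S \<inter> space lebesgue) \<in> sets lebesgue"
          using X by (intro sets.Int) (auto simp: compact_imp_closed)
        also have "X \<inter> ((\<lambda>y. indicator X y *\<^sub>R weak_grad (cell_int L) u y) -` S \<inter> space lebesgue)
            = {y. y \<in> X \<and> restr L (weak_grad (cell_int L) u) y \<in> S}"
          using X by (auto simp: restr_def indicator_def split: if_splits)
        finally show ?thesis .
      qed
      have "{y :: real^'n. y \<notin> cell_int L \<and> (0 :: real^'n) \<in> S} \<in> sets lebesgue"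
        by (cases "(0 :: real^'n) \<in> S") (auto simp: Compl_eq[symmetric])
      moreover have "{y \<in> space lebesgue. restr L (weak_grad (cell_int L) u) y \<in> S} =
          {y. y \<notin> cell_int L \<and> (0 :: real^'n) \<in> S} \<union> (\<Union>X\<in>\<D>. {y. y \<in> X \<and> restr L (weak_grad (cell_int L) u) y \<in> S})"
        using D(2,4) by (auto simp: restr_def indicator_def split: if_splits)
      moreover have "(\<Union>X\<in>\<D>. {y. y \<in> X \<and> restr L (weak_grad (cell_int L) u) y \<in> S}) \<in> sets lebesgue"
        using K by (intro sets.countable_UN'[OF D(1)]) blast
      ultimately show ?thesis by (simp only: sets.Un)
    qed
    then show ?thesis by (intro borel_measurableI) (auto simp: vimage_def Int_def conj_commute)
  qed
  have "integrable (cellm L) (\<lambda>y. (norm (restr L u y))\<^sup>2)"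
    using set_integral_cell_cong(2)[OF L, of "\<lambda>y. (norm (restr L u y))\<^sup>2" "\<lambda>y. (u y)\<^sup>2 * 1"] m1 u
    by (auto simp: H1_def restr_in)
  then show "sqint (cellm L) (restr L u)" using m1 by (simp add: sqint_def)
  have "integrable (cellm L) (\<lambda>y. (norm (restr L (weak_grad (cell_int L) u) y))\<^sup>2)"
    using set_integral_cell_cong(2)[OF L, of "\<lambda>y. (norm (restr L (weak_grad (cell_int L) u) y))\<^sup>2" "\<lambda>y. (norm (weak_grad (cell_int L) u y))\<^sup>2 * 1"] m2 u
    by (auto simp: H1_def restr_in)
  then show "sqint (cellm L) (restr L (weak_grad (cell_int L) u))" using m2 by (simp add: sqint_def)
qed

lemma H1_norm_cell_diff:
  fixes u :: "real^'n \<Rightarrow> real"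
  assumes L: "L > 0" and v: "smooth v" and u: "u' \<in> borel_measurable lebesgue" "\<And>y. y \<in> cell_int L \<Longrightarrow> u y = u' y"
    and g: "g \<in> borel_measurable lebesgue" and w: "has_weak_gradient (cell_int L) u g"
  shows "H1_norm (cell_int L) (\<lambda>_. 1) (\<lambda>y. u y - v y) =
    sqrt (L ^ CARD('n) * ((l2norm (cellm L) (\<lambda>y. v y - u' y))\<^sup>2 + (l2norm (cellm L) (\<lambda>y. grad v y - g y))\<^sup>2))"
proof -
  have "has_weak_gradient (cell_int L) (\<lambda>y. 1 * u y + (- 1) * v y) (\<lambda>y. 1 *\<^sub>R g y + (- 1) *\<^sub>R grad v y)"
    by (intro has_weak_gradient_lin w has_weak_gradient_smooth v)
  then have "has_weak_gradient (cell_int L) (\<lambda>y. u y - v y) (\<lambda>y. g y - grad v y)" by simp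
  from H1_norm_cell[OF L this, of "\<lambda>y. u' y - v y"] u g show ?thesis
    using measurable_lebesgue_continuous[OF smooth_continuous[OF v]] measurable_lebesgue_continuous[OF smooth_grad_continuous[OF v]]
    by (simp add: l2norm_minus_commute[of _ u' v] l2norm_minus_commute[of _ g "grad v"])
qed

lemma H1_perI:
  fixes u :: "real^'n \<Rightarrow> real"
  assumes L: "L > 0" and v: "\<And>n. smooth (v n)" "\<And>n. periodic L (v n)" and u: "sqint (cellm L) u" and g: "sqint (cellm L) g"
    and lim: "(\<lambda>n. l2norm (cellm L) (\<lambda>y. v n y - u y)) \<longlonglongrightarrow> 0"
      "(\<lambda>n. l2norm (cellm L) (\<lambda>y. grad (v n) y - g y)) \<longlonglongrightarrow> 0"
  shows "u \<in> H1_per L" "has_weak_gradient (cell_int L) u g"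
proof -
  show w: "has_weak_gradient (cell_int L) u g" by (rule cell_weak_gradient_limit[OF L v(1) u g lim])
  have "(\<lambda>n. sqrt (L ^ CARD('n) * ((l2norm (cellm L) (\<lambda>y. v n y - u y))\<^sup>2 + (l2norm (cellm L) (\<lambda>y. grad (v n) y - g y))\<^sup>2)))
      \<longlonglongrightarrow> sqrt (L ^ CARD('n) * (0\<^sup>2 + 0\<^sup>2))"
    by (intro tendsto_intros lim)
  moreover have "H1_norm (cell_int L) (\<lambda>_. 1) (\<lambda>y. u y - v n y) =
    sqrt (L ^ CARD('n) * ((l2norm (cellm L) (\<lambda>y. v n y - u y))\<^sup>2 + (l2norm (cellm L) (\<lambda>y. grad (v n) y - g y))\<^sup>2))" for n
    using sqint_measurable[OF u] sqint_measurable[OF g] by (intro H1_norm_cell_diff[OF L v(1) _ _ _ w]) auto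
  ultimately show "u \<in> H1_per L"
    unfolding H1_per_def using H1_cellI[OF L u g w] v by (auto intro!: exI[of _ v])
qed

lemma H1_perE:
  fixes u :: "real^'n \<Rightarrow> real"
  assumes L: "L > 0" and u: "u \<in> H1_per L"
  obtains v where "\<And>n. smooth (v n)" "\<And>n. periodic L (v n)"
    "(\<lambda>n. l2norm (cellm L) (\<lambda>y. v n y - restr L u y)) \<longlonglongrightarrow> 0"
    "(\<lambda>n. l2norm (cellm L) (\<lambda>y. grad (v n) y - restr L (weak_grad (cell_int L) u) y)) \<longlonglongrightarrow> 0"
proof -
  have h: "u \<in> H1 (cell_int L) (\<lambda>_. 1)" using u by (simp add: H1_per_def)
  note E = H1_cellE[OF L h]
  obtain v where v: "\<And>n::nat. smooth (v n)" "\<And>n. periodic L (v n)"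
    and lim: "(\<lambda>n. H1_norm (cell_int L) (\<lambda>_. 1) (\<lambda>y. u y - v n y)) \<longlonglongrightarrow> 0"
    using u by (auto simp: H1_per_def)
  let ?a = "\<lambda>n. l2norm (cellm L) (\<lambda>y. v n y - restr L u y)"
  let ?b = "\<lambda>n. l2norm (cellm L) (\<lambda>y. grad (v n) y - restr L (weak_grad (cell_int L) u) y)"
  have eq: "H1_norm (cell_int L) (\<lambda>_. 1) (\<lambda>y. u y - v n y) = sqrt (L ^ CARD('n)) * sqrt ((?a n)\<^sup>2 + (?b n)\<^sup>2)" for n
    using sqint_measurable[OF E(1)] sqint_measurable[OF E(2)]
    by (subst H1_norm_cell_diff[OF L v(1) _ _ _ E(3), of "restr L u"]) (auto simp: restr_in real_sqrt_mult)
  have pos: "sqrt (L ^ CARD('n)) \<noteq> 0" using L by simp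
  have lim': "(\<lambda>n. sqrt ((?a n)\<^sup>2 + (?b n)\<^sup>2)) \<longlonglongrightarrow> 0"
    using tendsto_divide[OF lim tendsto_const[of "sqrt (L ^ CARD('n))"] pos] pos unfolding eq by simp
  show thesis
  proof (rule that[OF v])
    show "?a \<longlonglongrightarrow> 0" by (rule Lim_null_comparison[OF always_eventually lim']) (auto intro: real_le_rsqrt)
    show "?b \<longlonglongrightarrow> 0" by (rule Lim_null_comparison[OF always_eventually lim']) (auto intro: real_le_rsqrt)
  qed
qed

subsection \<open>Classes modulo constants\<close>

definition W_rel :: "real \<Rightarrow> ((real^'n \<Rightarrow> real) \<times> (real^'n \<Rightarrow> real)) set"
  where "W_rel L = {(u, v). u \<in> H1_per L \<and> v \<in> H1_per L \<and> (\<exists>c. AE y in lebesgue. y \<in> cell L \<longrightarrow> u y = v y + c)}"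

lemma W_per_eq: "W_per L = H1_per L // W_rel L"
  by (simp add: W_per_def W_rel_def)

lemma equiv_W_rel: "equiv (H1_per L) (W_rel L :: ((real^'n \<Rightarrow> real) \<times> (real^'n \<Rightarrow> real)) set)"
proof (rule equivI)
  show "(W_rel L :: ((real^'n \<Rightarrow> real) \<times> (real^'n \<Rightarrow> real)) set) \<subseteq> H1_per L \<times> H1_per L" by (auto simp: W_rel_def)
  show "refl_on (H1_per L) (W_rel L :: ((real^'n \<Rightarrow> real) \<times> (real^'n \<Rightarrow> real)) set)" by (auto simp: refl_on_def W_rel_def intro!: exI[of _ 0])
  show "sym (W_rel L :: ((real^'n \<Rightarrow> real) \<times> (real^'n \<Rightarrow> real)) set)"
  proof (rule symI)
    fix u v :: "real^'n \<Rightarrow> real" assume "(u, v) \<in> W_rel L"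
    then obtain c where c: "u \<in> H1_per L" "v \<in> H1_per L" "AE y in lebesgue. y \<in> cell L \<longrightarrow> u y = v y + c"
      by (auto simp: W_rel_def)
    from c(3) have "AE y in lebesgue. y \<in> cell L \<longrightarrow> v y = u y + (- c)" by eventually_elim auto
    then show "(v, u) \<in> W_rel L" using c unfolding W_rel_def by blast
  qed
  show "trans (W_rel L :: ((real^'n \<Rightarrow> real) \<times> (real^'n \<Rightarrow> real)) set)"
  proof (rule transI)
    fix u v w :: "real^'n \<Rightarrow> real" assume "(u, v) \<in> W_rel L" "(v, w) \<in> W_rel L"
    then obtain c d where c: "u \<in> H1_per L" "w \<in> H1_per L" "AE y in lebesgue. y \<in> cell L \<longrightarrow> u y = v y + c"
        "AE y in lebesgue. y \<in> cell L \<longrightarrow> v y = w y + d"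
      by (auto simp: W_rel_def)
    from c(3,4) have "AE y in lebesgue. y \<in> cell L \<longrightarrow> u y = w y + (d + c)" by eventually_elim auto
    then show "(u, w) \<in> W_rel L" using c unfolding W_rel_def by blast
  qed
qed

lemma W_rel_weak_gradient:
  assumes "(u, w) \<in> W_rel L" "has_weak_gradient (cell_int L) u g"
  shows "has_weak_gradient (cell_int L) w g"
proof -
  obtain c where c: "AE y in lebesgue. y \<in> cell L \<longrightarrow> u y = w y + c" using assms(1) by (auto simp: W_rel_def)
  have "has_weak_gradient (cell_int L) (\<lambda>y. 1 * u y + (- c) * 1) (\<lambda>y. 1 *\<^sub>R g y + (- c) *\<^sub>R grad (\<lambda>_. 1) y)"
    by (intro has_weak_gradient_lin assms has_weak_gradient_smooth smooth_const)
  then show ?thesis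
  proof (rule has_weak_gradient_AE_cong)
    from c show "AE y in lebesgue. y \<in> cell_int L \<longrightarrow> 1 * u y + - c * 1 = w y"
      by eventually_elim (use interior_subset in fastforce)
  qed (simp add: grad_const)
qed

definition W_class :: "real \<Rightarrow> (real^'n \<Rightarrow> real) \<Rightarrow> (real^'n \<Rightarrow> real) set"
  where "W_class L u = W_rel L `` {u}"

lemma W_class_in: "u \<in> H1_per L \<Longrightarrow> W_class L u \<in> W_per L"
  by (simp add: W_per_eq W_class_def quotientI)

text \<open>The gradient of a class is that of a chosen representative; naming it once makes the choice
  available to later proofs.\<close>

lemma W_perE:
  assumes "U \<in> W_per L"
  obtains u where "u \<in> H1_per L" "U = W_class L u" "W_grad L U = weak_grad (cell_int L) u"
proof -
  obtain u where u: "u \<in> H1_per L" "U = W_rel L `` {u}" using assms unfolding W_per_eq by (rule quotientE)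
  have "u \<in> U" using u equiv_class_self[OF equiv_W_rel] by blast
  then have s: "(SOME u. u \<in> U) \<in> U" by (rule someI[where P="\<lambda>u. u \<in> U"])
  then have r: "(u, SOME u. u \<in> U) \<in> W_rel L" using u by blast
  show thesis
  proof (rule that)
    show "(SOME u. u \<in> U) \<in> H1_per L" using r by (auto simp: W_rel_def)
    show "U = W_class L (SOME u. u \<in> U)" using equiv_class_eq[OF equiv_W_rel r] u(2) by (metis W_class_def)
  qed (simp add: W_grad_def)
qed

abbreviation W_gr :: "real \<Rightarrow> (real^'n \<Rightarrow> real) set \<Rightarrow> real^'n \<Rightarrow> real^'n"
  where "W_gr L U \<equiv> restr L (W_grad L U)"

lemma sqint_W_gr:
  assumes "L > 0" "U \<in> W_per L" shows "sqint (cellm L) (W_gr L U)"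
  using W_perE[OF assms(2)] H1_cellE(2)[OF assms(1)] by (metis (no_types, lifting) H1_per_def mem_Collect_eq)

lemma W_gr_class:
  assumes L: "L > 0" and u: "u \<in> H1_per L" and w: "has_weak_gradient (cell_int L) u g"
  shows "AE y in cellm L. W_gr L (W_class L u) y = g y"
proof -
  obtain u' where u': "u' \<in> H1_per L" "W_class L u = W_class L u'" "W_grad L (W_class L u) = weak_grad (cell_int L) u'"
    using W_perE[OF W_class_in[OF u]] by metis
  have "(u, u') \<in> W_rel L"
    using eq_equiv_class[OF _ equiv_W_rel] u'(1,2) unfolding W_class_def by metis
  from W_rel_weak_gradient[OF this w] have "has_weak_gradient (cell_int L) u' g" .
  from cell_weak_grad_AE[OF this] show ?thesis
    unfolding AE_cellm_int[OF L] u'(3) by eventually_elim (simp add: restr_in)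
qed

lemma W_class_weak_gradient:
  "w \<in> W_class L u \<Longrightarrow> has_weak_gradient (cell_int L) u g \<Longrightarrow> has_weak_gradient (cell_int L) w g"
  unfolding W_class_def using W_rel_weak_gradient by blast

lemma W_dist_eq:
  assumes L: "L > 0" and U: "U \<in> W_per L" "V \<in> W_per L"
  shows "W_dist L U V = sqrt (L ^ CARD('n)) * l2norm (cellm L) (\<lambda>y::real^'n. W_gr L U y - W_gr L V y)"
proof -
  have "(LINT y:cell L|lebesgue. (norm (W_grad L U y - W_grad L V y))\<^sup>2) = L ^ CARD('n) * (\<integral>y. (norm (W_gr L U y - W_gr L V y))\<^sup>2 \<partial>cellm L)"
    using sqint_measurable[OF sqint_W_gr[OF L U(1)]] sqint_measurable[OF sqint_W_gr[OF L U(2)]]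
    by (intro set_integral_cell_cong(3)[OF L]) (auto simp: restr_in)
  then show ?thesis by (simp add: W_dist_def l2norm_def real_sqrt_mult)
qed

lemma W_norm_eq:
  assumes L: "L > 0" and U: "U \<in> W_per L"
  shows "W_norm L U = sqrt (L ^ CARD('n)) * l2norm (cellm L) (W_gr L U :: real^'n \<Rightarrow> _)"
proof -
  have "(LINT y:cell L|lebesgue. (norm (W_grad L U y))\<^sup>2) = L ^ CARD('n) * (\<integral>y. (norm (W_gr L U y))\<^sup>2 \<partial>cellm L)"
    using sqint_measurable[OF sqint_W_gr[OF L U]]
    by (intro set_integral_cell_cong(3)[OF L]) (auto simp: restr_in)
  then show ?thesis by (simp add: W_norm_def l2norm_def real_sqrt_mult)
qed

lemma grad_diff_const:
  assumes "smooth v" shows "grad (\<lambda>y. v y - c) y = grad v y"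
  by (rule grad_eqI) (auto intro!: derivative_eq_intros smooth_has_derivative assms)

lemma grad_diff:
  assumes "smooth v" "smooth w" shows "grad (\<lambda>y. v y - w y) y = grad v y - grad w y"
  by (rule grad_eqI) (auto intro!: derivative_eq_intros smooth_has_derivative assms simp: inner_diff_left)

lemma poincare_oscillation:
  fixes v :: "real^'n \<Rightarrow> real"
  assumes L: "L > 0" and v: "smooth v" "periodic L v"
  shows "l2norm (cellm L) (\<lambda>y. v y - (\<integral>y. v y \<partial>cellm L)) \<le> (L * CARD('n)) * l2norm (cellm L) (grad v)"
proof -
  let ?m = "\<integral>y. v y \<partial>cellm L"
  interpret finite_measure "cellm L :: (real^'n) measure" by (rule finite_measure_cellm[OF L])
  have g: "grad (\<lambda>y. v y - ?m) = grad v" using grad_diff_const[OF v(1)] by auto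
  have "(\<integral>y. v y - ?m \<partial>cellm L) = 0"
    using integrable_cellm_bounded[OF L smooth_continuous[OF v(1)]] finite_measure_cellm(2)[OF L, where 'n='n] by simp
  from poincare_periodic[OF L _ _ this] show ?thesis
    unfolding g using v by (simp add: smooth_diff smooth_const periodic_def)
qed

text \<open>The difference is a limit of smooth periodic functions whose gradients tend to zero. By the
  Poincare inequality these are close to their means, so the limit is constant.\<close>

lemma W_gr_zero_imp_const:
  fixes u u' :: "real^'n \<Rightarrow> real"
  assumes L: "L > 0" and u: "u \<in> H1_per L" "u' \<in> H1_per L"
    and eq: "AE y in cellm L. restr L (weak_grad (cell_int L) u) y = restr L (weak_grad (cell_int L) u') y"
  shows "(u, u') \<in> W_rel L"
proof -
  interpret finite_measure "cellm L :: (real^'n) measure" by (rule finite_measure_cellm[OF L])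
  obtain v where v: "\<And>n. smooth (v n)" "\<And>n. periodic L (v n)"
    "(\<lambda>n. l2norm (cellm L) (\<lambda>y. v n y - restr L u y)) \<longlonglongrightarrow> 0"
    "(\<lambda>n. l2norm (cellm L) (\<lambda>y. grad (v n) y - restr L (weak_grad (cell_int L) u) y)) \<longlonglongrightarrow> 0"
    using H1_perE[OF L u(1)] by blast
  obtain v' where v': "\<And>n. smooth (v' n)" "\<And>n. periodic L (v' n)"
    "(\<lambda>n. l2norm (cellm L) (\<lambda>y. v' n y - restr L u' y)) \<longlonglongrightarrow> 0"
    "(\<lambda>n. l2norm (cellm L) (\<lambda>y. grad (v' n) y - restr L (weak_grad (cell_int L) u') y)) \<longlonglongrightarrow> 0"
    using H1_perE[OF L u(2)] by blast
  have h: "u \<in> H1 (cell_int L) (\<lambda>_. 1)" "u' \<in> H1 (cell_int L) (\<lambda>_. 1)" using u by (auto simp: H1_per_def)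
  note E = H1_cellE[OF L h(1)] and E' = H1_cellE[OF L h(2)]
  define w where "w n y = v n y - v' n y" for n y
  define d where "d y = restr L u y - restr L u' y" for y
  have w: "smooth (w n)" "periodic L (w n)" for n
    using v v' by (auto simp: w_def[abs_def] smooth_diff periodic_def)
  have d: "sqint (cellm L) d" unfolding d_def[abs_def] by (intro sqint_diff E E')
  have sc: "sqint (cellm L) (f :: real^'n \<Rightarrow> real)" if "smooth f" for f using that by (intro sqint_cellm_continuous L smooth_continuous)
  have sg: "sqint (cellm L) (grad f :: real^'n \<Rightarrow> real^'n)" if "smooth f" for f using that by (intro sqint_cellm_continuous L smooth_grad_continuous)
  have "l2norm (cellm L) (\<lambda>y. w n y - d y) \<le> l2norm (cellm L) (\<lambda>y. v n y - restr L u y) + l2norm (cellm L) (\<lambda>y. v' n y - restr L u' y)" for n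
  proof -
    have "(\<lambda>y. w n y - d y) = (\<lambda>y. (v n y - restr L u y) + (restr L u' y - v' n y))" by (auto simp: w_def d_def)
    then show ?thesis
      using l2norm_triangle[OF sqint_diff[OF sc[OF v(1)[of n]] E(1)] sqint_diff[OF E'(1) sc[OF v'(1)[of n]]]]
      by (simp add: l2norm_minus_commute[of _ "restr L u'"])
  qed
  then have wd: "(\<lambda>n. l2norm (cellm L) (\<lambda>y. w n y - d y)) \<longlonglongrightarrow> 0"
    using tendsto_add[OF v(3) v'(3)] by (intro l2norm_null_comparison) auto
  have "l2norm (cellm L) (grad (w n)) \<le> l2norm (cellm L) (\<lambda>y. grad (v n) y - restr L (weak_grad (cell_int L) u) y)
      + l2norm (cellm L) (\<lambda>y. grad (v' n) y - restr L (weak_grad (cell_int L) u') y)" for n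
  proof -
    have g: "grad (w n) y = grad (v n) y - grad (v' n) y" for y using grad_diff[OF v(1) v'(1)] by (simp add: w_def[abs_def])
    have "AE y in cellm L. (grad (v n) y - restr L (weak_grad (cell_int L) u) y) + (restr L (weak_grad (cell_int L) u') y - grad (v' n) y) = grad (w n) y"
      using eq by eventually_elim (simp add: g)
    moreover have sq: "sqint (cellm L) (\<lambda>y. (grad (v n) y - restr L (weak_grad (cell_int L) u) y) + (restr L (weak_grad (cell_int L) u') y - grad (v' n) y))"
      by (intro sqint_add sqint_diff sg v v' E E')
    ultimately have "l2norm (cellm L) (grad (w n)) = l2norm (cellm L) (\<lambda>y. (grad (v n) y - restr L (weak_grad (cell_int L) u) y) + (restr L (weak_grad (cell_int L) u') y - grad (v' n) y))"
      using sqint_measurable[OF sg[OF w(1)]] by (intro l2norm_sqint_AE_cong(1)[symmetric]) auto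
    then show ?thesis
      using l2norm_triangle[OF sqint_diff[OF sg[OF v(1)[of n]] E(2)] sqint_diff[OF E'(2) sg[OF v'(1)[of n]]]]
      by (simp add: l2norm_minus_commute[of _ "restr L (weak_grad (cell_int L) u')"])
  qed
  then have gw: "(\<lambda>n. l2norm (cellm L) (grad (w n))) \<longlonglongrightarrow> 0"
    using tendsto_add[OF v(4) v'(4)] by (intro l2norm_null_comparison) auto
  define c where "c n = (\<integral>y. w n y \<partial>cellm L)" for n
  have one: "sqint (cellm L) (\<lambda>y::real^'n. k)" for k :: real by (intro sqint_cellm_continuous L continuous_intros)
  have "(\<lambda>n. \<integral>y. w n y \<bullet> 1 \<partial>cellm L) \<longlonglongrightarrow> (\<integral>y. d y \<bullet> 1 \<partial>cellm L)"
    by (rule l2_tendsto_inner[OF sc[OF w(1)] d one wd])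
  then have c: "c \<longlonglongrightarrow> (\<integral>y. d y \<partial>cellm L)" by (simp add: c_def[abs_def])
  define C where "C = (\<integral>y. d y \<partial>cellm L)"
  have cn: "l2norm (cellm L) (\<lambda>y::real^'n. k) = \<bar>k\<bar>" for k :: real
    using finite_measure_cellm(2)[OF L, where 'n='n] by (simp add: l2norm_def)
  have bound: "l2norm (cellm L) (\<lambda>y. d y - C) \<le> l2norm (cellm L) (\<lambda>y. w n y - d y) + (L * CARD('n)) * l2norm (cellm L) (grad (w n)) + \<bar>c n - C\<bar>" for n
  proof -
    have "l2norm (cellm L) (\<lambda>y. d y - C) \<le> l2norm (cellm L) (\<lambda>y. d y - w n y) + l2norm (cellm L) (\<lambda>y. w n y - C)"
      by (rule l2norm_triangle_diff[OF d sc[OF w(1)] one])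
    also have "l2norm (cellm L) (\<lambda>y. w n y - C) \<le> l2norm (cellm L) (\<lambda>y. w n y - c n) + l2norm (cellm L) (\<lambda>y::real^'n. c n - C)"
      by (rule l2norm_triangle_diff[OF sc[OF w(1)] one one])
    also have "l2norm (cellm L) (\<lambda>y. w n y - c n) \<le> (L * CARD('n)) * l2norm (cellm L) (grad (w n))"
      unfolding c_def by (rule poincare_oscillation[OF L w])
    finally show ?thesis by (simp add: cn l2norm_minus_commute[of _ d])
  qed
  have "(\<lambda>n. l2norm (cellm L) (\<lambda>y. w n y - d y) + (L * CARD('n)) * l2norm (cellm L) (grad (w n)) + \<bar>c n - C\<bar>) \<longlonglongrightarrow> 0 + (L * CARD('n)) * 0 + \<bar>C - C\<bar>"
    unfolding C_def by (intro tendsto_intros wd gw c)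
  then have "l2norm (cellm L) (\<lambda>y. d y - C) \<le> 0" using bound by (intro LIMSEQ_le_const) auto
  then have "l2norm (cellm L) (\<lambda>y. d y - C) = 0" by (simp add: order_antisym)
  then have "AE y in cellm L. d y - C = 0" using l2norm_eq_0[OF sqint_diff[OF d one]] by blast
  then have "AE y in lebesgue. y \<in> cell_int L \<longrightarrow> d y - C = 0" unfolding AE_cellm_int[OF L] .
  with AE_cell_interior have "AE y in lebesgue. y \<in> cell L \<longrightarrow> u y = u' y + C"
    by eventually_elim (auto simp: d_def restr_in)
  then show ?thesis using u by (auto simp: W_rel_def)
qed

text \<open>That distance zero means equality is the Poincare inequality, in the form of
  \<open>W_gr_zero_imp_const\<close>; the rest holds because the distance is one of gradients in the
  mean.\<close>

lemma Metric_space_W: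
  assumes L: "L > 0"
  shows "Metric_space (W_per L :: (real^'n \<Rightarrow> real) set set) (W_dist L)"
proof
  fix U V T :: "(real^'n \<Rightarrow> real) set"
  show "0 \<le> W_dist L U V"
    unfolding W_dist_def set_lebesgue_integral_def by (intro real_sqrt_ge_zero Bochner_Integration.integral_nonneg) auto
  show "W_dist L U V = W_dist L V U" by (simp add: W_dist_def norm_minus_commute)
  {
    assume U: "U \<in> W_per L" and V: "V \<in> W_per L"
    note s = sqint_diff[OF sqint_W_gr[OF L U] sqint_W_gr[OF L V]]
    show "W_dist L U V = 0 \<longleftrightarrow> U = V"
    proof
      assume "W_dist L U V = 0"
      then have "l2norm (cellm L) (\<lambda>y. W_gr L U y - W_gr L V y) = 0" using L by (simp add: W_dist_eq[OF L U V])
      from l2norm_eq_0[OF s this] have ae: "AE y in cellm L. W_gr L U y = W_gr L V y" by simp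
      obtain u where u: "u \<in> H1_per L" "U = W_class L u" "W_grad L U = weak_grad (cell_int L) u" using W_perE[OF U] .
      obtain v where v: "v \<in> H1_per L" "V = W_class L v" "W_grad L V = weak_grad (cell_int L) v" using W_perE[OF V] .
      have "(u, v) \<in> W_rel L" using W_gr_zero_imp_const[OF L u(1) v(1)] ae u(3) v(3) by simp
      then show "U = V" unfolding u(2) v(2) W_class_def by (rule equiv_class_eq[OF equiv_W_rel])
    qed (simp add: W_dist_def)
  }
  assume U: "U \<in> W_per L" and V: "V \<in> W_per L" and T: "T \<in> W_per L"
  show "W_dist L U T \<le> W_dist L U V + W_dist L V T"
    unfolding W_dist_eq[OF L U V] W_dist_eq[OF L V T] W_dist_eq[OF L U T] distrib_left[symmetric]
    by (intro mult_left_mono l2norm_triangle_diff sqint_W_gr L U V T) (use L in simp)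
qed

text \<open>The gradient fields of periodic functions are closed in the mean: by the Poincare inequality the
  approximants converge themselves once their means are removed.\<close>

lemma W_limit:
  fixes g :: "real^'n \<Rightarrow> real^'n"
  assumes L: "L > 0" and v: "\<And>n. smooth (v n)" "\<And>n. periodic L (v n)" and g: "sqint (cellm L) g"
    and lim: "(\<lambda>n. l2norm (cellm L) (\<lambda>y. grad (v n) y - g y)) \<longlonglongrightarrow> 0"
  obtains u where "u \<in> H1_per L" "has_weak_gradient (cell_int L) u g"
proof -
  define m where "m n = (\<integral>y. v n y \<partial>cellm L)" for n
  define w where "w n y = v n y - m n" for n y
  have w: "smooth (w n)" "periodic L (w n)" for n
    using v by (auto simp: w_def[abs_def] smooth_diff smooth_const periodic_def)
  have gw: "grad (w n) = grad (v n)" for n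
    using grad_diff_const[OF v(1)] by (auto simp: w_def[abs_def])
  have sw: "sqint (cellm L) (w n)" for n by (intro sqint_cellm_continuous L smooth_continuous w)
  have sg: "sqint (cellm L) (grad (v n))" for n by (intro sqint_cellm_continuous L smooth_grad_continuous v)
  have cau: "l2norm (cellm L) (\<lambda>y. w i y - w j y) \<le> (L * CARD('n)) *
      (l2norm (cellm L) (\<lambda>y. grad (v i) y - g y) + l2norm (cellm L) (\<lambda>y. grad (v j) y - g y))" for i j
  proof -
    define z where "z y = v i y - v j y" for y
    have z: "smooth z" "periodic L z"
      using v by (auto simp: z_def[abs_def] smooth_diff periodic_def)
    have gz: "grad z = (\<lambda>y. grad (v i) y - grad (v j) y)" using grad_diff[OF v(1) v(1)] by (auto simp: z_def[abs_def])
    have "(\<integral>y. z y \<partial>cellm L) = m i - m j"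
      using integrable_cellm_bounded[OF L smooth_continuous[OF v(1)]] by (simp add: z_def m_def)
    then have "(\<lambda>y. z y - (\<integral>y. z y \<partial>cellm L)) = (\<lambda>y. w i y - w j y)" by (auto simp: z_def w_def)
    then have "l2norm (cellm L) (\<lambda>y. w i y - w j y) \<le> (L * CARD('n)) * l2norm (cellm L) (\<lambda>y. grad (v i) y - grad (v j) y)"
      using poincare_oscillation[OF L z] gz by simp
    also have "\<dots> \<le> (L * CARD('n)) * (l2norm (cellm L) (\<lambda>y. grad (v i) y - g y) + l2norm (cellm L) (\<lambda>y. grad (v j) y - g y))"
      using l2norm_triangle_diff[OF sg g sg, of i j] L by (intro mult_left_mono) (auto simp: l2norm_minus_commute[of _ g])
    finally show ?thesis .
  qed
  obtain u where u: "sqint (cellm L) u" "(\<lambda>n. l2norm (cellm L) (\<lambda>y. w n y - u y)) \<longlonglongrightarrow> 0"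
  proof (rule l2_complete[OF sw])
    fix e :: real assume e: "e > 0"
    have K: "L * CARD('n) > 0" using L by simp
    have "eventually (\<lambda>n. l2norm (cellm L) (\<lambda>y. grad (v n) y - g y) < e / (2 * (L * CARD('n)))) sequentially"
      using e K by (intro order_tendstoD(2)[OF lim]) simp
    then obtain N where N: "\<And>n. n \<ge> N \<Longrightarrow> l2norm (cellm L) (\<lambda>y. grad (v n) y - g y) < e / (2 * (L * CARD('n)))"
      by (auto simp: eventually_sequentially)
    have "l2norm (cellm L) (\<lambda>y. w i y - w j y) \<le> e" if "i \<ge> N" "j \<ge> N" for i j
    proof -
      have "l2norm (cellm L) (\<lambda>y. w i y - w j y) \<le> (L * CARD('n)) * (e / (2 * (L * CARD('n))) + e / (2 * (L * CARD('n))))"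
        using N[OF that(1)] N[OF that(2)] K by (intro order_trans[OF cau] mult_left_mono) auto
      also have "\<dots> = e" using L by (simp add: field_simps)
      finally show ?thesis .
    qed
    then show "\<exists>N. \<forall>i\<ge>N. \<forall>j\<ge>N. l2norm (cellm L) (\<lambda>y. w i y - w j y) \<le> e" by blast
  qed
  have "u \<in> H1_per L" "has_weak_gradient (cell_int L) u g"
    using H1_perI[OF L w u(1) g u(2)] lim gw by simp_all
  then show thesis by (rule that)
qed

lemma smooth_periodic_H1_per:
  fixes v :: "real^'n \<Rightarrow> real"
  assumes "L > 0" "smooth v" "periodic L v" shows "v \<in> H1_per L"
  by (rule H1_perI(1)[of L "\<lambda>_. v" v "grad v"])
     (auto intro!: assms sqint_cellm_continuous smooth_continuous smooth_grad_continuous simp: l2norm_def)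

text \<open>The gradient determines the distance, so Fubini's theorem gives measurability of the distance to a
  fixed class. The values lie in the closure of a countable set, so the preimage of an open set is a countable
  union of preimages of balls.\<close>

lemma measurable_W_borel:
  fixes \<Phi> :: "real^'n \<Rightarrow> (real^'n \<Rightarrow> real) set"
  assumes L: "L > 0" and \<Phi>: "\<And>x. \<Phi> x \<in> W_per L"
    and G: "(\<lambda>(x, y). G x y) \<in> borel_measurable (lebesgue \<Otimes>\<^sub>M lebesgue)"
    and eq: "\<And>x. AE y in cellm L. W_gr L (\<Phi> x) y = G x y"
    and Q: "countable Q" "Q \<subseteq> W_per L" and dense: "\<And>x e. e > 0 \<Longrightarrow> \<exists>U\<in>Q. W_dist L (\<Phi> x) U < e"
  shows "\<Phi> \<in> measurable lebesgue (W_borel L)"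
proof -
  interpret M: Metric_space "W_per L :: (real^'n \<Rightarrow> real) set set" "W_dist L" by (rule Metric_space_W[OF L])
  interpret C: finite_measure "cellm L :: (real^'n) measure" by (rule finite_measure_cellm[OF L])
  have dist: "W_dist L (\<Phi> x) U = sqrt (L ^ CARD('n)) * l2norm (cellm L) (\<lambda>y. G x y - W_gr L U y)" if U: "U \<in> W_per L" for U x
  proof -
    have "G x \<in> borel_measurable lebesgue"
      using measurable_compose_Pair1[OF _ G, of x] by simp
    moreover note sqint_measurable[OF sqint_W_gr[OF L U]] sqint_measurable[OF sqint_W_gr[OF L \<Phi>[of x]]]
    ultimately have "l2norm (cellm L) (\<lambda>y. W_gr L (\<Phi> x) y - W_gr L U y) = l2norm (cellm L) (\<lambda>y. G x y - W_gr L U y)"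
      using eq[of x] by (intro l2norm_sqint_AE_cong(1) sqint_diff sqint_W_gr L U \<Phi>) (auto elim!: eventually_mono)
    then show ?thesis by (simp add: W_dist_eq[OF L \<Phi> U])
  qed
  have meas: "(\<lambda>x. W_dist L (\<Phi> x) U) \<in> borel_measurable lebesgue" if U: "U \<in> W_per L" for U
  proof -
    have s: "sets (lebesgue \<Otimes>\<^sub>M cellm L) = sets (lebesgue \<Otimes>\<^sub>M lebesgue :: ((real^'n) \<times> (real^'n)) measure)"
      by (intro sets_pair_measure_cong) simp_all
    have [measurable]: "(\<lambda>(x, y). G x y) \<in> borel_measurable (lebesgue \<Otimes>\<^sub>M cellm L)"
      using G measurable_cong_sets[OF s refl] by blast
    have [measurable]: "W_gr L U \<in> borel_measurable (cellm L)" using sqint_measurable[OF sqint_W_gr[OF L U]] .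
    have "(\<lambda>x. \<integral>y. (norm (G x y - W_gr L U y))\<^sup>2 \<partial>cellm L) \<in> borel_measurable lebesgue"
      by (rule C.borel_measurable_lebesgue_integral) measurable
    then show ?thesis unfolding dist[OF U] l2norm_def by measurable
  qed
  show ?thesis unfolding W_borel_def
  proof (rule measurable_measure_of)
    show "{S. openin M.mtopology S} \<subseteq> Pow (W_per L)" using openin_subset[of M.mtopology] by auto
    show "\<Phi> \<in> space lebesgue \<rightarrow> W_per L" using \<Phi> by auto
    fix S assume "S \<in> {S. openin M.mtopology S}"
    then have S: "openin M.mtopology S" by simp
    let ?I = "{(U, r). U \<in> Q \<and> r \<in> \<rat> \<and> M.mball U r \<subseteq> S}"
    have "?I \<subseteq> Q \<times> \<rat>" by auto
    then have cI: "countable ?I" using Q(1) countable_rat by (meson countable_SIGMA countable_subset)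
    have "\<Phi> -` S = (\<Union>(U, r)\<in>?I. {x. W_dist L (\<Phi> x) U < r})"
    proof (intro equalityI subsetI)
      fix x assume "x \<in> \<Phi> -` S"
      then obtain r where r: "r > 0" "M.mball (\<Phi> x) r \<subseteq> S" using S unfolding M.openin_mtopology by auto
      obtain U where U: "U \<in> Q" "W_dist L (\<Phi> x) U < r / 2" using dense[of "r / 2" x] r by auto
      obtain q where q: "q \<in> \<rat>" "W_dist L (\<Phi> x) U < q" "q < r / 2" using Rats_dense_in_real[OF U(2)] by auto
      have "M.mball U q \<subseteq> M.mball (\<Phi> x) r"
        using U q \<Phi>[of x] Q(2) by (intro M.mball_subset) (auto simp: M.commute[of U])
      then show "x \<in> (\<Union>(U, r)\<in>?I. {x. W_dist L (\<Phi> x) U < r})" using r U q by blast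
    next
      fix x assume "x \<in> (\<Union>(U, r)\<in>?I. {x. W_dist L (\<Phi> x) U < r})"
      then obtain U r where U: "U \<in> Q" "M.mball U r \<subseteq> S" "W_dist L (\<Phi> x) U < r" by blast
      then have "\<Phi> x \<in> M.mball U r" using \<Phi>[of x] Q(2) by (auto simp: M.commute[of U])
      then show "x \<in> \<Phi> -` S" using U by blast
    qed
    moreover have "{x. W_dist L (\<Phi> x) U < r} \<in> sets lebesgue" if "U \<in> Q" for U r
      using meas[of U] that Q(2) borel_measurable_less[of "\<lambda>x. W_dist L (\<Phi> x) U" lebesgue "\<lambda>_. r"] by auto
    ultimately show "\<Phi> -` S \<inter> space lebesgue \<in> sets lebesgue"
      using cI by (auto intro!: sets.countable_UN')
  qed
qed

section \<open>Density of trigonometric polynomials\<close>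

inductive trig_poly :: "real \<Rightarrow> (real^'n \<Rightarrow> real) \<Rightarrow> bool" for L
  where
    wave: "\<kappa> \<in> dual_lattice L \<Longrightarrow> trig_poly L (wave \<kappa> j)"
  | add: "trig_poly L f \<Longrightarrow> trig_poly L g \<Longrightarrow> trig_poly L (\<lambda>y. f y + g y)"
  | scale: "trig_poly L f \<Longrightarrow> trig_poly L (\<lambda>y. c * f y)"

lemma wave_zero: "wave 0 0 y = 1"
  by (simp add: wave_def)

lemma trig_poly_const: "trig_poly L (\<lambda>y. c)"
  using trig_poly.scale[OF trig_poly.wave[OF dual_lattice_zero], of L c 0] by (simp add: wave_zero)

lemma trig_poly_wave_mult:
  assumes "trig_poly L g" "\<kappa> \<in> dual_lattice L" shows "trig_poly L (\<lambda>y. wave \<kappa> j y * g y)"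
  using assms(1)
proof induction
  case (wave \<kappa>' j')
  have "trig_poly L (\<lambda>y. (1 / 2) * wave (\<kappa> - \<kappa>') (j - j') y + (1 / 2) * wave (\<kappa> + \<kappa>') (j + j') y)"
    by (intro trig_poly.intros dual_lattice_add dual_lattice_diff wave assms)
  then show ?case by (simp add: wave_mult add_divide_distrib)
next
  case (add f g)
  then show ?case using trig_poly.add by (fastforce simp: distrib_left)
next
  case (scale f c)
  then show ?case using trig_poly.scale[of L "\<lambda>y. wave \<kappa> j y * f y" c] by (simp add: algebra_simps)
qed

lemma trig_poly_mult:
  assumes "trig_poly L f" "trig_poly L g" shows "trig_poly L (\<lambda>y. f y * g y)"
  using assms(1)
proof induction
  case (wave \<kappa> j)
  then show ?case using trig_poly_wave_mult[OF assms(2)] by blast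
next
  case (add f h)
  then show ?case using trig_poly.add by (fastforce simp: distrib_right)
next
  case (scale f c)
  then show ?case using trig_poly.scale[of L "\<lambda>y. f y * g y" c] by (simp add: algebra_simps)
qed

lemma trig_poly_sum: "(\<And>i. i \<in> I \<Longrightarrow> trig_poly L (f i)) \<Longrightarrow> trig_poly L (\<lambda>y. \<Sum>i\<in>I. f i y)"
  by (induction I rule: infinite_finite_induct) (auto intro: trig_poly_const trig_poly.add)

definition torus_map :: "real \<Rightarrow> real^'n \<Rightarrow> (real^'n) \<times> (real^'n)"
  where "torus_map L y = ((\<chi> i. cos (2 * pi * y $ i / L)), (\<chi> i. sin (2 * pi * y $ i / L)))"

lemma continuous_torus_map: "L > 0 \<Longrightarrow> continuous_on S (torus_map L)"
  unfolding torus_map_def by (intro continuous_intros) auto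

lemma torus_map_eqD:
  assumes "L > 0" "torus_map L x = torus_map L y" "periodic L f" shows "f x = f y"
proof -
  have "\<exists>k::int. x $ i = y $ i + of_int k * L" for i
  proof -
    have "sin (2 * pi * x $ i / L) = sin (2 * pi * y $ i / L)" "cos (2 * pi * x $ i / L) = cos (2 * pi * y $ i / L)"
      using assms(2) by (simp_all add: torus_map_def vec_eq_iff)
    then obtain k :: int where "2 * pi * x $ i / L = 2 * pi * y $ i / L + 2 * pi * k" using sin_cos_eq_iff by blast
    then have "2 * pi * x $ i = 2 * pi * (y $ i + of_int k * L)" using assms(1) by (simp add: field_simps)
    then have "x $ i = y $ i + of_int k * L" by simp
    then show ?thesis by blast
  qed
  then obtain k :: "'a \<Rightarrow> int" where k: "\<And>i. x $ i = y $ i + of_int (k i) * L" by metis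
  have "x = y + (\<Sum>i\<in>UNIV. (of_int (k i) * L) *\<^sub>R axis i 1)"
    by (simp add: vec_eq_iff k axis_def if_distrib cong: if_cong)
  then show ?thesis using periodic_lattice[OF assms(3), of y k UNIV] by simp
qed

text \<open>The coordinates of \<open>torus_map\<close> are waves, and products of waves are sums of
  waves.\<close>

lemma trig_poly_torus_polynomial:
  assumes L: "L > 0" and "real_polynomial_function g" shows "trig_poly L (\<lambda>y::real^'n. g (torus_map L y))"
  using assms(2)
proof induction
  case (linear h)
  interpret bounded_linear h by fact
  have c: "cos (2 * pi * y $ i / L) = wave (axis i (2 * pi / L)) 0 y" for y :: "real^'n" and i
    by (simp add: wave_def inner_axis')
  have s: "sin (2 * pi * y $ i / L) = wave (axis i (2 * pi / L)) (-1) y" for y :: "real^'n" and i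
    by (simp add: wave_def inner_axis' cos_diff)
  have d: "axis i (2 * pi / L) \<in> dual_lattice L" for i :: 'n
    unfolding dual_lattice_def axis_def by (auto intro: exI[of _ 1] exI[of _ 0])
  have "torus_map L y = (\<Sum>i\<in>UNIV. cos (2 * pi * y $ i / L) *\<^sub>R (axis i 1, 0)) + (\<Sum>i\<in>UNIV. sin (2 * pi * y $ i / L) *\<^sub>R (0, axis i 1))" for y :: "real^'n"
    by (auto simp: torus_map_def prod_eq_iff fst_sum snd_sum vec_eq_iff axis_def if_distrib cong: if_cong)
  then have "h (torus_map L y) = (\<Sum>i\<in>UNIV. h (axis i 1, 0) * cos (2 * pi * y $ i / L)) + (\<Sum>i\<in>UNIV. h (0, axis i 1) * sin (2 * pi * y $ i / L))" for y :: "real^'n"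
    by (simp only: add sum scaleR real_scaleR_def mult.commute)
  then show ?case unfolding c s by (simp only:) (intro trig_poly.add trig_poly_sum trig_poly.scale trig_poly.wave d)
next
  case (const c)
  then show ?case by (rule trig_poly_const)
next
  case (add f g)
  then show ?case by (auto intro: trig_poly.add)
next
  case (mult f g)
  then show ?case by (auto intro: trig_poly_mult)
qed

text \<open>A periodic function is a function on the torus, embedded as a compact set, where the
  Stone-Weierstrass theorem applies.\<close>

lemma trig_poly_dense:
  fixes f :: "real^'n \<Rightarrow> real"
  assumes L: "L > 0" and f: "continuous_on UNIV f" "periodic L f" and e: "e > 0"
  obtains P where "trig_poly L P" "\<And>y. \<bar>f y - P y\<bar> < e"
proof -
  let ?T = "torus_map L ` (cell L :: (real^'n) set)"
  define F where "F t = f (SOME y. y \<in> cell L \<and> torus_map L y = t)" for t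
  have F: "F (torus_map L y) = f y" if "y \<in> cell L" for y :: "real^'n"
  proof -
    have "(SOME z. z \<in> cell L \<and> torus_map L z = torus_map L y) \<in> cell L \<and> torus_map L (SOME z. z \<in> cell L \<and> torus_map L z = torus_map L y) = torus_map L y"
      by (rule someI[of "\<lambda>z. z \<in> cell L \<and> torus_map L z = torus_map L y" y]) (use that in auto)
    then show ?thesis unfolding F_def using torus_map_eqD[OF L _ f(2)] by blast
  qed
  have cT: "compact ?T" by (intro compact_continuous_image continuous_torus_map[OF L]) (simp add: cell_eq_cbox)
  \<comment> \<open>\<open>torus_map\<close> is a closed map on the compact cell, so \<open>F\<close> inherits the continuity of \<open>f\<close>.\<close>
  have "continuous_on ?T F"
    unfolding continuous_on_closed_vimage[OF compact_imp_closed[OF cT]]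
  proof (intro allI impI)
    fix B :: "real set" assume "closed B"
    then have "closed (f -` B)" using f(1) by (simp add: continuous_closed_vimage continuous_on_eq_continuous_at)
    then have "compact (cell L \<inter> f -` B)" by (intro compact_Int_closed) (simp_all add: cell_eq_cbox)
    then have "compact (torus_map L ` (cell L \<inter> f -` B))" by (intro compact_continuous_image continuous_torus_map[OF L])
    moreover have "F -` B \<inter> ?T = torus_map L ` (cell L \<inter> f -` B)" using F by auto
    ultimately show "closed (F -` B \<inter> ?T)" by (simp add: compact_imp_closed)
  qed
  from Stone_Weierstrass_real_polynomial_function[OF cT this e] obtain g where
    g: "real_polynomial_function g" "\<And>t. t \<in> ?T \<Longrightarrow> \<bar>F t - g t\<bar> < e" by blast
  show thesis
  proof (rule that)
    show "trig_poly L (\<lambda>y. g (torus_map L y))" by (rule trig_poly_torus_polynomial[OF L g(1)])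
    fix y :: "real^'n"
    obtain z where z: "z \<in> cell L" "\<And>h. periodic L h \<Longrightarrow> h y = h z" using cell_representative[OF L] by blast
    have "periodic L (\<lambda>y. g (torus_map L y))"
    proof -
      have "torus_map L (x + L *\<^sub>R axis i 1) = torus_map L x" for x :: "real^'n" and i
      proof -
        have "2 * pi * (x + L *\<^sub>R axis i 1) $ j / L = 2 * pi * x $ j / L + (if i = j then 2 * pi else 0)" for j
          using L by (simp add: axis_def field_simps)
        then show ?thesis by (simp add: torus_map_def vec_eq_iff)
      qed
      then show ?thesis by (simp add: periodic_def)
    qed
    then show "\<bar>f y - g (torus_map L y)\<bar> < e"
      using z(2)[OF f(2)] z(2)[of "\<lambda>y. g (torus_map L y)"] g(2)[of "torus_map L z"] z(1) F[OF z(1)] by auto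
  qed
qed

text \<open>Combinations are represented by lists because lists over a countable set are countable.\<close>

definition wave_comb :: "(real \<times> (real^'n) \<times> int) list \<Rightarrow> real^'n \<Rightarrow> real"
  where "wave_comb l y = (\<Sum>(c, \<kappa>, j)\<leftarrow>l. c * wave \<kappa> j y)"

lemma wave_comb_simps [simp]:
  "wave_comb [] y = 0" "wave_comb ((c, \<kappa>, j) # l) y = c * wave \<kappa> j y + wave_comb l y"
  "wave_comb (l @ l') y = wave_comb l y + wave_comb l' y"
  by (simp_all add: wave_comb_def)

lemma wave_comb_bounded: "\<exists>B\<ge>0. \<forall>y. \<bar>wave_comb l y\<bar> \<le> B"
proof (induction l)
  case (Cons a l)
  obtain c \<kappa> j where a: "a = (c, \<kappa>, j)" by (cases a)
  obtain B where B: "B \<ge> 0" "\<And>y. \<bar>wave_comb l y\<bar> \<le> B" using Cons by blast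
  have "\<bar>wave_comb (a # l) y\<bar> \<le> \<bar>c\<bar> + B" for y
  proof -
    have "\<bar>c * wave \<kappa> j y\<bar> \<le> \<bar>c\<bar>" using mult_left_le[OF abs_wave_le, of "\<bar>c\<bar>" \<kappa> j y] by (simp add: abs_mult)
    then show ?thesis using B(2)[of y] by (simp add: a)
  qed
  then show ?case using B(1) by (intro exI[of _ "\<bar>c\<bar> + B"]) auto
qed auto

lemma continuous_wave_comb: "continuous_on S (wave_comb l)"
proof (induction l)
  case (Cons a l)
  then show ?case by (cases a) (auto intro!: continuous_intros smooth_continuous[OF smooth_wave] simp: wave_comb_simps[abs_def])
qed (simp add: wave_comb_simps[abs_def])

definition rat_combs :: "real \<Rightarrow> (real \<times> (real^'n) \<times> int) list set"
  where "rat_combs L = lists (\<rat> \<times> dual_lattice L \<times> UNIV)"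

lemma countable_rat_combs: "countable (rat_combs L)"
  unfolding rat_combs_def by (intro countable_lists countable_SIGMA countable_rat countable_dual_lattice) auto

lemma wave_comb_scale: "wave_comb (map (\<lambda>(c, \<kappa>, j). (r * c, \<kappa>, j)) l) y = r * wave_comb l y"
  by (induction l) (auto simp: algebra_simps)

text \<open>Waves are bounded, so changing coefficients slightly changes a combination uniformly
  little.\<close>

lemma trig_poly_rat_combs:
  assumes "trig_poly L P" "e > 0"
  shows "\<exists>l\<in>rat_combs L. \<forall>y. \<bar>P y - wave_comb l y\<bar> < e"
  using assms
proof (induction arbitrary: e)
  case (wave \<kappa> j)
  then show ?case by (intro bexI[of _ "[(1, \<kappa>, j)]"]) (auto simp: rat_combs_def)
next
  case (add f g)
  from add(3,4)[of "e / 2"] add(5) obtain l l' where l: "l \<in> rat_combs L" "\<And>y. \<bar>f y - wave_comb l y\<bar> < e / 2"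
    and l': "l' \<in> rat_combs L" "\<And>y. \<bar>g y - wave_comb l' y\<bar> < e / 2" by (meson half_gt_zero)
  show ?case
  proof (intro bexI[of _ "l @ l'"] allI)
    show "\<bar>f y + g y - wave_comb (l @ l') y\<bar> < e" for y
      using l(2)[of y] l'(2)[of y] unfolding wave_comb_simps(3) by linarith
  qed (use l l' in \<open>auto simp: rat_combs_def\<close>)
next
  case (scale f c)
  have "e / (2 * (\<bar>c\<bar> + 1)) > 0" using scale(3) by simp
  then obtain l where l: "l \<in> rat_combs L" "\<And>y. \<bar>f y - wave_comb l y\<bar> < e / (2 * (\<bar>c\<bar> + 1))" using scale(2) by blast
  obtain B where B: "B \<ge> 0" "\<And>y. \<bar>wave_comb l y\<bar> \<le> B" using wave_comb_bounded by blast
  obtain r where r: "r \<in> \<rat>" "c < r" "r < c + e / (2 * (B + 1))"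
    using Rats_dense_in_real[of c "c + e / (2 * (B + 1))"] scale(3) B(1) by auto
  show ?case
  proof (intro bexI[of _ "map (\<lambda>(c, \<kappa>, j). (r * c, \<kappa>, j)) l"] allI)
    show "map (\<lambda>(c, \<kappa>, j). (r * c, \<kappa>, j)) l \<in> rat_combs L" using l(1) r(1) by (fastforce simp: rat_combs_def)
    fix y
    have "\<bar>c * f y - r * wave_comb l y\<bar> = \<bar>c * (f y - wave_comb l y) + (c - r) * wave_comb l y\<bar>" by (simp add: algebra_simps)
    also have "\<dots> \<le> \<bar>c\<bar> * \<bar>f y - wave_comb l y\<bar> + \<bar>c - r\<bar> * \<bar>wave_comb l y\<bar>"
      using abs_triangle_ineq[of "c * (f y - wave_comb l y)" "(c - r) * wave_comb l y"] by (simp add: abs_mult)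
    also have "\<bar>c\<bar> * \<bar>f y - wave_comb l y\<bar> \<le> (\<bar>c\<bar> + 1) * \<bar>f y - wave_comb l y\<bar>" by (intro mult_right_mono) auto
    also have "\<dots> < (\<bar>c\<bar> + 1) * (e / (2 * (\<bar>c\<bar> + 1)))" by (intro mult_strict_left_mono l) simp
    also have "\<dots> = e / 2" by (simp add: field_simps)
    also have "\<bar>c - r\<bar> * \<bar>wave_comb l y\<bar> \<le> (e / (2 * (B + 1))) * (B + 1)"
      using r B(1) B(2)[of y] by (intro mult_mono) auto
    also have "(e / (2 * (B + 1))) * (B + 1) = e / 2" using B(1) by (simp add: field_simps)
    finally have "\<bar>c * f y - r * wave_comb l y\<bar> < e" by simp
    then show "\<bar>c * f y - wave_comb (map (\<lambda>(c, \<kappa>, j). (r * c, \<kappa>, j)) l) y\<bar> < e" by (simp only: wave_comb_scale)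
  qed
qed

lemma rat_combs_dense:
  fixes f :: "real^'n \<Rightarrow> real"
  assumes "L > 0" "continuous_on UNIV f" "periodic L f" "e > 0"
  shows "\<exists>l\<in>rat_combs L. \<forall>y. \<bar>f y - wave_comb l y\<bar> < e"
proof -
  obtain P where P: "trig_poly L P" "\<And>y. \<bar>f y - P y\<bar> < e / 2"
    using trig_poly_dense[OF assms(1-3), of "e / 2"] assms(4) by auto
  obtain l where l: "l \<in> rat_combs L" "\<And>y. \<bar>P y - wave_comb l y\<bar> < e / 2"
    using trig_poly_rat_combs[OF P(1), of "e / 2"] assms(4) by auto
  have "\<bar>f y - wave_comb l y\<bar> < e" for y using P(2)[of y] l(2)[of y] by linarith
  then show ?thesis using l(1) by blast
qed

section \<open>A countable family of oscillating test functions\<close>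

text \<open>Indices of the products of a bump with a wave: the rational corners and the steepness of the bump,
  and the frequency and the phase of the wave.\<close>

type_synonym 'n test_index = "((rat^'n) \<times> (rat^'n) \<times> nat) \<times> ((int^'n) \<times> int)"

definition rat_vec :: "rat^'n \<Rightarrow> real^'n"
  where "rat_vec p = (\<chi> i. of_rat (p $ i))"

definition bump_of :: "(rat^'n) \<times> (rat^'n) \<times> nat \<Rightarrow> real^'n \<Rightarrow> real"
  where "bump_of b = (case b of (p, q, m) \<Rightarrow> box_bump (rat_vec p) (rat_vec q) m)"

definition freq :: "real \<Rightarrow> int^'n \<Rightarrow> real^'n"
  where "freq L k = (\<chi> i. 2 * pi * of_int (k $ i) / L)"

lemma freq_in: "freq L k \<in> dual_lattice L"
  by (auto simp: freq_def dual_lattice_def)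

lemma dual_latticeE:
  assumes "\<kappa> \<in> dual_lattice L" obtains k where "\<kappa> = freq L k"
proof -
  obtain f where "\<And>i. \<kappa> $ i = 2 * pi * of_int (f i) / L" using assms unfolding dual_lattice_def by (auto simp: choice_iff)
  then have "\<kappa> = freq L (\<chi> i. f i)" by (simp add: freq_def vec_eq_iff)
  then show thesis by (rule that)
qed

lemma smooth_bump_of: "smooth (bump_of b)"
  by (cases b) (simp add: bump_of_def smooth_box_bump)

lemma test_function_bump_of: "test_function UNIV (bump_of b)"
  by (cases b) (simp add: bump_of_def test_function_box_bump)

lemma bump_of_bounds: "0 \<le> bump_of b x" "bump_of b x \<le> 1" "\<bar>bump_of b x\<bar> \<le> 1"
proof -
  obtain p q m where b: "b = (p, q, m)" by (cases b)
  show "0 \<le> bump_of b x" "bump_of b x \<le> 1" "\<bar>bump_of b x\<bar> \<le> 1"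
    using box_bump_bounds[of "rat_vec p" "rat_vec q" m x] by (simp_all add: b bump_of_def)
qed

lemma flat_tendsto:
  assumes "c > 0" "t \<longlonglongrightarrow> s" shows "(\<lambda>n. flat c k (t n)) \<longlonglongrightarrow> flat c k s"
  using DERIV_isCont[OF has_derivative_flat[OF assms(1), of k s]] assms(2) by (rule isCont_tendsto_compose)

text \<open>Bumps depend continuously on the corners of their boxes, so rational boxes suffice in the
  fundamental lemma.\<close>

lemma orthogonal_to_rational_bumps_imp_AE_zero:
  fixes f :: "real^'n \<Rightarrow> real"
  assumes f: "locally_integrable UNIV f" and orth: "\<And>b. (\<integral>x. bump_of b x * f x \<partial>lebesgue) = 0"
  shows "AE x in lebesgue. f x = 0"
proof -
  have "(\<integral>x. box_bump p q m x * f x \<partial>lebesgue) = 0" for p q m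
  proof -
    have "\<exists>r::rat. c < of_rat r \<and> of_rat r < c + 1 / Suc n" for c :: real and n
      by (rule of_rat_dense) simp
    then obtain R where R: "\<And>c n. c < of_rat (R c n) \<and> of_rat (R c n) < c + 1 / real (Suc n)" by metis
    define P Q where "P n = (\<chi> i. R (p $ i) n)" and "Q n = (\<chi> i. R (q $ i) n)" for n
    have lim: "(\<lambda>n. real_of_rat (R c n)) \<longlonglongrightarrow> c" for c
    proof (rule tendsto_sandwich[of "\<lambda>_. c" _ _ "\<lambda>n. c + 1 / real (Suc n)"])
      show "(\<lambda>n. c + 1 / real (Suc n)) \<longlonglongrightarrow> c"
        using tendsto_add[OF tendsto_const LIMSEQ_Suc[OF lim_1_over_n], of c] by simp
    qed (use R in \<open>auto intro!: always_eventually less_imp_le\<close>)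
    \<comment> \<open>The corners are approximated from above, within distance one, so this box contains all supports.\<close>
    let ?K = "cbox p (q + (\<chi> i. 1)) :: (real^'n) set"
    have int: "integrable lebesgue (\<lambda>x. indicator ?K x * f x)"
      using f by (simp add: locally_integrable_def set_integrable_def)
    have supp: "box_bump (rat_vec (P n)) (rat_vec (Q n)) m x = box_bump (rat_vec (P n)) (rat_vec (Q n)) m x * indicator ?K x" for n x
    proof -
      have "box (rat_vec (P n)) (rat_vec (Q n)) \<subseteq> ?K"
      proof
        fix x assume "x \<in> box (rat_vec (P n)) (rat_vec (Q n))"
        then have "of_rat (R (p $ i) n) < x $ i" "x $ i < of_rat (R (q $ i) n)" for i
          by (auto simp: mem_box_cart rat_vec_def P_def Q_def)
        moreover have "1 / real (Suc n) \<le> 1" by simp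
        moreover have "p $ i < of_rat (R (p $ i) n)" "of_rat (R (q $ i) n) < q $ i + 1 / real (Suc n)" for i using R by auto
        ultimately show "x \<in> ?K"
          by (simp only: mem_box_cart vector_add_component vec_lambda_beta) (meson add_left_mono le_less_trans less_imp_le less_le_trans order_trans)
      qed
      then show ?thesis using box_bump_nonzero_iff[of "rat_vec (P n)" "rat_vec (Q n)" m x] by (auto simp: indicator_def)
    qed
    have "(\<lambda>n. \<integral>x. box_bump (rat_vec (P n)) (rat_vec (Q n)) m x * f x \<partial>lebesgue) \<longlonglongrightarrow> (\<integral>x. box_bump p q m x * f x \<partial>lebesgue)"
    proof (rule integral_dominated_convergence[where w="\<lambda>x. \<bar>indicator ?K x * f x\<bar>"])
      show "integrable lebesgue (\<lambda>x. \<bar>indicator ?K x * f x\<bar>)" using int by (rule integrable_abs)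
      show "AE x in lebesgue. (\<lambda>n. box_bump (rat_vec (P n)) (rat_vec (Q n)) m x * f x) \<longlonglongrightarrow> box_bump p q m x * f x"
        unfolding box_bump_def rat_vec_def P_def Q_def
        by (intro AE_I2 tendsto_mult tendsto_prod flat_tendsto tendsto_diff tendsto_const) (simp_all add: lim)
      show "AE x in lebesgue. norm (box_bump (rat_vec (P n)) (rat_vec (Q n)) m x * f x) \<le> \<bar>indicator ?K x * f x\<bar>" for n
      proof (intro AE_I2)
        fix x
        have "norm (box_bump (rat_vec (P n)) (rat_vec (Q n)) m x * f x) = box_bump (rat_vec (P n)) (rat_vec (Q n)) m x * \<bar>indicator ?K x * f x\<bar>"
          using box_bump_bounds(1)[of "rat_vec (P n)" "rat_vec (Q n)" m x] by (subst supp) (simp add: abs_mult)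
        also have "\<dots> \<le> \<bar>indicator ?K x * f x\<bar>"
          using box_bump_bounds[of "rat_vec (P n)" "rat_vec (Q n)" m x] by (intro mult_left_le_one_le) auto
        finally show "norm (box_bump (rat_vec (P n)) (rat_vec (Q n)) m x * f x) \<le> \<bar>indicator ?K x * f x\<bar>" .
      qed
      have m: "integrable lebesgue (\<lambda>x. box_bump p' q' m x *\<^sub>R f x)" for p' q'
        by (rule integrable_test_function(1)[OF test_function_box_bump f]) simp
      show "(\<lambda>x. box_bump p q m x * f x) \<in> borel_measurable lebesgue" using m[of p q] by auto
      show "(\<lambda>x. box_bump (rat_vec (P n)) (rat_vec (Q n)) m x * f x) \<in> borel_measurable lebesgue" for n using m by auto
    qed
    then show ?thesis using orth[of "(P _, Q _, m)"] by (simp add: bump_of_def LIMSEQ_const_iff)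
  qed
  then show ?thesis using orthogonal_to_bumps_imp_AE_zero[OF open_UNIV f] by simp
qed

section \<open>The weighted measure and the two-scale product measure\<close>

definition weighted :: "(real^'n \<Rightarrow> real) \<Rightarrow> (real^'n) measure"
  where "weighted \<rho> = density lebesgue (\<lambda>x. ennreal (\<rho> x))"

lemma sets_weighted [measurable_cong, simp]: "sets (weighted \<rho>) = sets lebesgue"
  by (simp add: weighted_def)
lemma space_weighted [simp]: "space (weighted \<rho>) = UNIV"
  by (simp add: weighted_def)
lemma measurable_weighted [simp]: "f \<in> borel_measurable (weighted \<rho>) \<longleftrightarrow> f \<in> borel_measurable lebesgue"
  by (simp cong: measurable_cong_sets)

lemma sets_two_scale_product:
  "sets (weighted \<rho> \<Otimes>\<^sub>M cellm L) = sets (lebesgue \<Otimes>\<^sub>M lebesgue)"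
  by (intro sets_pair_measure_cong) simp_all

lemma measurable_two_scale_product [simp]:
  "f \<in> borel_measurable (weighted \<rho> \<Otimes>\<^sub>M cellm L) \<longleftrightarrow> f \<in> borel_measurable (lebesgue \<Otimes>\<^sub>M lebesgue)"
  using sets_two_scale_product by (simp cong: measurable_cong_sets)

lemma bounded_sqint:
  assumes "finite_measure M" "f \<in> borel_measurable M" "\<And>x. norm (f x) \<le> B"
  shows "sqint M f"
proof -
  interpret finite_measure M by fact
  have "integrable M (\<lambda>x. (norm (f x))\<^sup>2)"
    using assms by (intro integrable_const_bound[of _ "B\<^sup>2"] AE_I2) (auto intro!: power_mono)
  then show ?thesis using assms by (simp add: sqint_def)
qed

text \<open>A function of the first variable alone has the same integral over the product with a probability
  measure.\<close>

lemma distr_pair_fst_prob: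
  assumes "sigma_finite_measure M" "finite_measure P" "measure P (space P) = 1"
  shows "distr (M \<Otimes>\<^sub>M P) M fst = M"
proof (rule measure_eqI)
  interpret P: finite_measure P by fact
  fix A assume "A \<in> sets (distr (M \<Otimes>\<^sub>M P) M fst)"
  then have A: "A \<in> sets M" by simp
  have "fst -` A \<inter> space (M \<Otimes>\<^sub>M P) = A \<times> space P"
    using sets.sets_into_space[OF A] by (auto simp: space_pair_measure)
  then show "emeasure (distr (M \<Otimes>\<^sub>M P) M fst) A = emeasure M A"
    using A assms(3) by (simp add: emeasure_distr P.emeasure_pair_measure_Times P.emeasure_eq_measure)
qed simp

text \<open>Positivity of the weight makes its null sets the Lebesgue null sets and allows division by it;
  smoothness makes \<open>\<zeta> \<rho>\<close> a test function whenever \<open>\<zeta>\<close> is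
  one.\<close>

locale two_scale =
  fixes L :: real and \<rho> :: "real^'n \<Rightarrow> real" and \<epsilon> :: "nat \<Rightarrow> real"
  assumes L: "L > 0" and smooth_\<rho>: "smooth \<rho>" and \<rho>_pos: "\<And>x. \<rho> x > 0" and \<rho>_int: "integrable lebesgue \<rho>"
    and \<epsilon>_pos: "\<And>n. \<epsilon> n > 0" and \<epsilon>_lim: "\<epsilon> \<longlonglongrightarrow> 0"
begin

abbreviation "\<mu> \<equiv> weighted \<rho>"
abbreviation "\<nu> \<equiv> cellm L :: (real^'n) measure"
abbreviation "N \<equiv> \<mu> \<Otimes>\<^sub>M \<nu>"

lemma \<rho>_measurable: "\<rho> \<in> borel_measurable lebesgue"
  using \<rho>_int by auto

lemma \<rho>_nonneg: "0 \<le> \<rho> x"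
  using \<rho>_pos[of x] by simp

lemma integral_\<mu>:
  fixes f :: "real^'n \<Rightarrow> 'b::euclidean_space"
  assumes "f \<in> borel_measurable lebesgue"
  shows "(\<integral>x. f x \<partial>\<mu>) = (\<integral>x. \<rho> x *\<^sub>R f x \<partial>lebesgue)" "integrable \<mu> f \<longleftrightarrow> integrable lebesgue (\<lambda>x. \<rho> x *\<^sub>R f x)"
  unfolding weighted_def using assms \<rho>_measurable \<rho>_nonneg
  by (simp_all add: integral_density integrable_density)

lemma AE_\<mu>: "(AE x in \<mu>. P x) \<longleftrightarrow> (AE x in lebesgue. P x)"
  unfolding weighted_def using \<rho>_measurable \<rho>_pos by (subst AE_density) auto

lemma sqint_\<mu>_iff:
  fixes f :: "real^'n \<Rightarrow> 'b::euclidean_space"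
  shows "sqint \<mu> f \<longleftrightarrow> f \<in> borel_measurable lebesgue \<and> integrable lebesgue (\<lambda>x. (norm (f x))\<^sup>2 * \<rho> x)"
  unfolding sqint_def using integral_\<mu>(2)[of "\<lambda>x. (norm (f x))\<^sup>2"] by (auto simp: mult.commute)

lemma finite_\<mu>: "finite_measure \<mu>"
proof (rule finite_measureI)
  have "emeasure \<mu> (space \<mu>) = (\<integral>\<^sup>+x. ennreal (\<rho> x) \<partial>lebesgue)"
    unfolding weighted_def using \<rho>_measurable by (simp add: emeasure_density)
  also have "\<dots> < \<infinity>" using \<rho>_int \<rho>_nonneg by (simp add: integrable_iff_bounded)
  finally show "emeasure \<mu> (space \<mu>) \<noteq> \<infinity>" by simp
qed

sublocale M: finite_measure \<mu> by (rule finite_\<mu>)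
sublocale C: finite_measure \<nu> by (rule finite_measure_cellm[OF L])
sublocale P: pair_sigma_finite \<mu> \<nu> ..

lemma integral_N_fst:
  fixes f :: "real^'n \<Rightarrow> 'b::euclidean_space"
  assumes "f \<in> borel_measurable lebesgue"
  shows "(\<integral>z. f (fst z) \<partial>N) = (\<integral>x. f x \<partial>\<mu>)" "integrable N (\<lambda>z. f (fst z)) \<longleftrightarrow> integrable \<mu> f"
proof -
  have d: "distr N \<mu> fst = \<mu>"
    using finite_measure_cellm[OF L, where 'n='n] M.sigma_finite_measure_axioms by (intro distr_pair_fst_prob) auto
  show "(\<integral>z. f (fst z) \<partial>N) = (\<integral>x. f x \<partial>\<mu>)"
    using integral_distr[of fst N \<mu> f] assms unfolding d by simp
  show "integrable N (\<lambda>z. f (fst z)) \<longleftrightarrow> integrable \<mu> f"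
    using integrable_distr_eq[of fst N \<mu> f] assms unfolding d by simp
qed

lemma measurable_fst_N: "f \<in> borel_measurable lebesgue \<Longrightarrow> (\<lambda>z. f (fst z)) \<in> borel_measurable (lebesgue \<Otimes>\<^sub>M lebesgue)"
  by (rule measurable_compose[OF measurable_fst])
lemma measurable_snd_N: "f \<in> borel_measurable lebesgue \<Longrightarrow> (\<lambda>z. f (snd z)) \<in> borel_measurable (lebesgue \<Otimes>\<^sub>M lebesgue)"
  by (rule measurable_compose[OF measurable_snd])

lemma sqint_N_fst:
  fixes f :: "real^'n \<Rightarrow> 'b::euclidean_space"
  assumes "sqint \<mu> f"
  shows "sqint N (\<lambda>z. f (fst z))" "l2norm N (\<lambda>z. f (fst z)) = l2norm \<mu> f"
proof -
  have m: "f \<in> borel_measurable lebesgue" using sqint_measurable[OF assms] by simp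
  then have m2: "(\<lambda>x. (norm (f x))\<^sup>2) \<in> borel_measurable lebesgue" by measurable
  show "sqint N (\<lambda>z. f (fst z))"
    using integral_N_fst(2)[OF m2] sqint_integrable_sq[OF assms] measurable_fst_N[OF m] by (simp add: sqint_def)
  show "l2norm N (\<lambda>z. f (fst z)) = l2norm \<mu> f"
    using integral_N_fst(1)[OF m2] by (simp add: l2norm_def)
qed

lemma sqint_continuous_compact_support:
  fixes f :: "real^'n \<Rightarrow> 'b::euclidean_space"
  assumes "continuous_on UNIV f" "compact K" "\<And>x. x \<notin> K \<Longrightarrow> f x = 0"
  shows "sqint \<mu> f"
proof -
  obtain B where "\<And>x. norm (f x) \<le> B" using continuous_compact_support_bounded[OF assms] by blast
  then show ?thesis using measurable_lebesgue_continuous[OF assms(1)] by (intro bounded_sqint finite_\<mu>) auto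
qed

lemma sqint_test_function: "test_function UNIV \<zeta> \<Longrightarrow> sqint \<mu> \<zeta>"
  using test_functionE(4)[of UNIV \<zeta>] smooth_continuous[OF test_functionE(1)[of UNIV \<zeta>]]
  by (metis sqint_continuous_compact_support)

lemma wave_measurable: "(\<lambda>x. wave \<kappa> j (x /\<^sub>R e)) \<in> borel_measurable lebesgue"
  unfolding wave_scale by (intro measurable_lebesgue_continuous smooth_continuous smooth_wave)

lemma sqint_mult_bounded:
  assumes "sqint M f" "h \<in> borel_measurable M" "\<And>x. \<bar>h x\<bar> \<le> 1"
  shows "sqint M (\<lambda>x. f x * h x :: real)" "l2norm M (\<lambda>x. f x * h x) \<le> l2norm M f"
proof -
  have b: "norm (f x * h x) \<le> 1 * norm (f x)" for x
    using mult_right_le_one_le[of "\<bar>f x\<bar>" "\<bar>h x\<bar>"] assms(3)[of x] by (simp add: abs_mult)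
  have [measurable]: "f \<in> borel_measurable M" "h \<in> borel_measurable M" using assms by auto
  show s: "sqint M (\<lambda>x. f x * h x)" by (rule sqint_bound[OF assms(1), of _ 1]) (use b in auto)
  show "l2norm M (\<lambda>x. f x * h x) \<le> l2norm M f" by (rule l2norm_mono[OF s assms(1)]) (use b in auto)
qed

lemma sqint_mult_wave:
  assumes "sqint \<mu> f" shows "sqint \<mu> (\<lambda>x. f x * wave \<kappa> j (x /\<^sub>R e))" "l2norm \<mu> (\<lambda>x. f x * wave \<kappa> j (x /\<^sub>R e)) \<le> l2norm \<mu> f"
proof -
  have m: "(\<lambda>x. wave \<kappa> j (x /\<^sub>R e)) \<in> borel_measurable \<mu>" using wave_measurable by simp
  show "sqint \<mu> (\<lambda>x. f x * wave \<kappa> j (x /\<^sub>R e))" "l2norm \<mu> (\<lambda>x. f x * wave \<kappa> j (x /\<^sub>R e)) \<le> l2norm \<mu> f"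
    by (rule sqint_mult_bounded[OF assms m abs_wave_le])+
qed

text \<open>The Riesz representative \<open>w\<close> of the functional of \<open>f\<close> on the span of the
  bumps is the projection of \<open>f\<close> to the closure of the span. The difference of \<open>w\<close>
  and \<open>f\<close> is orthogonal to all rational bumps, hence zero.\<close>

lemma bump_density:
  assumes f: "sqint \<mu> f"
  obtains m c where "(\<lambda>n::nat. l2norm \<mu> (\<lambda>x. (\<Sum>i<m n. c n i * bump_of (from_nat i) x) - f x)) \<longlonglongrightarrow> (0::real)"
proof -
  let ?G = "\<lambda>i. bump_of (from_nat i) :: real^'n \<Rightarrow> real"
  have G: "sqint \<mu> (?G i)" for i by (rule sqint_test_function[OF test_function_bump_of])
  have "\<bar>\<Sum>i<m. c i * (\<integral>x. f x \<bullet> ?G i x \<partial>\<mu>)\<bar> \<le> l2norm \<mu> f * l2norm \<mu> (\<lambda>x. \<Sum>i<m. c i *\<^sub>R ?G i x)" for m c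
  proof -
    have "(\<Sum>i<m. c i * (\<integral>x. f x \<bullet> ?G i x \<partial>\<mu>)) = (\<integral>x. f x \<bullet> (\<Sum>i<m. c i *\<^sub>R ?G i x) \<partial>\<mu>)"
      using sqint_integrable_inner[OF f G] by (simp add: inner_sum_right sum_distrib_left mult.left_commute Bochner_Integration.integral_sum)
    moreover have "\<bar>\<integral>x. f x \<bullet> (\<Sum>i<m. c i *\<^sub>R ?G i x) \<partial>\<mu>\<bar> \<le> l2norm \<mu> f * l2norm \<mu> (\<lambda>x. \<Sum>i<m. c i *\<^sub>R ?G i x)"
      by (intro l2_Cauchy_Schwarz f sqint_sum sqint_scaleR G)
    ultimately show ?thesis by simp
  qed
  note bound = this
  obtain w m c where w: "sqint \<mu> w" "\<And>i. (\<integral>x. w x \<bullet> ?G i x \<partial>\<mu>) = (\<integral>x. f x \<bullet> ?G i x \<partial>\<mu>)"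
    and lim: "(\<lambda>n::nat. l2norm \<mu> (\<lambda>x. (\<Sum>i<m n. c n i *\<^sub>R ?G i x) - w x)) \<longlonglongrightarrow> 0"
    by (rule l2_riesz_span[OF G bound]) blast
  have "AE x in lebesgue. \<rho> x * (w x - f x) = 0"
  proof (rule orthogonal_to_rational_bumps_imp_AE_zero)
    have d: "sqint \<mu> (\<lambda>x. w x - f x)" by (intro sqint_diff w f)
    have i: "integrable lebesgue (\<lambda>x. \<rho> x * (w x - f x))"
      using integral_\<mu>(2)[of "\<lambda>x. w x - f x"] finite_sqint_integrable[OF finite_\<mu> d] sqint_measurable[OF d] by simp
    show "locally_integrable UNIV (\<lambda>x. \<rho> x * (w x - f x))"
      unfolding locally_integrable_def
    proof (intro allI impI)
      fix K :: "(real^'n) set" assume "compact K \<and> K \<subseteq> UNIV"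
      then have "K \<in> sets lebesgue" by (simp add: compact_imp_closed)
      then show "set_integrable lebesgue K (\<lambda>x. \<rho> x * (w x - f x))"
        unfolding set_integrable_def using i by (rule integrable_mult_indicator)
    qed
    fix b :: "(rat^'n) \<times> (rat^'n) \<times> nat"
    obtain i :: nat where b: "b = from_nat i" using from_nat_to_nat[of b] by metis
    have m: "(\<lambda>x. (w x - f x) * ?G i x) \<in> borel_measurable lebesgue"
      using sqint_measurable[OF d] sqint_measurable[OF G[of i]] by simp
    have "(\<integral>x. (w x - f x) * ?G i x \<partial>\<mu>) = 0"
      using w(2)[of i] sqint_integrable_inner[OF f G, of i] sqint_integrable_inner[OF w(1) G, of i] by (simp add: left_diff_distrib)
    then show "(\<integral>x. bump_of b x * (\<rho> x * (w x - f x)) \<partial>lebesgue) = 0"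
      unfolding integral_\<mu>(1)[OF m] b by (simp add: algebra_simps)
  qed
  then have ae: "AE x in \<mu>. w x = f x" unfolding AE_\<mu> by eventually_elim (use \<rho>_pos in \<open>auto simp: less_le\<close>)
  have "l2norm \<mu> (\<lambda>x. (\<Sum>i<m n. c n i *\<^sub>R ?G i x) - w x) = l2norm \<mu> (\<lambda>x. (\<Sum>i<m n. c n i *\<^sub>R ?G i x) - f x)" for n
  proof (rule l2norm_sqint_AE_cong(1))
    show "AE x in \<mu>. (\<Sum>i<m n. c n i *\<^sub>R ?G i x) - w x = (\<Sum>i<m n. c n i *\<^sub>R ?G i x) - f x"
      using ae by eventually_elim simp
    show "sqint \<mu> (\<lambda>x. (\<Sum>i<m n. c n i *\<^sub>R ?G i x) - w x)" by (intro sqint_diff sqint_sum sqint_scaleR G w)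
    show "(\<lambda>x. (\<Sum>i<m n. c n i *\<^sub>R ?G i x) - f x) \<in> borel_measurable \<mu>"
      by (intro sqint_measurable sqint_diff sqint_sum sqint_scaleR G f)
  qed
  then show thesis using that lim by simp
qed

text \<open>What remains when the derivative of a weighted test function falls on \<open>\<zeta>
  \<rho>\<close>, written as a density with respect to the weight.\<close>

definition log_derivative :: "(real^'n \<Rightarrow> real) \<Rightarrow> real^'n \<Rightarrow> real^'n \<Rightarrow> real"
  where "log_derivative \<zeta> v x = (grad (\<lambda>x. \<zeta> x * \<rho> x) x \<bullet> v) / \<rho> x"

lemma sqint_log_derivative:
  assumes "test_function UNIV \<zeta>" shows "sqint \<mu> (log_derivative \<zeta> v)"
proof -
  have t: "test_function UNIV (\<lambda>x. \<zeta> x * \<rho> x)" by (rule test_function_mult[OF assms smooth_\<rho>])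
  obtain K where K: "compact K" "\<And>x. x \<notin> K \<Longrightarrow> grad (\<lambda>x. \<zeta> x * \<rho> x) x = 0" using test_functionE(4)[OF t] by blast
  have "\<rho> x \<noteq> 0" for x using \<rho>_pos[of x] by simp
  then have "continuous_on UNIV (log_derivative \<zeta> v)"
    unfolding log_derivative_def[abs_def]
    by (intro continuous_intros smooth_grad_continuous[OF test_functionE(1)[OF t]] smooth_continuous[OF smooth_\<rho>]) auto
  then show ?thesis by (rule sqint_continuous_compact_support[OF _ K(1)]) (simp add: log_derivative_def K(2))
qed

text \<open>With \<open>v\<close> parallel to the frequency this trades an oscillation for a derivative; with
  \<open>v\<close> orthogonal to it the last term is absent.\<close>

lemma oscillating_integration_by_parts:
  assumes w: "has_weak_gradient UNIV u g" and u: "sqint \<mu> u" and g: "sqint \<mu> g" and \<zeta>: "test_function UNIV \<zeta>"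
  shows "(\<integral>x. (g x \<bullet> v) * (\<zeta> x * wave \<kappa> j x) \<partial>\<mu>) =
    - (\<integral>x. u x * (log_derivative \<zeta> v x * wave \<kappa> j x) \<partial>\<mu>) - (\<kappa> \<bullet> v) * (\<integral>x. u x * (\<zeta> x * wave \<kappa> (j + 1) x) \<partial>\<mu>)"
proof -
  define Z where "Z x = (\<zeta> x * \<rho> x) * wave \<kappa> j x" for x
  have t0: "test_function UNIV (\<lambda>x. \<zeta> x * \<rho> x)" by (rule test_function_mult[OF \<zeta> smooth_\<rho>])
  have t: "test_function UNIV Z" unfolding Z_def[abs_def] by (rule test_function_mult[OF t0 smooth_wave])
  have gZ: "grad Z x = wave \<kappa> j x *\<^sub>R grad (\<lambda>x. \<zeta> x * \<rho> x) x + (\<zeta> x * \<rho> x * wave \<kappa> (j + 1) x) *\<^sub>R \<kappa>" for x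
    unfolding Z_def[abs_def]
    using grad_mult[OF smooth_differentiable[OF test_functionE(1)[OF t0]] smooth_differentiable[OF smooth_wave]]
    by (simp add: grad_wave)
  have loc: "locally_integrable UNIV u" "locally_integrable UNIV g" using w by (auto simp: has_weak_gradient_def)
  have i1: "integrable lebesgue (\<lambda>x. u x * grad Z x $ i)" for i
    using integrable_test_function(2)[OF t loc(1), of i] by (simp add: mult.commute)
  have i2: "integrable lebesgue (\<lambda>x. Z x * g x $ i)" for i
    using integrable_test_function(1)[OF t locally_integrable_component[OF loc(2)], of i] by simp
  have "(\<integral>x. u x * (grad Z x \<bullet> v) \<partial>lebesgue) = (\<Sum>i\<in>UNIV. v $ i * (\<integral>x. u x * grad Z x $ i \<partial>lebesgue))"
  proof -
    have "u x * (grad Z x \<bullet> v) = (\<Sum>i\<in>UNIV. v $ i * (u x * grad Z x $ i))" for x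
      by (simp add: inner_vec_def sum_distrib_left algebra_simps)
    then show ?thesis using i1 by (simp add: Bochner_Integration.integral_sum)
  qed
  also have "\<dots> = - (\<Sum>i\<in>UNIV. v $ i * (\<integral>x. Z x * g x $ i \<partial>lebesgue))"
    using w t unfolding has_weak_gradient_iff by (simp add: sum_negf)
  also have "(\<Sum>i\<in>UNIV. v $ i * (\<integral>x. Z x * g x $ i \<partial>lebesgue)) = (\<integral>x. Z x * (g x \<bullet> v) \<partial>lebesgue)"
  proof -
    have "Z x * (g x \<bullet> v) = (\<Sum>i\<in>UNIV. v $ i * (Z x * g x $ i))" for x
      by (simp add: inner_vec_def sum_distrib_left algebra_simps)
    then show ?thesis using i2 by (simp add: Bochner_Integration.integral_sum)
  qed
  finally have main: "(\<integral>x. u x * (grad Z x \<bullet> v) \<partial>lebesgue) = - (\<integral>x. Z x * (g x \<bullet> v) \<partial>lebesgue)" .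
  have wm: "wave \<kappa> k \<in> borel_measurable \<mu>" for k
    using measurable_lebesgue_continuous[OF smooth_continuous[OF smooth_wave]] by simp
  have sz: "sqint \<mu> (\<lambda>x. \<zeta> x * wave \<kappa> k x)" for k
    by (rule sqint_mult_bounded(1)[OF sqint_test_function[OF \<zeta>] wm abs_wave_le])
  have sl: "sqint \<mu> (\<lambda>x. log_derivative \<zeta> v x * wave \<kappa> k x)" for k
    by (rule sqint_mult_bounded(1)[OF sqint_log_derivative[OF \<zeta>] wm abs_wave_le])
  have j1: "integrable \<mu> (\<lambda>x. u x * (log_derivative \<zeta> v x * wave \<kappa> j x))" "integrable \<mu> (\<lambda>x. u x * (\<zeta> x * wave \<kappa> (j + 1) x))"
    by (intro sqint_integrable_mult u sz sl)+
  have mg: "(\<lambda>x. (g x \<bullet> v) * (\<zeta> x * wave \<kappa> j x)) \<in> borel_measurable lebesgue"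
    using sqint_measurable[OF sqint_inner_right[OF g, of v]] sqint_measurable[OF sz[of j]] by simp
  have "(\<integral>x. (g x \<bullet> v) * (\<zeta> x * wave \<kappa> j x) \<partial>\<mu>) = (\<integral>x. Z x * (g x \<bullet> v) \<partial>lebesgue)"
    unfolding integral_\<mu>(1)[OF mg] by (simp add: Z_def algebra_simps)
  moreover have "(\<integral>x. u x * (log_derivative \<zeta> v x * wave \<kappa> j x) + (\<kappa> \<bullet> v) * (u x * (\<zeta> x * wave \<kappa> (j + 1) x)) \<partial>\<mu>) = (\<integral>x. u x * (grad Z x \<bullet> v) \<partial>lebesgue)"
  proof -
    have m: "(\<lambda>x. u x * (log_derivative \<zeta> v x * wave \<kappa> j x) + (\<kappa> \<bullet> v) * (u x * (\<zeta> x * wave \<kappa> (j + 1) x))) \<in> borel_measurable lebesgue"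
      using j1 by auto
    have "\<rho> x *\<^sub>R (u x * (log_derivative \<zeta> v x * wave \<kappa> j x) + (\<kappa> \<bullet> v) * (u x * (\<zeta> x * wave \<kappa> (j + 1) x))) = u x * (grad Z x \<bullet> v)" for x
      using \<rho>_pos[of x] by (simp add: gZ log_derivative_def inner_add_left field_simps)
    then show ?thesis unfolding integral_\<mu>(1)[OF m] by simp
  qed
  ultimately show ?thesis using main j1 by simp
qed

text \<open>Integration by parts along \<open>\<kappa>\<close>, with the frequency \<open>\<kappa> /
  \<epsilon> n\<close>, puts the factor \<open>(norm \<kappa>)\<^sup>2 / \<epsilon> n\<close> in front of the
  integral, while the other terms stay bounded.\<close>

lemma oscillation_vanishes:
  assumes w: "\<And>n. has_weak_gradient UNIV (u n) (g n)" and u: "\<And>n. sqint \<mu> (u n)" "\<And>n. l2norm \<mu> (u n) \<le> C"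
    and g: "\<And>n. sqint \<mu> (g n)" "\<And>n. l2norm \<mu> (g n) \<le> D" and \<zeta>: "test_function UNIV \<zeta>" and \<kappa>: "\<kappa> \<noteq> 0"
  shows "(\<lambda>n. \<integral>x. u n x * (\<zeta> x * wave \<kappa> j (x /\<^sub>R \<epsilon> n)) \<partial>\<mu>) \<longlonglongrightarrow> 0"
proof -
  define K where "K = (norm \<kappa> * D * l2norm \<mu> \<zeta> + C * l2norm \<mu> (log_derivative \<zeta> \<kappa>)) / (norm \<kappa>)\<^sup>2"
  have n\<kappa>: "norm \<kappa> > 0" using \<kappa> by simp
  have "norm (\<integral>x. u n x * (\<zeta> x * wave \<kappa> j (x /\<^sub>R \<epsilon> n)) \<partial>\<mu>) \<le> \<epsilon> n * K" for n
  proof -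
    let ?I = "\<integral>x. u n x * (\<zeta> x * wave \<kappa> j (x /\<^sub>R \<epsilon> n)) \<partial>\<mu>"
    \<comment> \<open>The phase is \<open>j - 1\<close> because differentiating the wave raises it by one.\<close>
    let ?A = "\<integral>x. (g n x \<bullet> \<kappa>) * (\<zeta> x * wave \<kappa> (j - 1) (x /\<^sub>R \<epsilon> n)) \<partial>\<mu>"
    let ?B = "\<integral>x. u n x * (log_derivative \<zeta> \<kappa> x * wave \<kappa> (j - 1) (x /\<^sub>R \<epsilon> n)) \<partial>\<mu>"
    have "?A = - ?B - ((\<kappa> /\<^sub>R \<epsilon> n) \<bullet> \<kappa>) * ?I"
      using oscillating_integration_by_parts[OF w[of n] u(1) g(1) \<zeta>, of \<kappa> "\<kappa> /\<^sub>R \<epsilon> n" "j - 1"] by (simp add: wave_scale)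
    then have eq: "((norm \<kappa>)\<^sup>2 / \<epsilon> n) * ?I = - ?A - ?B"
      by (simp add: dot_square_norm divide_inverse mult.commute)
    have "\<bar>?A\<bar> \<le> (norm \<kappa> * D) * l2norm \<mu> \<zeta>"
    proof -
      have "\<bar>?A\<bar> \<le> l2norm \<mu> (\<lambda>x. g n x \<bullet> \<kappa>) * l2norm \<mu> (\<lambda>x. \<zeta> x * wave \<kappa> (j - 1) (x /\<^sub>R \<epsilon> n))"
        using l2_Cauchy_Schwarz[OF sqint_inner_right[OF g(1)] sqint_mult_wave(1)[OF sqint_test_function[OF \<zeta>]]] by simp
      also have "\<dots> \<le> (norm \<kappa> * D) * l2norm \<mu> \<zeta>"
      proof (rule mult_mono)
        have "l2norm \<mu> (\<lambda>x. g n x \<bullet> \<kappa>) \<le> l2norm \<mu> (\<lambda>x. norm \<kappa> *\<^sub>R g n x)"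
          using Cauchy_Schwarz_ineq2[of "g n _" \<kappa>]
          by (intro l2norm_mono sqint_inner_right sqint_scaleR g AE_I2) (simp add: mult.commute)
        also have "\<dots> \<le> norm \<kappa> * D" using g(2)[of n] by (simp add: l2norm_scaleR mult_left_mono)
        finally show "l2norm \<mu> (\<lambda>x. g n x \<bullet> \<kappa>) \<le> norm \<kappa> * D" .
        then show "0 \<le> norm \<kappa> * D" using l2norm_nonneg order_trans by blast
      qed (auto intro: sqint_mult_wave(2) sqint_test_function \<zeta>)
      finally show ?thesis .
    qed
    moreover have "\<bar>?B\<bar> \<le> C * l2norm \<mu> (log_derivative \<zeta> \<kappa>)"
    proof -
      have "\<bar>?B\<bar> \<le> l2norm \<mu> (u n) * l2norm \<mu> (\<lambda>x. log_derivative \<zeta> \<kappa> x * wave \<kappa> (j - 1) (x /\<^sub>R \<epsilon> n))"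
        using l2_Cauchy_Schwarz[OF u(1) sqint_mult_wave(1)[OF sqint_log_derivative[OF \<zeta>]]] by simp
      also have "\<dots> \<le> C * l2norm \<mu> (log_derivative \<zeta> \<kappa>)"
        using order_trans[OF l2norm_nonneg u(2)] by (intro mult_mono u sqint_mult_wave(2) sqint_log_derivative \<zeta>) auto
      finally show ?thesis .
    qed
    ultimately have "\<bar>((norm \<kappa>)\<^sup>2 / \<epsilon> n) * ?I\<bar> \<le> norm \<kappa> * D * l2norm \<mu> \<zeta> + C * l2norm \<mu> (log_derivative \<zeta> \<kappa>)"
      unfolding eq by linarith
    then have "((norm \<kappa>)\<^sup>2 / \<epsilon> n) * \<bar>?I\<bar> \<le> norm \<kappa> * D * l2norm \<mu> \<zeta> + C * l2norm \<mu> (log_derivative \<zeta> \<kappa>)"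
      using \<epsilon>_pos[of n] by (simp add: abs_mult)
    then show ?thesis using \<epsilon>_pos[of n] n\<kappa> unfolding K_def by (simp add: field_simps)
  qed
  moreover have "(\<lambda>n. \<epsilon> n * K) \<longlonglongrightarrow> 0" using tendsto_mult_right[OF \<epsilon>_lim, of K] by simp
  ultimately show ?thesis by (rule Lim_null_comparison[OF always_eventually[OF allI]])
qed

end

section \<open>Enlarging the class of oscillating test functions\<close>

locale two_scale_seq = two_scale L \<rho> \<epsilon>
  for L :: real and \<rho> :: "real^'n \<Rightarrow> real" and \<epsilon> :: "nat \<Rightarrow> real" +
  fixes u :: "nat \<Rightarrow> real^'n \<Rightarrow> real" and u0 :: "(real^'n) \<times> (real^'n) \<Rightarrow> real" and B :: real
  assumes u: "\<And>n. sqint \<mu> (u n)" "\<And>n. l2norm \<mu> (u n) \<le> B" and u0: "sqint N u0"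
begin

text \<open>Domination by a function \<open>s\<close> of the slow variable alone controls the norm of
  \<open>\<psi>(x, x / \<epsilon>)\<close> uniformly in \<open>\<epsilon>\<close> and that of
  \<open>\<psi>\<close> on the product, as \<open>admissible_sqint\<close> shows.\<close>

definition admissible :: "(real^'n \<Rightarrow> real^'n \<Rightarrow> real) \<Rightarrow> bool"
  where "admissible \<psi> \<longleftrightarrow> (\<forall>n. (\<lambda>x. \<psi> x (x /\<^sub>R \<epsilon> n)) \<in> borel_measurable lebesgue) \<and>
    (\<lambda>(x, y). \<psi> x y) \<in> borel_measurable (lebesgue \<Otimes>\<^sub>M lebesgue) \<and> (\<exists>s. sqint \<mu> s \<and> (\<forall>x y. \<bar>\<psi> x y\<bar> \<le> s x))"

definition tested :: "(real^'n \<Rightarrow> real^'n \<Rightarrow> real) \<Rightarrow> bool"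
  where "tested \<psi> \<longleftrightarrow> admissible \<psi> \<and>
    (\<lambda>n. \<integral>x. u n x * \<psi> x (x /\<^sub>R \<epsilon> n) \<partial>\<mu>) \<longlonglongrightarrow> (\<integral>z. u0 z * \<psi> (fst z) (snd z) \<partial>N)"

lemma admissible_sqint:
  fixes \<psi> :: "real^'n \<Rightarrow> real^'n \<Rightarrow> real"
  assumes m: "(\<lambda>x. \<psi> x (x /\<^sub>R \<epsilon> n)) \<in> borel_measurable lebesgue" "(\<lambda>(x, y). \<psi> x y) \<in> borel_measurable (lebesgue \<Otimes>\<^sub>M lebesgue)"
    and s: "sqint \<mu> s" "\<And>x y. \<bar>\<psi> x y\<bar> \<le> s x"
  shows "sqint \<mu> (\<lambda>x. \<psi> x (x /\<^sub>R \<epsilon> n))" "sqint N (\<lambda>z. \<psi> (fst z) (snd z))"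
    "l2norm \<mu> (\<lambda>x. \<psi> x (x /\<^sub>R \<epsilon> n)) \<le> l2norm \<mu> s" "l2norm N (\<lambda>z. \<psi> (fst z) (snd z)) \<le> l2norm \<mu> s"
proof -
  have b: "\<bar>\<psi> x y\<bar> \<le> \<bar>s x\<bar>" for x y by (rule order_trans[OF s(2) abs_ge_self])
  have m2: "(\<lambda>z. \<psi> (fst z) (snd z)) \<in> borel_measurable N" using m(2) by (simp add: case_prod_beta')
  show s1: "sqint \<mu> (\<lambda>x. \<psi> x (x /\<^sub>R \<epsilon> n))" by (rule sqint_bound[OF s(1), of _ 1]) (use m(1) b in auto)
  show s2: "sqint N (\<lambda>z. \<psi> (fst z) (snd z))" by (rule sqint_bound[OF sqint_N_fst(1)[OF s(1)] m2, of 1]) (use b in auto)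
  show "l2norm \<mu> (\<lambda>x. \<psi> x (x /\<^sub>R \<epsilon> n)) \<le> l2norm \<mu> s" by (rule l2norm_mono[OF s1 s(1)]) (use b in auto)
  show "l2norm N (\<lambda>z. \<psi> (fst z) (snd z)) \<le> l2norm \<mu> s"
    unfolding sqint_N_fst(2)[OF s(1), symmetric] by (rule l2norm_mono[OF s2 sqint_N_fst(1)[OF s(1)]]) (use b in auto)
qed

lemma admissible_sqint':
  assumes "admissible \<psi>" shows "sqint \<mu> (\<lambda>x. \<psi> x (x /\<^sub>R \<epsilon> n))" "sqint N (\<lambda>z. \<psi> (fst z) (snd z))"
  using assms admissible_sqint(1,2) unfolding admissible_def by blast+

lemma admissible_lin:
  assumes "admissible \<psi>" "admissible \<theta>" shows "admissible (\<lambda>x y. a * \<psi> x y + b * \<theta> x y)"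
proof -
  obtain s t where st: "sqint \<mu> s" "\<And>x y. \<bar>\<psi> x y\<bar> \<le> s x" "sqint \<mu> t" "\<And>x y. \<bar>\<theta> x y\<bar> \<le> t x"
    using assms unfolding admissible_def by blast
  have "sqint \<mu> (\<lambda>x. \<bar>a\<bar> * s x + \<bar>b\<bar> * t x)" by (intro sqint_add sqint_mult st)
  moreover have "\<bar>a * \<psi> x y + b * \<theta> x y\<bar> \<le> \<bar>a\<bar> * s x + \<bar>b\<bar> * t x" for x y
  proof -
    have "\<bar>a * \<psi> x y + b * \<theta> x y\<bar> \<le> \<bar>a\<bar> * \<bar>\<psi> x y\<bar> + \<bar>b\<bar> * \<bar>\<theta> x y\<bar>"
      using abs_triangle_ineq[of "a * \<psi> x y" "b * \<theta> x y"] by (simp add: abs_mult)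
    also have "\<dots> \<le> \<bar>a\<bar> * s x + \<bar>b\<bar> * t x" by (intro add_mono mult_left_mono st) auto
    finally show ?thesis .
  qed
  ultimately show ?thesis using assms unfolding admissible_def case_prod_beta
    by (auto intro!: borel_measurable_add borel_measurable_times)
qed

lemma tested_lin:
  assumes "tested \<psi>" "tested \<theta>" shows "tested (\<lambda>x y. a * \<psi> x y + b * \<theta> x y)"
proof -
  have adm: "admissible \<psi>" "admissible \<theta>" using assms by (auto simp: tested_def)
  have i: "integrable \<mu> (\<lambda>x. u n x * \<psi> x (x /\<^sub>R \<epsilon> n))" "integrable \<mu> (\<lambda>x. u n x * \<theta> x (x /\<^sub>R \<epsilon> n))" for n
    by (intro sqint_integrable_mult u admissible_sqint' adm)+
  have j: "integrable N (\<lambda>z. u0 z * \<psi> (fst z) (snd z))" "integrable N (\<lambda>z. u0 z * \<theta> (fst z) (snd z))"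
    by (intro sqint_integrable_mult u0 admissible_sqint' adm)+
  have 1: "(\<integral>x. u n x * (a * \<psi> x (x /\<^sub>R \<epsilon> n) + b * \<theta> x (x /\<^sub>R \<epsilon> n)) \<partial>\<mu>) =
      a * (\<integral>x. u n x * \<psi> x (x /\<^sub>R \<epsilon> n) \<partial>\<mu>) + b * (\<integral>x. u n x * \<theta> x (x /\<^sub>R \<epsilon> n) \<partial>\<mu>)" for n
  proof -
    have "u n x * (a * \<psi> x (x /\<^sub>R \<epsilon> n) + b * \<theta> x (x /\<^sub>R \<epsilon> n)) = a * (u n x * \<psi> x (x /\<^sub>R \<epsilon> n)) + b * (u n x * \<theta> x (x /\<^sub>R \<epsilon> n))" for x
      by (simp add: algebra_simps)
    then show ?thesis using i by simp
  qed
  have 2: "(\<integral>z. u0 z * (a * \<psi> (fst z) (snd z) + b * \<theta> (fst z) (snd z)) \<partial>N) =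
      a * (\<integral>z. u0 z * \<psi> (fst z) (snd z) \<partial>N) + b * (\<integral>z. u0 z * \<theta> (fst z) (snd z) \<partial>N)"
  proof -
    have "u0 z * (a * \<psi> (fst z) (snd z) + b * \<theta> (fst z) (snd z)) = a * (u0 z * \<psi> (fst z) (snd z)) + b * (u0 z * \<theta> (fst z) (snd z))" for z
      by (simp add: algebra_simps)
    then show ?thesis using j by simp
  qed
  show ?thesis unfolding tested_def 1 2
    using assms admissible_lin[OF adm] by (auto simp: tested_def intro!: tendsto_intros)
qed

lemma tested_zero: "tested (\<lambda>x y. 0)"
  by (auto simp: tested_def admissible_def intro!: exI[of _ "\<lambda>_. 0"] sqint_zero)

lemma tested_sum: "(\<And>i. i \<in> I \<Longrightarrow> tested (\<psi> i)) \<Longrightarrow> tested (\<lambda>x y. \<Sum>i\<in>I. c i * \<psi> i x y)"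
proof (induction I rule: infinite_finite_induct)
  case (insert i I)
  then show ?case using tested_lin[of "\<psi> i" "\<lambda>x y. \<Sum>i\<in>I. c i * \<psi> i x y" "c i" 1] by simp
qed (auto simp: tested_zero)

text \<open>The norm of \<open>s\<close> bounds the error on both sides of the definition of two-scale
  convergence, uniformly in \<open>n\<close>.\<close>

lemma tested_limit:
  assumes adm: "admissible \<psi>"
    and approx: "\<And>\<delta>. \<delta> > 0 \<Longrightarrow> \<exists>\<theta> s. tested \<theta> \<and> sqint \<mu> s \<and> l2norm \<mu> s \<le> \<delta> \<and> (\<forall>x y. \<bar>\<psi> x y - \<theta> x y\<bar> \<le> s x)"
  shows "tested \<psi>"
proof -
  let ?a = "\<lambda>\<psi> n. \<integral>x. u n x * \<psi> x (x /\<^sub>R \<epsilon> n) \<partial>\<mu>" and ?R = "\<lambda>\<psi>. \<integral>z. u0 z * \<psi> (fst z) (snd z) \<partial>N"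
  have "?a \<psi> \<longlonglongrightarrow> ?R \<psi>"
  proof (rule LIMSEQ_I)
    fix e :: real assume e: "e > 0"
    \<comment> \<open>Chosen such that the two errors of size \<open>e / K\<close>, multiplied by the norms of \<open>u n\<close> and \<open>u0\<close>, add up to less than \<open>e / 2\<close>.\<close>
    define K where "K = 2 * (\<bar>B\<bar> + l2norm N u0 + 1)"
    have K: "K > 0" using l2norm_nonneg[of N u0] by (simp add: K_def add_nonneg_pos)
    obtain \<theta> s where \<theta>: "tested \<theta>" "sqint \<mu> s" "l2norm \<mu> s \<le> e / K" "\<And>x y. \<bar>\<psi> x y - \<theta> x y\<bar> \<le> s x"
      using approx[of "e / K"] e K by auto
    have adm': "admissible \<theta>" using \<theta>(1) by (simp add: tested_def)
    have admd: "admissible (\<lambda>x y. \<psi> x y - \<theta> x y)" using admissible_lin[OF adm adm', of 1 "-1"] by simp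
    have d: "sqint \<mu> (\<lambda>x. \<psi> x (x /\<^sub>R \<epsilon> n) - \<theta> x (x /\<^sub>R \<epsilon> n))" "l2norm \<mu> (\<lambda>x. \<psi> x (x /\<^sub>R \<epsilon> n) - \<theta> x (x /\<^sub>R \<epsilon> n)) \<le> e / K"
      "sqint N (\<lambda>z. \<psi> (fst z) (snd z) - \<theta> (fst z) (snd z))" "l2norm N (\<lambda>z. \<psi> (fst z) (snd z) - \<theta> (fst z) (snd z)) \<le> e / K" for n
      using admissible_sqint[of "\<lambda>x y. \<psi> x y - \<theta> x y" n s] admd \<theta> unfolding admissible_def by (auto intro: order_trans)
    have 1: "\<bar>?a \<psi> n - ?a \<theta> n\<bar> \<le> \<bar>B\<bar> * (e / K)" for n
    proof -
      have "?a \<psi> n - ?a \<theta> n = (\<integral>x. u n x \<bullet> (\<psi> x (x /\<^sub>R \<epsilon> n) - \<theta> x (x /\<^sub>R \<epsilon> n)) \<partial>\<mu>)"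
        using sqint_integrable_mult[OF u(1) admissible_sqint'(1)[OF adm]] sqint_integrable_mult[OF u(1) admissible_sqint'(1)[OF adm']]
        by (simp add: right_diff_distrib)
      then have "\<bar>?a \<psi> n - ?a \<theta> n\<bar> \<le> l2norm \<mu> (u n) * l2norm \<mu> (\<lambda>x. \<psi> x (x /\<^sub>R \<epsilon> n) - \<theta> x (x /\<^sub>R \<epsilon> n))"
        using l2_Cauchy_Schwarz[OF u(1) d(1), of n n] by simp
      also have "\<dots> \<le> \<bar>B\<bar> * (e / K)" using u(2)[of n] d(2)[of n] by (intro mult_mono) auto
      finally show ?thesis .
    qed
    have 2: "\<bar>?R \<psi> - ?R \<theta>\<bar> \<le> l2norm N u0 * (e / K)"
    proof -
      have "?R \<psi> - ?R \<theta> = (\<integral>z. u0 z \<bullet> (\<psi> (fst z) (snd z) - \<theta> (fst z) (snd z)) \<partial>N)"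
        using sqint_integrable_mult[OF u0 admissible_sqint'(2)[OF adm]] sqint_integrable_mult[OF u0 admissible_sqint'(2)[OF adm']]
        by (simp add: right_diff_distrib)
      then have "\<bar>?R \<psi> - ?R \<theta>\<bar> \<le> l2norm N u0 * l2norm N (\<lambda>z. \<psi> (fst z) (snd z) - \<theta> (fst z) (snd z))"
        using l2_Cauchy_Schwarz[OF u0 d(3)] by simp
      also have "\<dots> \<le> l2norm N u0 * (e / K)" using d(4) by (intro mult_left_mono) auto
      finally show ?thesis .
    qed
    have 3: "\<bar>B\<bar> * (e / K) + l2norm N u0 * (e / K) < e / 2"
    proof -
      have "\<bar>B\<bar> + l2norm N u0 < K / 2" by (simp add: K_def)
      then have "(\<bar>B\<bar> + l2norm N u0) * (e / K) < K / 2 * (e / K)" using e K by (intro mult_strict_right_mono) auto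
      then show ?thesis using K by (simp add: distrib_right add_divide_distrib)
    qed
    obtain n0 where n0: "\<And>n. n \<ge> n0 \<Longrightarrow> \<bar>?a \<theta> n - ?R \<theta>\<bar> < e / 2"
      using \<theta>(1) LIMSEQ_D[of "?a \<theta>" "?R \<theta>" "e / 2"] e by (auto simp: tested_def)
    show "\<exists>n0. \<forall>n\<ge>n0. norm (?a \<psi> n - ?R \<psi>) < e"
    proof (intro exI[of _ n0] allI impI)
      fix n assume "n \<ge> n0"
      then show "norm (?a \<psi> n - ?R \<psi>) < e" using 1[of n] 2 3 n0[of n] unfolding real_norm_def by linarith
    qed
  qed
  then show ?thesis using adm by (simp add: tested_def)
qed

lemma admissible_product:
  assumes f: "sqint \<mu> f" and h: "continuous_on UNIV h" "\<And>y. \<bar>h y\<bar> \<le> K"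
  shows "admissible (\<lambda>x y. f x * h y)"
proof -
  have mf: "f \<in> borel_measurable lebesgue" using sqint_measurable[OF f] by simp
  have mh: "h \<in> borel_measurable lebesgue" by (rule measurable_lebesgue_continuous[OF h(1)])
  have mhn: "(\<lambda>x. h (x /\<^sub>R \<epsilon> n)) \<in> borel_measurable lebesgue" for n
    by (intro measurable_lebesgue_continuous continuous_on_compose2[OF h(1)] continuous_intros) auto
  have "\<bar>f x * h y\<bar> \<le> K * \<bar>f x\<bar>" for x y
    using mult_left_mono[OF h(2)[of y], of "\<bar>f x\<bar>"] by (simp add: abs_mult mult.commute)
  moreover have "sqint \<mu> (\<lambda>x. K * \<bar>f x\<bar>)" using sqint_mult[OF sqint_norm[OF f], of K] by simp
  ultimately show ?thesis unfolding admissible_def case_prod_beta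
    using mf mhn measurable_fst_N[OF mf] measurable_snd_N[OF mh]
    by (auto intro!: borel_measurable_times)
qed

text \<open>The slow factor can be an arbitrary square integrable function, because bumps are dense.\<close>

lemma tested_wave:
  assumes gen: "\<And>b k j. (\<lambda>n. \<integral>x. u n x * (bump_of b x * wave (freq L k) j (x /\<^sub>R \<epsilon> n)) \<partial>\<mu>)
      \<longlonglongrightarrow> (\<integral>z. u0 z * (bump_of b (fst z) * wave (freq L k) j (snd z)) \<partial>N)"
    and f: "sqint \<mu> f" and \<kappa>: "\<kappa> \<in> dual_lattice L"
  shows "tested (\<lambda>x y. f x * wave \<kappa> j y)"
proof (rule tested_limit)
  show "admissible (\<lambda>x y. f x * wave \<kappa> j y)"
    by (rule admissible_product[OF f smooth_continuous[OF smooth_wave] abs_wave_le])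
  obtain k where k: "\<kappa> = freq L k" using dual_latticeE[OF \<kappa>] .
  have bt: "tested (\<lambda>x y. bump_of b x * wave \<kappa> j y)" for b
    unfolding tested_def using gen[of b k j] k
      admissible_product[OF sqint_test_function[OF test_function_bump_of] smooth_continuous[OF smooth_wave] abs_wave_le] by blast
  obtain m c where lim: "(\<lambda>n::nat. l2norm \<mu> (\<lambda>x. (\<Sum>i<m n. c n i * bump_of (from_nat i) x) - f x)) \<longlonglongrightarrow> (0::real)"
    using bump_density[OF f] .
  fix \<delta> :: real assume "\<delta> > 0"
  then obtain n where n: "l2norm \<mu> (\<lambda>x. (\<Sum>i<m n. c n i * bump_of (from_nat i) x) - f x) < \<delta>"
    using order_tendstoD(2)[OF lim] by (metis (no_types, lifting) eventually_sequentially order_refl)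
  define F where "F x = (\<Sum>i<m n. c n i * bump_of (from_nat i) x)" for x :: "real^'n"
  have F: "sqint \<mu> (\<lambda>x. F x - f x)" unfolding F_def
    by (intro sqint_diff sqint_sum sqint_mult sqint_test_function test_function_bump_of f)
  show "\<exists>\<theta> s. tested \<theta> \<and> sqint \<mu> s \<and> l2norm \<mu> s \<le> \<delta> \<and> (\<forall>x y. \<bar>f x * wave \<kappa> j y - \<theta> x y\<bar> \<le> s x)"
  proof (intro exI conjI allI)
    have "tested (\<lambda>x y. \<Sum>i<m n. c n i * (bump_of (from_nat i) x * wave \<kappa> j y))" by (intro tested_sum bt)
    moreover have "(\<lambda>x y. \<Sum>i<m n. c n i * (bump_of (from_nat i) x * wave \<kappa> j y)) = (\<lambda>x y. F x * wave \<kappa> j y)"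
      by (simp add: F_def sum_distrib_right mult.assoc)
    ultimately show "tested (\<lambda>x y. F x * wave \<kappa> j y)" by simp
    show "sqint \<mu> (\<lambda>x. norm (F x - f x))" by (rule sqint_norm[OF F])
    show "l2norm \<mu> (\<lambda>x. norm (F x - f x)) \<le> \<delta>" using n by (simp add: l2norm_def F_def)
    fix x y
    have "\<bar>f x * wave \<kappa> j y - F x * wave \<kappa> j y\<bar> = \<bar>F x - f x\<bar> * \<bar>wave \<kappa> j y\<bar>"
      by (simp add: abs_mult[symmetric] left_diff_distrib abs_minus_commute)
    also have "\<dots> \<le> norm (F x - f x)" using abs_wave_le[of \<kappa> j y] by (simp add: mult_left_le)
    finally show "\<bar>f x * wave \<kappa> j y - F x * wave \<kappa> j y\<bar> \<le> norm (F x - f x)" .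
  qed
qed

end

lemma sigma_finite_lebesgue: "sigma_finite_measure (lebesgue :: (real^'n) measure)"
proof -
  obtain A :: "(real^'n) set set" where "countable A" "A \<subseteq> sets lborel" "\<Union>A = space lborel" "\<forall>a\<in>A. emeasure lborel a \<noteq> \<infinity>"
    using lborel.sigma_finite_countable by blast
  then show ?thesis
    by (intro sigma_finite_measure.intro exI[of _ A]) (auto intro: sets_completionI_sets)
qed

lemma norm_periodic_bcontfun:
  fixes f :: "(real^'n) \<Rightarrow>\<^sub>C real"
  assumes L: "L > 0" and "periodic L f"
  shows "(SUP y\<in>cell L. \<bar>f y\<bar>) = norm f"
proof (rule antisym)
  have ne: "cell L \<noteq> ({} :: (real^'n) set)" using L by (auto simp: cell_def intro!: exI[of _ 0])
  have b: "\<bar>f y\<bar> \<le> norm f" for y using norm_bounded[of f y] by simp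
  show "(SUP y\<in>cell L. \<bar>f y\<bar>) \<le> norm f" by (intro cSUP_least ne b)
  show "norm f \<le> (SUP y\<in>cell L. \<bar>f y\<bar>)"
  proof (rule norm_bound)
    fix x
    obtain y where y: "y \<in> cell L" "f x = f y" using cell_representative[OF L, of x] assms(2) by metis
    have "\<bar>f y\<bar> \<le> (SUP y\<in>cell L. \<bar>f y\<bar>)"
      using b by (intro cSUP_upper y bdd_aboveI2) auto
    then show "norm (f x) \<le> (SUP y\<in>cell L. \<bar>f y\<bar>)" using y by simp
  qed
qed

lemma rat_vec_dense: "\<exists>P. (\<lambda>n. rat_vec (P n)) \<longlonglongrightarrow> (y :: real^'n)"
proof -
  have "\<exists>r::rat. c < of_rat r \<and> of_rat r < c + 1 / Suc n" for c :: real and n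
    by (rule of_rat_dense) simp
  then obtain R where R: "\<And>c n. c < of_rat (R c n) \<and> of_rat (R c n) < c + 1 / real (Suc n)" by metis
  have "(\<lambda>n. real_of_rat (R c n)) \<longlonglongrightarrow> c" for c
  proof (rule tendsto_sandwich[of "\<lambda>_. c" _ _ "\<lambda>n. c + 1 / real (Suc n)"])
    show "(\<lambda>n. c + 1 / real (Suc n)) \<longlonglongrightarrow> c"
      using tendsto_add[OF tendsto_const LIMSEQ_Suc[OF lim_1_over_n], of c] by simp
  qed (use R in \<open>auto intro!: always_eventually less_imp_le\<close>)
  then have "(\<lambda>n. rat_vec (\<chi> i. R (y $ i) n)) \<longlonglongrightarrow> y"
    by (intro vec_tendstoI) (simp add: rat_vec_def)
  then show ?thesis by (rule exI[where x="\<lambda>n. \<chi> i. R (y $ i) n"])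
qed

context two_scale_seq
begin

text \<open>The combination numbered \<open>J x\<close> is the first in a fixed enumeration that is close to
  \<open>\<psi> x\<close>. So \<open>\<psi>\<close> is a uniform limit of functions that are piecewise
  constant in \<open>x\<close> with trigonometric values; this gives both the joint measurability and that
  along \<open>(x, x / \<epsilon>)\<close>.\<close>

lemma admissible_bcontfun:
  assumes \<psi>: "\<psi> \<in> L2_C_per L \<rho>"
  shows "admissible (\<lambda>x y. \<psi> x y)" "sqint \<mu> (\<lambda>x. norm (\<psi> x))"
    "\<And>\<delta>. \<delta> > 0 \<Longrightarrow> \<exists>J. J \<in> measurable lebesgue (count_space UNIV) \<and>
      (\<forall>x y. \<bar>\<psi> x y - wave_comb (from_nat_into (rat_combs L) (J x)) y\<bar> < \<delta>)"
proof -
  have meas: "(\<lambda>x. apply_bcontfun (\<psi> x)) \<in> borel_measurable lebesgue" and per: "\<And>x. periodic L (\<psi> x)"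
    and int: "integrable lebesgue (\<lambda>x. (SUP y\<in>cell L. \<bar>\<psi> x y\<bar>)\<^sup>2 * \<rho> x)"
    using \<psi> by (auto simp: L2_C_per_def)
  have ev [measurable]: "(\<lambda>x. \<psi> x y) \<in> borel_measurable lebesgue" for y
    by (rule measurable_compose[OF meas borel_measurable_continuous_onI[OF continuous_on_product_coordinates]])
  define t where "t i = wave_comb (from_nat_into (rat_combs L :: (real \<times> (real^'n) \<times> int) list set) i)" for i
  have ct: "continuous_on S (t i)" for i S unfolding t_def by (rule continuous_wave_comb)
  define T where "T i = Bcontfun (t i)" for i
  have T: "apply_bcontfun (T i) = t i" for i
  proof -
    obtain B where "\<And>y. \<bar>t i y\<bar> \<le> B" using wave_comb_bounded unfolding t_def by metis
    then have "t i \<in> bcontfun" using ct by (intro bcontfun_normI) auto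
    then show ?thesis by (simp add: T_def Bcontfun_inverse)
  qed
  show J: "\<exists>J. J \<in> measurable lebesgue (count_space UNIV) \<and> (\<forall>x y. \<bar>\<psi> x y - wave_comb (from_nat_into (rat_combs L) (J x)) y\<bar> < \<delta>)"
    if \<delta>: "\<delta> > 0" for \<delta>
  proof -
    \<comment> \<open>The comparison at rational points only, which suffices by continuity, makes \<open>J\<close> measurable.\<close>
    define J where "J x = (LEAST i. \<forall>q::rat^'n. \<bar>\<psi> x (rat_vec q) - t i (rat_vec q)\<bar> \<le> \<delta> / 2)" for x
    have "J \<in> measurable lebesgue (count_space UNIV)"
      unfolding J_def by measurable
    moreover have "\<bar>\<psi> x y - t (J x) y\<bar> < \<delta>" for x y
    proof -
      obtain l where l: "l \<in> rat_combs L" "\<And>y. \<bar>\<psi> x y - wave_comb l y\<bar> < \<delta> / 2"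
        using rat_combs_dense[OF L continuous_on_apply_bcontfun per, of "\<delta> / 2"] \<delta> by auto
      obtain i where i: "from_nat_into (rat_combs L) i = l" using from_nat_into_surj[OF countable_rat_combs l(1)] by blast
      have "\<forall>q::rat^'n. \<bar>\<psi> x (rat_vec q) - t i (rat_vec q)\<bar> \<le> \<delta> / 2" using l(2) by (simp add: t_def i less_imp_le)
      then have *: "\<bar>\<psi> x (rat_vec q) - t (J x) (rat_vec q)\<bar> \<le> \<delta> / 2" for q :: "rat^'n"
        unfolding J_def by (rule LeastI[THEN spec])
      obtain P where P: "(\<lambda>n. rat_vec (P n)) \<longlonglongrightarrow> y" using rat_vec_dense by blast
      have "(\<lambda>n. \<bar>\<psi> x (rat_vec (P n)) - t (J x) (rat_vec (P n))\<bar>) \<longlonglongrightarrow> \<bar>\<psi> x y - t (J x) y\<bar>"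
        by (intro tendsto_rabs tendsto_diff continuous_on_tendsto_compose[OF continuous_on_apply_bcontfun[of UNIV] P]
            continuous_on_tendsto_compose[OF ct[of UNIV] P]) auto
      then have "\<bar>\<psi> x y - t (J x) y\<bar> \<le> \<delta> / 2" using * by (intro LIMSEQ_le_const2) auto
      then show ?thesis using \<delta> by simp
    qed
    ultimately show ?thesis unfolding t_def by blast
  qed
  have "\<exists>J. J \<in> measurable lebesgue (count_space UNIV) \<and> (\<forall>x y. \<bar>\<psi> x y - t (J x) y\<bar> < 1 / real (Suc m))" for m
    unfolding t_def by (rule J) simp
  then obtain J where mJ: "\<And>m. J m \<in> measurable lebesgue (count_space UNIV)" and aJ: "\<And>m x y. \<bar>\<psi> x y - t (J m x) y\<bar> < 1 / real (Suc m)"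
    by metis
  have lim: "(\<lambda>m. t (J m x) y) \<longlonglongrightarrow> \<psi> x y" for x y
  proof -
    have "(\<lambda>m. t (J m x) y - \<psi> x y) \<longlonglongrightarrow> 0"
      by (rule Lim_null_comparison[OF always_eventually LIMSEQ_Suc[OF lim_1_over_n]])
         (use aJ[of x y] in \<open>auto simp: abs_minus_commute less_imp_le\<close>)
    then show ?thesis by (rule LIM_zero_cancel)
  qed
  have mn: "(\<lambda>x. norm (\<psi> x)) \<in> borel_measurable lebesgue"
  proof (rule borel_measurable_LIMSEQ_metric)
    show "(\<lambda>x. norm (T (J m x))) \<in> borel_measurable lebesgue" for m
      by (rule measurable_compose[OF mJ]) simp
    fix x
    have "\<bar>norm (T (J m x)) - norm (\<psi> x)\<bar> \<le> 1 / real (Suc m)" for m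
    proof -
      have "dist (T (J m x)) (\<psi> x) \<le> 1 / real (Suc m)"
        using aJ[of x _ m] by (intro dist_bound) (simp add: T dist_real_def abs_minus_commute less_imp_le)
      then show ?thesis using norm_triangle_ineq3[of "T (J m x)" "\<psi> x"] by (simp add: dist_norm)
    qed
    then have "(\<lambda>m. norm (T (J m x)) - norm (\<psi> x)) \<longlonglongrightarrow> 0"
      by (intro Lim_null_comparison[OF always_eventually LIMSEQ_Suc[OF lim_1_over_n]]) auto
    then show "(\<lambda>m. norm (T (J m x))) \<longlonglongrightarrow> norm (\<psi> x)" by (rule LIM_zero_cancel)
  qed
  show sn: "sqint \<mu> (\<lambda>x. norm (\<psi> x))"
    using int mn unfolding sqint_\<mu>_iff norm_periodic_bcontfun[OF L per] by simp
  show "admissible (\<lambda>x y. \<psi> x y)"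
    unfolding admissible_def
  proof (intro conjI allI)
    fix n
    show "(\<lambda>x. \<psi> x (x /\<^sub>R \<epsilon> n)) \<in> borel_measurable lebesgue"
    proof (rule borel_measurable_LIMSEQ_metric[OF _ lim])
      fix m
      show "(\<lambda>x. t (J m x) (x /\<^sub>R \<epsilon> n)) \<in> borel_measurable lebesgue"
        by (rule measurable_compose_countable[OF _ mJ, where f="\<lambda>i x. t i (x /\<^sub>R \<epsilon> n)"])
           (intro measurable_lebesgue_continuous continuous_on_compose2[OF ct[of UNIV]] continuous_intros, auto)
    qed
  next
    show "(\<lambda>(x, y). \<psi> x y) \<in> borel_measurable (lebesgue \<Otimes>\<^sub>M lebesgue)"
      unfolding case_prod_beta
    proof (rule borel_measurable_LIMSEQ_metric[OF _ lim])
      fix m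
      have "(\<lambda>z. J m (fst z)) \<in> measurable (lebesgue \<Otimes>\<^sub>M lebesgue) (count_space UNIV)"
        by (rule measurable_compose[OF measurable_fst mJ])
      then show "(\<lambda>z. t (J m (fst z)) (snd z)) \<in> borel_measurable (lebesgue \<Otimes>\<^sub>M (lebesgue :: (real^'n) measure))"
        by (rule measurable_compose_countable[rotated, where f="\<lambda>i z. t i (snd z)"])
           (intro measurable_snd_N measurable_lebesgue_continuous ct)
    qed
  next
    show "\<exists>s. sqint \<mu> s \<and> (\<forall>x y. \<bar>\<psi> x y\<bar> \<le> s x)"
      using sn norm_bounded[of "\<psi> _"] by (intro exI[of _ "\<lambda>x. norm (\<psi> x)"]) auto
  qed
qed

lemma tested_wave_comb:
  assumes "\<And>\<kappa> j. \<kappa> \<in> dual_lattice L \<Longrightarrow> tested (\<lambda>x y. f x * wave \<kappa> j y)" "l \<in> rat_combs L"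
  shows "tested (\<lambda>x y. f x * wave_comb l y)"
  using assms(2)
proof (induction l)
  case Nil
  then show ?case by (simp add: tested_zero)
next
  case (Cons a l)
  obtain c \<kappa> j where a: "a = (c, \<kappa>, j)" by (cases a)
  have "tested (\<lambda>x y. c * (f x * wave \<kappa> j y) + 1 * (f x * wave_comb l y))"
    using Cons a by (intro tested_lin assms(1)) (auto simp: rat_combs_def)
  then show ?case by (simp add: a algebra_simps)
qed

text \<open>Approximate \<open>\<psi> x\<close> by the combination numbered \<open>J x\<close> if \<open>J x <
  K\<close> and by zero otherwise. The result is a finite sum of products of indicators with waves, and the
  part of \<open>\<psi>\<close> with \<open>J x \<ge> K\<close> is small in norm for large \<open>K\<close> by
  dominated convergence.\<close>

lemma tested_L2_C_per:
  assumes wv: "\<And>f \<kappa> j. sqint \<mu> f \<Longrightarrow> \<kappa> \<in> dual_lattice L \<Longrightarrow> tested (\<lambda>x y. f x * wave \<kappa> j y)"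
    and \<psi>: "\<psi> \<in> L2_C_per L \<rho>"
  shows "tested (\<lambda>x y. \<psi> x y)"
proof (rule tested_limit)
  note A = admissible_bcontfun[OF \<psi>]
  show "admissible (\<lambda>x y. \<psi> x y)" by (rule A)
  fix \<delta> :: real assume \<delta>: "\<delta> > 0"
  have one: "sqint \<mu> (\<lambda>x. c)" for c :: real by (rule bounded_sqint[OF finite_\<mu>, of _ "\<bar>c\<bar>"]) auto
  define e where "e = \<delta> / (2 * (l2norm \<mu> (\<lambda>x. 1::real) + 1))"
  have e: "e > 0" using \<delta> l2norm_nonneg[of \<mu> "\<lambda>x. 1::real"] by (simp add: e_def add_nonneg_pos)
  obtain J where mJ [measurable]: "J \<in> measurable lebesgue (count_space UNIV)"
    and J: "\<And>x y. \<bar>\<psi> x y - wave_comb (from_nat_into (rat_combs L) (J x)) y\<bar> < e"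
    using A(3)[OF e] by blast
  define t where "t i = wave_comb (from_nat_into (rat_combs L :: (real \<times> (real^'n) \<times> int) list set) i)" for i
  have Jset: "{x. J x = i} \<in> sets lebesgue" "{x. J x \<ge> i} \<in> sets lebesgue" for i
    using measurable_sets[OF mJ, of "{i}"] measurable_sets[OF mJ, of "{i..}"] by (auto simp: vimage_def)
  define r where "r K x = indicator {x. J x \<ge> K} x * norm (\<psi> x)" for K x
  have mr: "r K \<in> borel_measurable lebesgue" for K
    unfolding r_def using sqint_measurable[OF A(2)] Jset(2) by (auto intro!: borel_measurable_times borel_measurable_indicator)
  have r: "sqint \<mu> (r K)" for K
    by (rule sqint_bound[OF A(2), of _ 1]) (use mr in \<open>auto simp: r_def indicator_def\<close>)
  have "(\<lambda>K. l2norm \<mu> (r K)) \<longlonglongrightarrow> sqrt (\<integral>x. 0 \<partial>\<mu>)"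
    unfolding l2norm_def
  proof (intro tendsto_real_sqrt integral_dominated_convergence[where w="\<lambda>x. (norm (norm (\<psi> x)))\<^sup>2"])
    show "integrable \<mu> (\<lambda>x. (norm (norm (\<psi> x)))\<^sup>2)" using sqint_integrable_sq[OF A(2)] .
    show "(\<lambda>x. (norm (r K x))\<^sup>2) \<in> borel_measurable \<mu>" for K using sqint_integrable_sq[OF r] by auto
    show "AE x in \<mu>. (\<lambda>K. (norm (r K x))\<^sup>2) \<longlonglongrightarrow> 0"
    proof (intro AE_I2 tendsto_eventually)
      show "\<forall>\<^sub>F K in sequentially. (norm (r K x))\<^sup>2 = 0" for x
        by (rule eventually_sequentiallyI[of "Suc (J x)"]) (simp add: r_def)
    qed
    show "AE x in \<mu>. norm ((norm (r K x))\<^sup>2) \<le> (norm (norm (\<psi> x)))\<^sup>2" for K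
      by (intro AE_I2) (auto simp: r_def indicator_def)
  qed simp
  then have "(\<lambda>K. l2norm \<mu> (r K)) \<longlonglongrightarrow> 0" by simp
  then obtain K where K: "l2norm \<mu> (r K) < \<delta> / 2"
    using order_tendstoD(2)[of "\<lambda>K. l2norm \<mu> (r K)" 0 sequentially "\<delta> / 2"] \<delta>
    by (metis (no_types, lifting) eventually_sequentially half_gt_zero order_refl)
  show "\<exists>\<theta> s. tested \<theta> \<and> sqint \<mu> s \<and> l2norm \<mu> s \<le> \<delta> \<and> (\<forall>x y. \<bar>\<psi> x y - \<theta> x y\<bar> \<le> s x)"
  proof (intro exI conjI allI)
    have ne: "rat_combs L \<noteq> ({} :: (real \<times> (real^'n) \<times> int) list set)" by (auto simp: rat_combs_def)
    have ind: "sqint \<mu> (indicat_real {x. J x = i})" for i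
      using Jset(1)[of i] by (intro bounded_sqint[OF finite_\<mu>, of _ 1]) (auto simp: indicator_def)
    show "tested (\<lambda>x y. \<Sum>i<K. 1 * (indicat_real {x. J x = i} x * t i y))"
      unfolding t_def by (intro tested_sum tested_wave_comb wv ind from_nat_into ne)
    show s: "sqint \<mu> (\<lambda>x. e *\<^sub>R 1 + r K x)" by (intro sqint_add sqint_scaleR one r)
    have "l2norm \<mu> (\<lambda>x. e *\<^sub>R 1 + r K x) \<le> e * l2norm \<mu> (\<lambda>x. 1::real) + l2norm \<mu> (r K)"
      using l2norm_triangle[OF sqint_scaleR[OF one] r, of e 1 K] e unfolding l2norm_scaleR by simp
    also have "e * l2norm \<mu> (\<lambda>x. 1::real) \<le> \<delta> / 2"
    proof -
      let ?n = "l2norm \<mu> (\<lambda>x. 1::real)"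
      have "e * ?n \<le> e * (?n + 1)" using e by (intro mult_left_mono) auto
      also have "\<dots> = \<delta> / 2"
      proof -
        define k where "k = ?n + 1"
        have "k \<noteq> 0" using l2norm_nonneg[of \<mu> "\<lambda>x. 1::real"] unfolding k_def by linarith
        then show ?thesis unfolding e_def k_def[symmetric] by simp
      qed
      finally show ?thesis .
    qed
    finally show "l2norm \<mu> (\<lambda>x. e *\<^sub>R 1 + r K x) \<le> \<delta>" using K by simp
    fix x y
    have sum: "(\<Sum>i<K. 1 * (indicat_real {x. J x = i} x * t i y)) = (if J x < K then t (J x) y else 0)"
      by (simp add: indicator_def if_distrib[of "\<lambda>a. a * _"] sum.delta' cong: if_cong)
    show "\<bar>\<psi> x y - (\<Sum>i<K. 1 * (indicat_real {x. J x = i} x * t i y))\<bar> \<le> e *\<^sub>R 1 + r K x"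
    proof (cases "J x < K")
      case True
      then show ?thesis unfolding sum using J[of x y] by (simp add: t_def r_def)
    next
      case False
      then show ?thesis unfolding sum using norm_bounded[of "\<psi> x" y] e by (simp add: r_def)
    qed
  qed
qed

lemma two_scale_convergentI:
  assumes gen: "\<And>b k j. (\<lambda>n. \<integral>x. u n x * (bump_of b x * wave (freq L k) j (x /\<^sub>R \<epsilon> n)) \<partial>\<mu>)
      \<longlonglongrightarrow> (\<integral>z. u0 z * (bump_of b (fst z) * wave (freq L k) j (snd z)) \<partial>N)"
  shows "two_scale_convergent L \<rho> \<epsilon> u (\<lambda>x y. u0 (x, y))"
  unfolding two_scale_convergent_def
proof (intro conjI allI ballI)
  show "u n \<in> L2 \<rho>" for n using u(1)[of n] unfolding sqint_\<mu>_iff by (simp add: L2_def)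
  have mu0: "u0 \<in> borel_measurable (lebesgue \<Otimes>\<^sub>M lebesgue)" using sqint_measurable[OF u0] by simp
  show "(\<lambda>x y. u0 (x, y)) \<in> L2_cell L \<rho>"
    unfolding L2_cell_def
  proof (intro CollectI conjI)
    have cs: "UNIV \<times> cell L \<in> sets (lebesgue \<Otimes>\<^sub>M (lebesgue :: (real^'n) measure))" by (intro pair_measureI) auto
    show "set_borel_measurable (lebesgue \<Otimes>\<^sub>M lebesgue) (UNIV \<times> cell L) (\<lambda>(x, y). u0 (x, y))"
      unfolding set_borel_measurable_def using mu0 cs by (auto intro!: borel_measurable_times borel_measurable_indicator)
    interpret SL: sigma_finite_measure "lebesgue :: (real^'n) measure" by (rule sigma_finite_lebesgue)
    let ?w = "\<lambda>(x, y). ennreal (\<rho> x) * ennreal (indicator (cell L :: (real^'n) set) y / L ^ CARD('n))"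
    let ?v = "\<lambda>z. \<rho> (fst z) * (indicator (cell L :: (real^'n) set) (snd z) / L ^ CARD('n))"
    have N: "N = density (lebesgue \<Otimes>\<^sub>M lebesgue) ?w"
    proof -
      have "sigma_finite_measure (density lebesgue (\<lambda>y::real^'n. ennreal (indicator (cell L) y / L ^ CARD('n))))"
        unfolding cellm_density[OF L, symmetric] by (rule C.sigma_finite_measure_axioms)
      then show ?thesis unfolding weighted_def cellm_density[OF L]
        using \<rho>_measurable by (intro pair_measure_density) (auto intro: SL.sigma_finite_measure_axioms)
    qed
    have w: "?w = (\<lambda>z. ennreal (?v z))" using L \<rho>_nonneg by (auto simp: ennreal_mult[symmetric])
    have mi: "(\<lambda>y. indicat_real (cell L) y / L ^ CARD('n)) \<in> borel_measurable (lebesgue :: (real^'n) measure)" by measurable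
    have mv: "?v \<in> borel_measurable (lebesgue \<Otimes>\<^sub>M lebesgue)"
      by (rule borel_measurable_times[OF measurable_fst_N[OF \<rho>_measurable] measurable_snd_N[OF mi]])
    have "integrable N (\<lambda>z. (u0 z)\<^sup>2)" using sqint_integrable_sq[OF u0] by simp
    then have "integrable (lebesgue \<Otimes>\<^sub>M lebesgue) (\<lambda>z. ?v z *\<^sub>R (u0 z)\<^sup>2)"
      unfolding N w using mv mu0 L \<rho>_nonneg by (subst (asm) integrable_density) (auto intro!: AE_I2)
    then have "integrable (lebesgue \<Otimes>\<^sub>M lebesgue) (\<lambda>z. L ^ CARD('n) *\<^sub>R (?v z *\<^sub>R (u0 z)\<^sup>2))" by (rule integrable_scaleR_right)
    moreover have "L ^ CARD('n) *\<^sub>R (?v z *\<^sub>R (u0 z)\<^sup>2) = indicator (UNIV \<times> cell L) z *\<^sub>R (case z of (x, y) \<Rightarrow> (u0 (x, y))\<^sup>2 * \<rho> x)" for z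
      using L by (cases z) (simp add: indicator_def)
    ultimately show "set_integrable (lebesgue \<Otimes>\<^sub>M lebesgue) (UNIV \<times> cell L) (\<lambda>(x, y). (u0 (x, y))\<^sup>2 * \<rho> x)"
      unfolding set_integrable_def by simp
  qed
  fix \<psi> assume \<psi>: "\<psi> \<in> L2_C_per L \<rho>"
  have tst: "tested (\<lambda>x y. \<psi> x y)" by (rule tested_L2_C_per[OF tested_wave[OF gen] \<psi>])
  then have adm: "admissible (\<lambda>x y. \<psi> x y)" by (simp add: tested_def)
  have 1: "(\<integral>x. u n x * \<psi> x (x /\<^sub>R \<epsilon> n) * \<rho> x \<partial>lebesgue) = (\<integral>x. u n x * \<psi> x (x /\<^sub>R \<epsilon> n) \<partial>\<mu>)" for n
  proof -
    have "(\<lambda>x. u n x * \<psi> x (x /\<^sub>R \<epsilon> n)) \<in> borel_measurable lebesgue"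
      using sqint_integrable_mult[OF u(1) admissible_sqint'(1)[OF adm], of n n] by auto
    from integral_\<mu>(1)[OF this] show ?thesis by (simp add: mult.commute)
  qed
  let ?F = "\<lambda>z. u0 z * \<psi> (fst z) (snd z)"
  have iF: "integrable N ?F" by (intro sqint_integrable_mult u0 admissible_sqint'(2)[OF adm])
  have 2: "1 / measure lebesgue (cell L :: (real^'n) set) * (\<integral>x. (LINT y:cell L|lebesgue. u0 (x, y) * \<psi> x y * \<rho> x) \<partial>lebesgue) = (\<integral>z. ?F z \<partial>N)"
  proof -
    have mF: "?F \<in> borel_measurable (lebesgue \<Otimes>\<^sub>M lebesgue)" using borel_measurable_integrable[OF iF] by simp
    have sec: "(\<lambda>y. ?F (x, y)) \<in> borel_measurable lebesgue" for x
      by (rule measurable_compose[OF measurable_Pair1' mF]) simp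
    have "(\<integral>z. ?F z \<partial>N) = (\<integral>x. (\<integral>y. ?F (x, y) \<partial>\<nu>) \<partial>\<mu>)" by (rule P.integral_fst'[OF iF, symmetric])
    also have "\<dots> = (\<integral>x. \<rho> x *\<^sub>R (\<integral>y. ?F (x, y) \<partial>\<nu>) \<partial>lebesgue)"
      using P.integrable_fst'[OF iF] by (intro integral_\<mu>(1)) auto
    also have "\<dots> = (\<integral>x. (1 / L ^ CARD('n)) * (LINT y:cell L|lebesgue. u0 (x, y) * \<psi> x y * \<rho> x) \<partial>lebesgue)"
    proof (rule Bochner_Integration.integral_cong[OF refl])
      fix x
      show "\<rho> x *\<^sub>R (\<integral>y. ?F (x, y) \<partial>\<nu>) = (1 / L ^ CARD('n)) * (LINT y:cell L|lebesgue. u0 (x, y) * \<psi> x y * \<rho> x)"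
        using integral_cellm(1)[OF L sec[of x]] by (simp add: divide_inverse)
    qed
    finally show ?thesis by (simp add: measure_cell[OF L])
  qed
  show "(\<lambda>n. \<integral>x. u n x * \<psi> x (x /\<^sub>R \<epsilon> n) * \<rho> x \<partial>lebesgue) \<longlonglongrightarrow>
      1 / measure lebesgue (cell L :: (real^'n) set) * (\<integral>x. (LINT y:cell L|lebesgue. u0 (x, y) * \<psi> x y * \<rho> x) \<partial>lebesgue)"
    unfolding 1 2 using tst by (simp add: tested_def)
qed

end

context two_scale
begin

lemma integral_N_product:
  fixes f h w :: "real^'n \<Rightarrow> real"
  assumes f: "sqint \<mu> f" and h: "sqint \<mu> h" and w: "continuous_on UNIV w" "\<And>y. \<bar>w y\<bar> \<le> 1"
  shows "(\<integral>z. f (fst z) * (h (fst z) * w (snd z)) \<partial>N) = (\<integral>x. f x * h x \<partial>\<mu>) * (\<integral>y. w y \<partial>\<nu>)"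
    "integrable N (\<lambda>z. f (fst z) * (h (fst z) * w (snd z)))"
proof -
  have mw: "(\<lambda>z. w (snd z)) \<in> borel_measurable N" using measurable_snd_N[OF measurable_lebesgue_continuous[OF w(1)]] by simp
  have "sqint N (\<lambda>z. h (fst z) * w (snd z))" by (rule sqint_mult_bounded(1)[OF sqint_N_fst(1)[OF h] mw]) (rule w)
  then show i: "integrable N (\<lambda>z. f (fst z) * (h (fst z) * w (snd z)))"
    by (intro sqint_integrable_mult sqint_N_fst(1) f)
  show "(\<integral>z. f (fst z) * (h (fst z) * w (snd z)) \<partial>N) = (\<integral>x. f x * h x \<partial>\<mu>) * (\<integral>y. w y \<partial>\<nu>)"
    using P.integral_fst'[OF i] by (simp add: mult.assoc[symmetric])
qed

lemma wave_const: "wave 0 j y = cos (of_int j * (pi / 2))"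
  by (simp add: wave_def)

text \<open>At a nonzero frequency the wave averages to zero over the cell, and the tests of the sequence
  vanish by \<open>oscillation_vanishes\<close>. At frequency zero the wave is a constant and the claim is
  weak convergence.\<close>

lemma no_oscillation:
  assumes w: "\<And>n. has_weak_gradient UNIV (u n) (g n)" and u: "\<And>n. sqint \<mu> (u n)" "\<And>n. l2norm \<mu> (u n) \<le> B"
    and g: "\<And>n. sqint \<mu> (g n)" "\<And>n. l2norm \<mu> (g n) \<le> D" and v: "sqint \<mu> v"
    and weak: "\<And>f. sqint \<mu> f \<Longrightarrow> (\<lambda>n. \<integral>x. u n x * f x \<partial>\<mu>) \<longlonglongrightarrow> (\<integral>x. v x * f x \<partial>\<mu>)"
  shows "two_scale_seq L \<rho> \<epsilon> u (\<lambda>z. v (fst z)) B"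
    "(\<lambda>n. \<integral>x. u n x * (bump_of b x * wave (freq L k) j (x /\<^sub>R \<epsilon> n)) \<partial>\<mu>)
      \<longlonglongrightarrow> (\<integral>z. v (fst z) * (bump_of b (fst z) * wave (freq L k) j (snd z)) \<partial>N)"
proof -
  show "two_scale_seq L \<rho> \<epsilon> u (\<lambda>z. v (fst z)) B"
    by unfold_locales (use u sqint_N_fst(1)[OF v] in auto)
  have sb: "sqint \<mu> (bump_of b)" by (rule sqint_test_function[OF test_function_bump_of])
  have R: "(\<integral>z. v (fst z) * (bump_of b (fst z) * wave (freq L k) j (snd z)) \<partial>N) = (\<integral>x. v x * bump_of b x \<partial>\<mu>) * (\<integral>y. wave (freq L k) j y \<partial>\<nu>)"
    by (rule integral_N_product(1)[OF v sb smooth_continuous[OF smooth_wave] abs_wave_le])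
  show "(\<lambda>n. \<integral>x. u n x * (bump_of b x * wave (freq L k) j (x /\<^sub>R \<epsilon> n)) \<partial>\<mu>)
      \<longlonglongrightarrow> (\<integral>z. v (fst z) * (bump_of b (fst z) * wave (freq L k) j (snd z)) \<partial>N)"
  proof (cases "freq L k = 0")
    case True
    have "(\<lambda>n. (\<integral>x. u n x * bump_of b x \<partial>\<mu>) * cos (of_int j * (pi / 2))) \<longlonglongrightarrow> (\<integral>x. v x * bump_of b x \<partial>\<mu>) * cos (of_int j * (pi / 2))"
      by (intro tendsto_intros weak sb)
    then show ?thesis unfolding R unfolding True wave_const
      using finite_measure_cellm(2)[OF L, where 'n='n] by (simp add: mult.assoc[symmetric])
  next
    case False
    then show ?thesis unfolding R integral_wave_zero[OF L freq_in False]
      using oscillation_vanishes[OF w u g test_function_bump_of False] by simp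
  qed
qed

text \<open>Constant sequences are their own two-scale limits: the mean of an oscillating function converges
  to its average over the fast variable.\<close>

lemma averaging:
  assumes "finite I" and f: "\<And>i. i \<in> I \<Longrightarrow> sqint \<mu> (f i)" and \<kappa>: "\<And>i. i \<in> I \<Longrightarrow> \<kappa> i \<in> dual_lattice L"
  shows "(\<lambda>n. \<integral>x. (\<Sum>i\<in>I. c i * (f i x * wave (\<kappa> i) (j i) (x /\<^sub>R \<epsilon> n))) \<partial>\<mu>)
      \<longlonglongrightarrow> (\<integral>z. (\<Sum>i\<in>I. c i * (f i (fst z) * wave (\<kappa> i) (j i) (snd z))) \<partial>N)"
proof -
  have one: "sqint \<mu> (\<lambda>x. 1::real)" by (rule bounded_sqint[OF finite_\<mu>, of _ 1]) auto
  have zero: "sqint \<mu> (\<lambda>x. 0 :: real^'n)" by (rule sqint_zero)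
  have w: "has_weak_gradient UNIV (\<lambda>x. 1) (\<lambda>x. 0 :: real^'n)"
    using has_weak_gradient_smooth[OF smooth_const[of 1], of UNIV] by (simp add: grad_const[abs_def])
  interpret S: two_scale_seq L \<rho> \<epsilon> "\<lambda>n x. 1" "\<lambda>z. 1" "l2norm \<mu> (\<lambda>x. 1::real)"
    by (rule no_oscillation(1)[OF w one order_refl zero order_refl one]) simp
  have gen: "(\<lambda>n. \<integral>x. 1 * (bump_of b x * wave (freq L k) j (x /\<^sub>R \<epsilon> n)) \<partial>\<mu>)
      \<longlonglongrightarrow> (\<integral>z. 1 * (bump_of b (fst z) * wave (freq L k) j (snd z)) \<partial>N)" for b k j
    by (rule no_oscillation(2)[OF w one order_refl zero order_refl one]) simp
  have "S.tested (\<lambda>x y. \<Sum>i\<in>I. c i * (f i x * wave (\<kappa> i) (j i) y))"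
    by (intro S.tested_sum S.tested_wave[OF gen] f \<kappa>)
  then show ?thesis by (simp add: S.tested_def)
qed

end

section \<open>The two-scale limit of the gradients\<close>

text \<open>The fields are numbered because \<open>l2_riesz_span\<close> speaks about sequences.\<close>

definition field_bump :: "nat \<Rightarrow> real^'n \<Rightarrow> real"
  where "field_bump a = bump_of (fst (from_nat a :: 'n test_index))"
definition field_freq :: "real \<Rightarrow> nat \<Rightarrow> real^'n"
  where "field_freq L a = freq L (fst (snd (from_nat a :: 'n test_index)))"
definition field_phase :: "'n::finite itself \<Rightarrow> nat \<Rightarrow> int"
  where "field_phase _ a = snd (snd (from_nat a :: 'n test_index))"

text \<open>The gradient, in the fast variable, of a bump in the slow variable times a wave.\<close>

definition grad_field :: "real \<Rightarrow> nat \<Rightarrow> (real^'n) \<times> (real^'n) \<Rightarrow> real^'n"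
  where "grad_field L a z = (field_bump a (fst z) * wave (field_freq L a) (field_phase TYPE('n) a) (snd z)) *\<^sub>R field_freq L a"

lemma field_freq_in: "field_freq L a \<in> dual_lattice L"
  by (simp add: field_freq_def freq_in)

lemma field_surj:
  obtains a where "field_bump a = (bump_of b :: real^'n \<Rightarrow> real)" "field_freq L a = (freq L k :: real^'n)" "field_phase TYPE('n) a = j"
  by (rule that[of "to_nat (b, k, j)"]) (simp_all add: field_bump_def field_freq_def field_phase_def)

context two_scale
begin

lemma sqint_N_product:
  fixes h w :: "real^'n \<Rightarrow> real"
  assumes h: "sqint \<mu> h" and w: "continuous_on UNIV w" "\<And>y. \<bar>w y\<bar> \<le> 1"
  shows "sqint N (\<lambda>z. h (fst z) * w (snd z))"
proof -
  have mw: "(\<lambda>z. w (snd z)) \<in> borel_measurable N" using measurable_snd_N[OF measurable_lebesgue_continuous[OF w(1)]] by simp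
  show ?thesis by (rule sqint_mult_bounded(1)[OF sqint_N_fst(1)[OF h] mw]) (rule w)
qed

lemma sqint_scaleR_const: "sqint M h \<Longrightarrow> sqint M (\<lambda>z. h z *\<^sub>R (v :: 'b::euclidean_space))" for h :: "_ \<Rightarrow> real"
  by (rule sqint_bound[of M h _ "norm v"]) auto

lemma sqint_field_bump: "sqint \<mu> (field_bump a)"
  unfolding field_bump_def by (rule sqint_test_function[OF test_function_bump_of])

lemma sqint_field: "sqint N (grad_field L a)"
  unfolding grad_field_def[abs_def]
  by (intro sqint_scaleR_const sqint_N_product sqint_field_bump smooth_continuous smooth_wave abs_wave_le)

definition field_coeff :: "(nat \<Rightarrow> real^'n \<Rightarrow> real^'n) \<Rightarrow> nat \<Rightarrow> nat \<Rightarrow> real"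
  where "field_coeff U a n = (\<integral>x. U n x \<bullet> grad_field L a (x, x /\<^sub>R \<epsilon> n) \<partial>\<mu>)"

lemma sqint_field_osc: "sqint \<mu> (\<lambda>x. grad_field L a (x, x /\<^sub>R \<epsilon> n))"
  unfolding grad_field_def[abs_def] fst_conv snd_conv
  by (intro sqint_scaleR_const sqint_mult_wave(1) sqint_field_bump)

text \<open>The squared length of a combination of fields is again a combination of oscillating functions, so
  \<open>averaging\<close> applies.\<close>

lemma l2norm_field_comb_tendsto:
  "(\<lambda>n. l2norm \<mu> (\<lambda>x. \<Sum>a<m. c a *\<^sub>R grad_field L a (x, x /\<^sub>R \<epsilon> n))) \<longlonglongrightarrow> l2norm N (\<lambda>z. \<Sum>a<m. c a *\<^sub>R grad_field L a z)"
proof -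
  \<comment> \<open>A product of two waves is half the sum of the waves at the difference and at the sum of the frequencies; the boolean in the index selects one of them.\<close>
  define I where "I = ({..<m} \<times> {..<m}) \<times> (UNIV :: bool set)"
  define coef where "coef = (\<lambda>((a, b), t::bool). c a * c b * (field_freq L a \<bullet> (field_freq L b :: real^'n)) / 2)"
  define f where "f = (\<lambda>((a, b), t::bool) (x::real^'n). field_bump a x * field_bump b x)"
  define \<kappa> where "\<kappa> = (\<lambda>((a, b), t). if t then field_freq L a - field_freq L b else field_freq L a + (field_freq L b :: real^'n))"
  define j where "j = (\<lambda>((a, b), t). if t then field_phase TYPE('n) a - field_phase TYPE('n) b else field_phase TYPE('n) a + field_phase TYPE('n) b)"
  have eq: "(norm (\<Sum>a<m. c a *\<^sub>R grad_field L a (x, y)))\<^sup>2 = (\<Sum>i\<in>I. coef i * (f i x * wave (\<kappa> i) (j i) y))" for x y :: "real^'n"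
  proof -
    have "(norm (\<Sum>a<m. c a *\<^sub>R grad_field L a (x, y)))\<^sup>2 = (\<Sum>a<m. \<Sum>b<m. (c a *\<^sub>R grad_field L a (x, y)) \<bullet> (c b *\<^sub>R grad_field L b (x, y)))"
      unfolding power2_norm_eq_inner by (subst inner_sum_left) (simp only: inner_sum_right)
    also have "\<dots> = (\<Sum>p\<in>{..<m} \<times> {..<m}. case p of (a, b) \<Rightarrow> (c a *\<^sub>R grad_field L a (x, y)) \<bullet> (c b *\<^sub>R grad_field L b (x, y)))"
      by (rule sum.cartesian_product)
    also have "\<dots> = (\<Sum>p\<in>{..<m} \<times> {..<m}. \<Sum>t\<in>(UNIV :: bool set). coef (p, t) * (f (p, t) x * wave (\<kappa> (p, t)) (j (p, t)) y))"
    proof (rule sum.cong[OF refl])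
      fix p :: "nat \<times> nat"
      obtain a b where p: "p = (a, b)" by (cases p)
      let ?wa = "wave (field_freq L a) (field_phase TYPE('n) a) y" and ?wb = "wave (field_freq L b) (field_phase TYPE('n) b) y"
      have "(c a *\<^sub>R grad_field L a (x, y)) \<bullet> (c b *\<^sub>R grad_field L b (x, y)) = c a * c b * (field_freq L a \<bullet> (field_freq L b :: real^'n)) * (field_bump a x * field_bump b x) * (?wa * ?wb)"
        by (simp add: grad_field_def)
      also have "\<dots> = (\<Sum>t\<in>(UNIV :: bool set). coef (p, t) * (f (p, t) x * wave (\<kappa> (p, t)) (j (p, t)) y))"
        unfolding wave_mult by (simp add: UNIV_bool coef_def f_def \<kappa>_def j_def p algebra_simps add_divide_distrib)
      finally show "(case p of (a, b) \<Rightarrow> (c a *\<^sub>R grad_field L a (x, y)) \<bullet> (c b *\<^sub>R grad_field L b (x, y))) = (\<Sum>t\<in>(UNIV :: bool set). coef (p, t) * (f (p, t) x * wave (\<kappa> (p, t)) (j (p, t)) y))"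
        by (simp add: p)
    qed
    also have "\<dots> = (\<Sum>i\<in>I. coef i * (f i x * wave (\<kappa> i) (j i) y))"
      unfolding I_def by (subst sum.cartesian_product) (simp add: case_prod_beta)
    finally show ?thesis .
  qed
  have "(\<lambda>n. \<integral>x. (\<Sum>i\<in>I. coef i * (f i x * wave (\<kappa> i) (j i) (x /\<^sub>R \<epsilon> n))) \<partial>\<mu>)
      \<longlonglongrightarrow> (\<integral>z. (\<Sum>i\<in>I. coef i * (f i (fst z) * wave (\<kappa> i) (j i) (snd z))) \<partial>N)"
  proof (rule averaging)
    show "finite I" by (simp add: I_def)
    fix i :: "(nat \<times> nat) \<times> bool"
    obtain a b t where i: "i = ((a, b), t)" by (metis surj_pair)
    show "\<kappa> i \<in> dual_lattice L" by (simp add: i \<kappa>_def dual_lattice_add dual_lattice_diff field_freq_in)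
    have mb: "field_bump b \<in> borel_measurable \<mu>" using sqint_measurable[OF sqint_field_bump] .
    show "sqint \<mu> (f i)" unfolding i f_def prod.case
      by (rule sqint_mult_bounded(1)[OF sqint_field_bump mb]) (simp add: field_bump_def bump_of_bounds)
  qed
  then have "(\<lambda>n. \<integral>x. (norm (\<Sum>a<m. c a *\<^sub>R grad_field L a (x, x /\<^sub>R \<epsilon> n)))\<^sup>2 \<partial>\<mu>) \<longlonglongrightarrow> (\<integral>z. (norm (\<Sum>a<m. c a *\<^sub>R grad_field L a z))\<^sup>2 \<partial>N)"
    unfolding eq[symmetric] by simp
  then show ?thesis unfolding l2norm_def by (rule tendsto_real_sqrt)
qed

lemma coeff_bounded:
  assumes "\<And>n. sqint \<mu> (U n)" "\<And>n. l2norm \<mu> (U n) \<le> D"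
  shows "\<exists>K. \<forall>n. \<bar>field_coeff U a n\<bar> \<le> K"
proof (intro exI allI)
  fix n
  have "l2norm \<mu> (\<lambda>x. grad_field L a (x, x /\<^sub>R \<epsilon> n)) \<le> l2norm \<mu> (\<lambda>x. norm (field_freq L a :: real^'n) *\<^sub>R field_bump a x)"
  proof (intro l2norm_mono AE_I2 sqint_field_osc sqint_scaleR sqint_field_bump)
    fix x :: "real^'n"
    have "\<bar>field_bump a x\<bar> * \<bar>wave (field_freq L a) (field_phase TYPE('n) a) (x /\<^sub>R \<epsilon> n)\<bar> \<le> \<bar>field_bump a x\<bar>" by (intro mult_left_le abs_wave_le) simp
    then have "(\<bar>field_bump a x\<bar> * \<bar>wave (field_freq L a) (field_phase TYPE('n) a) (x /\<^sub>R \<epsilon> n)\<bar>) * norm (field_freq L a :: real^'n) \<le> \<bar>field_bump a x\<bar> * norm (field_freq L a :: real^'n)"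
      by (rule mult_right_mono) simp
    then show "norm (grad_field L a (x, x /\<^sub>R \<epsilon> n)) \<le> norm (norm (field_freq L a :: real^'n) *\<^sub>R field_bump a x)"
      by (simp add: grad_field_def abs_mult mult.commute mult.left_commute)
  qed
  then have "l2norm \<mu> (U n) * l2norm \<mu> (\<lambda>x. grad_field L a (x, x /\<^sub>R \<epsilon> n)) \<le> D * l2norm \<mu> (\<lambda>x. norm (field_freq L a :: real^'n) *\<^sub>R field_bump a x)"
    using assms(2) order_trans[OF l2norm_nonneg assms(2)] by (intro mult_mono) auto
  then show "\<bar>field_coeff U a n\<bar> \<le> D * l2norm \<mu> (\<lambda>x. norm (field_freq L a :: real^'n) *\<^sub>R field_bump a x)"
    using l2_Cauchy_Schwarz[OF assms(1) sqint_field_osc, of n a n] unfolding field_coeff_def by linarith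
qed

text \<open>A diagonal subsequence makes all tests against fields converge. For a combination of fields the
  limit is at most \<open>D\<close> times the limit of its oscillating norms, which by
  \<open>l2norm_field_comb_tendsto\<close> is its norm on the product: this is the bound that the Riesz
  representation needs.\<close>

lemma two_scale_field_limit:
  fixes U :: "nat \<Rightarrow> real^'n \<Rightarrow> real^'n"
  assumes U: "\<And>n. sqint \<mu> (U n)" "\<And>n. l2norm \<mu> (U n) \<le> D"
  obtains r g m c where "strict_mono r" "sqint N g"
    "\<And>a. (\<lambda>n. field_coeff U a (r n)) \<longlonglongrightarrow> (\<integral>z. g z \<bullet> grad_field L a z \<partial>N)"
    "(\<lambda>n::nat. l2norm N (\<lambda>z. (\<Sum>a<m n. c n a *\<^sub>R grad_field L a z) - g z)) \<longlonglongrightarrow> 0"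
proof -
  interpret S: subseqs "\<lambda>a s. convergent (\<lambda>n. field_coeff U a (s n))"
  proof
    fix a and s :: "nat \<Rightarrow> nat"
    obtain K where "\<And>n. \<bar>field_coeff U a n\<bar> \<le> K" using coeff_bounded[of U D a, OF U] by blast
    then have "bounded (range (\<lambda>n. field_coeff U a (s n)))" unfolding bounded_iff by auto
    from bounded_imp_convergent_subsequence[OF this] obtain l r' where
      r': "strict_mono r'" "((\<lambda>n. field_coeff U a (s n)) \<circ> r') \<longlonglongrightarrow> l" by blast
    then show "\<exists>r'. strict_mono r' \<and> convergent (\<lambda>n. field_coeff U a ((s \<circ> r') n))"
      by (auto simp: o_def convergent_def intro!: exI[of _ r'])
  qed
  define r where "r = S.diagseq"
  have r: "strict_mono r" unfolding r_def by (rule S.subseq_diagseq)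
  have "convergent (\<lambda>n. field_coeff U a ((S.diagseq \<circ> (+) (Suc a)) n))" for a
  proof (rule S.diagseq_holds)
    fix q s :: "nat \<Rightarrow> nat" and a assume q: "strict_mono q" and "convergent (\<lambda>n. field_coeff U a (s n))"
    then have "convergent ((\<lambda>n. field_coeff U a (s n)) \<circ> q)" by (intro convergent_subseq_convergent)
    then show "convergent (\<lambda>n. field_coeff U a ((s \<circ> q) n))" by (simp add: o_def)
  qed
  then have "convergent (\<lambda>n. field_coeff U a (r (n + Suc a)))" for a unfolding r_def o_def by (simp only: add.commute)
  then have "convergent (\<lambda>n. field_coeff U a (r n))" for a using convergent_ignore_initial_segment by blast
  then obtain l where l: "\<And>a. (\<lambda>n. field_coeff U a (r n)) \<longlonglongrightarrow> l a" unfolding convergent_def by metis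
  have bound: "\<bar>\<Sum>a<m. c a * l a\<bar> \<le> D * l2norm N (\<lambda>z. \<Sum>a<m. c a *\<^sub>R grad_field L a z)" for m c
  proof (rule LIMSEQ_le)
    show "(\<lambda>n. \<bar>\<Sum>a<m. c a * field_coeff U a (r n)\<bar>) \<longlonglongrightarrow> \<bar>\<Sum>a<m. c a * l a\<bar>" by (intro tendsto_intros l)
    show "(\<lambda>n. D * l2norm \<mu> (\<lambda>x. \<Sum>a<m. c a *\<^sub>R grad_field L a (x, x /\<^sub>R \<epsilon> (r n)))) \<longlonglongrightarrow> D * l2norm N (\<lambda>z. \<Sum>a<m. c a *\<^sub>R grad_field L a z)"
      using LIMSEQ_subseq_LIMSEQ[OF l2norm_field_comb_tendsto r] by (intro tendsto_intros) (simp add: o_def)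
    have "\<bar>\<Sum>a<m. c a * field_coeff U a n\<bar> \<le> D * l2norm \<mu> (\<lambda>x. \<Sum>a<m. c a *\<^sub>R grad_field L a (x, x /\<^sub>R \<epsilon> n))" for n
    proof -
      have s: "sqint \<mu> (\<lambda>x. \<Sum>a<m. c a *\<^sub>R grad_field L a (x, x /\<^sub>R \<epsilon> n))" by (intro sqint_sum sqint_scaleR sqint_field_osc)
      have "(\<Sum>a<m. c a * field_coeff U a n) = (\<integral>x. U n x \<bullet> (\<Sum>a<m. c a *\<^sub>R grad_field L a (x, x /\<^sub>R \<epsilon> n)) \<partial>\<mu>)"
        using sqint_integrable_inner[OF U(1) sqint_field_osc] by (simp add: field_coeff_def inner_sum_right Bochner_Integration.integral_sum)
      then have "\<bar>\<Sum>a<m. c a * field_coeff U a n\<bar> \<le> l2norm \<mu> (U n) * l2norm \<mu> (\<lambda>x. \<Sum>a<m. c a *\<^sub>R grad_field L a (x, x /\<^sub>R \<epsilon> n))"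
        using l2_Cauchy_Schwarz[OF U(1) s, of n] by simp
      also have "\<dots> \<le> D * l2norm \<mu> (\<lambda>x. \<Sum>a<m. c a *\<^sub>R grad_field L a (x, x /\<^sub>R \<epsilon> n))" by (intro mult_right_mono U) simp
      finally show ?thesis .
    qed
    then show "\<exists>N. \<forall>n\<ge>N. \<bar>\<Sum>a<m. c a * field_coeff U a (r n)\<bar> \<le> D * l2norm \<mu> (\<lambda>x. \<Sum>a<m. c a *\<^sub>R grad_field L a (x, x /\<^sub>R \<epsilon> (r n)))" by blast
  qed
  show thesis
  proof (rule l2_riesz_span[OF sqint_field bound])
    fix g m c
    assume g: "sqint N g" "\<And>a. (\<integral>z. g z \<bullet> grad_field L a z \<partial>N) = l a"
      "(\<lambda>n::nat. l2norm N (\<lambda>z. (\<Sum>a<m n. c n a *\<^sub>R grad_field L a z) - g z)) \<longlonglongrightarrow> 0"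
    show thesis by (rule that[OF r g(1) _ g(3)]) (use l g(2) in simp)
  qed
qed

text \<open>If the frequency of the field is neither \<open>\<kappa>\<close> nor its negative, the product of
  the two waves has mean zero; otherwise \<open>v\<close> is orthogonal to the field. Thus the limits of
  gradient fields are orthogonal to the fields that are divergence free in the fast variable.\<close>

lemma field_orthogonal:
  assumes h: "sqint \<mu> h" and \<kappa>: "\<kappa> \<in> dual_lattice L" and v: "\<kappa> \<bullet> v = 0"
  shows "(\<integral>z. grad_field L a z \<bullet> ((h (fst z) * wave \<kappa> j (snd z)) *\<^sub>R v) \<partial>N) = 0"
proof (cases "field_freq L a \<bullet> v = 0")
  case True
  then show ?thesis by (simp add: grad_field_def)
next
  case False
  let ?k = "field_freq L a :: real^'n" and ?p = "field_phase TYPE('n) a"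
  have ne: "?k - \<kappa> \<noteq> 0" "?k + \<kappa> \<noteq> 0" using False v by (auto simp: add_eq_0_iff2)
  let ?w = "\<lambda>y. wave ?k ?p y * wave \<kappa> j y"
  have w: "continuous_on UNIV ?w" by (intro continuous_intros smooth_continuous smooth_wave)
  have w1: "\<bar>?w y\<bar> \<le> 1" for y using mult_le_one[OF abs_wave_le abs_ge_zero abs_wave_le, of ?k ?p y \<kappa> j y] by (simp add: abs_mult)
  have i: "integrable \<nu> (wave \<kappa>' j')" for \<kappa>' j' by (rule integrable_cellm_bounded[OF L smooth_continuous[OF smooth_wave]])
  have "(\<integral>y. ?w y \<partial>\<nu>) = 0"
    unfolding wave_mult
    using integral_wave_zero[OF L dual_lattice_diff[OF field_freq_in \<kappa>] ne(1)] integral_wave_zero[OF L dual_lattice_add[OF field_freq_in \<kappa>] ne(2)]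
    by (simp add: i)
  then have "(\<integral>z. field_bump a (fst z) * (h (fst z) * ?w (snd z)) \<partial>N) = 0"
    using integral_N_product(1)[OF sqint_field_bump h w w1] by simp
  moreover have "grad_field L a z \<bullet> ((h (fst z) * wave \<kappa> j (snd z)) *\<^sub>R v) = (?k \<bullet> v) * (field_bump a (fst z) * (h (fst z) * ?w (snd z)))" for z
    by (simp add: grad_field_def)
  ultimately show ?thesis by (simp only: integral_mult_right_zero)
qed

lemma field_limit_orthogonal:
  assumes g: "sqint N g" and lim: "(\<lambda>n::nat. l2norm N (\<lambda>z. (\<Sum>a<m n. c n a *\<^sub>R grad_field L a z) - g z)) \<longlonglongrightarrow> 0"
    and h: "sqint \<mu> h" and \<kappa>: "\<kappa> \<in> dual_lattice L" and v: "\<kappa> \<bullet> v = 0"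
  shows "(\<integral>z. g z \<bullet> ((h (fst z) * wave \<kappa> j (snd z)) *\<^sub>R v) \<partial>N) = 0"
proof -
  let ?T = "\<lambda>z. (h (fst z) * wave \<kappa> j (snd z)) *\<^sub>R v"
  have T: "sqint N ?T" by (intro sqint_scaleR_const sqint_N_product h smooth_continuous smooth_wave abs_wave_le)
  have s: "sqint N (\<lambda>z. \<Sum>a<m n. c n a *\<^sub>R grad_field L a z)" for n by (intro sqint_sum sqint_scaleR sqint_field)
  have "(\<integral>z. (\<Sum>a<m n. c n a *\<^sub>R grad_field L a z) \<bullet> ?T z \<partial>N) = (\<Sum>a<m n. c n a * (\<integral>z. grad_field L a z \<bullet> ?T z \<partial>N))" for n
    using sqint_integrable_inner[OF sqint_field T] by (simp add: inner_sum_left Bochner_Integration.integral_sum del: inner_scaleR_right)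
  then have "(\<integral>z. (\<Sum>a<m n. c n a *\<^sub>R grad_field L a z) \<bullet> ?T z \<partial>N) = 0" for n using field_orthogonal[OF h \<kappa> v] by simp
  with l2_tendsto_inner[OF s g T lim] show ?thesis by (simp add: LIMSEQ_const_iff)
qed

text \<open>Split the coordinate vector \<open>i\<close> into its parts along and across the frequency. The
  first is tested by a gradient field. For the second, integration by parts does not see the oscillation and
  reduces the test to one of \<open>u\<close>, which tends to zero, in accordance with the orthogonality of
  \<open>g\<close>. At frequency zero \<open>g\<close> is orthogonal to the test as well, and the claim is
  weak convergence.\<close>

lemma gradient_limit_tested:
  fixes U :: "nat \<Rightarrow> real^'n \<Rightarrow> real^'n"
  assumes w: "\<And>n. has_weak_gradient UNIV (u n) (U n)"
    and u: "\<And>n. sqint \<mu> (u n)" "\<And>n. l2norm \<mu> (u n) \<le> B" and U: "\<And>n. sqint \<mu> (U n)" "\<And>n. l2norm \<mu> (U n) \<le> D"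
    and v: "sqint \<mu> v" and V: "sqint \<mu> V"
    and weak: "\<And>f. sqint \<mu> f \<Longrightarrow> (\<lambda>n. \<integral>x. u n x * f x \<partial>\<mu>) \<longlonglongrightarrow> (\<integral>x. v x * f x \<partial>\<mu>)"
      "\<And>f. sqint \<mu> f \<Longrightarrow> (\<lambda>n. \<integral>x. U n x \<bullet> f x \<partial>\<mu>) \<longlonglongrightarrow> (\<integral>x. V x \<bullet> f x \<partial>\<mu>)"
    and r: "strict_mono r" and g: "sqint N g" and field_coeff: "\<And>a. (\<lambda>n. field_coeff U a (r n)) \<longlonglongrightarrow> (\<integral>z. g z \<bullet> grad_field L a z \<partial>N)"
    and lim: "(\<lambda>n::nat. l2norm N (\<lambda>z. (\<Sum>a<m n. c n a *\<^sub>R grad_field L a z) - g z)) \<longlonglongrightarrow> 0"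
  shows "(\<lambda>n. \<integral>x. U (r n) x $ i * (bump_of b x * wave (freq L k) j (x /\<^sub>R \<epsilon> (r n))) \<partial>\<mu>)
      \<longlonglongrightarrow> (\<integral>z. (V (fst z) $ i + g z $ i) * (bump_of b (fst z) * wave (freq L k) j (snd z)) \<partial>N)"
proof -
  define \<kappa> where "\<kappa> = (freq L k :: real^'n)"
  have \<kappa>: "\<kappa> \<in> dual_lattice L" by (simp add: \<kappa>_def freq_in)
  have tb: "test_function UNIV (bump_of b :: real^'n \<Rightarrow> real)" by (rule test_function_bump_of)
  have sb: "sqint \<mu> (bump_of b)" by (rule sqint_test_function[OF tb])
  define t where "t z = bump_of b (fst z) * wave \<kappa> j (snd z)" for z
  have st: "sqint N t" unfolding t_def[abs_def] by (intro sqint_N_product sb smooth_continuous smooth_wave abs_wave_le)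
  have split: "(\<integral>z. (V (fst z) $ i + g z $ i) * t z \<partial>N) = (\<integral>z. V (fst z) $ i * t z \<partial>N) + (\<integral>z. g z $ i * t z \<partial>N)"
    using sqint_integrable_mult[OF sqint_N_fst(1)[OF sqint_component[OF V, of i]] st] sqint_integrable_mult[OF sqint_component[OF g, of i] st]
    by (simp add: distrib_right)
  have Vt: "(\<integral>z. V (fst z) $ i * t z \<partial>N) = (\<integral>x. V x $ i * bump_of b x \<partial>\<mu>) * (\<integral>y. wave \<kappa> j y \<partial>\<nu>)"
    unfolding t_def by (rule integral_N_product(1)[OF sqint_component[OF V] sb smooth_continuous[OF smooth_wave] abs_wave_le])
  show ?thesis
  proof (cases "\<kappa> = 0")
    case True
    have "(\<integral>z. g z \<bullet> (t z *\<^sub>R axis i 1) \<partial>N) = 0" unfolding t_def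
      by (rule field_limit_orthogonal[OF g lim sb \<kappa>]) (simp add: True)
    then have R: "(\<integral>z. (V (fst z) $ i + g z $ i) * t z \<partial>N) = (\<integral>x. V x \<bullet> (bump_of b x *\<^sub>R axis i 1) \<partial>\<mu>) * cos (of_int j * (pi / 2))"
      unfolding split Vt True wave_const
      using finite_measure_cellm(2)[OF L, where 'n='n] by (simp add: inner_axis mult.commute)
    have "(\<lambda>n. (\<integral>x. U n x \<bullet> (bump_of b x *\<^sub>R axis i 1) \<partial>\<mu>) * cos (of_int j * (pi / 2))) \<longlonglongrightarrow> (\<integral>z. (V (fst z) $ i + g z $ i) * t z \<partial>N)"
      unfolding R by (intro tendsto_intros weak sqint_scaleR_const sb)
    from LIMSEQ_subseq_LIMSEQ[OF this r] show ?thesis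
      unfolding \<kappa>_def[symmetric] t_def[symmetric] True wave_const
      by (simp add: o_def inner_axis t_def True wave_const flip: Bochner_Integration.integral_mult_left_zero) (simp add: mult.assoc mult.left_commute mult.commute)?
  next
    case False
    define \<alpha> where "\<alpha> = \<kappa> $ i / (\<kappa> \<bullet> \<kappa>)"
    define p where "p = axis i 1 - \<alpha> *\<^sub>R \<kappa>"
    have kk: "\<kappa> \<bullet> \<kappa> \<noteq> 0" using False by simp
    have p: "\<kappa> \<bullet> p = 0" using kk by (simp add: p_def \<alpha>_def inner_diff_right inner_axis)
    have comp: "q $ i = \<alpha> * (q \<bullet> \<kappa>) + q \<bullet> p" for q :: "real^'n"
      by (simp add: p_def inner_diff_right inner_axis)
    obtain a where a: "field_bump a = (bump_of b :: real^'n \<Rightarrow> real)" "field_freq L a = \<kappa>" "field_phase TYPE('n) a = j"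
      unfolding \<kappa>_def by (rule field_surj[of b L k j])
    have fa: "grad_field L a z = t z *\<^sub>R \<kappa>" for z by (simp add: grad_field_def a t_def)
    have "(\<integral>z. g z \<bullet> (t z *\<^sub>R p) \<partial>N) = 0" unfolding t_def by (rule field_limit_orthogonal[OF g lim sb \<kappa> p])
    moreover have "(\<integral>z. g z $ i * t z \<partial>N) = \<alpha> * (\<integral>z. g z \<bullet> grad_field L a z \<partial>N) + (\<integral>z. g z \<bullet> (t z *\<^sub>R p) \<partial>N)"
    proof -
      have "g z $ i * t z = \<alpha> * (g z \<bullet> grad_field L a z) + g z \<bullet> (t z *\<^sub>R p)" for z
        by (simp add: comp[of "g z"] fa algebra_simps)
      then show ?thesis
        using sqint_integrable_inner[OF g sqint_field[of a]] sqint_integrable_inner[OF g sqint_scaleR_const[OF st, of p]] by simp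
    qed
    ultimately have R: "(\<integral>z. (V (fst z) $ i + g z $ i) * t z \<partial>N) = \<alpha> * (\<integral>z. g z \<bullet> grad_field L a z \<partial>N) - 0"
      unfolding split Vt integral_wave_zero[OF L \<kappa> False] by simp
    define lg where "lg = log_derivative (bump_of b) p"
    have slg: "sqint \<mu> lg" unfolding lg_def by (rule sqint_log_derivative[OF tb])
    have perp: "(\<integral>x. (U n x \<bullet> p) * (bump_of b x * wave \<kappa> j (x /\<^sub>R \<epsilon> n)) \<partial>\<mu>) = - (\<integral>x. u n x * (lg x * wave \<kappa> j (x /\<^sub>R \<epsilon> n)) \<partial>\<mu>)" for n
      using oscillating_integration_by_parts[OF w u(1) U(1) tb, of n p "\<kappa> /\<^sub>R \<epsilon> n" j] p by (simp add: wave_scale lg_def)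
    interpret S: two_scale_seq L \<rho> \<epsilon> u "\<lambda>z. v (fst z)" B by (rule no_oscillation(1)[OF w u U v weak(1)])
    have "S.tested (\<lambda>x y. lg x * wave \<kappa> j y)"
      by (rule S.tested_wave[OF no_oscillation(2)[OF w u U v weak(1)] slg \<kappa>])
    moreover have "(\<integral>z. v (fst z) * (lg (fst z) * wave \<kappa> j (snd z)) \<partial>N) = 0"
      using integral_N_product(1)[OF v slg smooth_continuous[OF smooth_wave] abs_wave_le, of \<kappa> j] integral_wave_zero[OF L \<kappa> False] by simp
    ultimately have "(\<lambda>n. \<integral>x. u n x * (lg x * wave \<kappa> j (x /\<^sub>R \<epsilon> n)) \<partial>\<mu>) \<longlonglongrightarrow> 0" by (simp add: S.tested_def)
    from LIMSEQ_subseq_LIMSEQ[OF this r] have 0: "(\<lambda>n. \<integral>x. u (r n) x * (lg x * wave \<kappa> j (x /\<^sub>R \<epsilon> (r n))) \<partial>\<mu>) \<longlonglongrightarrow> 0" by (simp add: o_def)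
    have eq: "(\<integral>x. U n x $ i * (bump_of b x * wave \<kappa> j (x /\<^sub>R \<epsilon> n)) \<partial>\<mu>) =
        \<alpha> * field_coeff U a n - (\<integral>x. u n x * (lg x * wave \<kappa> j (x /\<^sub>R \<epsilon> n)) \<partial>\<mu>)" for n
    proof -
      have e: "U n x $ i * (bump_of b x * wave \<kappa> j (x /\<^sub>R \<epsilon> n)) =
          \<alpha> * (U n x \<bullet> grad_field L a (x, x /\<^sub>R \<epsilon> n)) + (U n x \<bullet> p) * (bump_of b x * wave \<kappa> j (x /\<^sub>R \<epsilon> n))" for x
        by (simp add: comp[of "U n x"] fa t_def algebra_simps)
      show ?thesis unfolding e field_coeff_def
        using perp[of n] sqint_integrable_inner[OF U(1) sqint_field_osc, of n a n]
          sqint_integrable_mult[OF sqint_inner_right[OF U(1), of n p] sqint_mult_wave(1)[OF sb, of \<kappa> j "\<epsilon> n"]] by simp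
    qed
    show ?thesis unfolding \<kappa>_def[symmetric] eq t_def[symmetric] R
      by (intro tendsto_intros field_coeff 0)
  qed
qed

subsection \<open>The corrector\<close>

text \<open>The phase is lowered by one because the gradient raises it.\<close>

definition potential :: "nat \<Rightarrow> real^'n \<Rightarrow> real^'n \<Rightarrow> real"
  where "potential a x y = field_bump a x * wave (field_freq L a) (field_phase TYPE('n) a - 1) y"

lemma potential_comb:
  fixes x y :: "real^'n"
  shows
  "smooth (\<lambda>y. \<Sum>a<m. c a * potential a x y)" "periodic L (\<lambda>y. \<Sum>a<m. c a * potential a x y)"
  "grad (\<lambda>y. \<Sum>a<m. c a * potential a x y) y = (\<Sum>a<m. c a *\<^sub>R grad_field L a (x, y))"
proof -
  have s: "smooth (\<lambda>y. c a * potential a x y)" for a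
    unfolding potential_def by (intro smooth_mult smooth_const smooth_wave)
  then show "smooth (\<lambda>y. \<Sum>a<m. c a * potential a x y)" by (rule smooth_sum)
  show "periodic L (\<lambda>y. \<Sum>a<m. c a * potential a x y)"
    unfolding periodic_def potential_def
  proof (intro allI sum.cong refl)
    fix y :: "real^'n" and i a
    have "periodic L (wave (field_freq L a :: real^'n) (field_phase TYPE('n) a - 1))" by (rule periodic_wave[OF L field_freq_in])
    then show "c a * (field_bump a x * wave (field_freq L a) (field_phase TYPE('n) a - 1) (y + L *\<^sub>R axis i 1)) = c a * (field_bump a x * wave (field_freq L a) (field_phase TYPE('n) a - 1) y)"
      by (simp add: periodic_def)
  qed
  have "grad (\<lambda>y. c a * (field_bump a x * wave (field_freq L a) (field_phase TYPE('n) a - 1) y)) y = c a *\<^sub>R grad_field L a (x, y)" for a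
    using grad_mult[OF smooth_differentiable[OF smooth_const[of "c a * field_bump a x"]] smooth_differentiable[OF smooth_wave], of "field_freq L a" "field_phase TYPE('n) a - 1" y]
    by (simp add: grad_const grad_wave grad_field_def mult.assoc)
  then have "grad (\<lambda>y. c a * potential a x y) y = c a *\<^sub>R grad_field L a (x, y)" for a by (simp add: potential_def)
  then show "grad (\<lambda>y. \<Sum>a<m. c a * potential a x y) y = (\<Sum>a<m. c a *\<^sub>R grad_field L a (x, y))"
    using grad_sum[of "{..<m}" "\<lambda>a y. c a * potential a x y" y, OF smooth_differentiable[OF s]] by simp
qed

lemma measurable_section:
  fixes g :: "(real^'n) \<times> (real^'n) \<Rightarrow> 'b::euclidean_space"
  assumes "g \<in> borel_measurable (lebesgue \<Otimes>\<^sub>M lebesgue)" shows "(\<lambda>y. g (x, y)) \<in> borel_measurable lebesgue"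
  by (rule measurable_compose[OF measurable_Pair1' assms]) simp

text \<open>Fubini's theorem turns the convergence on the product into convergence of the squared distances of
  the sections in the mean, hence almost everywhere along a subsequence.\<close>

lemma sections_converge:
  fixes f :: "nat \<Rightarrow> (real^'n) \<times> (real^'n) \<Rightarrow> real^'n"
  assumes f: "\<And>n. sqint N (f n)" and g: "sqint N g" and lim: "(\<lambda>n. l2norm N (\<lambda>z. f n z - g z)) \<longlonglongrightarrow> 0"
  obtains s where "strict_mono s"
    "AE x in lebesgue. sqint \<nu> (\<lambda>y. g (x, y)) \<and> (\<lambda>n. l2norm \<nu> (\<lambda>y. f (s n) (x, y) - g (x, y))) \<longlonglongrightarrow> 0"
proof -
  have i: "integrable N (\<lambda>z. (norm (f n z - g z))\<^sup>2)" for n by (intro sqint_integrable_sq sqint_diff f g)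
  define h where "h n x = (\<integral>y. (norm (f n (x, y) - g (x, y)))\<^sup>2 \<partial>\<nu>)" for n x
  have hi: "integrable \<mu> (h n)" for n unfolding h_def[abs_def] using P.integrable_fst'[OF i] .
  have h0: "0 \<le> h n x" for n x by (simp add: h_def)
  have "(\<integral>x. norm (h n x) \<partial>\<mu>) = (l2norm N (\<lambda>z. f n z - g z))\<^sup>2" for n
    unfolding l2norm_sq using P.integral_fst'[OF i, of n] h0 by (simp add: h_def)
  then have "(\<lambda>n. \<integral>x. norm (h n x) \<partial>\<mu>) \<longlonglongrightarrow> 0" using tendsto_power[OF lim, of 2] by simp
  from tendsto_L1_AE_subseq[OF hi this] obtain s where s: "strict_mono s" "AE x in \<mu>. (\<lambda>n. h (s n) x) \<longlonglongrightarrow> 0" by blast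
  have mg: "g \<in> borel_measurable (lebesgue \<Otimes>\<^sub>M lebesgue)" using sqint_measurable[OF g] by simp
  have "AE x in \<mu>. integrable \<nu> (\<lambda>y. (norm (g (x, y)))\<^sup>2)" by (rule P.AE_integrable_fst'[OF sqint_integrable_sq[OF g]])
  with s(2) have "AE x in \<mu>. sqint \<nu> (\<lambda>y. g (x, y)) \<and> (\<lambda>n. l2norm \<nu> (\<lambda>y. f (s n) (x, y) - g (x, y))) \<longlonglongrightarrow> 0"
  proof eventually_elim
    case (elim x)
    have "(\<lambda>n. sqrt (h (s n) x)) \<longlonglongrightarrow> sqrt 0" by (intro tendsto_real_sqrt elim)
    then show ?case using elim(2) measurable_section[OF mg, of x] by (simp add: sqint_def l2norm_def h_def)
  qed
  then show thesis using s(1) that unfolding AE_\<mu> by blast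
qed

text \<open>The slow variable enters a combination of fields only through bumps. By this continuity, the
  potentials at a countable dense set of points approximate those at all points.\<close>

lemma field_comb_continuous:
  fixes x :: "real^'n"
  shows "((\<lambda>q. l2norm \<nu> (\<lambda>y. (\<Sum>a<m. c a *\<^sub>R grad_field L a (x, y)) - (\<Sum>a<m. c a *\<^sub>R grad_field L a (q, y)))) \<longlongrightarrow> 0) (nhds x)"
proof (rule Lim_null_comparison[OF always_eventually])
  let ?M = "\<lambda>q::real^'n. \<Sum>a<m. \<bar>c a\<bar> * (\<bar>field_bump a x - field_bump a q\<bar> * norm (field_freq L a :: real^'n))"
  show "\<forall>q::real^'n. norm (l2norm \<nu> (\<lambda>y. (\<Sum>a<m. c a *\<^sub>R grad_field L a (x, y)) - (\<Sum>a<m. c a *\<^sub>R grad_field L a (q, y)))) \<le> ?M q"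
  proof
    fix q :: "real^'n"
    have cont: "continuous_on UNIV (\<lambda>y. \<Sum>a<m. c a *\<^sub>R grad_field L a (p, y))" for p :: "real^'n"
      unfolding grad_field_def fst_conv snd_conv by (intro continuous_intros smooth_continuous smooth_wave)
    have const: "sqint \<nu> (\<lambda>y. ?M q)" by (intro sqint_cellm_continuous L continuous_intros)
    have M0: "0 \<le> ?M q" by (intro sum_nonneg mult_nonneg_nonneg) auto
    have "l2norm \<nu> (\<lambda>y. (\<Sum>a<m. c a *\<^sub>R grad_field L a (x, y)) - (\<Sum>a<m. c a *\<^sub>R grad_field L a (q, y))) \<le> l2norm \<nu> (\<lambda>y. ?M q)"
    proof (intro l2norm_mono AE_I2 const sqint_diff sqint_cellm_continuous L cont)
      fix y :: "real^'n"
      have "norm ((\<Sum>a<m. c a *\<^sub>R grad_field L a (x, y)) - (\<Sum>a<m. c a *\<^sub>R grad_field L a (q, y)))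
          \<le> (\<Sum>a<m. norm (c a *\<^sub>R grad_field L a (x, y) - c a *\<^sub>R grad_field L a (q, y)))"
        unfolding sum_subtractf[symmetric] by (rule norm_sum)
      also have "\<dots> \<le> ?M q"
      proof (rule sum_mono)
        fix a
        let ?w = "wave (field_freq L a) (field_phase TYPE('n) a) y"
        have "c a *\<^sub>R grad_field L a (x, y) - c a *\<^sub>R grad_field L a (q, y) = (c a * ((field_bump a x - field_bump a q) * ?w)) *\<^sub>R field_freq L a"
          by (simp add: grad_field_def algebra_simps)
        then have "norm (c a *\<^sub>R grad_field L a (x, y) - c a *\<^sub>R grad_field L a (q, y)) = \<bar>c a\<bar> * ((\<bar>field_bump a x - field_bump a q\<bar> * \<bar>?w\<bar>) * norm (field_freq L a :: real^'n))"
          by (simp add: abs_mult)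
        also have "\<dots> \<le> \<bar>c a\<bar> * (\<bar>field_bump a x - field_bump a q\<bar> * norm (field_freq L a :: real^'n))"
          by (intro mult_left_mono mult_right_mono mult_left_le abs_wave_le) auto
        finally show "norm (c a *\<^sub>R grad_field L a (x, y) - c a *\<^sub>R grad_field L a (q, y)) \<le> \<bar>c a\<bar> * (\<bar>field_bump a x - field_bump a q\<bar> * norm (field_freq L a :: real^'n))" .
      qed
      finally show "norm ((\<Sum>a<m. c a *\<^sub>R grad_field L a (x, y)) - (\<Sum>a<m. c a *\<^sub>R grad_field L a (q, y))) \<le> norm (?M q)" using M0 by simp
    qed
    also have "\<dots> = ?M q" using M0 finite_measure_cellm(2)[OF L, where 'n='n] by (simp add: l2norm_def)
    finally show "norm (l2norm \<nu> (\<lambda>y. (\<Sum>a<m. c a *\<^sub>R grad_field L a (x, y)) - (\<Sum>a<m. c a *\<^sub>R grad_field L a (q, y)))) \<le> ?M q" by simp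
  qed
  have fb: "((\<lambda>q::real^'n. field_bump a q) \<longlongrightarrow> field_bump a x) (nhds x)" for a
  proof -
    have "continuous_on UNIV (field_bump a :: real^'n \<Rightarrow> real)" unfolding field_bump_def by (rule smooth_continuous[OF smooth_bump_of])
    then show ?thesis by (simp add: continuous_on_eq_continuous_at isCont_def tendsto_at_iff_tendsto_nhds)
  qed
  have "(?M \<longlongrightarrow> (\<Sum>a<m. \<bar>c a\<bar> * (\<bar>field_bump a x - field_bump a x\<bar> * norm (field_freq L a :: real^'n)))) (nhds x)"
    by (intro tendsto_intros fb)
  then show "(?M \<longlongrightarrow> 0) (nhds x)" by simp
qed

text \<open>Almost every section of \<open>g\<close> is a limit of gradients of periodic potentials, hence the
  gradient of a class by \<open>W_limit\<close>. The classes of the potentials at a countable dense set of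
  points approximate all these classes, which gives the measurability by
  \<open>measurable_W_borel\<close>.\<close>

lemma corrector_exists:
  assumes g: "sqint N g" and lim: "(\<lambda>n::nat. l2norm N (\<lambda>z. (\<Sum>a<m n. c n a *\<^sub>R grad_field L a z) - g z)) \<longlonglongrightarrow> 0"
  obtains \<Phi> where "\<Phi> \<in> L2_W_per L \<rho>" "has_y_gradient L \<Phi> (\<lambda>x y. g (x, y))"
proof -
  define f where "f n z = (\<Sum>a<m n. c n a *\<^sub>R grad_field L a z)" for n and z :: "(real^'n) \<times> (real^'n)"
  define Pt where "Pt n x y = (\<Sum>a<m n. c n a * potential a x y)" for n and x y :: "real^'n"
  have Pt: "smooth (Pt n x)" "periodic L (Pt n x)" "grad (Pt n x) y = f n (x, y)" for n x y
    unfolding Pt_def[abs_def] f_def by (rule potential_comb)+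
  have gPt: "grad (Pt n x) = (\<lambda>y. f n (x, y))" for n x using Pt(3) by blast
  have f: "sqint N (f n)" for n unfolding f_def[abs_def] by (intro sqint_sum sqint_scaleR sqint_field)
  have lim': "(\<lambda>n. l2norm N (\<lambda>z. f n z - g z)) \<longlonglongrightarrow> 0" using lim by (simp add: f_def)
  have mg: "g \<in> borel_measurable (lebesgue \<Otimes>\<^sub>M lebesgue)" using sqint_measurable[OF g] by simp
  obtain s where s: "strict_mono s"
    and ae: "AE x in lebesgue. sqint \<nu> (\<lambda>y. g (x, y)) \<and> (\<lambda>n. l2norm \<nu> (\<lambda>y. f (s n) (x, y) - g (x, y))) \<longlonglongrightarrow> 0"
    using sections_converge[OF f g lim'] .
  obtain Z where Z: "Z \<in> null_sets lebesgue"
    and good: "\<And>x. x \<notin> Z \<Longrightarrow> sqint \<nu> (\<lambda>y. g (x, y)) \<and> (\<lambda>n. l2norm \<nu> (\<lambda>y. f (s n) (x, y) - g (x, y))) \<longlonglongrightarrow> 0"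
  proof (rule AE_E3[OF ae])
    fix Z assume "\<And>x. x \<in> space lebesgue - Z \<Longrightarrow> sqint \<nu> (\<lambda>y. g (x, y)) \<and> (\<lambda>n. l2norm \<nu> (\<lambda>y. f (s n) (x, y) - g (x, y))) \<longlonglongrightarrow> 0"
      "Z \<in> null_sets lebesgue"
    then show thesis by (intro that[of Z]) simp_all
  qed
  \<comment> \<open>On the null set of bad points the corrector is zero, so that it has values in the quotient space everywhere.\<close>
  define G where "G x y = (if x \<in> Z then 0 else g (x, y))" for x y
  have "\<exists>u. u \<in> H1_per L \<and> has_weak_gradient (cell_int L) u (G x)" for x
  proof (cases "x \<in> Z")
    case True
    have "has_weak_gradient (cell_int L) (\<lambda>_. 0) (G x)"
      using has_weak_gradient_smooth[OF smooth_const[of 0], of "cell_int L"] True by (simp add: grad_const[abs_def] G_def[abs_def])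
    moreover have "(\<lambda>_. 0) \<in> (H1_per L :: (real^'n \<Rightarrow> real) set)"
      by (rule smooth_periodic_H1_per[OF L smooth_const]) (simp add: periodic_def)
    ultimately show ?thesis by blast
  next
    case False
    have "(\<lambda>n. l2norm \<nu> (\<lambda>y. grad (Pt (s n) x) y - g (x, y))) \<longlonglongrightarrow> 0" using good[OF False] by (simp add: Pt(3))
    from W_limit[OF L Pt(1,2) conjunct1[OF good[OF False]] this] show ?thesis using False by (auto simp: G_def[abs_def])
  qed
  then obtain u where u: "\<And>x. u x \<in> H1_per L" "\<And>x. has_weak_gradient (cell_int L) (u x) (G x)" by metis
  define \<Phi> where "\<Phi> x = W_class L (u x)" for x
  have \<Phi>: "\<Phi> x \<in> W_per L" for x unfolding \<Phi>_def by (rule W_class_in[OF u(1)])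
  have gr: "AE y in \<nu>. W_gr L (\<Phi> x) y = G x y" for x unfolding \<Phi>_def by (rule W_gr_class[OF L u])
  have mG: "(\<lambda>(x, y). G x y) \<in> borel_measurable (lebesgue \<Otimes>\<^sub>M lebesgue)"
  proof -
    have "(\<lambda>x. indicator (- Z) x :: real) \<in> borel_measurable lebesgue"
      using null_setsD2[OF Z] by (intro borel_measurable_indicator Compl_in_sets_lebesgue[THEN iffD2])
    note m = borel_measurable_scaleR[OF measurable_fst_N[OF this] mg]
    have "(\<lambda>(x, y). G x y) = (\<lambda>z. indicator (- Z) (fst z) *\<^sub>R g z)" by (auto simp: G_def indicator_def)
    then show ?thesis using m by simp
  qed
  have sG: "sqint \<nu> (G x)" for x
    using good[of x] by (cases "x \<in> Z") (auto simp: G_def[abs_def] sqint_zero)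
  obtain D :: "(real^'n) set" where D: "countable D" "\<And>X. open X \<Longrightarrow> X \<noteq> {} \<Longrightarrow> \<exists>d\<in>D. d \<in> X"
    using countable_dense_setE by blast
  define Q where "Q = insert (W_class L (\<lambda>_. 0)) ((\<lambda>(n, q). W_class L (Pt n q)) ` (UNIV \<times> D))"
  have PtH: "Pt n q \<in> H1_per L" for n q by (rule smooth_periodic_H1_per[OF L Pt(1,2)])
  have zeroH: "(\<lambda>_. 0) \<in> (H1_per L :: (real^'n \<Rightarrow> real) set)"
    by (rule smooth_periodic_H1_per[OF L smooth_const]) (simp add: periodic_def)
  have dist: "W_dist L (\<Phi> x) (W_class L v) = sqrt (L ^ CARD('n)) * l2norm \<nu> (\<lambda>y. G x y - w y)"
    if v: "v \<in> H1_per L" "has_weak_gradient (cell_int L) v w" and w: "sqint \<nu> w" for x v w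
  proof -
    have "AE y in \<nu>. W_gr L (\<Phi> x) y - W_gr L (W_class L v) y = G x y - w y"
      using gr[of x] W_gr_class[OF L v] by eventually_elim simp
    then have "l2norm \<nu> (\<lambda>y. W_gr L (\<Phi> x) y - W_gr L (W_class L v) y) = l2norm \<nu> (\<lambda>y. G x y - w y)"
      by (rule l2norm_sqint_AE_cong(1)) (auto intro!: sqint_diff sqint_W_gr L \<Phi> W_class_in v sqint_measurable[OF sqint_diff[OF sG w], simplified])
    then show ?thesis by (simp add: W_dist_eq[OF L \<Phi> W_class_in[OF v(1)]])
  qed
  have meas: "\<Phi> \<in> measurable lebesgue (W_borel L)"
  proof (rule measurable_W_borel[OF L \<Phi> mG gr])
    show "countable Q" unfolding Q_def using D(1) by (intro countable_insert countable_image countable_SIGMA) auto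
    show "Q \<subseteq> W_per L" unfolding Q_def using W_class_in[OF PtH] W_class_in[OF zeroH] by auto
    fix x and e :: real assume e: "e > 0"
    show "\<exists>U\<in>Q. W_dist L (\<Phi> x) U < e"
    proof (cases "x \<in> Z")
      case True
      have "W_dist L (\<Phi> x) (W_class L (\<lambda>_. 0)) = sqrt (L ^ CARD('n)) * l2norm \<nu> (\<lambda>y. G x y - 0)"
        using has_weak_gradient_smooth[OF smooth_const[of 0], of "cell_int L"] by (intro dist zeroH sqint_zero) (simp add: grad_const[abs_def])
      also have "\<dots> = 0" using True by (simp add: G_def l2norm_def)
      finally show ?thesis using e unfolding Q_def by auto
    next
      case False
      define \<delta> where "\<delta> = e / (2 * sqrt (L ^ CARD('n)))"
      have sL: "sqrt (L ^ CARD('n)) > 0" using L by simp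
      then have \<delta>: "\<delta> > 0" using e by (simp add: \<delta>_def)
      have "eventually (\<lambda>n. l2norm \<nu> (\<lambda>y. f (s n) (x, y) - g (x, y)) < \<delta>) sequentially"
        using good[OF False] \<delta> order_tendstoD(2) by blast
      then obtain n where n: "l2norm \<nu> (\<lambda>y. f (s n) (x, y) - g (x, y)) < \<delta>" by (auto simp: eventually_sequentially)
      have "eventually (\<lambda>q. l2norm \<nu> (\<lambda>y. f (s n) (x, y) - f (s n) (q, y)) < \<delta>) (nhds x)"
        using order_tendstoD(2)[OF field_comb_continuous \<delta>] unfolding f_def .
      then obtain X where X: "open X" "x \<in> X" "\<And>q. q \<in> X \<Longrightarrow> l2norm \<nu> (\<lambda>y. f (s n) (x, y) - f (s n) (q, y)) < \<delta>"
        unfolding eventually_nhds by blast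
      obtain q where q: "q \<in> D" "q \<in> X" using D(2)[OF X(1)] X(2) by blast
      have sf: "sqint \<nu> (\<lambda>y. f k (p, y))" for k p
        using sqint_cellm_continuous[OF L smooth_grad_continuous[OF Pt(1)], of k p] by (simp add: gPt)
      have "W_dist L (\<Phi> x) (W_class L (Pt (s n) q)) = sqrt (L ^ CARD('n)) * l2norm \<nu> (\<lambda>y. G x y - f (s n) (q, y))"
        using has_weak_gradient_smooth[OF Pt(1), of "cell_int L" "s n" q] by (intro dist PtH sf) (simp add: gPt)
      also have "l2norm \<nu> (\<lambda>y. G x y - f (s n) (q, y)) \<le> l2norm \<nu> (\<lambda>y. G x y - f (s n) (x, y)) + l2norm \<nu> (\<lambda>y. f (s n) (x, y) - f (s n) (q, y))"
        by (rule l2norm_triangle_diff[OF sG sf sf])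
      also have "l2norm \<nu> (\<lambda>y. G x y - f (s n) (x, y)) = l2norm \<nu> (\<lambda>y. f (s n) (x, y) - g (x, y))"
        using False by (simp add: G_def l2norm_minus_commute[of _ "\<lambda>y. g (x, y)"])
      finally have "W_dist L (\<Phi> x) (W_class L (Pt (s n) q)) \<le> sqrt (L ^ CARD('n)) * (l2norm \<nu> (\<lambda>y. f (s n) (x, y) - g (x, y)) + l2norm \<nu> (\<lambda>y. f (s n) (x, y) - f (s n) (q, y)))"
        using sL by simp
      also have "\<dots> < sqrt (L ^ CARD('n)) * (\<delta> + \<delta>)" using n X(3)[OF q(2)] sL by (intro mult_strict_left_mono add_strict_mono)
      also have "\<dots> = e" using sL L by (simp add: \<delta>_def field_simps)
      finally show ?thesis using q(1) unfolding Q_def by auto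
    qed
  qed
  have Wn: "(W_norm L (\<Phi> x))\<^sup>2 = L ^ CARD('n) * (\<integral>y. (norm (G x y))\<^sup>2 \<partial>\<nu>)" for x
  proof -
    have "l2norm \<nu> (W_gr L (\<Phi> x)) = l2norm \<nu> (G x)"
      by (rule l2norm_sqint_AE_cong(1)[OF gr sqint_W_gr[OF L \<Phi>] sqint_measurable[OF sG]])
    then show ?thesis using L by (simp add: W_norm_eq[OF L \<Phi>] power_mult_distrib l2norm_sq)
  qed
  have iG: "integrable \<mu> (\<lambda>x. \<integral>y. (norm (G x y))\<^sup>2 \<partial>\<nu>)"
  proof -
    have a: "AE x in \<mu>. (\<integral>y. (norm (g (x, y)))\<^sup>2 \<partial>\<nu>) = (\<integral>y. (norm (G x y))\<^sup>2 \<partial>\<nu>)"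
      unfolding AE_\<mu> using AE_not_in[OF Z] by eventually_elim (simp add: G_def)
    have m: "(\<lambda>x. \<integral>y. (norm (G x y))\<^sup>2 \<partial>\<nu>) \<in> borel_measurable \<mu>"
    proof -
      have "(\<lambda>(x, y). (norm (G x y))\<^sup>2) \<in> borel_measurable N" using mG by (simp add: case_prod_beta)
      then show ?thesis by (rule C.borel_measurable_lebesgue_integral)
    qed
    show ?thesis by (rule integrable_cong_AE_imp[OF P.integrable_fst'[OF sqint_integrable_sq[OF g]] m a])
  qed
  have "\<Phi> \<in> L2_W_per L \<rho>"
  proof -
    have "integrable \<mu> (\<lambda>x. (W_norm L (\<Phi> x))\<^sup>2)" unfolding Wn using iG by simp
    moreover have m: "(\<lambda>x. (W_norm L (\<Phi> x))\<^sup>2) \<in> borel_measurable lebesgue" unfolding Wn using iG by auto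
    ultimately have "integrable lebesgue (\<lambda>x. (W_norm L (\<Phi> x))\<^sup>2 * \<rho> x)" using integral_\<mu>(2)[OF m] by (simp add: mult.commute)
    then show ?thesis using meas by (simp add: L2_W_per_def)
  qed
  moreover have "has_y_gradient L \<Phi> (\<lambda>x y. g (x, y))"
    unfolding has_y_gradient_def
  proof
    have cs: "UNIV \<times> cell L \<in> sets (lebesgue \<Otimes>\<^sub>M (lebesgue :: (real^'n) measure))" by (intro pair_measureI) auto
    show "set_borel_measurable (lebesgue \<Otimes>\<^sub>M lebesgue) (UNIV \<times> cell L) (\<lambda>(x, y). g (x, y))"
      unfolding set_borel_measurable_def using mg cs by (auto intro!: borel_measurable_scaleR borel_measurable_indicator)
    show "AE x in lebesgue. \<forall>w\<in>\<Phi> x. has_weak_gradient (cell_int L) w (\<lambda>y. g (x, y))"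
      using AE_not_in[OF Z]
    proof eventually_elim
      case (elim x)
      then have "G x = (\<lambda>y. g (x, y))" by (simp add: G_def[abs_def])
      then show ?case using W_class_weak_gradient[OF _ u(2)[of x]] unfolding \<Phi>_def by auto
    qed
  qed
  ultimately show thesis by (rule that)
qed

end

section \<open>Weak convergence and two-scale compactness\<close>

lemma locally_integrable_UNIV_measurable:
  fixes f :: "real^'n \<Rightarrow> 'b::euclidean_space"
  assumes "locally_integrable UNIV f" shows "f \<in> borel_measurable lebesgue"
proof (rule borel_measurable_LIMSEQ_metric)
  show "(\<lambda>x. indicator (cball 0 (real n)) x *\<^sub>R f x) \<in> borel_measurable lebesgue" for n
    using assms unfolding locally_integrable_def set_integrable_def by (auto intro: borel_measurable_integrable)
  show "(\<lambda>n. indicator (cball 0 (real n)) x *\<^sub>R f x) \<longlonglongrightarrow> f x" for x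
  proof (rule tendsto_eventually)
    obtain k where "norm x \<le> real k" using real_arch_simple by blast
    then show "\<forall>\<^sub>F n in sequentially. indicator (cball 0 (real n)) x *\<^sub>R f x = f x"
      by (intro eventually_sequentiallyI[of k]) (simp add: indicator_def)
  qed
qed

lemma weak_gradient_measurable: "has_weak_gradient UNIV u g \<Longrightarrow> g \<in> borel_measurable lebesgue"
  by (simp add: has_weak_gradient_def locally_integrable_UNIV_measurable)

context two_scale
begin

lemma H1_weightedE:
  assumes "u \<in> H1 UNIV \<rho>"
  shows "sqint \<mu> u" "sqint \<mu> (weak_grad UNIV u)" "has_weak_gradient UNIV u (weak_grad UNIV u)"
    "l2norm \<mu> u \<le> H1_norm UNIV \<rho> u" "l2norm \<mu> (weak_grad UNIV u) \<le> H1_norm UNIV \<rho> u"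
proof -
  show w: "has_weak_gradient UNIV u (weak_grad UNIV u)"
    using assms has_weak_gradient_weak_grad by (auto simp: H1_def)
  show s: "sqint \<mu> u" "sqint \<mu> (weak_grad UNIV u)"
    using assms weak_gradient_measurable[OF w] unfolding sqint_\<mu>_iff
    by (simp_all add: H1_def set_borel_measurable_def set_integrable_def)
  have eq: "(l2norm \<mu> f)\<^sup>2 = (LINT x:UNIV|lebesgue. (norm (f x))\<^sup>2 * \<rho> x)" if "sqint \<mu> f" for f :: "real^'n \<Rightarrow> 'b::euclidean_space"
  proof -
    have "(\<lambda>x. (norm (f x))\<^sup>2) \<in> borel_measurable lebesgue" using sqint_integrable_sq[OF that] by auto
    then show ?thesis by (simp add: l2norm_sq integral_\<mu>(1) set_lebesgue_integral_def mult.commute)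
  qed
  have "H1_norm UNIV \<rho> u = sqrt ((l2norm \<mu> u)\<^sup>2 + (l2norm \<mu> (weak_grad UNIV u))\<^sup>2)"
    unfolding eq[OF s(1)] eq[OF s(2)] by (simp add: H1_norm_def)
  then show "l2norm \<mu> u \<le> H1_norm UNIV \<rho> u" "l2norm \<mu> (weak_grad UNIV u) \<le> H1_norm UNIV \<rho> u"
    by (simp_all add: real_le_rsqrt)
qed

lemma H1_functional_mean:
  assumes f: "sqint \<mu> f" shows "H1_functional UNIV \<rho> (\<lambda>u. \<integral>x. u x * f x \<partial>\<mu>)"
  unfolding H1_functional_def
proof (intro conjI ballI allI exI)
  fix u assume u: "u \<in> H1 UNIV \<rho>"
  note i = sqint_integrable_mult[OF H1_weightedE(1) f]
  show "(\<integral>x. (u x + v x) * f x \<partial>\<mu>) = (\<integral>x. u x * f x \<partial>\<mu>) + (\<integral>x. v x * f x \<partial>\<mu>)" if "v \<in> H1 UNIV \<rho>" for v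
    using i[OF u] i[OF that] by (simp add: distrib_right)
  show "(\<integral>x. (c * u x) * f x \<partial>\<mu>) = c * (\<integral>x. u x * f x \<partial>\<mu>)" for c by (simp add: mult.assoc)
  have "\<bar>\<integral>x. u x * f x \<partial>\<mu>\<bar> \<le> l2norm \<mu> u * l2norm \<mu> f" using l2_Cauchy_Schwarz[OF H1_weightedE(1)[OF u] f] by simp
  also have "\<dots> \<le> l2norm \<mu> f * H1_norm UNIV \<rho> u"
    using mult_left_mono[OF H1_weightedE(4)[OF u] l2norm_nonneg[of \<mu> f]] by (simp add: mult.commute)
  finally show "\<bar>\<integral>x. u x * f x \<partial>\<mu>\<bar> \<le> l2norm \<mu> f * H1_norm UNIV \<rho> u" .
qed

text \<open>Weak gradients are chosen representatives, so their linearity holds only almost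
  everywhere.\<close>

lemma H1_functional_gradient_mean:
  fixes f :: "real^'n \<Rightarrow> real^'n"
  assumes f: "sqint \<mu> f" shows "H1_functional UNIV \<rho> (\<lambda>u. \<integral>x. weak_grad UNIV u x \<bullet> f x \<partial>\<mu>)"
  unfolding H1_functional_def
proof (intro conjI ballI allI exI)
  have lin: "(\<integral>x. weak_grad UNIV (\<lambda>x. a * u x + b * v x) x \<bullet> f x \<partial>\<mu>) =
      a * (\<integral>x. weak_grad UNIV u x \<bullet> f x \<partial>\<mu>) + b * (\<integral>x. weak_grad UNIV v x \<bullet> f x \<partial>\<mu>)"
    if "u \<in> H1 UNIV \<rho>" "v \<in> H1 UNIV \<rho>" for u v and a b :: real
  proof -
    note U = H1_weightedE[OF that(1)] and V = H1_weightedE[OF that(2)]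
    let ?w = "weak_grad UNIV (\<lambda>x. a * u x + b * v x)"
    have l: "has_weak_gradient UNIV (\<lambda>x. a * u x + b * v x) (\<lambda>x. a *\<^sub>R weak_grad UNIV u x + b *\<^sub>R weak_grad UNIV v x)"
      by (rule has_weak_gradient_lin[OF U(3) V(3)])
    have ae: "AE x in lebesgue. ?w x = a *\<^sub>R weak_grad UNIV u x + b *\<^sub>R weak_grad UNIV v x"
      using weak_grad_AE[OF open_UNIV l] by simp
    have m: "?w \<in> borel_measurable \<mu>" "f \<in> borel_measurable \<mu>"
        "weak_grad UNIV u \<in> borel_measurable \<mu>" "weak_grad UNIV v \<in> borel_measurable \<mu>"
      using weak_gradient_measurable[OF has_weak_gradient_weak_grad[OF l]] sqint_measurable[OF f]
        sqint_measurable[OF U(2)] sqint_measurable[OF V(2)] by auto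
    have "(\<integral>x. ?w x \<bullet> f x \<partial>\<mu>) = (\<integral>x. a * (weak_grad UNIV u x \<bullet> f x) + b * (weak_grad UNIV v x \<bullet> f x) \<partial>\<mu>)"
    proof (rule integral_cong_AE)
      show "AE x in \<mu>. ?w x \<bullet> f x = a * (weak_grad UNIV u x \<bullet> f x) + b * (weak_grad UNIV v x \<bullet> f x)"
        unfolding AE_\<mu> using ae by eventually_elim (simp add: inner_add_left)
      show "(\<lambda>x. ?w x \<bullet> f x) \<in> borel_measurable \<mu>" by (rule borel_measurable_inner[OF m(1,2)])
      show "(\<lambda>x. a * (weak_grad UNIV u x \<bullet> f x) + b * (weak_grad UNIV v x \<bullet> f x)) \<in> borel_measurable \<mu>"
        by (intro borel_measurable_add borel_measurable_times borel_measurable_const borel_measurable_inner m)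
    qed
    then show ?thesis using sqint_integrable_inner[OF U(2) f] sqint_integrable_inner[OF V(2) f] by simp
  qed
  fix u assume u: "u \<in> H1 UNIV \<rho>"
  show "(\<integral>x. weak_grad UNIV (\<lambda>x. u x + v x) x \<bullet> f x \<partial>\<mu>) = (\<integral>x. weak_grad UNIV u x \<bullet> f x \<partial>\<mu>) + (\<integral>x. weak_grad UNIV v x \<bullet> f x \<partial>\<mu>)"
    if "v \<in> H1 UNIV \<rho>" for v
    using lin[OF u that, of 1 1] by simp
  show "(\<integral>x. weak_grad UNIV (\<lambda>x. c * u x) x \<bullet> f x \<partial>\<mu>) = c * (\<integral>x. weak_grad UNIV u x \<bullet> f x \<partial>\<mu>)" for c
    using lin[OF u u, of c 0] by simp
  have "\<bar>\<integral>x. weak_grad UNIV u x \<bullet> f x \<partial>\<mu>\<bar> \<le> l2norm \<mu> (weak_grad UNIV u) * l2norm \<mu> f"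
    by (rule l2_Cauchy_Schwarz[OF H1_weightedE(2)[OF u] f])
  also have "\<dots> \<le> l2norm \<mu> f * H1_norm UNIV \<rho> u"
    using mult_left_mono[OF H1_weightedE(5)[OF u] l2norm_nonneg[of \<mu> f]] by (simp add: mult.commute)
  finally show "\<bar>\<integral>x. weak_grad UNIV u x \<bullet> f x \<partial>\<mu>\<bar> \<le> l2norm \<mu> f * H1_norm UNIV \<rho> u" .
qed

lemma weakly_convergent_bounded:
  fixes u :: "nat \<Rightarrow> real^'n \<Rightarrow> 'b::euclidean_space"
  assumes "\<And>n. sqint \<mu> (u n)" "\<And>f. sqint \<mu> f \<Longrightarrow> (\<lambda>n. \<integral>x. u n x \<bullet> f x \<partial>\<mu>) \<longlonglongrightarrow> l f"
  obtains B where "\<And>n. l2norm \<mu> (u n) \<le> B"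
proof -
  have "\<exists>C. \<forall>n. \<bar>\<integral>x. u n x \<bullet> f x \<partial>\<mu>\<bar> \<le> C" if "sqint \<mu> f" for f
    using convergent_imp_Bseq[of "\<lambda>n. \<integral>x. u n x \<bullet> f x \<partial>\<mu>"] assms(2)[OF that] unfolding Bseq_def convergent_def by auto
  from l2_uniform_boundedness[OF assms(1) this] show thesis using that by blast
qed

theorem two_scale_compactness:
  assumes weak: "H1_weakly_convergent UNIV \<rho> u v"
  shows "two_scale_convergent L \<rho> \<epsilon> u (\<lambda>x y. v x)"
    "\<exists>r \<Phi> g. strict_mono r \<and> \<Phi> \<in> L2_W_per L \<rho> \<and> has_y_gradient L \<Phi> g \<and>
      (\<forall>i. two_scale_convergent L \<rho> (\<epsilon> \<circ> r) (\<lambda>n x. weak_grad UNIV (u (r n)) x $ i) (\<lambda>x y. weak_grad UNIV v x $ i + g x y $ i))"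
proof -
  have uH: "u n \<in> H1 UNIV \<rho>" and vH: "v \<in> H1 UNIV \<rho>" for n using weak by (auto simp: H1_weakly_convergent_def)
  note U = H1_weightedE[OF uH] and V = H1_weightedE[OF vH]
  have wk: "(\<lambda>n. \<integral>x. u n x * f x \<partial>\<mu>) \<longlonglongrightarrow> (\<integral>x. v x * f x \<partial>\<mu>)" if "sqint \<mu> f" for f
    using weak H1_functional_mean[OF that] unfolding H1_weakly_convergent_def by blast
  have wkg: "(\<lambda>n. \<integral>x. weak_grad UNIV (u n) x \<bullet> f x \<partial>\<mu>) \<longlonglongrightarrow> (\<integral>x. weak_grad UNIV v x \<bullet> f x \<partial>\<mu>)" if "sqint \<mu> f" for f
    using weak H1_functional_gradient_mean[OF that] unfolding H1_weakly_convergent_def by blast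
  obtain B where B: "\<And>n. l2norm \<mu> (u n) \<le> B"
  proof (rule weakly_convergent_bounded[of u "\<lambda>f. \<integral>x. v x * f x \<partial>\<mu>", OF U(1)])
    show "(\<lambda>n. \<integral>x. u n x \<bullet> f x \<partial>\<mu>) \<longlonglongrightarrow> (\<integral>x. v x * f x \<partial>\<mu>)" if "sqint \<mu> f" for f using wk[OF that] by simp
  qed blast
  obtain D where D: "\<And>n. l2norm \<mu> (weak_grad UNIV (u n)) \<le> D"
    by (rule weakly_convergent_bounded[of "\<lambda>n. weak_grad UNIV (u n)", OF U(2) wkg]) (assumption, rule that)
  interpret S: two_scale_seq L \<rho> \<epsilon> u "\<lambda>z. v (fst z)" B
    by (rule no_oscillation(1)[OF U(3) U(1) B U(2) D V(1) wk])
  show "two_scale_convergent L \<rho> \<epsilon> u (\<lambda>x y. v x)"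
    using S.two_scale_convergentI[OF no_oscillation(2)[OF U(3) U(1) B U(2) D V(1) wk]] by simp
  obtain r g m c where r: "strict_mono r" and g: "sqint N g"
    and co: "\<And>a. (\<lambda>n. field_coeff (\<lambda>n. weak_grad UNIV (u n)) a (r n)) \<longlonglongrightarrow> (\<integral>z. g z \<bullet> grad_field L a z \<partial>N)"
    and lim: "(\<lambda>n::nat. l2norm N (\<lambda>z. (\<Sum>a<m n. c n a *\<^sub>R grad_field L a z) - g z)) \<longlonglongrightarrow> 0"
    by (rule two_scale_field_limit[of "\<lambda>n. weak_grad UNIV (u n)" D, OF U(2) D]) (rule that)
  obtain \<Phi> where \<Phi>: "\<Phi> \<in> L2_W_per L \<rho>" "has_y_gradient L \<Phi> (\<lambda>x y. g (x, y))"
    using corrector_exists[OF g lim] .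
  have "two_scale_convergent L \<rho> (\<epsilon> \<circ> r) (\<lambda>n x. weak_grad UNIV (u (r n)) x $ i) (\<lambda>x y. weak_grad UNIV v x $ i + g (x, y) $ i)" for i
  proof -
    interpret R: two_scale_seq L \<rho> "\<epsilon> \<circ> r" "\<lambda>n x. weak_grad UNIV (u (r n)) x $ i" "\<lambda>z. weak_grad UNIV v (fst z) $ i + g z $ i" D
    proof unfold_locales
      show "(\<epsilon> \<circ> r) \<longlonglongrightarrow> 0" by (rule LIMSEQ_subseq_LIMSEQ[OF \<epsilon>_lim r])
      show "(\<epsilon> \<circ> r) n > 0" for n by (simp add: \<epsilon>_pos)
      show "sqint \<mu> (\<lambda>x. weak_grad UNIV (u (r n)) x $ i)" for n by (rule sqint_component[OF U(2)])
      have "l2norm \<mu> (\<lambda>x. weak_grad UNIV (u (r n)) x $ i) \<le> l2norm \<mu> (weak_grad UNIV (u (r n)))" for n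
        by (rule l2norm_mono[OF sqint_component[OF U(2)] U(2)]) (simp add: component_le_norm_cart)
      then show "l2norm \<mu> (\<lambda>x. weak_grad UNIV (u (r n)) x $ i) \<le> D" for n using D order_trans by blast
      show "sqint N (\<lambda>z. weak_grad UNIV v (fst z) $ i + g z $ i)"
        by (intro sqint_add sqint_component[OF g] sqint_component[OF sqint_N_fst(1)[OF V(2)]])
    qed (rule L smooth_\<rho> \<rho>_pos \<rho>_int)+
    have "two_scale_convergent L \<rho> (\<epsilon> \<circ> r) (\<lambda>n x. weak_grad UNIV (u (r n)) x $ i)
      (\<lambda>x y. weak_grad UNIV v (fst (x, y)) $ i + g (x, y) $ i)"
      by (rule R.two_scale_convergentI)
        (use gradient_limit_tested[OF U(3) U(1) B U(2) D V(1) V(2) wk wkg r g co lim] in simp)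
    then show ?thesis by simp
  qed
  then show "\<exists>r \<Phi> g. strict_mono r \<and> \<Phi> \<in> L2_W_per L \<rho> \<and> has_y_gradient L \<Phi> g \<and>
      (\<forall>i. two_scale_convergent L \<rho> (\<epsilon> \<circ> r) (\<lambda>n x. weak_grad UNIV (u (r n)) x $ i) (\<lambda>x y. weak_grad UNIV v x $ i + g x y $ i))"
    using r \<Phi> by (intro exI[of _ r] exI[of _ \<Phi>] exI[of _ "\<lambda>x y. g (x, y)"]) simp
qed

end

subsection \<open>The vanishing weight\<close>

lemma two_scale_convergent_zero:
  assumes "\<And>n. u n \<in> borel_measurable lebesgue" "(\<lambda>(x, y). u0 x y) \<in> borel_measurable (lebesgue \<Otimes>\<^sub>M (lebesgue :: (real^'n) measure))"
  shows "two_scale_convergent L (\<lambda>x::real^'n. 0) \<epsilon> u u0"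
proof -
  have "UNIV \<times> cell L \<in> sets (lebesgue \<Otimes>\<^sub>M (lebesgue :: (real^'n) measure))" by (intro pair_measureI) auto
  then have "set_borel_measurable (lebesgue \<Otimes>\<^sub>M lebesgue) (UNIV \<times> cell L) (\<lambda>(x, y). u0 x y)"
    unfolding set_borel_measurable_def using assms(2) by (intro borel_measurable_scaleR borel_measurable_indicator)
  then show ?thesis using assms(1)
    by (auto simp: two_scale_convergent_def L2_def L2_cell_def set_integrable_def set_lebesgue_integral_def case_prod_beta)
qed

lemma zero_corrector:
  assumes L: "L > 0"
  defines "\<Phi> \<equiv> (\<lambda>x::real^'n. W_class L (\<lambda>_::real^'n. 0 :: real))"
  shows "\<Phi> \<in> L2_W_per L (\<lambda>_. 0)" "has_y_gradient L \<Phi> (\<lambda>_ _. 0)"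
proof -
  have H: "(\<lambda>_. 0) \<in> (H1_per L :: (real^'n \<Rightarrow> real) set)"
    by (rule smooth_periodic_H1_per[OF L smooth_const]) (simp add: periodic_def)
  have w: "has_weak_gradient (cell_int L) (\<lambda>_. 0) (\<lambda>_::real^'n. 0 :: real^'n)"
    using has_weak_gradient_smooth[OF smooth_const[of 0], of "cell_int L"] by (simp add: grad_const[abs_def])
  interpret M: Metric_space "W_per L :: (real^'n \<Rightarrow> real) set set" "W_dist L" by (rule Metric_space_W[OF L])
  have "\<Phi> \<in> measurable lebesgue (W_borel L)"
  proof (rule measurable_W_borel[OF L, of _ "\<lambda>_ _. 0" "{W_class L (\<lambda>_. 0)}"])
    show "\<Phi> x \<in> W_per L" for x unfolding \<Phi>_def by (rule W_class_in[OF H])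
    show "AE y in cellm L. W_gr L (\<Phi> x) y = 0" for x unfolding \<Phi>_def by (rule W_gr_class[OF L H w])
    show "\<exists>U\<in>{W_class L (\<lambda>_. 0)}. W_dist L (\<Phi> x) U < e" if "e > 0" for x and e :: real
      using that W_class_in[OF H] by (simp add: \<Phi>_def)
  qed (use W_class_in[OF H] in auto)
  then show "\<Phi> \<in> L2_W_per L (\<lambda>_. 0)" by (simp add: L2_W_per_def)
  show "has_y_gradient L \<Phi> (\<lambda>_ _. 0)"
    unfolding has_y_gradient_def \<Phi>_def set_borel_measurable_def by (auto intro: W_class_weak_gradient[OF _ w])
qed

lemma H1_UNIV_measurable:
  assumes "u \<in> H1 UNIV \<rho>"
  shows "u \<in> borel_measurable lebesgue" "weak_grad UNIV u \<in> borel_measurable lebesgue"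
proof -
  obtain g where "has_weak_gradient UNIV u g" using assms by (auto simp: H1_def)
  from has_weak_gradient_weak_grad[OF this] show "u \<in> borel_measurable lebesgue" "weak_grad UNIV u \<in> borel_measurable lebesgue"
    by (auto simp: has_weak_gradient_def intro: locally_integrable_UNIV_measurable)
qed

text \<open>If \<open>exp (- V / \<sigma>)\<close> had no integral, the normalising integral would take the
  default value zero, and division by it would give the weight zero. Then all integrals in the definition of
  two-scale convergence vanish, and the zero class is a corrector.\<close>

lemma two_scale_compactness_zero_weight:
  fixes u :: "nat \<Rightarrow> real^'n \<Rightarrow> real"
  assumes L: "L > 0" and u: "\<And>n. u n \<in> H1 UNIV (\<lambda>_. 0)" and v: "v \<in> H1 UNIV (\<lambda>_. 0)"
  shows "two_scale_convergent L (\<lambda>_. 0) \<epsilon> u (\<lambda>x y. v x)"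
    "\<exists>r \<Phi> g. strict_mono r \<and> \<Phi> \<in> L2_W_per L (\<lambda>_. 0) \<and> has_y_gradient L \<Phi> g \<and>
      (\<forall>i. two_scale_convergent L (\<lambda>_. 0) (\<epsilon> \<circ> r) (\<lambda>n x. weak_grad UNIV (u (r n)) x $ i) (\<lambda>x y. weak_grad UNIV v x $ i + g x y $ i))"
proof -
  have fst: "(\<lambda>(x, y). f x) \<in> borel_measurable (lebesgue \<Otimes>\<^sub>M (lebesgue :: (real^'n) measure))"
    if "f \<in> borel_measurable lebesgue" for f :: "real^'n \<Rightarrow> real"
    unfolding case_prod_beta by (rule measurable_compose[OF measurable_fst that])
  have comp: "(\<lambda>x. weak_grad UNIV w x $ i) \<in> borel_measurable lebesgue" if "w \<in> H1 UNIV (\<lambda>_. 0)" for w :: "real^'n \<Rightarrow> real" and i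
    using borel_measurable_inner[OF H1_UNIV_measurable(2)[OF that] borel_measurable_const[of "axis i 1"]] by (simp add: inner_axis)
  show "two_scale_convergent L (\<lambda>_. 0) \<epsilon> u (\<lambda>x y. v x)"
    by (intro two_scale_convergent_zero fst H1_UNIV_measurable(1)[OF u] H1_UNIV_measurable(1)[OF v])
  have "two_scale_convergent L (\<lambda>_. 0) (\<epsilon> \<circ> id) (\<lambda>n x. weak_grad UNIV (u (id n)) x $ i) (\<lambda>x y. weak_grad UNIV v x $ i + (0 :: real^'n) $ i)" for i
    by (intro two_scale_convergent_zero) (simp_all add: comp u v fst)
  then show "\<exists>r \<Phi> g. strict_mono r \<and> \<Phi> \<in> L2_W_per L (\<lambda>_. 0) \<and> has_y_gradient L \<Phi> g \<and>
      (\<forall>i. two_scale_convergent L (\<lambda>_. 0) (\<epsilon> \<circ> r) (\<lambda>n x. weak_grad UNIV (u (r n)) x $ i) (\<lambda>x y. weak_grad UNIV v x $ i + g x y $ i))"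
    using zero_corrector[OF L, where 'n='n]
    by (intro exI[of _ id] exI[of _ "\<lambda>x. W_class L (\<lambda>_. 0)"] exI[of _ "\<lambda>_ _. 0"]) (simp add: strict_mono_id)
qed

section \<open>The Gibbs weight\<close>

lemma two_scale_gibbs:
  fixes V :: "real^'n \<Rightarrow> real"
  assumes "L > 0" and V: "smooth V" and Z: "(LINT z|lebesgue. exp (- V z / \<sigma>)) \<noteq> 0"
    and "\<And>n. \<epsilon> n > 0" "\<epsilon> \<longlonglongrightarrow> 0"
  shows "two_scale L (gibbs \<sigma> V) \<epsilon>"
proof unfold_locales
  let ?Z = "LINT z|lebesgue. exp (- V z / \<sigma>)"
  have Zpos: "?Z > 0" using Z Bochner_Integration.integral_nonneg[of lebesgue "\<lambda>z. exp (- V z / \<sigma>)"] by (simp add: less_le)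
  have i: "integrable lebesgue (\<lambda>z. exp (- V z / \<sigma>))" using Z not_integrable_integral_eq by blast
  have eq: "gibbs \<sigma> V = (\<lambda>x. exp ((- 1 / \<sigma>) * V x) * (1 / ?Z))" by (simp add: gibbs_def[abs_def])
  show "smooth (gibbs \<sigma> V)" unfolding eq by (intro smooth_mult smooth_exp smooth_const V)
  show "gibbs \<sigma> V x > 0" for x using Zpos by (simp add: gibbs_def)
  show "integrable lebesgue (gibbs \<sigma> V)" unfolding gibbs_def[abs_def] using i by (rule integrable_divide_zero)
qed (use assms in auto)

theorem proposition3p9:
  fixes V :: "real^'n \<Rightarrow> real" and \<phi>0 :: "real^'n \<Rightarrow> real"
    and \<phi> :: "nat \<Rightarrow> real^'n \<Rightarrow> real" and \<epsilon> :: "nat \<Rightarrow> real"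
    and \<sigma> L a b :: real
  assumes "\<sigma> > 0" and "L > 0"
    and "smooth V"
    and "\<exists>C m. \<forall>x. V x \<le> C * (1 + norm x ^ m)"
    and "\<exists>c. \<forall>x. c \<le> V x"
    and "a > 0" and "b > 0"
    and "\<forall>x. - (grad V x \<bullet> x) \<le> a - b * (norm x)\<^sup>2"
    and "\<forall>n. \<epsilon> n > 0" and "\<epsilon> \<longlonglongrightarrow> 0"
    and "H1_weakly_convergent UNIV (gibbs \<sigma> V) \<phi> \<phi>0"
  shows "two_scale_convergent L (gibbs \<sigma> V) \<epsilon> \<phi> (\<lambda>x y. \<phi>0 x) \<and>
    (\<exists>r \<phi>1 g. strict_mono r \<and> \<phi>1 \<in> L2_W_per L (gibbs \<sigma> V) \<and> has_y_gradient L \<phi>1 g \<and>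
      (\<forall>i. two_scale_convergent L (gibbs \<sigma> V) (\<epsilon> \<circ> r)
        (\<lambda>n x. weak_grad UNIV (\<phi> (r n)) x $ i)
        (\<lambda>x y. weak_grad UNIV \<phi>0 x $ i + g x y $ i)))"
proof (cases "(LINT z|lebesgue. exp (- V z / \<sigma>)) = 0")
  case True
  then have "gibbs \<sigma> V = (\<lambda>_. 0)" by (simp add: gibbs_def[abs_def])
  with assms(11) show ?thesis
    using two_scale_compactness_zero_weight[OF assms(2), of \<phi> \<phi>0 \<epsilon>] by (simp add: H1_weakly_convergent_def)
next
  case False
  then interpret two_scale L "gibbs \<sigma> V" \<epsilon>
    using assms by (intro two_scale_gibbs) auto
  show ?thesis using two_scale_compactness[OF assms(11)] by simp
qed

end
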